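(* Let $N\ge 3$, $a\in\{0,1\}$, $2\le q<2_*$ and $\lambda,\mu\in\mathbb{R}$. Suppose that $u\in C^2(\mathbb{R}^N_+)\cap X$ is a nonnegative solution of $$-\Delta u-\tfrac12 (x\cdot\nabla u)=\lambda u+a|u|^{2^*-2}u\ \text{ in }\mathbb{R}^N_+,\qquad \frac{\partial u}{\partial n}=\mu|u|^{q-2}u+|u|^{2_*-2}u\ \text{ on }\partial\mathbb{R}^N_+ .$$ Then $u\equiv 0$ if one of the following assumptions holds: (1) $\lambda<N/4$ and $\mu=0$; (2) $\lambda\le N/4$ and $\mu<0$; (3) $\lambda\ge N/2$ and $\mu\ge 0$; (4) $q=2$, $\lambda\ge 0$ and $\mu\ge\mu_1$.
   Context: $\mathbb{R}^N_+=\{(x',x_N):x'\in\mathbb{R}^{N-1},x_N>0\}$, its boundary is identified with $\mathbb{R}^{N-1}$, $n$ is the outward normal at the boundary, $2^*=\frac{2N}{N-2}$, $2_*=\frac{2(N-1)}{N-2}$, $K(x)=e^{|x|^2/4}$. The space $X$ is the closure of $C_c^\infty(\overline{\mathbb{R}^N_+})$ with respect to the norm $\|u\|=\big(\int_{\mathbb{R}^N_+}K(x)|\nabla u|^2dx\big)^{1/2}$. It embeds continuously (via restriction/trace) into the weighted spaces with norms $\|u\|_{L^r_K(\mathbb{R}^N_+)}=\big(\int_{\mathbb{R}^N_+}K|u|^rdx\big)^{1/r}$ for $r\in[2,2^*]$ and $\|u\|_{L^s_K(\mathbb{R}^{N-1})}=\big(\int_{\mathbb{R}^{N-1}}K(x',0)|u|^sdx'\big)^{1/s}$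 for $s\in[2,2_*]$. A solution is understood as $u\in X$ satisfying, for all $\varphi\in X$, $$\int_{\mathbb{R}^N_+}K\nabla u\cdot\nabla\varphi\,dx=\lambda\int_{\mathbb{R}^N_+}Ku\varphi\,dx+a\int_{\mathbb{R}^N_+}K|u|^{2^*-2}u\varphi\,dx+\int_{\mathbb{R}^{N-1}}K(x',0)\big(\mu|u|^{q-2}u+|u|^{2_*-2}u\big)\varphi\,dx',$$ which is the weak form of the problem, since $\mathrm{div}(K\nabla u)=K(\Delta u+\frac12 x\cdot\nabla u)$. The constant $\mu_1$ is $$\mu_1:=\inf_{u\in X\setminus\{0\}}\frac{\|u\|^2}{\|u\|^2_{L^2_K(\mathbb{R}^{N-1})}}>0$$ (the quotient being $+\infty$ when the trace of $u$ vanishes). *)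

theory Defs
  imports "HOL-Analysis.Analysis"
begin

text \<open>Euclidean space of dimension \<open>N = CARD('m) + 1\<close> is \<open>(real^'m) \<times> real\<close>, whose points are
  the pairs \<open>(x', x\<^sub>N)\<close>; the boundary of the half-space is the factor \<open>real^'m\<close>.\<close>

type_synonym 'm pt = "(real^'m) \<times> real"

definition halfspace :: "('m::finite) pt set" where
  "halfspace = {x. snd x > 0}"

definition K :: "('m::finite) pt \<Rightarrow> real" where
  "K x = exp ((norm x)\<^sup>2 / 4)"

text \<open>The measures \<open>K(x) dx\<close> on the half-space and \<open>K(x',0) dx'\<close> on its boundary.\<close>

definition MH :: "('m::finite) pt measure" where
  "MH = density (restrict_space lborel halfspace) (\<lambda>x. ennreal (K x))"

definition MB :: "(real^'m::finite) measure" where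
  "MB = density lborel (\<lambda>y. ennreal (K (y, 0)))"

definition two_star :: "nat \<Rightarrow> real" where
  "two_star N = 2 * real N / (real N - 2)"

definition two_trace :: "nat \<Rightarrow> real" where
  "two_trace N = 2 * (real N - 1) / (real N - 2)"

text \<open>\<open>Ck k S f\<close> is meant for open \<open>S\<close>.\<close>

primrec Ck :: "nat \<Rightarrow> 'a::euclidean_space set \<Rightarrow> ('a \<Rightarrow> real) \<Rightarrow> bool" where
  "Ck 0 S f \<longleftrightarrow> continuous_on S f"
| "Ck (Suc k) S f \<longleftrightarrow> (\<forall>x\<in>S. f differentiable (at x)) \<and>
     (\<forall>b\<in>Basis. Ck k S (\<lambda>x. frechet_derivative f (at x) b))"

definition grad :: "('a::euclidean_space \<Rightarrow> real) \<Rightarrow> 'a \<Rightarrow> 'a" where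
  "grad f x = (\<Sum>b\<in>Basis. frechet_derivative f (at x) b *\<^sub>R b)"

text \<open>An element of \<open>C\<^sub>c\<^sup>\<infinity>\<close> of the closed half-space is the restriction of a smooth compactly
  supported function on the whole space. It is represented here by such an extension; only the
  values on the closed half-space are ever used.\<close>

definition test_functions :: "(('m::finite) pt \<Rightarrow> real) set" where
  "test_functions = {\<phi>. (\<forall>k. Ck k UNIV \<phi>) \<and> compact (closure {x. \<phi> x \<noteq> 0})}"

text \<open>The closure \<open>X\<close> of the test functions in the norm \<open>(\<integral> K |\<nabla>u|\<^sup>2)\<^sup>1\<^sup>/\<^sup>2\<close> is realized as a space
  of functions on the half-space through its continuous embedding into \<open>L\<^sup>2\<^sub>K\<close>: a Cauchy sequence of
  test functions \<open>\<phi> k\<close> represents the \<open>L\<^sup>2\<^sub>K\<close>-limit \<open>u\<close>, and the \<open>L\<^sup>2\<^sub>K\<close>-limit \<open>G\<close> of the gradients,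
  which exists by the Cauchy property, is the gradient of \<open>u\<close>. Extended nonnegative integrals are
  used for the distances, so a non-integrable difference has distance \<open>\<infinity>\<close>. Elements of \<open>X\<close> are
  functions, to be identified when they agree almost everywhere on the half-space.\<close>

definition X_limit ::
  "(nat \<Rightarrow> ('m::finite) pt \<Rightarrow> real) \<Rightarrow> ('m pt \<Rightarrow> real) \<Rightarrow> ('m pt \<Rightarrow> 'm pt) \<Rightarrow> bool" where
  "X_limit \<phi> u G \<longleftrightarrow>
     (\<forall>k. \<phi> k \<in> test_functions) \<and> u \<in> borel_measurable MH \<and> G \<in> borel_measurable MH \<and>
     (\<lambda>k. \<integral>\<^sup>+x. ennreal ((norm (grad (\<phi> k) x - G x))\<^sup>2) \<partial>MH) \<longlonglongrightarrow> 0 \<and>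
     (\<lambda>k. \<integral>\<^sup>+x. ennreal ((\<phi> k x - u x)\<^sup>2) \<partial>MH) \<longlonglongrightarrow> 0"

definition X :: "(('m::finite) pt \<Rightarrow> real) set" where
  "X = {u. \<exists>\<phi> G. X_limit \<phi> u G}"

text \<open>Gradient and trace on \<open>X\<close> are the continuous extensions of \<open>\<nabla>\<phi>\<close> and of \<open>\<phi>(\<sqdot>, 0)\<close>; they are
  determined up to null sets.\<close>

definition wgrad :: "(('m::finite) pt \<Rightarrow> real) \<Rightarrow> 'm pt \<Rightarrow> 'm pt" where
  "wgrad u = (SOME G. \<exists>\<phi>. X_limit \<phi> u G)"

definition trace :: "(('m::finite) pt \<Rightarrow> real) \<Rightarrow> real^'m \<Rightarrow> real" where
  "trace u = (SOME T. T \<in> borel_measurable MB \<and>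
     (\<exists>\<phi> G. X_limit \<phi> u G \<and>
        (\<lambda>k. \<integral>\<^sup>+y. ennreal ((\<phi> k (y, 0) - T y)\<^sup>2) \<partial>MB) \<longlonglongrightarrow> 0))"

definition X_norm :: "(('m::finite) pt \<Rightarrow> real) \<Rightarrow> real" where
  "X_norm u = sqrt (\<integral>x. (norm (wgrad u x))\<^sup>2 \<partial>MH)"

definition mu1 :: "'m::finite itself \<Rightarrow> ereal" where
  "mu1 _ = (INF u \<in> {u \<in> (X :: ('m pt \<Rightarrow> real) set). \<not> (AE x in MH. u x = 0)}.
     if AE y in MB. trace u y = 0 then \<infinity>
     else ereal ((X_norm u)\<^sup>2 / (\<integral>y. (trace u y)\<^sup>2 \<partial>MB)))"

text \<open>In the case \<open>q = 2\<close> the factor \<open>0 powr 0 = 0\<close> is multiplied by \<open>u = 0\<close>, so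
  \<open>|u| powr (q - 2) * u\<close> is \<open>u\<close>, as it should be.\<close>

definition weak_solution ::
  "real \<Rightarrow> real \<Rightarrow> real \<Rightarrow> real \<Rightarrow> (('m::finite) pt \<Rightarrow> real) \<Rightarrow> bool" where
  "weak_solution a lam \<mu> q u \<longleftrightarrow> u \<in> X \<and>
     (let N = DIM('m pt) in
      \<forall>\<phi>\<in>X.
       (\<integral>x. wgrad u x \<bullet> wgrad \<phi> x \<partial>MH) =
         lam * (\<integral>x. u x * \<phi> x \<partial>MH)
       + a * (\<integral>x. \<bar>u x\<bar> powr (two_star N - 2) * u x * \<phi> x \<partial>MH)
       + (\<integral>y. (\<mu> * \<bar>trace u y\<bar> powr (q - 2) * trace u y
               + \<bar>trace u y\<bar> powr (two_trace N - 2) * trace u y) * trace \<phi> y \<partial>MB))"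

end

theory Submission
  imports Defs
begin

text \<open>Write \<open>m = CARD('m)\<close>, so that the dimension is \<open>N = m + 1\<close>, and let \<open>T\<close> be the trace of \<open>u\<close>. Two
  families of test functions decide the four cases.

  The first family is explicit: \<open>herm_sol j x = exp (- |x'|\<^sup>2/4) h\<^sub>j(x\<^sub>N)\<close>, where the positive decaying
  function \<open>h\<^sub>j\<close> is a Hermite function of order \<open>- j\<close>. It satisfies \<open>- div (K \<nabla>\<phi>) = (N - j)/2 K \<phi>\<close> in the
  half-space and \<open>\<partial>\<phi>/\<partial>n = \<kappa>\<^sub>j \<phi>\<close> on the boundary. For \<open>j = 0\<close> this is \<open>1/K\<close>, with eigenvalue \<open>N/2\<close> and
  \<open>\<kappa>\<^sub>0 = 0\<close>; for \<open>j = N\<close> the eigenvalue is \<open>0\<close>, and the identity of Picone shows that \<open>\<kappa>\<^sub>N\<close> is a lower bound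
  of the quotient that defines \<open>\<mu>\<^sub>1\<close> (\<open>robin_le_mu1\<close>). If \<open>\<lambda> \<ge> N/2\<close> and \<open>\<mu> \<ge> 0\<close>, the equation tested with
  \<open>herm_sol 0\<close> consists of terms of one sign; if \<open>q = 2\<close>, \<open>\<lambda> \<ge> 0\<close> and \<open>\<mu> \<ge> \<mu>\<^sub>1 \<ge> \<kappa>\<^sub>N\<close>, the same happens
  with \<open>herm_sol N\<close>. In both cases the critical boundary term vanishes, so \<open>T = 0\<close>.

  The second family consists of dilations. With \<open>\<phi> = v/K\<close> the weight disappears from the equation and
  the drift \<open>x \<cdot> \<nabla>u / 2\<close> remains as a term. The functions \<open>U\<^sub>t(x) = exp (\<beta> t) u (exp t x)\<close> with
  \<open>\<beta> = (N - 2)/2\<close> have the Dirichlet integral of \<open>u\<close> and both its critical norms, so testing with the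
  generator \<open>z = x \<cdot> \<nabla>u + \<beta> u\<close> leaves
  \<open>\<lambda> \<integral>u\<^sup>2 - (1/2) (\<integral>z\<^sup>2 + \<beta> \<integral>u\<^sup>2) = - \<mu> \<gamma> \<integral>|T|\<^sup>q\<close> with \<open>\<gamma> = (m - \<beta> q)/q > 0\<close>, where \<open>\<integral>u z = - \<integral>u\<^sup>2\<close>
  was used. From \<open>\<integral>(z + u)\<^sup>2 \<ge> 0\<close> one gets \<open>\<integral>z\<^sup>2 \<ge> \<integral>u\<^sup>2\<close>, hence
  \<open>- \<mu> \<gamma> \<integral>|T|\<^sup>q \<le> (\<lambda> - N/4) \<integral>u\<^sup>2\<close>. If \<open>\<lambda> < N/4\<close> and \<open>\<mu> \<le> 0\<close>, this gives \<open>u = 0\<close>; if \<open>\<lambda> = N/4\<close> and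
  \<open>\<mu> < 0\<close>, it gives \<open>T = 0\<close>. The function \<open>z\<close> itself is known to lie in \<open>L\<^sup>2\<close> only, so the equation is tested
  with the differences \<open>U\<^sub>t - u\<close> instead, and for \<open>\<mu> \<le> 0\<close> the relation survives the limit \<open>t \<rightarrow> 0\<close> as an
  inequality (\<open>Pohozaev\<close>).

  If \<open>T = 0\<close> and \<open>\<lambda> \<ge> 0\<close>, then the term with \<open>\<mu>\<close> drops out: for \<open>\<lambda> < N/4\<close> the second argument applies
  with \<open>\<mu> = 0\<close>, and otherwise \<open>\<lambda> > 0\<close> and testing with \<open>herm_sol N\<close> gives \<open>\<lambda> \<integral>K u \<phi> \<le> 0\<close>.

  Behind this stand three facts about \<open>X\<close>: gradient and trace are well defined and determined by the
  function (\<open>X_Sob\<close>, \<open>Sob_unique\<close>), the trace of a nonnegative function is nonnegative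
  (\<open>Sob_trace_nonneg\<close>), and the Sobolev inequalities for the two critical exponents hold
  (\<open>Sobolev\<close>, from the Gagliardo--Nirenberg inequality).\<close>

section \<open>Calculus of smooth functions\<close>

definition smooth :: "('a::euclidean_space \<Rightarrow> real) \<Rightarrow> bool" where
  "smooth f \<longleftrightarrow> (\<forall>k. Ck k UNIV f)"

lemma smooth_iff:
  "smooth f \<longleftrightarrow> (\<forall>x. f differentiable (at x)) \<and>
     (\<forall>b\<in>Basis. smooth (\<lambda>x. frechet_derivative f (at x) b))"
proof -
  have c0: "continuous_on UNIV f" if "\<forall>x. f differentiable (at x)"
    using that by (simp add: continuous_at_imp_continuous_on differentiable_imp_continuous_within)
  have "smooth f \<longleftrightarrow> (\<forall>k. Ck (Suc k) UNIV f)" if "\<forall>x. f differentiable (at x)"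
    unfolding smooth_def using c0[OF that]
    by (metis (no_types, lifting) Ck.simps(1) not0_implies_Suc)
  moreover have "smooth f \<Longrightarrow> \<forall>x. f differentiable (at x)"
    unfolding smooth_def by (metis Ck.simps(2) UNIV_I)
  ultimately show ?thesis
    unfolding smooth_def by auto
qed

lemma smooth_differentiable: "smooth f \<Longrightarrow> f differentiable (at x)"
  using smooth_iff by blast

lemma smooth_partial: "smooth f \<Longrightarrow> b \<in> Basis \<Longrightarrow> smooth (\<lambda>x. frechet_derivative f (at x) b)"
  using smooth_iff by blast

lemma smooth_has_derivative: "smooth f \<Longrightarrow> (f has_derivative frechet_derivative f (at x)) (at x)"
  using smooth_differentiable frechet_derivative_works by blast

lemma smooth_continuous_on: "smooth f \<Longrightarrow> continuous_on S f"
  unfolding smooth_def by (metis Ck.simps(1) continuous_on_subset subset_UNIV)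

lemma Ck_Suc_imp: "Ck (Suc k) UNIV f \<Longrightarrow> Ck k UNIV f"
proof (induction k arbitrary: f)
  case 0
  then show ?case by (simp add: continuous_at_imp_continuous_on differentiable_imp_continuous_within)
next
  case (Suc k)
  show ?case
    unfolding Ck.simps(2)[of k]
    using Suc.IH Suc.prems by (metis Ck.simps(2))
qed

lemma Ck_add: "Ck k UNIV f \<Longrightarrow> Ck k UNIV g \<Longrightarrow> Ck k UNIV (\<lambda>x. f x + g x)"
proof (induction k arbitrary: f g)
  case 0
  then show ?case by (auto intro: continuous_intros)
next
  case (Suc k)
  have fd: "((\<lambda>x. f x + g x) has_derivative (\<lambda>h. frechet_derivative f (at x) h + frechet_derivative g (at x) h)) (at x)" for x
    using Suc.prems by (auto intro!: has_derivative_add simp: frechet_derivative_works[symmetric])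
  show ?case
    unfolding Ck.simps(2) frechet_derivative_at[OF fd, symmetric]
    using Suc fd by (auto simp: differentiable_def)
qed

lemma Ck_mult: "Ck k UNIV f \<Longrightarrow> Ck k UNIV g \<Longrightarrow> Ck k UNIV (\<lambda>x. f x * g x)"
proof (induction k arbitrary: f g)
  case 0
  then show ?case by (auto intro: continuous_intros)
next
  case (Suc k)
  have fd: "((\<lambda>x. f x * g x) has_derivative (\<lambda>h. f x * frechet_derivative g (at x) h + frechet_derivative f (at x) h * g x)) (at x)" for x
    using Suc.prems by (auto intro!: has_derivative_mult simp: frechet_derivative_works[symmetric])
  have 1: "Ck k UNIV f" "Ck k UNIV g" using Suc.prems Ck_Suc_imp by blast+
  show ?case
    unfolding Ck.simps(2) frechet_derivative_at[OF fd, symmetric]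
  proof (intro conjI ballI)
    show "(\<lambda>x. f x * g x) differentiable at x" for x
      using fd by (auto simp: differentiable_def)
    show "Ck k UNIV (\<lambda>x. f x * frechet_derivative g (at x) b + frechet_derivative f (at x) b * g x)" if "b \<in> Basis" for b
      using Suc.prems that by (intro Ck_add Suc.IH 1) auto
  qed
qed

lemma Ck_const: "Ck k UNIV (\<lambda>x. c)"
  by (induction k arbitrary: c) (auto simp: frechet_derivative_const)

lemma Ck_inner: "Ck k UNIV (\<lambda>x. x \<bullet> c)"
proof (cases k)
  case (Suc j)
  have fd: "((\<lambda>x. x \<bullet> c) has_derivative (\<lambda>h. h \<bullet> c)) (at x)" for x :: 'a
    by (auto intro!: derivative_eq_intros)
  show ?thesis
    unfolding Suc Ck.simps(2) frechet_derivative_at[OF fd, symmetric]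
    using fd by (auto simp: differentiable_def Ck_const)
qed (auto intro: continuous_intros)

lemma Ck_scale: "Ck k UNIV f \<Longrightarrow> Ck k UNIV (\<lambda>x. f (c *\<^sub>R x))"
proof (induction k arbitrary: f)
  case 0
  then show ?case
    by (auto intro!: continuous_on_compose2[of UNIV f] continuous_intros)
next
  case (Suc k)
  have fd: "((\<lambda>x. f (c *\<^sub>R x)) has_derivative (\<lambda>h. frechet_derivative f (at (c *\<^sub>R x)) (c *\<^sub>R h))) (at x)" for x
    using Suc.prems
    by (intro has_derivative_compose[of "\<lambda>x. c *\<^sub>R x" _ _ _ f]) (auto intro!: derivative_eq_intros simp: frechet_derivative_works[symmetric])
  have lin: "linear (frechet_derivative f (at y))" for y
    using Suc.prems by (auto intro!: linear_frechet_derivative)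
  show ?case
    unfolding Ck.simps(2) frechet_derivative_at[OF fd, symmetric] linear_scale[OF lin]
  proof (intro conjI ballI)
    show "(\<lambda>x. f (c *\<^sub>R x)) differentiable at x" for x
      using fd by (auto simp: differentiable_def)
    show "Ck k UNIV (\<lambda>x. c *\<^sub>R frechet_derivative f (at (c *\<^sub>R x)) b)" if "b \<in> Basis" for b
      unfolding real_scaleR_def
      using Suc.prems that by (intro Ck_mult Ck_const Suc.IH) auto
  qed
qed

text \<open>A function of one real variable is smooth when it starts a sequence of successive derivatives;
  carrying the whole sequence makes the chain rule an induction.\<close>

lemma Ck_compose:
  fixes h :: "nat \<Rightarrow> real \<Rightarrow> real"
  assumes h: "\<And>n s. (h n has_real_derivative h (Suc n) s) (at s)"
  shows "Ck k UNIV f \<Longrightarrow> Ck k UNIV (\<lambda>x. h n (f x))"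
proof (induction k arbitrary: n)
  case 0
  have "continuous_on UNIV (h n)"
    by (intro continuous_at_imp_continuous_on ballI DERIV_isCont[OF h])
  then show ?case using 0
    by (auto intro!: continuous_on_compose2[of UNIV "h n"])
next
  case (Suc k)
  have fd: "((\<lambda>x. h n (f x)) has_derivative (\<lambda>v. h (Suc n) (f x) * frechet_derivative f (at x) v)) (at x)" for x
    using Suc.prems h[of n "f x"]
    by (intro has_derivative_compose[of f _ _ _ "h n"]) (auto simp: frechet_derivative_works[symmetric] has_field_derivative_def)
  have 1: "Ck k UNIV f" using Suc.prems Ck_Suc_imp by blast
  show ?case
    unfolding Ck.simps(2) frechet_derivative_at[OF fd, symmetric]
  proof (intro conjI ballI)
    show "(\<lambda>x. h n (f x)) differentiable at x" for x
      using fd by (auto simp: differentiable_def)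
    show "Ck k UNIV (\<lambda>x. h (Suc n) (f x) * frechet_derivative f (at x) b)" if "b \<in> Basis" for b
      using Suc.prems that by (intro Ck_mult Suc.IH 1) auto
  qed
qed

lemma smooth_add: "smooth f \<Longrightarrow> smooth g \<Longrightarrow> smooth (\<lambda>x. f x + g x)"
  and smooth_mult: "smooth f \<Longrightarrow> smooth g \<Longrightarrow> smooth (\<lambda>x. f x * g x)"
  and smooth_const: "smooth (\<lambda>x. c)"
  and smooth_inner: "smooth (\<lambda>x. x \<bullet> v)"
  and smooth_scale: "smooth f \<Longrightarrow> smooth (\<lambda>x. f (c *\<^sub>R x))"
  and smooth_compose: "(\<And>n s. (h n has_real_derivative h (Suc n) s) (at s)) \<Longrightarrow> smooth f \<Longrightarrow> smooth (\<lambda>x. h n (f x))"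
  unfolding smooth_def
  by (simp_all add: Ck_add Ck_mult Ck_const Ck_inner Ck_scale Ck_compose)

lemma smooth_diff: "smooth f \<Longrightarrow> smooth g \<Longrightarrow> smooth (\<lambda>x. f x - g x)"
  using smooth_add[of f "\<lambda>x. (-1) * g x"] smooth_mult[OF smooth_const, of g "-1"] by simp

lemma smooth_sum: "finite A \<Longrightarrow> (\<And>i. i \<in> A \<Longrightarrow> smooth (f i)) \<Longrightarrow> smooth (\<lambda>x. \<Sum>i\<in>A. f i x)"
  by (induction rule: finite_induct) (auto simp: smooth_const smooth_add)

lemma smooth_norm2: "smooth (\<lambda>x::'a::euclidean_space. (norm x)\<^sup>2)"
proof -
  have "smooth (\<lambda>x::'a. \<Sum>b\<in>Basis. (x \<bullet> b) * (x \<bullet> b))"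
    by (intro smooth_sum smooth_mult smooth_inner) auto
  moreover have "(\<lambda>x::'a. \<Sum>b\<in>Basis. (x \<bullet> b) * (x \<bullet> b)) = (\<lambda>x. (norm x)\<^sup>2)"
    by (auto simp: power2_norm_eq_inner euclidean_inner[symmetric] fun_eq_iff)
  ultimately show ?thesis by simp
qed

lemma smooth_exp: "smooth f \<Longrightarrow> smooth (\<lambda>x. exp (f x))"
  by (rule smooth_compose[where h="\<lambda>_. exp" and n=0]) auto

lemma grad_inner: "b \<in> Basis \<Longrightarrow> grad f x \<bullet> b = frechet_derivative f (at x) b"
  by (simp add: grad_def inner_sum_left inner_Basis if_distrib[of "\<lambda>t. _ * t"] sum.delta' cong: if_cong)

lemma frechet_derivative_grad:
  assumes "smooth f" shows "frechet_derivative f (at x) v = grad f x \<bullet> v"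
proof -
  have lin: "linear (frechet_derivative f (at x))"
    using assms by (auto intro!: linear_frechet_derivative smooth_differentiable)
  have "frechet_derivative f (at x) v = frechet_derivative f (at x) (\<Sum>b\<in>Basis. (v \<bullet> b) *\<^sub>R b)"
    by (simp add: euclidean_representation)
  also have "\<dots> = (\<Sum>b\<in>Basis. (v \<bullet> b) * frechet_derivative f (at x) b)"
    by (simp add: linear_sum[OF lin] linear_scale[OF lin])
  also have "\<dots> = grad f x \<bullet> v"
    unfolding grad_def inner_sum_left by (intro sum.cong refl) (simp add: inner_commute)
  finally show ?thesis .
qed

lemma smooth_has_derivative_grad: "smooth f \<Longrightarrow> (f has_derivative (\<lambda>v. grad f x \<bullet> v)) (at x)"
  using smooth_has_derivative frechet_derivative_grad
  by (metis (no_types, lifting) ext)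

lemma grad_eqI: "(f has_derivative (\<lambda>v. g \<bullet> v)) (at x) \<Longrightarrow> grad f x = g"
  using frechet_derivative_at[of f "\<lambda>v. g \<bullet> v" x]
  by (auto simp: grad_def euclidean_representation fun_eq_iff)
     (metis (no_types, lifting) euclidean_representation sum.cong)

lemma smooth_grad_continuous_on: "smooth f \<Longrightarrow> continuous_on S (grad f)"
  unfolding grad_def by (auto intro!: continuous_intros smooth_continuous_on smooth_partial)

section \<open>A smooth bump\<close>

text \<open>Up to linear combinations these are the successive derivatives of \<open>exp (- 1/s)\<close>, extended by zero
  to \<open>s \<le> 0\<close>.\<close>

definition flat :: "nat \<Rightarrow> real \<Rightarrow> real" where
  "flat n s = (if s > 0 then (1/s) ^ n * exp (- (1/s)) else 0)"

lemma power_le_exp: "y ^ k \<le> real k ^ k * exp y" if "y \<ge> 0"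
proof (cases "k = 0")
  case False
  have "(1 + y / k) ^ k \<le> exp y"
    using False that by (intro exp_ge_one_plus_x_over_n_power_n) auto
  moreover have "(y / k) ^ k \<le> (1 + y / k) ^ k"
    using False that by (intro power_mono) auto
  ultimately have "y ^ k / real k ^ k \<le> exp y" by (simp add: power_divide)
  then show ?thesis using False by (simp add: divide_le_eq mult.commute)
qed (use that in auto)

text \<open>The bound is quadratic in \<open>s\<close>, which makes the derivative at \<open>0\<close> exist and vanish.\<close>

lemma flat_bound: "\<bar>flat n s\<bar> \<le> real (n + 2) ^ (n + 2) * s\<^sup>2"
proof (cases "s > 0")
  case True
  have "(1/s) ^ (n + 2) \<le> real (n + 2) ^ (n + 2) * exp (1/s)"
    using True by (intro power_le_exp) auto
  then have "(1/s) ^ (n+2) * exp (- (1/s)) \<le> real (n + 2) ^ (n + 2)"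
    by (simp only: exp_minus) (simp only: inverse_eq_divide times_divide_eq_right mult_1_right pos_divide_le_eq[OF exp_gt_zero])
  then have "(1/s) ^ (n+2) * exp (- (1/s)) * s\<^sup>2 \<le> real (n + 2) ^ (n + 2) * s\<^sup>2"
    by (intro mult_right_mono) auto
  moreover have "(1/s) ^ (n+2) * exp (- (1/s)) * s\<^sup>2 = (1/s)^n * exp (- (1/s))"
    using True by (simp add: power_add power2_eq_square)
  ultimately show ?thesis using True by (simp add: flat_def)
qed (simp add: flat_def)

lemma flat_derivative: "(flat n has_real_derivative (flat (n + 2) s - real n * flat (n + 1) s)) (at s)"
proof -
  consider "s > 0" | "s < 0" | "s = 0" by linarith
  then show ?thesis
  proof cases
    case 1
    define y where "y = 1 / s"
    have 0: "((\<lambda>s. 1 / s) has_real_derivative - (y ^ 2)) (at s)"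
      using 1 by (auto intro!: derivative_eq_intros simp: y_def power2_eq_square)
    have "((\<lambda>s. (1/s) ^ n * exp (- (1/s))) has_real_derivative
       (real n * (y ^ (n - Suc 0) * - (y ^ 2))) * exp (- y) + exp (- y) * - (- (y ^ 2)) * y ^ n) (at s)"
      unfolding y_def[symmetric]
      by (rule DERIV_mult[OF DERIV_power[OF 0, of n] DERIV_fun_exp[OF DERIV_minus[OF 0]], folded y_def, THEN DERIV_cong])
        (simp add: y_def mult_ac)
    moreover have "(real n * (y ^ (n - Suc 0) * - (y ^ 2))) * exp (- y) + exp (- y) * - (- (y ^ 2)) * y ^ n
       = flat (n + 2) s - real n * flat (n + 1) s"
      using 1 by (cases n) (simp_all add: flat_def power2_eq_square y_def[symmetric] algebra_simps)
    ultimately have "((\<lambda>s. (1/s) ^ n * exp (- (1/s))) has_real_derivative (flat (n + 2) s - real n * flat (n + 1) s)) (at s)"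
      by simp
    then show ?thesis
      by (rule has_field_derivative_transform_within_open[where S="{0<..}"]) (use 1 in \<open>auto simp: flat_def\<close>)
  next
    case 2
    have "((\<lambda>s. 0) has_real_derivative (flat (n + 2) s - real n * flat (n + 1) s)) (at s)"
      using 2 by (auto simp: flat_def)
    then show ?thesis
      by (rule has_field_derivative_transform_within_open[where S="{..<0}"]) (use 2 in \<open>auto simp: flat_def\<close>)
  next
    case 3
    have "((\<lambda>h. flat n h / h) \<longlongrightarrow> 0) (at 0)"
    proof (rule Lim_null_comparison)
      show "((\<lambda>h. real (n + 2) ^ (n + 2) * \<bar>h\<bar>) \<longlongrightarrow> 0) (at (0::real))"
        by (auto intro!: tendsto_eq_intros)
      show "\<forall>\<^sub>F h in at 0. norm (flat n h / h) \<le> real (n + 2) ^ (n + 2) * \<bar>h\<bar>"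
        using eventually_at_filter by (auto simp: eventually_at_filter divide_le_eq power2_eq_square mult.assoc
            intro!: always_eventually order_trans[OF flat_bound])
    qed
    then show ?thesis using 3 by (simp add: has_field_derivative_iff flat_def)
  qed
qed

lemma Ck_flat: "Ck k UNIV f \<Longrightarrow> Ck k UNIV (\<lambda>x. flat n (f x))"
proof (induction k arbitrary: n)
  case 0
  have "continuous_on UNIV (flat n)"
    by (intro continuous_at_imp_continuous_on ballI DERIV_isCont[OF flat_derivative])
  then show ?case using 0
    by (auto intro!: continuous_on_compose2[of UNIV "flat n"])
next
  case (Suc k)
  have fd: "((\<lambda>x. flat n (f x)) has_derivative
      (\<lambda>v. (flat (n + 2) (f x) + (- real n) * flat (n + 1) (f x)) * frechet_derivative f (at x) v)) (at x)" for x
    using Suc.prems flat_derivative[of n "f x"]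
    by (intro has_derivative_compose[of f _ _ _ "flat n"]) (auto simp: frechet_derivative_works[symmetric] has_field_derivative_def)
  have 1: "Ck k UNIV f" using Suc.prems Ck_Suc_imp by blast
  show ?case
    unfolding Ck.simps(2) frechet_derivative_at[OF fd, symmetric]
  proof (intro conjI ballI)
    show "(\<lambda>x. flat n (f x)) differentiable at x" for x
      using fd by (auto simp: differentiable_def)
    show "Ck k UNIV (\<lambda>x. (flat (n + 2) (f x) + (- real n) * flat (n + 1) (f x)) * frechet_derivative f (at x) b)" if "b \<in> Basis" for b
      using Suc.prems that by (intro Ck_mult Ck_add Ck_const Suc.IH 1) auto
  qed
qed

text \<open>The factor \<open>exp 1\<close> gives the bumps the value \<open>1\<close> at the origin, so that they serve as cut-off functions
  when \<open>R\<close> grows.\<close>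

definition bump :: "real \<Rightarrow> 'a::euclidean_space \<Rightarrow> real" where
  "bump R x = exp 1 * flat 0 (1 - (norm x)\<^sup>2 / R\<^sup>2)"

lemma smooth_bump: "smooth (bump R)"
proof -
  have "smooth (\<lambda>x::'a. 1 - (norm x)\<^sup>2 * (1 / R\<^sup>2))"
    by (intro smooth_diff smooth_mult smooth_const smooth_norm2)
  then have "smooth (\<lambda>x::'a. flat 0 (1 - (norm x)\<^sup>2 * (1 / R\<^sup>2)))"
    unfolding smooth_def using Ck_flat by blast
  then have "smooth (\<lambda>x::'a. exp 1 * flat 0 (1 - (norm x)\<^sup>2 * (1 / R\<^sup>2)))"
    by (intro smooth_mult smooth_const)
  then show ?thesis by (simp add: bump_def[abs_def])
qed

lemma bump_support: "R > 0 \<Longrightarrow> norm x \<ge> R \<Longrightarrow> bump R x = 0"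
  by (simp add: bump_def flat_def not_less power_mono)

lemma bump_bounds: "0 \<le> bump R x" "bump R x \<le> 1"
proof -
  show "0 \<le> bump R x" by (simp add: bump_def flat_def)
  have "exp 1 * flat 0 s \<le> 1" if "s \<le> 1" for s :: real
    using that by (auto simp: flat_def exp_add[symmetric] le_divide_eq)
  then show "bump R x \<le> 1" by (simp add: bump_def)
qed

lemma grad_bump:
  assumes "R > 0" shows "grad (bump R) x = (- (2 * exp 1 / R\<^sup>2) * flat 2 (1 - (norm x)\<^sup>2 / R\<^sup>2)) *\<^sub>R x"
proof (rule grad_eqI)
  have "((\<lambda>x. 1 - (norm x)\<^sup>2 / R\<^sup>2) has_derivative (\<lambda>v. - (2 * (x \<bullet> v) / R\<^sup>2))) (at x)"
    unfolding power2_norm_eq_inner using assms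
    by (auto intro!: derivative_eq_intros simp: inner_commute fun_eq_iff power4_eq_xxxx power2_eq_square)
  moreover have "(flat 0 has_derivative (\<lambda>h. flat 2 (1 - (norm x)\<^sup>2 / R\<^sup>2) * h)) (at (1 - (norm x)\<^sup>2 / R\<^sup>2))"
    using flat_derivative[of 0 "1 - (norm x)\<^sup>2 / R\<^sup>2"] by (simp add: has_field_derivative_def numeral_2_eq_2[symmetric] del: One_nat_def)
  ultimately have "((\<lambda>x. flat 0 (1 - (norm x)\<^sup>2 / R\<^sup>2)) has_derivative
      (\<lambda>v. flat 2 (1 - (norm x)\<^sup>2 / R\<^sup>2) * - (2 * (x \<bullet> v) / R\<^sup>2))) (at x)"
    by (rule has_derivative_compose)
  from has_derivative_mult_right[OF this, of "exp 1"]
  show "(bump R has_derivative (\<lambda>v. (- (2 * exp 1 / R\<^sup>2) * flat 2 (1 - (norm x)\<^sup>2 / R\<^sup>2)) *\<^sub>R x \<bullet> v)) (at x)"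
    by (simp add: bump_def[abs_def] mult.assoc mult.left_commute)
qed

lemma grad_bump_bound:
  assumes "R > 0" shows "norm (grad (bump R) x) \<le> 32 * exp 1 / R\<^sup>2 * norm x"
proof -
  let ?s = "1 - (norm x)\<^sup>2 / R\<^sup>2"
  have "\<bar>flat 2 ?s\<bar> \<le> 4"
  proof (cases "?s > 0")
    case True
    then have "(1/?s)^2 \<le> real 2 ^ 2 * exp (1/?s)"
      by (intro power_le_exp) auto
    then have "(1/?s)^2 * exp (- (1/?s)) \<le> 4"
      by (simp only: exp_minus) (simp only: inverse_eq_divide times_divide_eq_right mult_1_right pos_divide_le_eq[OF exp_gt_zero], simp)
    then show ?thesis using True by (simp add: flat_def)
  qed (simp add: flat_def)
  then have "2 * exp 1 / R\<^sup>2 * \<bar>flat 2 ?s\<bar> \<le> 2 * exp 1 / R\<^sup>2 * 16"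
    by (intro mult_left_mono) auto
  from mult_right_mono[OF this norm_ge_zero[of x]] show ?thesis
    unfolding grad_bump[OF assms] by (simp add: abs_mult mult_ac)
qed

lemma bump_tendsto: "(\<lambda>n. bump (real (Suc n)) x) \<longlonglongrightarrow> 1"
proof -
  have "(\<lambda>n. 1 - (norm x)\<^sup>2 * (inverse (real (Suc n)))\<^sup>2) \<longlonglongrightarrow> 1 - (norm x)\<^sup>2 * 0\<^sup>2"
    by (intro tendsto_intros LIMSEQ_inverse_real_of_nat)
  then have *: "(\<lambda>n. 1 - (norm x)\<^sup>2 / (real (Suc n))\<^sup>2) \<longlonglongrightarrow> 1"
    by (simp add: divide_inverse power_inverse)
  have "isCont (flat 0) 1"
    by (rule DERIV_isCont[OF flat_derivative])
  from isCont_tendsto_compose[OF this *]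
  have "(\<lambda>n. exp 1 * flat 0 (1 - (norm x)\<^sup>2 / (real (Suc n))\<^sup>2)) \<longlonglongrightarrow> exp 1 * flat 0 1"
    by (intro tendsto_intros)
  then show ?thesis by (simp add: bump_def flat_def exp_minus_inverse)
qed

section \<open>Convergence in \<open>L\<^sup>2\<close>\<close>

text \<open>The distance is an extended integral, as in the definition of \<open>X_limit\<close>; convergence is meaningful
  before the limit is known to be square integrable.\<close>

definition L2_tendsto :: "'a measure \<Rightarrow> (nat \<Rightarrow> 'a \<Rightarrow> 'b::euclidean_space) \<Rightarrow> ('a \<Rightarrow> 'b) \<Rightarrow> bool" where
  "L2_tendsto M f g \<longleftrightarrow> (\<lambda>k. \<integral>\<^sup>+x. ennreal ((norm (f k x - g x))\<^sup>2) \<partial>M) \<longlonglongrightarrow> 0"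

lemma ennreal_tendsto_zero_le: "(\<And>k. a k \<le> b k) \<Longrightarrow> b \<longlonglongrightarrow> 0 \<Longrightarrow> a \<longlonglongrightarrow> (0::ennreal)"
  by (rule tendsto_sandwich[where f="\<lambda>_. 0" and h=b]) auto

definition L2 :: "'a measure \<Rightarrow> ('a \<Rightarrow> 'b::euclidean_space) set" where
  "L2 M = {f. f \<in> borel_measurable M \<and> integrable M (\<lambda>x. (norm (f x))\<^sup>2)}"

lemma L2_measurable [measurable_dest]: "f \<in> L2 M \<Longrightarrow> f \<in> borel_measurable M"
  by (simp add: L2_def)

lemma L2_integrable: "f \<in> L2 M \<Longrightarrow> integrable M (\<lambda>x. (norm (f x))\<^sup>2)"
  by (simp add: L2_def)

lemma L2_iff: "f \<in> L2 M \<longleftrightarrow> f \<in> borel_measurable M \<and> (\<integral>\<^sup>+x. ennreal ((norm (f x))\<^sup>2) \<partial>M) < \<infinity>"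
  by (auto simp: L2_def integrable_iff_bounded)

lemma norm_add_sq_le: "(norm (a + b))\<^sup>2 \<le> 2 * (norm a)\<^sup>2 + 2 * (norm b)\<^sup>2"
  for a b :: "'b::real_normed_vector"
proof -
  have "(norm (a + b))\<^sup>2 \<le> (norm a + norm b)\<^sup>2"
    by (intro power_mono norm_triangle_ineq) auto
  also have "\<dots> \<le> 2 * (norm a)\<^sup>2 + 2 * (norm b)\<^sup>2"
    using sum_squares_bound[of "norm a" "norm b"] by (simp add: power2_sum)
  finally show ?thesis .
qed

lemma norm_diff_sq_le: "(norm (a - b))\<^sup>2 \<le> 2 * (norm a)\<^sup>2 + 2 * (norm b)\<^sup>2"
  for a b :: "'b::real_normed_vector"
  using norm_add_sq_le[of a "-b"] by simp

lemma L2_bound: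
  assumes [measurable]: "f \<in> borel_measurable M" and g: "integrable M g" and "AE x in M. (norm (f x))\<^sup>2 \<le> g x"
  shows "f \<in> L2 M"
  unfolding L2_def using assms by (auto intro!: Bochner_Integration.integrable_bound[OF g])

lemma L2_diff: "f \<in> L2 M \<Longrightarrow> g \<in> L2 M \<Longrightarrow> (\<lambda>x. f x - g x) \<in> L2 M"
  by (rule L2_bound[of _ _ "\<lambda>x. 2 * (norm (f x))\<^sup>2 + 2 * (norm (g x))\<^sup>2"])
     (auto simp: norm_diff_sq_le L2_integrable L2_measurable intro!: borel_measurable_diff)

lemma L2_scaleR: "f \<in> L2 M \<Longrightarrow> (\<lambda>x. c *\<^sub>R f x) \<in> L2 M"
  by (rule L2_bound[of _ _ "\<lambda>x. c\<^sup>2 * (norm (f x))\<^sup>2"])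
     (auto simp: power_mult_distrib L2_integrable L2_measurable)

lemma L2_mult_left: "(f :: 'a \<Rightarrow> real) \<in> L2 M \<Longrightarrow> (\<lambda>x. c * f x) \<in> L2 M"
  using L2_scaleR[of f M c] by simp

lemma L2_inner_integrable:
  assumes f: "f \<in> L2 M" and g: "g \<in> L2 M"
  shows "integrable M (\<lambda>x. f x \<bullet> g x)"
proof -
  note [measurable] = L2_measurable[OF f] L2_measurable[OF g]
  have "integrable M (\<lambda>x. (norm (f x))\<^sup>2 + (norm (g x))\<^sup>2)"
    by (intro Bochner_Integration.integrable_add L2_integrable f g)
  then show ?thesis
  proof (rule Bochner_Integration.integrable_bound)
    have "\<bar>f x \<bullet> g x\<bar> \<le> (norm (f x))\<^sup>2 + (norm (g x))\<^sup>2" for x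
      using Cauchy_Schwarz_ineq2[of "f x" "g x"] sum_squares_bound[of "norm (f x)" "norm (g x)"]
        mult_nonneg_nonneg[OF norm_ge_zero[of "f x"] norm_ge_zero[of "g x"]]
      by linarith
    then show "AE x in M. norm (f x \<bullet> g x) \<le> norm ((norm (f x))\<^sup>2 + (norm (g x))\<^sup>2)" by simp
  qed auto
qed

lemma L2_mult_integrable: "(f :: 'a \<Rightarrow> real) \<in> L2 M \<Longrightarrow> g \<in> L2 M \<Longrightarrow> integrable M (\<lambda>x. f x * g x)"
  using L2_inner_integrable[of f M g] by simp

lemma L2_Cauchy_Schwarz:
  assumes f: "f \<in> L2 M" and g: "g \<in> L2 M"
  shows "(\<integral>x. f x \<bullet> g x \<partial>M)\<^sup>2 \<le> (\<integral>x. (norm (f x))\<^sup>2 \<partial>M) * (\<integral>x. (norm (g x))\<^sup>2 \<partial>M)"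
proof -
  define A B C where "A = (\<integral>x. (norm (f x))\<^sup>2 \<partial>M)" and "B = (\<integral>x. f x \<bullet> g x \<partial>M)" and "C = (\<integral>x. (norm (g x))\<^sup>2 \<partial>M)"
  have *: "0 \<le> A + 2 * t * B + t\<^sup>2 * C" for t
  proof -
    have "0 \<le> (\<integral>x. (norm (f x + t *\<^sub>R g x))\<^sup>2 \<partial>M)" by simp
    also have "\<dots> = (\<integral>x. (norm (f x))\<^sup>2 + 2 * t * (f x \<bullet> g x) + t\<^sup>2 * (norm (g x))\<^sup>2 \<partial>M)"
      by (intro Bochner_Integration.integral_cong refl)
         (simp add: power2_norm_eq_inner inner_add_left inner_add_right inner_commute power2_eq_square[of t] algebra_simps)
    also have "\<dots> = A + 2 * t * B + t\<^sup>2 * C"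
      using L2_integrable[OF f] L2_integrable[OF g] L2_inner_integrable[OF f g]
      by (simp add: A_def B_def C_def)
    finally show ?thesis .
  qed
  have "A \<ge> 0" "C \<ge> 0" by (simp_all add: A_def C_def)
  show ?thesis unfolding A_def[symmetric] B_def[symmetric] C_def[symmetric]
  proof (cases "C = 0")
    case True
    have "B = 0"
    proof (rule ccontr)
      assume "B \<noteq> 0"
      with *[of "- (A + 1) / (2 * B)"] True show False by (simp add: field_simps)
    qed
    then show "B\<^sup>2 \<le> A * C" using True by simp
  next
    case False
    with \<open>C \<ge> 0\<close> have "C > 0" by simp
    with *[of "- B / C"] show "B\<^sup>2 \<le> A * C" by (simp add: field_simps power2_eq_square)
  qed
qed

lemma L2_Cauchy_Schwarz_sqrt:
  assumes "f \<in> L2 M" "g \<in> L2 M"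
  shows "\<bar>\<integral>x. f x \<bullet> g x \<partial>M\<bar> \<le> sqrt (\<integral>x. (norm (f x))\<^sup>2 \<partial>M) * sqrt (\<integral>x. (norm (g x))\<^sup>2 \<partial>M)"
  using real_le_rsqrt[OF L2_Cauchy_Schwarz[OF assms, unfolded power2_abs[of "\<integral>x. f x \<bullet> g x \<partial>M", symmetric]]]
  by (simp add: real_sqrt_mult)

lemma L2_tendsto_real:
  "L2_tendsto M f g \<longleftrightarrow> (\<lambda>k. \<integral>\<^sup>+x. ennreal ((f k x - g x)\<^sup>2) \<partial>M) \<longlonglongrightarrow> 0" for g :: "'a \<Rightarrow> real"
  by (simp add: L2_tendsto_def)

lemma L2_tendsto_bound:
  assumes "L2_tendsto M f g" and [measurable]: "g \<in> borel_measurable M" "\<And>k. f k \<in> borel_measurable M"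
    and "AE x in M. \<forall>k. (norm (f' k x - g' x))\<^sup>2 \<le> C * (norm (f k x - g x))\<^sup>2" "C \<ge> 0"
  shows "L2_tendsto M f' g'"
  unfolding L2_tendsto_def
proof (rule tendsto_sandwich[OF _ _ tendsto_const])
  show "(\<lambda>k. ennreal C * (\<integral>\<^sup>+x. ennreal ((norm (f k x - g x))\<^sup>2) \<partial>M)) \<longlonglongrightarrow> 0"
    using ennreal_tendsto_cmult[OF _ assms(1)[unfolded L2_tendsto_def], of "ennreal C"] by simp
  show "\<forall>\<^sub>F k in sequentially. (\<integral>\<^sup>+x. ennreal ((norm (f' k x - g' x))\<^sup>2) \<partial>M) \<le> ennreal C * (\<integral>\<^sup>+x. ennreal ((norm (f k x - g x))\<^sup>2) \<partial>M)"
    using assms(4,5)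
    by (subst nn_integral_cmult[symmetric])
       (auto simp: ennreal_mult[symmetric] intro!: always_eventually nn_integral_mono_AE ennreal_leI elim!: eventually_mono)
qed simp

lemma L2_tendsto_add:
  assumes f: "L2_tendsto M f g" and h: "L2_tendsto M h l"
    and [measurable]: "g \<in> borel_measurable M" "\<And>k. f k \<in> borel_measurable M" "l \<in> borel_measurable M" "\<And>k. h k \<in> borel_measurable M"
  shows "L2_tendsto M (\<lambda>k x. f k x + h k x) (\<lambda>x. g x + l x)"
  unfolding L2_tendsto_def
proof (rule tendsto_sandwich[OF _ _ tendsto_const])
  let ?I = "\<lambda>k. 2 * (\<integral>\<^sup>+x. ennreal ((norm (f k x - g x))\<^sup>2) \<partial>M) + 2 * (\<integral>\<^sup>+x. ennreal ((norm (h k x - l x))\<^sup>2) \<partial>M)"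
  have "?I \<longlonglongrightarrow> 2 * 0 + 2 * 0"
    by (intro tendsto_add ennreal_tendsto_cmult f[unfolded L2_tendsto_def] h[unfolded L2_tendsto_def]) auto
  then show "?I \<longlonglongrightarrow> 0" by simp
  show "\<forall>\<^sub>F k in sequentially. (\<integral>\<^sup>+x. ennreal ((norm (f k x + h k x - (g x + l x)))\<^sup>2) \<partial>M) \<le> ?I k"
  proof (intro always_eventually allI)
    fix k
    have "(\<integral>\<^sup>+x. ennreal ((norm (f k x + h k x - (g x + l x)))\<^sup>2) \<partial>M) \<le>
        (\<integral>\<^sup>+x. 2 * ennreal ((norm (f k x - g x))\<^sup>2) + 2 * ennreal ((norm (h k x - l x))\<^sup>2) \<partial>M)"
    proof (intro nn_integral_mono)
      fix x
      have "(norm (f k x + h k x - (g x + l x)))\<^sup>2 \<le> 2 * (norm (f k x - g x))\<^sup>2 + 2 * (norm (h k x - l x))\<^sup>2"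
        using norm_add_sq_le[of "f k x - g x" "h k x - l x"] by (simp add: algebra_simps)
      then have "ennreal ((norm (f k x + h k x - (g x + l x)))\<^sup>2) \<le> ennreal (2 * (norm (f k x - g x))\<^sup>2 + 2 * (norm (h k x - l x))\<^sup>2)"
        by (rule ennreal_leI)
      then show "ennreal ((norm (f k x + h k x - (g x + l x)))\<^sup>2) \<le> 2 * ennreal ((norm (f k x - g x))\<^sup>2) + 2 * ennreal ((norm (h k x - l x))\<^sup>2)"
        by (simp add: ennreal_plus ennreal_mult'')
    qed
    also have "\<dots> = ?I k" by (simp add: nn_integral_add nn_integral_cmult)
    finally show "(\<integral>\<^sup>+x. ennreal ((norm (f k x + h k x - (g x + l x)))\<^sup>2) \<partial>M) \<le> ?I k" .
  qed
qed simp

lemma L2_tendsto_scaleR: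
  assumes "L2_tendsto M f g" and [measurable]: "g \<in> borel_measurable M" "\<And>k. f k \<in> borel_measurable M"
  shows "L2_tendsto M (\<lambda>k x. c *\<^sub>R f k x) (\<lambda>x. c *\<^sub>R g x)"
  by (rule L2_tendsto_bound[OF assms, of _ _ "c\<^sup>2"]) (auto simp: scaleR_diff_right[symmetric] power_mult_distrib)

lemma L2_tendsto_in_L2:
  assumes f: "L2_tendsto M f g" and fk: "\<And>k. f k \<in> L2 M" and [measurable]: "g \<in> borel_measurable M"
  shows "g \<in> L2 M"
proof -
  note [measurable] = L2_measurable[OF fk]
  have "\<forall>\<^sub>F k in sequentially. (\<integral>\<^sup>+x. ennreal ((norm (f k x - g x))\<^sup>2) \<partial>M) < 1"
    using f unfolding L2_tendsto_def by (rule order_tendstoD) simp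
  then obtain k where "(\<integral>\<^sup>+x. ennreal ((norm (f k x - g x))\<^sup>2) \<partial>M) < 1"
    using eventually_happens'[OF sequentially_bot] by blast
  then have "(\<integral>\<^sup>+x. ennreal ((norm (f k x - g x))\<^sup>2) \<partial>M) < \<infinity>"
    by (rule order_less_trans) simp
  then have "(\<lambda>x. f k x - g x) \<in> L2 M" by (simp add: L2_iff)
  from L2_diff[OF fk[of k] this] show ?thesis by simp
qed

lemma L2_tendsto_integral_norm:
  assumes f: "L2_tendsto M f g" and fk: "\<And>k. f k \<in> L2 M" and g: "g \<in> borel_measurable M"
  shows "(\<lambda>k. \<integral>x. (norm (f k x - g x))\<^sup>2 \<partial>M) \<longlonglongrightarrow> 0"
proof -
  have "(\<lambda>x. f k x - g x) \<in> L2 M" for k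
    by (intro L2_diff fk L2_tendsto_in_L2[OF assms])
  then have "(\<integral>\<^sup>+x. ennreal ((norm (f k x - g x))\<^sup>2) \<partial>M) = ennreal (\<integral>x. (norm (f k x - g x))\<^sup>2 \<partial>M)" for k
    by (intro nn_integral_eq_integral L2_integrable) auto
  with f have "(\<lambda>k. ennreal (\<integral>x. (norm (f k x - g x))\<^sup>2 \<partial>M)) \<longlonglongrightarrow> ennreal 0"
    unfolding L2_tendsto_def by simp
  then show ?thesis by (rule tendsto_ennrealD) auto
qed

lemma L2_tendsto_iff_integral:
  assumes "\<And>k. f k \<in> L2 M" "g \<in> L2 M"
  shows "L2_tendsto M f g \<longleftrightarrow> (\<lambda>k. \<integral>x. (norm (f k x - g x))\<^sup>2 \<partial>M) \<longlonglongrightarrow> 0"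
proof
  assume "(\<lambda>k. \<integral>x. (norm (f k x - g x))\<^sup>2 \<partial>M) \<longlonglongrightarrow> 0"
  from tendsto_ennrealI[OF this] have "(\<lambda>k. ennreal (\<integral>x. (norm (f k x - g x))\<^sup>2 \<partial>M)) \<longlonglongrightarrow> 0" by simp
  moreover have "(\<integral>\<^sup>+x. ennreal ((norm (f k x - g x))\<^sup>2) \<partial>M) = ennreal (\<integral>x. (norm (f k x - g x))\<^sup>2 \<partial>M)" for k
    by (intro nn_integral_eq_integral L2_integrable L2_diff assms) auto
  ultimately show "L2_tendsto M f g"
    unfolding L2_tendsto_def by simp
qed (use assms L2_tendsto_integral_norm L2_measurable in blast)

lemma L2_tendsto_integral_inner:
  assumes f: "L2_tendsto M f g" and fk: "\<And>k. f k \<in> L2 M" and gm: "g \<in> borel_measurable M"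
    and h: "L2_tendsto M h l" and hk: "\<And>k. h k \<in> L2 M" and lm: "l \<in> borel_measurable M"
  shows "(\<lambda>k. \<integral>x. f k x \<bullet> h k x \<partial>M) \<longlonglongrightarrow> (\<integral>x. g x \<bullet> l x \<partial>M)"
proof -
  have g: "g \<in> L2 M" and l: "l \<in> L2 M"
    using L2_tendsto_in_L2 assms by blast+
  define a where "a k = sqrt (\<integral>x. (norm (f k x - g x))\<^sup>2 \<partial>M)" for k
  define b where "b k = sqrt (\<integral>x. (norm (h k x - l x))\<^sup>2 \<partial>M)" for k
  have a: "a \<longlonglongrightarrow> 0" and b: "b \<longlonglongrightarrow> 0"
    unfolding a_def b_def
    using tendsto_real_sqrt[OF L2_tendsto_integral_norm[OF f fk gm]] tendsto_real_sqrt[OF L2_tendsto_integral_norm[OF h hk lm]]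
    by simp_all
  define A where "A = sqrt (\<integral>x. (norm (g x))\<^sup>2 \<partial>M)"
  define B where "B = sqrt (\<integral>x. (norm (l x))\<^sup>2 \<partial>M)"
  have "(\<lambda>k. (\<integral>x. f k x \<bullet> h k x \<partial>M) - (\<integral>x. g x \<bullet> l x \<partial>M)) \<longlonglongrightarrow> 0"
  proof (rule Lim_null_comparison)
    have "(\<lambda>k. a k * b k + a k * B + A * b k) \<longlonglongrightarrow> 0 * 0 + 0 * B + A * 0"
      by (intro tendsto_intros a b)
    then show "(\<lambda>k. a k * b k + a k * B + A * b k) \<longlonglongrightarrow> 0" by simp
    have "\<bar>(\<integral>x. f k x \<bullet> h k x \<partial>M) - (\<integral>x. g x \<bullet> l x \<partial>M)\<bar> \<le> a k * b k + a k * B + A * b k" for k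
    proof -
      have df: "(\<lambda>x. f k x - g x) \<in> L2 M" and dh: "(\<lambda>x. h k x - l x) \<in> L2 M"
        by (intro L2_diff fk hk g l)+
      have "(\<integral>x. f k x \<bullet> h k x \<partial>M) - (\<integral>x. g x \<bullet> l x \<partial>M) = (\<integral>x. f k x \<bullet> h k x - g x \<bullet> l x \<partial>M)"
        by (intro Bochner_Integration.integral_diff[symmetric] L2_inner_integrable fk hk g l)
      also have "\<dots> = (\<integral>x. (f k x - g x) \<bullet> (h k x - l x) + (f k x - g x) \<bullet> l x + g x \<bullet> (h k x - l x) \<partial>M)"
        by (intro Bochner_Integration.integral_cong refl) (simp add: algebra_simps inner_diff_left inner_diff_right)
      also have "\<dots> = (\<integral>x. (f k x - g x) \<bullet> (h k x - l x) \<partial>M) + (\<integral>x. (f k x - g x) \<bullet> l x \<partial>M) + (\<integral>x. g x \<bullet> (h k x - l x) \<partial>M)"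
        using L2_inner_integrable[OF df dh] L2_inner_integrable[OF df l] L2_inner_integrable[OF g dh] by simp
      finally show ?thesis
        using L2_Cauchy_Schwarz_sqrt[OF df dh] L2_Cauchy_Schwarz_sqrt[OF df l] L2_Cauchy_Schwarz_sqrt[OF g dh]
        unfolding a_def[symmetric] b_def[symmetric] A_def[symmetric] B_def[symmetric] by linarith
    qed
    then show "\<forall>\<^sub>F k in sequentially. norm ((\<integral>x. f k x \<bullet> h k x \<partial>M) - (\<integral>x. g x \<bullet> l x \<partial>M)) \<le> a k * b k + a k * B + A * b k"
      by simp
  qed
  then show ?thesis by (simp add: LIM_zero_iff)
qed

lemma L2_tendsto_const: "L2_tendsto M (\<lambda>k. g) g"
  by (simp add: L2_tendsto_def)

lemma L2_tendsto_AE_subseq: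
  assumes f: "L2_tendsto M f g" and fk: "\<And>k. f k \<in> L2 M" and gm: "g \<in> borel_measurable M"
  shows "\<exists>r::nat\<Rightarrow>nat. strict_mono r \<and> (AE x in M. (\<lambda>k. f (r k) x) \<longlonglongrightarrow> g x)"
proof -
  have d: "(\<lambda>x. f k x - g x) \<in> L2 M" for k
    by (intro L2_diff fk L2_tendsto_in_L2[OF assms])
  have "\<exists>r::nat\<Rightarrow>nat. strict_mono r \<and> (AE x in M. (\<lambda>k. (norm (f (r k) x - g x))\<^sup>2) \<longlonglongrightarrow> 0)"
    by (rule tendsto_L1_AE_subseq) (use L2_integrable[OF d] L2_tendsto_integral_norm[OF assms] in auto)
  then obtain r :: "nat \<Rightarrow> nat" where r: "strict_mono r" "AE x in M. (\<lambda>k. (norm (f (r k) x - g x))\<^sup>2) \<longlonglongrightarrow> 0"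
    by blast
  from r(2) have "AE x in M. (\<lambda>k. f (r k) x) \<longlonglongrightarrow> g x"
  proof eventually_elim
    case (elim x)
    from tendsto_real_sqrt[OF this] show ?case
      by (simp add: tendsto_norm_zero_iff LIM_zero_iff)
  qed
  with r(1) show ?thesis by blast
qed

text \<open>Riesz--Fischer in the form that is used for traces: increments that are square summable with
  geometric room to spare force pointwise convergence, and Fatou's lemma turns this into convergence
  in the mean.\<close>

lemma L2_complete_fast:
  fixes f :: "nat \<Rightarrow> 'a \<Rightarrow> real"
  assumes fk: "\<And>k. f k \<in> L2 M"
    and fast: "\<And>j k. j \<le> k \<Longrightarrow> (\<integral>\<^sup>+x. ennreal ((f k x - f j x)\<^sup>2) \<partial>M) \<le> ennreal ((1/8) ^ j)"
  shows "\<exists>g. g \<in> borel_measurable M \<and> L2_tendsto M f g"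
proof -
  note [measurable] = L2_measurable[OF fk]
  have "(\<integral>\<^sup>+x. (\<Sum>j. ennreal (4 ^ j * (f (Suc j) x - f j x)\<^sup>2)) \<partial>M) = (\<Sum>j. \<integral>\<^sup>+x. ennreal (4 ^ j * (f (Suc j) x - f j x)\<^sup>2) \<partial>M)"
    by (intro nn_integral_suminf) auto
  also have "\<dots> \<le> (\<Sum>j. ennreal ((1/2) ^ j))"
  proof (intro suminf_le allI)
    fix j
    have "(\<integral>\<^sup>+x. ennreal (4 ^ j * (f (Suc j) x - f j x)\<^sup>2) \<partial>M) = ennreal (4 ^ j) * (\<integral>\<^sup>+x. ennreal ((f (Suc j) x - f j x)\<^sup>2) \<partial>M)"
      by (subst nn_integral_cmult[symmetric]) (auto simp: ennreal_mult)
    also have "\<dots> \<le> ennreal (4 ^ j) * ennreal ((1/8) ^ j)"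
      by (intro mult_left_mono fast) auto
    also have "\<dots> = ennreal ((1/2) ^ j)"
      by (subst ennreal_mult[symmetric]) (auto simp: power_mult_distrib[symmetric])
    finally show "(\<integral>\<^sup>+x. ennreal (4 ^ j * (f (Suc j) x - f j x)\<^sup>2) \<partial>M) \<le> ennreal ((1/2) ^ j)" .
  qed auto
  also have "\<dots> < \<infinity>"
    by (subst suminf_ennreal2) (auto intro!: summable_geometric)
  finally have "(\<integral>\<^sup>+x. (\<Sum>j. ennreal (4 ^ j * (f (Suc j) x - f j x)\<^sup>2)) \<partial>M) \<noteq> \<infinity>" by simp
  then have "AE x in M. (\<Sum>j. ennreal (4 ^ j * (f (Suc j) x - f j x)\<^sup>2)) \<noteq> \<infinity>"
    by (intro nn_integral_PInf_AE) auto
  then have conv: "AE x in M. convergent (\<lambda>k. f k x)"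
  proof eventually_elim
    case (elim x)
    then have sm: "summable (\<lambda>j. 4 ^ j * (f (Suc j) x - f j x)\<^sup>2)"
      by (intro summable_suminf_not_top) auto
    have "summable (\<lambda>j. (1/4) ^ j + 4 ^ j * (f (Suc j) x - f j x)\<^sup>2)"
      by (intro summable_add sm summable_geometric) auto
    then have "summable (\<lambda>j. f (Suc j) x - f j x)"
    proof (rule summable_comparison_test')
      fix j :: nat
      have aux: "c \<le> a" if "0 \<le> a - 2 * c" "0 \<le> c" for a c :: real
        using that by simp
      have four: "((2::real) ^ j)\<^sup>2 = 4 ^ j" by (simp add: power2_eq_square flip: power_mult_distrib)
      have "0 \<le> ((1/2)^j - 2^j * \<bar>f (Suc j) x - f j x\<bar>)\<^sup>2" by simp
      also have "\<dots> = (1/4)^j + 4 ^ j * (f (Suc j) x - f j x)\<^sup>2 - 2 * \<bar>f (Suc j) x - f j x\<bar>"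
        using four by (simp add: power2_diff power_mult_distrib power_divide algebra_simps)
      finally show "norm (f (Suc j) x - f j x) \<le> (1/4) ^ j + 4 ^ j * (f (Suc j) x - f j x)\<^sup>2"
        unfolding real_norm_def by (intro aux[OF _ abs_ge_zero])
    qed
    then have "convergent (\<lambda>n. \<Sum>j<n. f (Suc j) x - f j x)"
      by (simp add: summable_iff_convergent)
    then have "convergent (\<lambda>n. f n x - f 0 x)" by (simp only: sum_lessThan_telescope[of "\<lambda>n. f n x"])
    then have "convergent (\<lambda>n. f n x - f 0 x + f 0 x)" by (intro convergent_add convergent_const)
    then show ?case by simp
  qed
  define g where "g x = lim (\<lambda>k. f k x)" for x
  have [measurable]: "g \<in> borel_measurable M" unfolding g_def by measurable
  have "(\<integral>\<^sup>+x. ennreal ((f j x - g x)\<^sup>2) \<partial>M) \<le> ennreal ((1/8) ^ j)" for j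
  proof -
    have "(\<integral>\<^sup>+x. ennreal ((f j x - g x)\<^sup>2) \<partial>M) = (\<integral>\<^sup>+x. liminf (\<lambda>k. ennreal ((f k x - f j x)\<^sup>2)) \<partial>M)"
    proof (rule nn_integral_cong_AE)
      show "AE x in M. ennreal ((f j x - g x)\<^sup>2) = liminf (\<lambda>k. ennreal ((f k x - f j x)\<^sup>2))"
        using conv
      proof eventually_elim
        case (elim x)
        then have "(\<lambda>k. f k x) \<longlonglongrightarrow> g x" unfolding g_def by (simp add: convergent_LIMSEQ_iff)
        then have "(\<lambda>k. ennreal ((f k x - f j x)\<^sup>2)) \<longlonglongrightarrow> ennreal ((g x - f j x)\<^sup>2)"
          by (intro tendsto_intros tendsto_ennrealI)
        from lim_imp_Liminf[OF sequentially_bot this] show ?case by (simp add: power2_commute)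
      qed
    qed
    also have "\<dots> \<le> liminf (\<lambda>k. \<integral>\<^sup>+x. ennreal ((f k x - f j x)\<^sup>2) \<partial>M)"
      by (intro nn_integral_liminf) auto
    also have "\<dots> \<le> ennreal ((1/8) ^ j)"
      by (intro Liminf_le eventually_sequentiallyI[of j] fast) auto
    finally show ?thesis .
  qed
  moreover
  have "(\<lambda>j. (1/8::real) ^ j) \<longlonglongrightarrow> 0" by (rule LIMSEQ_power_zero) simp
  from tendsto_ennrealI[OF this] have "(\<lambda>j. ennreal ((1/8) ^ j)) \<longlonglongrightarrow> 0" by (simp only: ennreal_0)
  ultimately have "L2_tendsto M f g"
    unfolding L2_tendsto_real by (rule ennreal_tendsto_zero_le)
  then show ?thesis using \<open>g \<in> borel_measurable M\<close> by blast
qed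

section \<open>Integration by parts on the half-space\<close>

definition M0 :: "('m::finite) pt measure" where
  "M0 = restrict_space lborel halfspace"

lemma abs_snd_le: "\<bar>snd x\<bar> \<le> norm x" for x :: "'a::real_normed_vector \<times> real"
  using norm_snd_le[of "snd x" "fst x"] by simp

lemma halfspace_open: "open (halfspace :: ('m::finite) pt set)"
proof -
  have "open {x :: 'm pt. 0 < snd x}"
    by (intro open_Collect_less continuous_intros)
  then show ?thesis by (simp add: halfspace_def)
qed

lemma halfspace_measurable [measurable]: "halfspace \<in> sets borel"
  using halfspace_open by (rule borel_open)

lemma space_M0 [simp]: "space M0 = halfspace"
  by (simp add: M0_def space_restrict_space)

lemma measurable_M0: "f \<in> borel_measurable borel \<Longrightarrow> f \<in> borel_measurable M0"
  by (simp add: M0_def measurable_restrict_space1)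

lemma continuous_measurable_M0: "continuous_on UNIV f \<Longrightarrow> f \<in> borel_measurable M0"
  by (intro measurable_M0 borel_measurable_continuous_onI)

lemma integral_M0: "integral\<^sup>L M0 f = (\<integral>x. indicator halfspace x *\<^sub>R f x \<partial>lborel)"
  for f :: "'m::finite pt \<Rightarrow> 'b::{banach, second_countable_topology}"
  unfolding M0_def by (subst integral_restrict_space) auto

lemma integrable_M0: "integrable M0 f \<longleftrightarrow> integrable lborel (\<lambda>x. indicator halfspace x *\<^sub>R f x)"
  for f :: "'m::finite pt \<Rightarrow> 'b::{banach, second_countable_topology}"
  unfolding M0_def by (subst integrable_restrict_space) auto

lemma integrable_lborel_imp_M0: "integrable lborel f \<Longrightarrow> integrable M0 f"
  for f :: "'m::finite pt \<Rightarrow> 'b::{banach, second_countable_topology}"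
  unfolding integrable_M0 by (intro integrable_mult_indicator) auto

lemma continuous_compact_integrable:
  fixes f :: "'a::euclidean_space \<Rightarrow> 'b::euclidean_space"
  assumes "continuous_on UNIV f" "\<And>x. norm x \<ge> R \<Longrightarrow> f x = 0"
  shows "integrable lborel f"
proof -
  have "integrable lborel (\<lambda>x. indicator (cball 0 R) x *\<^sub>R f x)"
    by (intro borel_integrable_compact continuous_on_subset[OF assms(1)]) auto
  moreover have "(\<lambda>x. indicator (cball 0 R) x *\<^sub>R f x) = f"
    using assms(2) by (auto simp: indicator_def fun_eq_iff)
  ultimately show ?thesis by simp
qed

text \<open>\<open>C1 f F\<close> means that \<open>f\<close> is continuously differentiable with gradient \<open>F\<close>; carrying the gradient
  along keeps the product and chain rules computable. \<open>C1c\<close> adds compact support.\<close>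

definition C1 :: "('a::euclidean_space \<Rightarrow> real) \<Rightarrow> ('a \<Rightarrow> 'a) \<Rightarrow> bool" where
  "C1 f F \<longleftrightarrow> (\<forall>x. (f has_derivative (\<lambda>v. F x \<bullet> v)) (at x)) \<and> continuous_on UNIV F"

definition C1c :: "('a::euclidean_space \<Rightarrow> real) \<Rightarrow> ('a \<Rightarrow> 'a) \<Rightarrow> bool" where
  "C1c f F \<longleftrightarrow> C1 f F \<and> (\<exists>R>0. \<forall>x. norm x \<ge> R \<longrightarrow> f x = 0 \<and> F x = 0)"

lemma C1_has_derivative: "C1 f F \<Longrightarrow> (f has_derivative (\<lambda>v. F x \<bullet> v)) (at x within S)"
  by (rule has_derivative_at_withinI[OF spec[OF conjunct1[OF C1_def[THEN iffD1]]]])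

lemma C1_continuous:
  assumes "C1 f F" shows "continuous_on UNIV f" "continuous_on UNIV F"
proof -
  show "continuous_on UNIV f"
    by (intro continuous_at_imp_continuous_on ballI has_derivative_continuous[OF C1_has_derivative[OF assms]])
qed (use assms in \<open>simp add: C1_def\<close>)

lemma C1_smooth: "smooth f \<Longrightarrow> C1 f (grad f)"
  by (simp add: C1_def smooth_has_derivative_grad smooth_grad_continuous_on)

lemma C1_grad: "C1 f F \<Longrightarrow> grad f = F"
  by (auto simp: C1_def intro!: grad_eqI)

lemma C1_mult: "C1 f F \<Longrightarrow> C1 g G \<Longrightarrow> C1 (\<lambda>x. f x * g x) (\<lambda>x. f x *\<^sub>R G x + g x *\<^sub>R F x)"
  using C1_continuous[of f F] C1_continuous[of g G]
  by (auto simp: C1_def inner_add_left mult.commute intro!: continuous_intros has_derivative_eq_rhs[OF has_derivative_mult])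

lemma C1_add: "C1 f F \<Longrightarrow> C1 g G \<Longrightarrow> C1 (\<lambda>x. f x + g x) (\<lambda>x. F x + G x)"
  by (auto simp: C1_def inner_add_left intro!: continuous_intros has_derivative_add)

lemma C1_compose:
  assumes h: "\<And>s. (h has_real_derivative h' s) (at s)" "continuous_on UNIV h'" and f: "C1 f F"
  shows "C1 (\<lambda>x. h (f x)) (\<lambda>x. h' (f x) *\<^sub>R F x)"
  unfolding C1_def
proof (intro conjI allI)
  fix x
  have "(h has_derivative (\<lambda>v. h' (f x) * v)) (at (f x))"
    using h(1)[of "f x"] by (simp add: has_field_derivative_def)
  then have "((\<lambda>x. h (f x)) has_derivative (\<lambda>v. h' (f x) * (F x \<bullet> v))) (at x)"
    by (intro has_derivative_compose[of f _ _ _ h] C1_has_derivative[OF f])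
  then show "((\<lambda>x. h (f x)) has_derivative (\<lambda>v. (h' (f x) *\<^sub>R F x) \<bullet> v)) (at x)" by simp
  show "continuous_on UNIV (\<lambda>x. h' (f x) *\<^sub>R F x)"
    by (intro continuous_on_scaleR continuous_on_compose2[OF h(2) C1_continuous(1)[OF f]] C1_continuous(2)[OF f] subset_UNIV)
qed

lemma C1c_C1: "C1c f F \<Longrightarrow> C1 f F"
  by (simp add: C1c_def)

lemma C1cI:
  assumes "C1 f F" "\<And>x. norm x \<ge> R \<Longrightarrow> f x = 0"
  shows "C1c f F"
proof -
  have "F x = 0" if "norm x \<ge> \<bar>R\<bar> + 1" for x
  proof -
    have "((\<lambda>x. 0) has_derivative (\<lambda>v. F x \<bullet> v)) (at x)"
    proof (rule has_derivative_transform_within_open[where s="- cball 0 \<bar>R\<bar>"])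
      show "(f has_derivative (\<lambda>v. F x \<bullet> v)) (at x)" using assms(1) by (simp add: C1_def)
    qed (use that assms(2) in auto)
    then have "(\<lambda>v. F x \<bullet> v) = (\<lambda>v. 0)"
      by (rule has_derivative_unique[OF _ has_derivative_const])
    then have "F x \<bullet> F x = 0" by (rule fun_cong)
    then show ?thesis by simp
  qed
  moreover have "f x = 0" if "norm x \<ge> \<bar>R\<bar> + 1" for x
    using that by (intro assms(2)) auto
  ultimately show ?thesis
    unfolding C1c_def using assms(1) by (intro conjI exI[of _ "\<bar>R\<bar> + 1"]) auto
qed

lemma C1c_mult: "C1c f F \<Longrightarrow> C1 g G \<Longrightarrow> C1c (\<lambda>x. f x * g x) (\<lambda>x. f x *\<^sub>R G x + g x *\<^sub>R F x)"
  unfolding C1c_def by (auto intro!: C1_mult)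

lemma C1c_integrable:
  assumes "C1c f F"
  shows "integrable lborel f" "integrable lborel F"
proof -
  obtain R where R: "\<And>x. norm x \<ge> R \<Longrightarrow> f x = 0 \<and> F x = 0"
    using assms by (auto simp: C1c_def)
  show "integrable lborel f" "integrable lborel F"
    using R C1_continuous[OF C1c_C1[OF assms]] by (auto intro!: continuous_compact_integrable[of _ R])
qed

lemma lborel_translate:
  fixes f :: "'a::euclidean_space \<Rightarrow> 'b::euclidean_space"
  assumes [measurable]: "f \<in> borel_measurable borel"
  shows "(\<integral>x. f (x + c) \<partial>lborel) = (\<integral>x. f x \<partial>lborel)"
proof -
  have "(\<integral>x. f x \<partial>lborel) = (\<integral>x. f x \<partial>(distr lborel borel ((+) c)))"
    by (simp add: lborel_distr_plus)
  also have "\<dots> = (\<integral>x. f (c + x) \<partial>lborel)"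
    by (intro integral_distr) auto
  finally show ?thesis by (simp add: add.commute)
qed

text \<open>Translations along the boundary preserve the half-space, so the integral of a difference quotient
  in such a direction vanishes before the limit is taken.\<close>

lemma divergence_tangential:
  fixes f :: "('m::finite) pt \<Rightarrow> real"
  assumes f: "C1c f F" and w: "snd w = 0"
  shows "(\<integral>x. F x \<bullet> w \<partial>M0) = 0"
proof -
  obtain R where R: "R > 0" "\<And>x. norm x \<ge> R \<Longrightarrow> f x = 0 \<and> F x = 0"
    using f by (auto simp: C1c_def)
  note cont = C1_continuous[OF C1c_C1[OF f]]
  have "bounded (F ` cball 0 R)"
    by (intro compact_imp_bounded compact_continuous_image continuous_on_subset[OF cont(2)]) auto
  then obtain B where B: "\<And>x. x \<in> cball 0 R \<Longrightarrow> norm (F x) \<le> B" "B > 0"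
    unfolding bounded_pos by blast
  have FB: "norm (F x) \<le> B" for x
    using B R(2)[of x] by (cases "norm x \<le> R") (auto simp: less_imp_le)
  have lip: "\<bar>f (x + h) - f x\<bar> \<le> B * norm h" for x h
  proof -
    have "norm (f (x + h) - f x) \<le> B * norm (x + h - x)"
    proof (rule differentiable_bound[where S=UNIV and f'="\<lambda>x v. F x \<bullet> v"])
      show "(f has_derivative (\<lambda>v. F y \<bullet> v)) (at y within UNIV)" for y
        by (rule C1_has_derivative[OF C1c_C1[OF f]])
      show "onorm (\<lambda>v. F y \<bullet> v) \<le> B" for y
        by (rule order_trans[OF onorm_le FB[of y]]) (use Cauchy_Schwarz_ineq2 in auto)
    qed auto
    then show ?thesis by simp
  qed
  define q where "q n x = real (Suc n) * (f (x + (1 / real (Suc n)) *\<^sub>R w) - f x)" for n x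
  have [measurable]: "f \<in> borel_measurable borel" "F \<in> borel_measurable borel"
    using cont by (auto intro: borel_measurable_continuous_onI)
  have z: "(\<integral>x. indicator halfspace x * q n x \<partial>lborel) = 0" for n
  proof -
    let ?h = "(1 / real (Suc n)) *\<^sub>R w"
    have hs: "indicator halfspace (x + ?h) = (indicator halfspace x :: real)" for x
      using w by (simp add: halfspace_def indicator_def)
    have i0: "integrable lborel (\<lambda>x. indicator halfspace x * f x)"
      using integrable_mult_indicator[of halfspace lborel f] C1c_integrable(1)[OF f] by simp
    have "(\<integral>x. indicator halfspace (x + ?h) * f (x + ?h) \<partial>lborel) = (\<integral>x. indicator halfspace x * f x \<partial>lborel)"
      by (rule lborel_translate) measurable
    moreover have i1: "integrable lborel (\<lambda>x. indicator halfspace (x + ?h) * f (x + ?h))"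
    proof -
      have "integrable (distr lborel borel ((+) ?h)) (\<lambda>x. indicator halfspace x * f x)"
        using i0 by (simp add: lborel_distr_plus)
      then show ?thesis
        by (subst (asm) integrable_distr_eq) (auto simp: add.commute)
    qed
    ultimately have "(\<integral>x. indicator halfspace x * f (x + ?h) - indicator halfspace x * f x \<partial>lborel) = 0"
      unfolding hs using i0 by (subst Bochner_Integration.integral_diff) auto
    then have "(\<integral>x. real (Suc n) * (indicator halfspace x * f (x + ?h) - indicator halfspace x * f x) \<partial>lborel) = 0"
      by simp
    then show ?thesis by (simp add: q_def algebra_simps)
  qed
  have "(\<lambda>n. \<integral>x. indicator halfspace x * q n x \<partial>lborel) \<longlonglongrightarrow> (\<integral>x. indicator halfspace x * (F x \<bullet> w) \<partial>lborel)"
  proof (rule integral_dominated_convergence)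
    show "integrable lborel (\<lambda>x. B * norm w * indicator (cball 0 (R + norm w)) x)"
      by (intro integrable_mult_right integrable_real_indicator)
         (auto simp: emeasure_lborel_cball_finite[unfolded infinity_ennreal_def])
    show "AE x in lborel. (\<lambda>n. indicator halfspace x * q n x) \<longlonglongrightarrow> indicator halfspace x * (F x \<bullet> w)"
    proof (intro AE_I2 tendsto_intros)
      fix x
      have "((\<lambda>s. f (x + s *\<^sub>R w)) has_derivative (\<lambda>s. F (x + 0 *\<^sub>R w) \<bullet> (s *\<^sub>R w))) (at (0::real))"
        by (intro has_derivative_compose[of "\<lambda>s. x + s *\<^sub>R w" _ _ _ f] C1_has_derivative[OF C1c_C1[OF f]])
           (auto intro!: derivative_eq_intros)
      then have "((\<lambda>s. f (x + s *\<^sub>R w)) has_real_derivative (F x \<bullet> w)) (at 0)"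
        unfolding has_field_derivative_def by (rule has_derivative_eq_rhs) (auto simp: mult.commute)
      then have lim: "((\<lambda>h. (f (x + h *\<^sub>R w) - f x) / h) \<longlongrightarrow> F x \<bullet> w) (at 0)"
        by (simp add: has_field_derivative_iff)
      have "filterlim (\<lambda>n. 1 / real (Suc n)) (at 0) sequentially"
        using LIMSEQ_inverse_real_of_nat by (intro filterlim_atI) (auto simp: inverse_eq_divide)
      from filterlim_compose[OF lim this] show "(\<lambda>n. q n x) \<longlonglongrightarrow> F x \<bullet> w"
        by (simp add: q_def mult.commute)
    qed
    show "AE x in lborel. norm (indicator halfspace x * q n x) \<le> B * norm w * indicator (cball 0 (R + norm w)) x" for n
    proof (intro AE_I2)
      fix x
      let ?h = "(1 / real (Suc n)) *\<^sub>R w"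
      have nh: "norm ?h \<le> norm w" by (simp add: divide_le_eq mult_le_cancel_left1)
      have "\<bar>q n x\<bar> \<le> real (Suc n) * (B * norm ?h)"
        unfolding q_def abs_mult using lip[of x ?h] by (intro mult_mono) auto
      also have "\<dots> = B * norm w" by simp
      finally have "\<bar>q n x\<bar> \<le> B * norm w" .
      moreover have "q n x = 0" if "x \<notin> cball 0 (R + norm w)"
      proof -
        have "norm x \<le> norm (x + ?h) + norm ?h" using norm_triangle_ineq4[of "x + ?h" ?h] by simp
        moreover have "norm x > R + norm w" using that by simp
        ultimately have "norm (x + ?h) \<ge> R" "norm x \<ge> R" using norm_ge_zero[of w] nh by linarith+
        then show ?thesis using R(2) by (simp add: q_def)
      qed
      ultimately show "norm (indicator halfspace x * q n x) \<le> B * norm w * indicator (cball 0 (R + norm w)) x"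
        using B(2) by (auto simp: indicator_def)
    qed
  qed (auto simp: q_def)
  with z have "(\<integral>x. indicator halfspace x * (F x \<bullet> w) \<partial>lborel) = 0"
    by (simp add: LIMSEQ_const_iff)
  then show ?thesis by (simp add: integral_M0)
qed

lemma divergence_normal:
  fixes f :: "('m::finite) pt \<Rightarrow> real"
  assumes f: "C1c f F"
  shows "(\<integral>x. snd (F x) \<partial>M0) = - (\<integral>y. f (y, 0) \<partial>lborel)"
proof -
  obtain R where R: "R > 0" "\<And>x. norm x \<ge> R \<Longrightarrow> f x = 0 \<and> F x = 0"
    using f by (auto simp: C1c_def)
  note cont = C1_continuous[OF C1c_C1[OF f]]
  have i: "integrable (lborel \<Otimes>\<^sub>M lborel) (\<lambda>x. indicator halfspace x * snd (F x))"
    unfolding lborel_prod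
  proof -
    have "integrable lborel (\<lambda>x. snd (F x))"
      using R cont by (intro continuous_compact_integrable[of _ R] continuous_intros) auto
    from integrable_mult_indicator[OF _ this, of halfspace]
    show "integrable lborel (\<lambda>x. indicator halfspace x * snd (F x))" by simp
  qed
  have inner: "(\<integral>t. indicator halfspace (y, t) * snd (F (y, t)) \<partial>lborel) = - f (y, 0)" for y
  proof -
    have "(\<integral>t. indicator halfspace (y, t) * snd (F (y, t)) \<partial>lborel) = (\<integral>t. indicator {0..R} t *\<^sub>R snd (F (y, t)) \<partial>lborel)"
    proof (rule integral_cong_AE)
      show "AE t in lborel. indicator halfspace (y, t) * snd (F (y, t)) = indicator {0..R} t *\<^sub>R snd (F (y, t))"
        using AE_lborel_singleton[of "0::real"]
      proof eventually_elim
        case (elim t)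
        have "norm (y, t) \<ge> t" for t :: real
          using abs_snd_le[of "(y,t)"] by simp
        then have "R \<le> norm (y, t)" if "R \<le> t"
          using that order_trans by blast
        with R(2)[of "(y, t)"] elim show ?case
          by (cases "t \<le> R") (auto simp: halfspace_def indicator_def)
      qed
      have 1: "continuous_on UNIV (\<lambda>t. snd (F (y, t)))"
        by (intro continuous_intros continuous_on_compose2[OF cont(2)]) auto
      then have [measurable]: "(\<lambda>t. snd (F (y, t))) \<in> borel_measurable borel"
        by (rule borel_measurable_continuous_onI)
      show "(\<lambda>t. indicator halfspace (y, t) * snd (F (y, t))) \<in> borel_measurable lborel"
        unfolding halfspace_def indicator_def by simp measurable
      show "(\<lambda>t. indicator {0..R} t *\<^sub>R snd (F (y, t))) \<in> borel_measurable lborel" by measurable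
    qed
    also have "\<dots> = f (y, R) - f (y, 0)"
    proof (rule integral_FTC_atLeastAtMost)
      show "((\<lambda>t. f (y, t)) has_vector_derivative snd (F (y, t))) (at t within {0..R})" for t
      proof -
        have "((\<lambda>t. f (y, t)) has_derivative (\<lambda>s. F (y, t) \<bullet> (0, s))) (at t)"
          by (intro has_derivative_compose[of "\<lambda>t. (y, t)" _ _ _ f] C1_has_derivative[OF C1c_C1[OF f]])
             (auto intro!: derivative_eq_intros)
        moreover have "(\<lambda>s. F (y, t) \<bullet> (0, s)) = (\<lambda>s. s *\<^sub>R snd (F (y, t)))"
          by (auto simp: inner_prod_def fun_eq_iff)
        ultimately show ?thesis
          by (simp add: has_vector_derivative_def has_derivative_at_withinI)
      qed
      show "continuous_on {0..R} (\<lambda>t. snd (F (y, t)))"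
        by (intro continuous_intros continuous_on_compose2[OF cont(2)]) auto
    qed (use R in auto)
    also have "f (y, R) = 0"
      using R abs_snd_le[of "(y,R)"] by auto
    finally show ?thesis by simp
  qed
  have "(\<integral>x. snd (F x) \<partial>M0) = (\<integral>x. indicator halfspace x * snd (F x) \<partial>(lborel \<Otimes>\<^sub>M lborel))"
    by (simp add: integral_M0 lborel_prod)
  also have "\<dots> = (\<integral>y. (\<integral>t. indicator halfspace (y, t) * snd (F (y, t)) \<partial>lborel) \<partial>lborel)"
    by (rule lborel_pair.integral_fst'[symmetric, OF i])
  also have "\<dots> = - (\<integral>y. f (y, 0) \<partial>lborel)"
    unfolding inner by simp
  finally show ?thesis .
qed

lemma divergence_halfspace:
  fixes f :: "('m::finite) pt \<Rightarrow> real"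
  assumes f: "C1c f F"
  shows "(\<integral>x. F x \<bullet> w \<partial>M0) = - snd w * (\<integral>y. f (y, 0) \<partial>lborel)" "integrable M0 (\<lambda>x. F x \<bullet> w)"
proof -
  have i: "integrable M0 (\<lambda>x. F x \<bullet> v)" for v
    using C1c_integrable(2)[OF f] by (intro integrable_lborel_imp_M0 integrable_inner_left) auto
  then show "integrable M0 (\<lambda>x. F x \<bullet> w)" .
  have "F x \<bullet> w = F x \<bullet> (fst w, 0) + snd w * snd (F x)" for x
    by (simp add: inner_prod_def)
  moreover have "integrable M0 (\<lambda>x. snd (F x))"
    using i[of "(0, 1)"] by (simp add: inner_prod_def)
  ultimately show "(\<integral>x. F x \<bullet> w \<partial>M0) = - snd w * (\<integral>y. f (y, 0) \<partial>lborel)"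
    using i[of "(fst w, 0)"] divergence_tangential[OF f, of "(fst w, 0)"] divergence_normal[OF f] by simp
qed

text \<open>The unweighted estimates of boundary values rest on this inequality; it is applied to squares, to the
  square of the negative part and to powers of the modulus.\<close>

lemma boundary_integral_le:
  fixes f :: "('m::finite) pt \<Rightarrow> real"
  assumes f: "C1c f F"
  shows "(\<integral>y. f (y, 0) \<partial>lborel) \<le> (\<integral>x. norm (F x) \<partial>M0)"
proof -
  have "(\<integral>y. f (y, 0) \<partial>lborel) = (\<integral>x. - snd (F x) \<partial>M0)"
    using divergence_normal[OF f] by simp
  also have "\<dots> \<le> (\<integral>x. norm (F x) \<partial>M0)"
  proof (rule integral_mono)
    show "integrable M0 (\<lambda>x. - snd (F x))"
      using divergence_halfspace(2)[OF f, of "(0,1)"] by (simp add: inner_prod_def)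
    show "integrable M0 (\<lambda>x. norm (F x))"
      using C1c_integrable(2)[OF f] integrable_lborel_imp_M0 by auto
    show "- snd (F x) \<le> norm (F x)" for x
      using abs_snd_le[of "F x"] abs_ge_minus_self[of "snd (F x)"] by linarith
  qed
  finally show ?thesis .
qed

section \<open>The weighted measures and the test functions\<close>

lemma K_pos [simp]: "K x > 0" "K x \<ge> 0" "K x \<noteq> 0"
  by (simp_all add: K_def)

lemma K_ge_1: "K x \<ge> 1"
  by (simp add: K_def)

lemma smooth_K: "smooth K"
proof -
  have "smooth (\<lambda>x::'a pt. exp ((norm x)\<^sup>2 * (1/4)))"
    by (intro smooth_exp smooth_mult smooth_norm2 smooth_const)
  then show ?thesis by (simp add: K_def[abs_def])
qed

lemma grad_K: "grad K x = (K x / 2) *\<^sub>R x"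
proof (rule grad_eqI)
  have "((\<lambda>x. (norm x)\<^sup>2 / 4) has_derivative (\<lambda>v. (x \<bullet> v) / 2)) (at x)" for x :: "'a pt"
    unfolding power2_norm_eq_inner
    by (auto intro!: derivative_eq_intros simp: inner_commute)
  from has_derivative_exp[OF this]
  show "(K has_derivative (\<lambda>v. (K x / 2) *\<^sub>R x \<bullet> v)) (at x)"
    by (simp add: K_def[abs_def] mult.commute)
qed

lemma C1_K: "C1 K (\<lambda>x::('a::finite) pt. (K x / 2) *\<^sub>R x)"
proof -
  have "grad K = (\<lambda>x::'a pt. (K x / 2) *\<^sub>R x)" by (rule ext) (rule grad_K)
  moreover have "C1 (K :: 'a pt \<Rightarrow> real) (grad K)" by (rule C1_smooth[OF smooth_K])
  ultimately show ?thesis by (simp only:)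
qed

lemma continuous_K: "continuous_on S K"
  by (rule smooth_continuous_on[OF smooth_K])

lemma K_measurable [measurable]: "K \<in> borel_measurable borel" "(\<lambda>y. K (y, 0)) \<in> borel_measurable borel"
  by (auto intro!: borel_measurable_continuous_onI continuous_K
      continuous_on_compose2[OF continuous_K[of UNIV]] continuous_intros)

lemma K_measurable_M0 [measurable]: "K \<in> borel_measurable M0"
  by (intro measurable_M0 K_measurable)

lemma MH_M0: "MH = density M0 (\<lambda>x. ennreal (K x))"
  by (simp add: MH_def M0_def)

lemma sets_MH [simp, measurable_cong]: "sets MH = sets M0"
  by (simp add: MH_M0)

lemma space_MH [simp]: "space MH = halfspace"
  by (simp add: MH_M0)

lemma sets_MB [simp, measurable_cong]: "sets MB = sets borel"
  by (simp add: MB_def)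

lemma space_MB [simp]: "space MB = UNIV"
  by (simp add: MB_def)

lemma measurable_MH: "borel_measurable MH = borel_measurable M0"
  by (intro measurable_cong_sets) auto

lemma measurable_MB: "borel_measurable MB = borel_measurable borel"
  by (intro measurable_cong_sets) auto

lemma AE_MH: "(AE x in MH. P x) \<longleftrightarrow> (AE x in M0. P x)"
  unfolding MH_M0 by (subst AE_density) auto

lemma AE_MB: "(AE x in MB. P x) \<longleftrightarrow> (AE x in lborel. P x)"
  unfolding MB_def by (subst AE_density) auto

lemma integral_MH: "f \<in> borel_measurable M0 \<Longrightarrow> integral\<^sup>L MH f = (\<integral>x. K x * f x \<partial>M0)" for f :: "_ \<Rightarrow> real"
  unfolding MH_M0 by (subst integral_density) auto

lemma integrable_MH: "f \<in> borel_measurable M0 \<Longrightarrow> integrable MH f \<longleftrightarrow> integrable M0 (\<lambda>x. K x * f x)" for f :: "_ \<Rightarrow> real"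
  unfolding MH_M0 by (subst integrable_density) auto

lemma integral_MB: "f \<in> borel_measurable borel \<Longrightarrow> integral\<^sup>L MB f = (\<integral>y. K (y, 0) * f y \<partial>lborel)" for f :: "_ \<Rightarrow> real"
  unfolding MB_def by (subst integral_density) auto

lemma integrable_MB: "f \<in> borel_measurable borel \<Longrightarrow> integrable MB f \<longleftrightarrow> integrable lborel (\<lambda>y. K (y, 0) * f y)" for f :: "_ \<Rightarrow> real"
  unfolding MB_def by (subst integrable_density) auto

lemma nn_integral_MH: "f \<in> borel_measurable M0 \<Longrightarrow> integral\<^sup>N MH f = (\<integral>\<^sup>+x. ennreal (K x) * f x \<partial>M0)"
  unfolding MH_M0 by (subst nn_integral_density) auto

lemma nn_integral_MB: "f \<in> borel_measurable borel \<Longrightarrow> integral\<^sup>N MB f = (\<integral>\<^sup>+y. ennreal (K (y, 0)) * f y \<partial>lborel)"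
  unfolding MB_def by (subst nn_integral_density) auto

lemma le_K_mult: "c \<le> ennreal (K x) * c"
proof -
  have "1 \<le> ennreal (K x)"
    using ennreal_leI[OF K_ge_1[of x]] by simp
  from mult_right_mono[OF this, of c] show ?thesis by simp
qed

lemma nn_integral_M0_le_MH: "f \<in> borel_measurable M0 \<Longrightarrow> integral\<^sup>N M0 f \<le> integral\<^sup>N MH f"
  unfolding nn_integral_MH
  by (intro nn_integral_mono) (rule le_K_mult)

lemma nn_integral_lborel_le_MB: "f \<in> borel_measurable borel \<Longrightarrow> integral\<^sup>N lborel f \<le> integral\<^sup>N MB f"
  unfolding nn_integral_MB
  by (intro nn_integral_mono) (rule le_K_mult)

lemma test_smooth: "\<phi> \<in> test_functions \<Longrightarrow> smooth \<phi>"
  by (simp add: test_functions_def smooth_def)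

lemma test_support: "\<phi> \<in> test_functions \<Longrightarrow> \<exists>R. \<forall>x. norm x \<ge> R \<longrightarrow> \<phi> x = 0"
proof -
  assume "\<phi> \<in> test_functions"
  then have "bounded {x. \<phi> x \<noteq> 0}"
    by (auto simp: test_functions_def intro: bounded_subset[OF compact_imp_bounded closure_subset])
  then obtain R where "\<And>x. \<phi> x \<noteq> 0 \<Longrightarrow> norm x \<le> R" by (auto simp: bounded_iff)
  then have "\<forall>x. norm x \<ge> R + 1 \<longrightarrow> \<phi> x = 0" by force
  then show ?thesis by blast
qed

lemma testI: "smooth \<phi> \<Longrightarrow> (\<And>x. norm x \<ge> R \<Longrightarrow> \<phi> x = 0) \<Longrightarrow> \<phi> \<in> test_functions"
proof -
  assume *: "smooth \<phi>" "\<And>x. norm x \<ge> R \<Longrightarrow> \<phi> x = 0"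
  then have "{x. \<phi> x \<noteq> 0} \<subseteq> cball 0 R" by force
  then have "bounded {x. \<phi> x \<noteq> 0}" by (rule bounded_subset[OF bounded_cball])
  with *(1) show ?thesis by (simp add: test_functions_def smooth_def compact_closure)
qed

lemma test_C1: "\<phi> \<in> test_functions \<Longrightarrow> C1 \<phi> (grad \<phi>)"
  by (intro C1_smooth test_smooth)

lemma test_C1c: "\<phi> \<in> test_functions \<Longrightarrow> C1c \<phi> (grad \<phi>)"
  using test_support[of \<phi>] C1cI[OF test_C1[of \<phi>]] by auto

lemma test_mult: "\<phi> \<in> test_functions \<Longrightarrow> smooth \<psi> \<Longrightarrow> (\<lambda>x. \<phi> x * \<psi> x) \<in> test_functions"
  using test_support[of \<phi>] testI[OF smooth_mult[OF test_smooth]] by force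

lemma test_add: "\<phi> \<in> test_functions \<Longrightarrow> \<psi> \<in> test_functions \<Longrightarrow> (\<lambda>x. \<phi> x + \<psi> x) \<in> test_functions"
proof -
  assume *: "\<phi> \<in> test_functions" "\<psi> \<in> test_functions"
  from test_support[OF *(1)] test_support[OF *(2)]
  obtain R S where "\<forall>x. norm x \<ge> R \<longrightarrow> \<phi> x = 0" "\<forall>x. norm x \<ge> S \<longrightarrow> \<psi> x = 0"
    by blast
  then show ?thesis using * by (intro testI[OF smooth_add[OF *[THEN test_smooth]], of "max R S"]) auto
qed

lemma test_cmult: "\<phi> \<in> test_functions \<Longrightarrow> (\<lambda>x. c * \<phi> x) \<in> test_functions"
  using test_mult[of \<phi> "\<lambda>_. c"] by (simp add: smooth_const mult.commute)

lemma test_scale: "\<phi> \<in> test_functions \<Longrightarrow> c > 0 \<Longrightarrow> (\<lambda>x. \<phi> (c *\<^sub>R x)) \<in> test_functions"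
proof -
  assume *: "\<phi> \<in> test_functions" "c > 0"
  from test_support[OF *(1)] obtain R where "\<forall>x. norm x \<ge> R \<longrightarrow> \<phi> x = 0"
    by blast
  then have "\<phi> (c *\<^sub>R x) = 0" if "norm x \<ge> R / c" for x
    using that *(2) by (simp add: divide_le_eq mult.commute del: split_paired_All)
  then show ?thesis
    by (intro testI[OF smooth_scale[OF test_smooth[OF *(1)]], of "R / c"])
qed

lemma grad_add: "C1 f F \<Longrightarrow> C1 g G \<Longrightarrow> grad (\<lambda>x. f x + g x) = (\<lambda>x. F x + G x)"
  by (rule C1_grad[OF C1_add])

lemma grad_cmult: "smooth f \<Longrightarrow> grad (\<lambda>x. c * f x) = (\<lambda>x. c *\<^sub>R grad f x)"
  using C1_grad[OF C1_mult[OF C1_smooth[OF smooth_const, of c] C1_smooth, of f]]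
  by (simp add: grad_def frechet_derivative_const)

lemma grad_scale: "smooth f \<Longrightarrow> grad (\<lambda>x. f (c *\<^sub>R x)) = (\<lambda>x. c *\<^sub>R grad f (c *\<^sub>R x))"
proof (intro ext grad_eqI)
  fix x assume f: "smooth f"
  have "((\<lambda>x. f (c *\<^sub>R x)) has_derivative (\<lambda>v. grad f (c *\<^sub>R x) \<bullet> (c *\<^sub>R v))) (at x)"
    by (intro has_derivative_compose[of "\<lambda>x. c *\<^sub>R x" _ _ _ f] smooth_has_derivative_grad f) (auto intro!: derivative_eq_intros)
  then show "((\<lambda>x. f (c *\<^sub>R x)) has_derivative (\<lambda>v. c *\<^sub>R grad f (c *\<^sub>R x) \<bullet> v)) (at x)" by simp
qed

section \<open>Sobolev functions with gradient and trace\<close>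

text \<open>\<open>Sob M B u G T\<close>: some sequence of test functions converges to \<open>u\<close> in \<open>L\<^sup>2(M)\<close>, its gradients to \<open>G\<close>
  and its boundary values in \<open>L\<^sup>2(B)\<close> to \<open>T\<close>. It is used for the weighted measures, where it describes
  the space \<open>X\<close>, and for Lebesgue measure, where dilations act.\<close>

definition Sob :: "('m::finite) pt measure \<Rightarrow> (real^'m) measure \<Rightarrow> ('m pt \<Rightarrow> real) \<Rightarrow> ('m pt \<Rightarrow> 'm pt) \<Rightarrow> (real^'m \<Rightarrow> real) \<Rightarrow> bool" where
  "Sob M B u G T \<longleftrightarrow> u \<in> borel_measurable M \<and> G \<in> borel_measurable M \<and> T \<in> borel_measurable B \<and>
     (\<exists>\<phi>. (\<forall>k. \<phi> k \<in> test_functions) \<and> L2_tendsto M \<phi> u \<and> L2_tendsto M (\<lambda>k. grad (\<phi> k)) G \<and>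
        L2_tendsto B (\<lambda>k y. \<phi> k (y, 0)) T)"

text \<open>The properties shared by the weighted measures \<open>MH\<close>, \<open>MB\<close> and by the Lebesgue measures \<open>M0\<close>, \<open>lborel\<close>;
  the calculus of \<open>Sob\<close> is developed for both at once.\<close>

locale measure_pair =
  fixes M :: "('m::finite) pt measure" and B :: "(real^'m) measure"
  assumes sets_M: "sets M = sets M0" and sets_B: "sets B = sets borel"
    and compact_M: "\<And>(f::'m pt \<Rightarrow> real) R. continuous_on UNIV f \<Longrightarrow> (\<And>x. norm x \<ge> R \<Longrightarrow> f x = 0) \<Longrightarrow> integrable M f"
    and compact_B: "\<And>(f::'m pt \<Rightarrow> real) R. continuous_on UNIV f \<Longrightarrow> (\<And>x. norm x \<ge> R \<Longrightarrow> f x = 0) \<Longrightarrow> integrable B (\<lambda>y. f (y, 0))"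
begin

lemma meas_M: "borel_measurable M = borel_measurable M0"
  by (intro measurable_cong_sets sets_M refl)

lemma meas_B: "borel_measurable B = borel_measurable borel"
  by (intro measurable_cong_sets sets_B refl)

lemma compact_L2:
  fixes f :: "'m pt \<Rightarrow> 'b::euclidean_space"
  assumes "continuous_on UNIV f" "\<And>x. norm x \<ge> R \<Longrightarrow> f x = 0"
  shows "f \<in> L2 M" "(\<lambda>y. f (y, 0)) \<in> L2 B"
proof -
  have "continuous_on UNIV (\<lambda>x. (norm (f x))\<^sup>2)" by (intro continuous_intros assms)
  then have "integrable M (\<lambda>x. (norm (f x))\<^sup>2)" "integrable B (\<lambda>y. (norm (f (y, 0)))\<^sup>2)"
    using assms(2) by (auto intro!: compact_M compact_B)
  moreover have "continuous_on UNIV (\<lambda>y. f (y, 0))"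
    by (intro continuous_on_compose2[OF assms(1)] continuous_intros) auto
  ultimately show "f \<in> L2 M" "(\<lambda>y. f (y, 0)) \<in> L2 B"
    using assms(1) by (auto simp: L2_def meas_M meas_B intro!: continuous_measurable_M0 borel_measurable_continuous_onI)
qed

lemma test_L2:
  assumes "\<phi> \<in> test_functions"
  shows "\<phi> \<in> L2 M" "grad \<phi> \<in> L2 M" "(\<lambda>y. \<phi> (y, 0)) \<in> L2 B"
proof -
  obtain R where R: "\<And>x. norm x \<ge> R \<Longrightarrow> \<phi> x = 0 \<and> grad \<phi> x = 0"
    using test_C1c[OF assms] by (auto simp: C1c_def)
  note C = C1_continuous[OF test_C1[OF assms]]
  show "\<phi> \<in> L2 M" "grad \<phi> \<in> L2 M" "(\<lambda>y. \<phi> (y, 0)) \<in> L2 B"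
    using R by (auto intro!: compact_L2[OF C(1), of R] compact_L2[OF C(2), of R])
qed

lemma Sob_L2:
  assumes "Sob M B u G T" shows "u \<in> L2 M" "G \<in> L2 M" "T \<in> L2 B"
proof -
  obtain \<phi> where "\<And>k. \<phi> k \<in> test_functions" "L2_tendsto M \<phi> u" "L2_tendsto M (\<lambda>k. grad (\<phi> k)) G"
     "L2_tendsto B (\<lambda>k y. \<phi> k (y, 0)) T"
    using assms by (auto simp: Sob_def)
  with assms test_L2 show "u \<in> L2 M" "G \<in> L2 M" "T \<in> L2 B"
    by (auto simp: Sob_def intro: L2_tendsto_in_L2)
qed

lemma Sob_test:
  assumes "\<phi> \<in> test_functions" shows "Sob M B \<phi> (grad \<phi>) (\<lambda>y. \<phi> (y, 0))"
  unfolding Sob_def using assms test_L2[OF assms]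
  by (auto intro!: L2_measurable L2_tendsto_const exI[of _ "\<lambda>k. \<phi>"])

lemma Sob_add:
  assumes "Sob M B u G T" "Sob M B v H S"
  shows "Sob M B (\<lambda>x. u x + v x) (\<lambda>x. G x + H x) (\<lambda>y. T y + S y)"
proof -
  obtain \<phi> where p: "\<And>k. \<phi> k \<in> test_functions" "L2_tendsto M \<phi> u" "L2_tendsto M (\<lambda>k. grad (\<phi> k)) G"
     "L2_tendsto B (\<lambda>k y. \<phi> k (y, 0)) T"
    using assms(1) by (auto simp: Sob_def)
  obtain \<psi> where q: "\<And>k. \<psi> k \<in> test_functions" "L2_tendsto M \<psi> v" "L2_tendsto M (\<lambda>k. grad (\<psi> k)) H"
     "L2_tendsto B (\<lambda>k y. \<psi> k (y, 0)) S"
    using assms(2) by (auto simp: Sob_def)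
  note m = L2_measurable[OF test_L2(1)] L2_measurable[OF test_L2(2)] L2_measurable[OF test_L2(3)]
    Sob_L2[OF assms(1), THEN L2_measurable] Sob_L2[OF assms(2), THEN L2_measurable]
  show ?thesis
    unfolding Sob_def
  proof (intro conjI exI[of _ "\<lambda>k x. \<phi> k x + \<psi> k x"] allI)
    show "L2_tendsto M (\<lambda>k. grad (\<lambda>x. \<phi> k x + \<psi> k x)) (\<lambda>x. G x + H x)"
      unfolding grad_add[OF test_C1[OF p(1)] test_C1[OF q(1)]]
      by (intro L2_tendsto_add p q m)
  qed (intro L2_tendsto_add p q m borel_measurable_add test_add)+
qed

lemma Sob_cmult:
  assumes "Sob M B u G T"
  shows "Sob M B (\<lambda>x. c * u x) (\<lambda>x. c *\<^sub>R G x) (\<lambda>y. c * T y)"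
proof -
  obtain \<phi> where p: "\<And>k. \<phi> k \<in> test_functions" "L2_tendsto M \<phi> u" "L2_tendsto M (\<lambda>k. grad (\<phi> k)) G"
     "L2_tendsto B (\<lambda>k y. \<phi> k (y, 0)) T"
    using assms(1) by (auto simp: Sob_def)
  note m = L2_measurable[OF test_L2(1)] L2_measurable[OF test_L2(2)] L2_measurable[OF test_L2(3)]
    Sob_L2[OF assms(1), THEN L2_measurable]
  show ?thesis
    unfolding Sob_def
  proof (intro conjI exI[of _ "\<lambda>k x. c * \<phi> k x"] allI)
    show "L2_tendsto M (\<lambda>k. grad (\<lambda>x. c * \<phi> k x)) (\<lambda>x. c *\<^sub>R G x)"
      unfolding grad_cmult[OF test_smooth[OF p(1)]]
      by (intro L2_tendsto_scaleR p m)
    show "L2_tendsto M (\<lambda>k x. c * \<phi> k x) (\<lambda>x. c * u x)" "L2_tendsto B (\<lambda>k y. c * \<phi> k (y, 0)) (\<lambda>y. c * T y)"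
      using L2_tendsto_scaleR[OF p(2), of c] L2_tendsto_scaleR[OF p(4), of c] p(1) m by auto
  qed (use m p in \<open>auto intro!: test_cmult\<close>)
qed

lemma Sob_diff:
  assumes "Sob M B u G T" "Sob M B v H S"
  shows "Sob M B (\<lambda>x. u x - v x) (\<lambda>x. G x - H x) (\<lambda>y. T y - S y)"
  using Sob_add[OF assms(1) Sob_cmult[OF assms(2), of "-1"]] by simp

end

lemma MH_pair: "measure_pair MH MB"
proof
  fix f :: "'a pt \<Rightarrow> real" and R
  assume f: "continuous_on UNIV f" "\<And>x. norm x \<ge> R \<Longrightarrow> f x = 0"
  have c: "continuous_on UNIV (\<lambda>x. K x * f x)" by (intro continuous_intros f continuous_K)
  have m: "f \<in> borel_measurable M0" "(\<lambda>y. f (y, 0)) \<in> borel_measurable borel"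
    by (auto intro!: continuous_measurable_M0 f borel_measurable_continuous_onI continuous_on_compose2[OF f(1)] continuous_intros)
  have "integrable lborel (\<lambda>x. K x * f x)"
    using f(2) by (intro continuous_compact_integrable[OF c, of R]) auto
  then show "integrable MH f" using m by (simp add: integrable_MH integrable_lborel_imp_M0)
  have "integrable lborel (\<lambda>y. K (y, 0) * f (y, 0))"
  proof (rule continuous_compact_integrable[of _ R])
    show "continuous_on UNIV (\<lambda>y. K (y, 0) * f (y, 0))"
      by (intro continuous_on_compose2[OF c] continuous_intros) auto
  qed (use f(2) in auto)
  then show "integrable MB (\<lambda>y. f (y, 0))" using m by (simp add: integrable_MB)
qed auto

lemma M0_pair: "measure_pair M0 lborel"
proof
  fix f :: "'a pt \<Rightarrow> real" and R
  assume f: "continuous_on UNIV f" "\<And>x. norm x \<ge> R \<Longrightarrow> f x = 0"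
  show "integrable M0 f" using f by (auto intro!: integrable_lborel_imp_M0 continuous_compact_integrable[of _ R])
  show "integrable lborel (\<lambda>y. f (y, 0))"
    using f(2) by (auto intro!: continuous_compact_integrable[of _ R] continuous_on_compose2[OF f(1)] continuous_intros)
qed auto

interpretation MH: measure_pair MH MB by (rule MH_pair)
interpretation M0: measure_pair M0 lborel by (rule M0_pair)

text \<open>Since \<open>K \<ge> 1\<close>, weighted convergence implies unweighted convergence.\<close>

lemma L2_tendsto_MH_imp_M0:
  assumes "L2_tendsto MH f g" "\<And>k. f k \<in> borel_measurable M0" "g \<in> borel_measurable M0"
  shows "L2_tendsto M0 f g"
  using assms(1) unfolding L2_tendsto_def
  by (rule ennreal_tendsto_zero_le[rotated]) (use assms(2,3) in \<open>auto intro!: nn_integral_M0_le_MH\<close>)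

lemma L2_tendsto_MB_imp_lborel:
  assumes "L2_tendsto MB f g" "\<And>k. f k \<in> borel_measurable borel" "g \<in> borel_measurable borel"
  shows "L2_tendsto lborel f g"
  using assms(1) unfolding L2_tendsto_def
  by (rule ennreal_tendsto_zero_le[rotated]) (use assms(2,3) in \<open>auto intro!: nn_integral_lborel_le_MB\<close>)

lemma Sob_MH_imp_M0:
  assumes "Sob MH MB u G T" shows "Sob M0 lborel u G T"
proof -
  obtain \<phi> where p: "\<And>k. \<phi> k \<in> test_functions" "L2_tendsto MH \<phi> u" "L2_tendsto MH (\<lambda>k. grad (\<phi> k)) G"
     "L2_tendsto MB (\<lambda>k y. \<phi> k (y, 0)) T"
    using assms by (auto simp: Sob_def)
  note m = L2_measurable[OF M0.test_L2(1)] L2_measurable[OF M0.test_L2(2)] L2_measurable[OF M0.test_L2(3)]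
  have um: "u \<in> borel_measurable M0" "G \<in> borel_measurable M0" "T \<in> borel_measurable borel"
    using assms by (auto simp: Sob_def measurable_MH measurable_MB)
  show ?thesis
    unfolding Sob_def using um p m
    by (auto intro!: exI[of _ \<phi>] L2_tendsto_MH_imp_M0 L2_tendsto_MB_imp_lborel)
qed

section \<open>Traces\<close>

lemma L2_norm: "f \<in> L2 M \<Longrightarrow> (\<lambda>x. norm (f x)) \<in> L2 M"
  by (auto simp: L2_def)

lemma L2_abs: "f \<in> L2 M \<Longrightarrow> (\<lambda>x. \<bar>f x\<bar>) \<in> L2 M" for f :: "'a \<Rightarrow> real"
  by (auto simp: L2_def)

lemma L2_tendsto_norm:
  assumes "L2_tendsto M f g" "g \<in> borel_measurable M" "\<And>k. f k \<in> borel_measurable M"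
  shows "L2_tendsto M (\<lambda>k x. norm (f k x)) (\<lambda>x. norm (g x))"
proof (rule L2_tendsto_bound[OF assms, of _ _ 1])
  have "(norm (norm (f k x) - norm (g x)))\<^sup>2 \<le> 1 * (norm (f k x - g x))\<^sup>2" for k x
    unfolding mult_1 real_norm_def by (intro power_mono norm_triangle_ineq3 abs_ge_zero)
  then show "AE x in M. \<forall>k. (norm (norm (f k x) - norm (g x)))\<^sup>2 \<le> 1 * (norm (f k x - g x))\<^sup>2" by blast
qed simp

lemma L2_tendsto_integral_sq:
  assumes "L2_tendsto M f g" "\<And>k. f k \<in> L2 M" "g \<in> borel_measurable M"
  shows "(\<lambda>k. \<integral>x. (norm (f k x))\<^sup>2 \<partial>M) \<longlonglongrightarrow> (\<integral>x. (norm (g x))\<^sup>2 \<partial>M)"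
  using L2_tendsto_integral_inner[OF assms assms] by (simp add: power2_norm_eq_inner)

lemma L2_tendsto_integral_mult:
  fixes f h :: "nat \<Rightarrow> 'a \<Rightarrow> real"
  assumes "L2_tendsto M f g" "\<And>k. f k \<in> L2 M" "g \<in> borel_measurable M"
    "L2_tendsto M h l" "\<And>k. h k \<in> L2 M" "l \<in> borel_measurable M"
  shows "(\<lambda>k. \<integral>x. f k x * h k x \<partial>M) \<longlonglongrightarrow> (\<integral>x. g x * l x \<partial>M)"
  using L2_tendsto_integral_inner[OF assms] by simp

lemma L2_tendsto_inner:
  assumes "L2_tendsto M f g" "g \<in> borel_measurable M" "\<And>k. f k \<in> borel_measurable M"
  shows "L2_tendsto M (\<lambda>k x. f k x \<bullet> b) (\<lambda>x. g x \<bullet> b)"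
proof (rule L2_tendsto_bound[OF assms, of _ _ "(norm b)\<^sup>2"])
  have "(norm (f k x \<bullet> b - g x \<bullet> b))\<^sup>2 \<le> (norm b)\<^sup>2 * (norm (f k x - g x))\<^sup>2" for k x
    unfolding inner_diff_left[symmetric] power_mult_distrib[symmetric] real_norm_def
    using Cauchy_Schwarz_ineq2[of "f k x - g x" b] by (intro power_mono) (auto simp: mult.commute)
  then show "AE x in M. \<forall>k. (norm (f k x \<bullet> b - g x \<bullet> b))\<^sup>2 \<le> (norm b)\<^sup>2 * (norm (f k x - g x))\<^sup>2" by simp
qed simp

lemma L2_inner: "f \<in> L2 M \<Longrightarrow> (\<lambda>x. f x \<bullet> b) \<in> L2 M"
proof (rule L2_bound[of _ _ "\<lambda>x. (norm (f x))\<^sup>2 * (norm b)\<^sup>2"])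
  have "(norm (f x \<bullet> b))\<^sup>2 \<le> (norm (f x))\<^sup>2 * (norm b)\<^sup>2" for x
    unfolding power_mult_distrib[symmetric] real_norm_def
    using Cauchy_Schwarz_ineq2[of "f x" b] by (intro power_mono) auto
  then show "AE x in M. (norm (f x \<bullet> b))\<^sup>2 \<le> (norm (f x))\<^sup>2 * (norm b)\<^sup>2" by simp
qed (auto simp: L2_integrable L2_measurable)

text \<open>The weight increases in the direction of the inner normal, so the term in which the derivative
  falls on it has the favourable sign.\<close>

lemma trace_test_MH:
  assumes "\<phi> \<in> test_functions"
  shows "(\<integral>y. (\<phi> (y, 0))\<^sup>2 \<partial>MB) \<le> 2 * (\<integral>x. \<bar>\<phi> x\<bar> * norm (grad \<phi> x) \<partial>MH)"
proof -
  let ?g = "grad \<phi>"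
  let ?F = "\<lambda>x. (\<phi> x * \<phi> x) *\<^sub>R ((K x / 2) *\<^sub>R x) + K x *\<^sub>R (\<phi> x *\<^sub>R ?g x + \<phi> x *\<^sub>R ?g x)"
  note C = test_C1[OF assms]
  note cont = C1_continuous[OF C]
  have F: "C1c (\<lambda>x. \<phi> x * \<phi> x * K x) ?F"
    by (rule C1c_mult[OF C1c_mult[OF test_C1c[OF assms] C] C1_K])
  have bm: "(\<lambda>y. (\<phi> (y, 0))\<^sup>2) \<in> borel_measurable borel"
    by (intro borel_measurable_continuous_onI continuous_intros continuous_on_compose2[OF cont(1)]) auto
  have mm: "(\<lambda>x. \<bar>\<phi> x\<bar> * norm (?g x)) \<in> borel_measurable M0"
    by (intro continuous_measurable_M0 continuous_intros cont)
  have im: "integrable MH (\<lambda>x. \<bar>\<phi> x\<bar> * norm (?g x))"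
    using L2_mult_integrable[OF L2_abs[OF MH.test_L2(1)[OF assms]] L2_norm[OF MH.test_L2(2)[OF assms]]] .
  have "(\<integral>y. (\<phi> (y, 0))\<^sup>2 \<partial>MB) = (\<integral>y. \<phi> (y, 0) * \<phi> (y, 0) * K (y, 0) \<partial>lborel)"
    unfolding integral_MB[OF bm] by (simp add: power2_eq_square mult_ac)
  also have "\<dots> = (\<integral>x. - snd (?F x) \<partial>M0)"
    unfolding Bochner_Integration.integral_minus divergence_normal[OF F] by simp
  also have "\<dots> \<le> (\<integral>x. K x * (2 * (\<bar>\<phi> x\<bar> * norm (?g x))) \<partial>M0)"
  proof (rule integral_mono)
    have "integrable M0 (\<lambda>x. snd (?F x))"
      using divergence_halfspace(2)[OF F, of "(0,1)"] by (simp add: inner_prod_def)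
    then show "integrable M0 (\<lambda>x. - snd (?F x))" by (rule Bochner_Integration.integrable_minus)
    have "integrable M0 (\<lambda>x. 2 * (K x * (\<bar>\<phi> x\<bar> * norm (?g x))))"
      using im mm by (simp add: integrable_MH)
    then show "integrable M0 (\<lambda>x. K x * (2 * (\<bar>\<phi> x\<bar> * norm (?g x))))"
      by (simp only: mult.left_commute[of 2])
    fix x assume "x \<in> space (M0 :: 'a pt measure)"
    then have "snd x > 0" by (simp add: halfspace_def)
    then have "0 \<le> \<phi> x * \<phi> x * (K x / 2) * snd x" by simp
    moreover have "- (\<phi> x * snd (?g x)) \<le> \<bar>\<phi> x\<bar> * norm (?g x)"
    proof -
      have "- (\<phi> x * snd (?g x)) \<le> \<bar>\<phi> x\<bar> * \<bar>snd (?g x)\<bar>" by (metis abs_ge_minus_self abs_mult)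
      also have "\<dots> \<le> \<bar>\<phi> x\<bar> * norm (?g x)" by (intro mult_left_mono abs_snd_le) auto
      finally show ?thesis .
    qed
    then have "K x * (2 * - (\<phi> x * snd (?g x))) \<le> K x * (2 * (\<bar>\<phi> x\<bar> * norm (?g x)))"
      by (intro mult_left_mono) auto
    moreover have "snd (?F x) = \<phi> x * \<phi> x * (K x / 2) * snd x - K x * (2 * - (\<phi> x * snd (?g x)))"
      by simp
    ultimately show "- snd (?F x) \<le> K x * (2 * (\<bar>\<phi> x\<bar> * norm (?g x)))"
      by linarith
  qed
  also have "\<dots> = (\<integral>x. 2 * (K x * (\<bar>\<phi> x\<bar> * norm (?g x))) \<partial>M0)"
    by (simp only: mult.left_commute[of 2])
  also have "\<dots> = 2 * (\<integral>x. \<bar>\<phi> x\<bar> * norm (?g x) \<partial>MH)"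
    by (simp add: integral_MH[OF mm])
  finally show ?thesis .
qed

lemma trace_test_M0:
  assumes "\<phi> \<in> test_functions"
  shows "(\<integral>y. (\<phi> (y, 0))\<^sup>2 \<partial>lborel) \<le> 2 * (\<integral>x. \<bar>\<phi> x\<bar> * norm (grad \<phi> x) \<partial>M0)"
proof -
  have "(\<integral>y. \<phi> (y, 0) * \<phi> (y, 0) \<partial>lborel) \<le> (\<integral>x. norm (\<phi> x *\<^sub>R grad \<phi> x + \<phi> x *\<^sub>R grad \<phi> x) \<partial>M0)"
    by (rule boundary_integral_le[OF C1c_mult[OF test_C1c[OF assms] test_C1[OF assms]]])
  also have "\<dots> = (\<integral>x. 2 * (\<bar>\<phi> x\<bar> * norm (grad \<phi> x)) \<partial>M0)"
    by (simp add: scaleR_2[symmetric] abs_mult mult.assoc)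
  finally show ?thesis by (simp add: power2_eq_square)
qed

locale trace_pair = measure_pair +
  assumes trace_test: "\<And>\<phi>. \<phi> \<in> test_functions \<Longrightarrow>
    (\<integral>y. (\<phi> (y, 0))\<^sup>2 \<partial>B) \<le> 2 * (\<integral>x. \<bar>\<phi> x\<bar> * norm (grad \<phi> x) \<partial>M)"
begin

text \<open>By approximation, since both sides are continuous in the \<open>L\<^sup>2\<close> norms of function, gradient and trace.\<close>

lemma Sob_trace_ineq:
  assumes "Sob M B u G T"
  shows "(\<integral>y. (T y)\<^sup>2 \<partial>B) \<le> 2 * (\<integral>x. \<bar>u x\<bar> * norm (G x) \<partial>M)"
proof -
  obtain \<phi> where p: "\<And>k. \<phi> k \<in> test_functions" "L2_tendsto M \<phi> u" "L2_tendsto M (\<lambda>k. grad (\<phi> k)) G"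
     "L2_tendsto B (\<lambda>k y. \<phi> k (y, 0)) T"
    using assms(1) by (auto simp: Sob_def)
  note t = test_L2[OF p(1)] and s = Sob_L2[OF assms]
  note tm = t[THEN L2_measurable] and sm = s[THEN L2_measurable]
  have "(\<lambda>k. \<integral>x. \<bar>\<phi> k x\<bar> * norm (grad (\<phi> k) x) \<partial>M) \<longlonglongrightarrow> (\<integral>x. \<bar>u x\<bar> * norm (G x) \<partial>M)"
    using L2_tendsto_norm[OF p(2) sm(1) tm(1)] L2_tendsto_norm[OF p(3) sm(2) tm(2)] t sm
    by (intro L2_tendsto_integral_mult) (auto intro!: L2_abs L2_norm)
  then have "(\<lambda>k. 2 * (\<integral>x. \<bar>\<phi> k x\<bar> * norm (grad (\<phi> k) x) \<partial>M)) \<longlonglongrightarrow> 2 * (\<integral>x. \<bar>u x\<bar> * norm (G x) \<partial>M)"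
    by (intro tendsto_intros)
  moreover have "(\<lambda>k. \<integral>y. (\<phi> k (y, 0))\<^sup>2 \<partial>B) \<longlonglongrightarrow> (\<integral>y. (T y)\<^sup>2 \<partial>B)"
    using L2_tendsto_integral_sq[OF p(4) t(3) sm(3)] by simp
  ultimately show ?thesis
    by (intro LIMSEQ_le[of "\<lambda>k. \<integral>y. (\<phi> k (y, 0))\<^sup>2 \<partial>B" _ "\<lambda>k. 2 * (\<integral>x. \<bar>\<phi> k x\<bar> * norm (grad (\<phi> k) x) \<partial>M)"]) (use trace_test[OF p(1)] in auto)
qed

lemma two_mult_le: "2 * (\<integral>x. \<bar>u x\<bar> * norm (G x) \<partial>M) \<le> (\<integral>x. (u x)\<^sup>2 \<partial>M) + (\<integral>x. (norm (G x))\<^sup>2 \<partial>M)"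
  if "u \<in> L2 M" "G \<in> L2 M" for u :: "'a pt \<Rightarrow> real" and G :: "'a pt \<Rightarrow> 'a pt"
proof -
  have i: "integrable M (\<lambda>x. (u x)\<^sup>2)" "integrable M (\<lambda>x. (norm (G x))\<^sup>2)"
    using that by (auto simp: L2_def)
  have "(\<integral>x. 2 * (\<bar>u x\<bar> * norm (G x)) \<partial>M) \<le> (\<integral>x. (u x)\<^sup>2 + (norm (G x))\<^sup>2 \<partial>M)"
  proof (rule integral_mono)
    show "integrable M (\<lambda>x. 2 * (\<bar>u x\<bar> * norm (G x)))"
      using L2_mult_integrable[OF L2_abs[OF that(1)] L2_norm[OF that(2)]] by simp
    show "2 * (\<bar>u x\<bar> * norm (G x)) \<le> (u x)\<^sup>2 + (norm (G x))\<^sup>2" for x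
      using sum_squares_bound[of "\<bar>u x\<bar>" "norm (G x)"] by simp
  qed (use i in auto)
  with i show ?thesis by simp
qed

text \<open>The trace inequality, applied to differences, turns fast convergence of functions and gradients into
  fast convergence of the boundary values.\<close>

lemma Sob_trace_exists:
  assumes p: "\<And>k. \<phi> k \<in> test_functions" "L2_tendsto M \<phi> u" "L2_tendsto M (\<lambda>k. grad (\<phi> k)) G"
    and um: "u \<in> borel_measurable M" "G \<in> borel_measurable M"
  shows "\<exists>T. Sob M B u G T"
proof -
  note t = test_L2[OF p(1)]
  have uL: "u \<in> L2 M" "G \<in> L2 M"
    using L2_tendsto_in_L2[OF p(2) t(1) um(1)] L2_tendsto_in_L2[OF p(3) t(2) um(2)] by auto
  define d where "d k = (\<integral>x. (norm (\<phi> k x - u x))\<^sup>2 \<partial>M) + (\<integral>x. (norm (grad (\<phi> k) x - G x))\<^sup>2 \<partial>M)" for k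
  have "d \<longlonglongrightarrow> 0 + 0"
    unfolding d_def by (intro tendsto_add L2_tendsto_integral_norm p t um)
  then have "d \<longlonglongrightarrow> 0" by simp
  then have "\<exists>k. d k < (1/8) ^ j / 4" for j
    by (intro eventually_happens'[OF sequentially_bot] order_tendstoD(2)[of d 0]) auto
  then obtain r where r: "\<And>j. d (r j) < (1/8) ^ j / 4" by metis
  have i: "integrable M (\<lambda>x. (norm (\<phi> k x - u x))\<^sup>2)" "integrable M (\<lambda>x. (norm (grad (\<phi> k) x - G x))\<^sup>2)" for k
    by (intro L2_integrable L2_diff t uL)+
  have lim: "(\<lambda>j. (1/8::real) ^ j / 4) \<longlonglongrightarrow> 0"
    using tendsto_divide[OF LIMSEQ_power_zero[of "1/8::real"] tendsto_const[of 4]] by simp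
  have "(\<lambda>j. \<integral>x. (norm (\<phi> (r j) x - u x))\<^sup>2 \<partial>M) \<longlonglongrightarrow> 0"
  proof (rule tendsto_sandwich[OF always_eventually always_eventually tendsto_const lim])
    show "\<forall>j. (\<integral>x. (norm (\<phi> (r j) x - u x))\<^sup>2 \<partial>M) \<le> (1/8) ^ j / 4"
    proof
      fix j
      have "0 \<le> (\<integral>x. (norm (grad (\<phi> (r j)) x - G x))\<^sup>2 \<partial>M)" by simp
      then show "(\<integral>x. (norm (\<phi> (r j) x - u x))\<^sup>2 \<partial>M) \<le> (1/8) ^ j / 4"
        using r[of j] unfolding d_def by linarith
    qed
  qed simp
  then have 1: "L2_tendsto M (\<lambda>j. \<phi> (r j)) u" using L2_tendsto_iff_integral[OF t(1) uL(1)] by simp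
  have "(\<lambda>j. \<integral>x. (norm (grad (\<phi> (r j)) x - G x))\<^sup>2 \<partial>M) \<longlonglongrightarrow> 0"
  proof (rule tendsto_sandwich[OF always_eventually always_eventually tendsto_const lim])
    show "\<forall>j. (\<integral>x. (norm (grad (\<phi> (r j)) x - G x))\<^sup>2 \<partial>M) \<le> (1/8) ^ j / 4"
    proof
      fix j
      have "0 \<le> (\<integral>x. (norm (\<phi> (r j) x - u x))\<^sup>2 \<partial>M)" by simp
      then show "(\<integral>x. (norm (grad (\<phi> (r j)) x - G x))\<^sup>2 \<partial>M) \<le> (1/8) ^ j / 4"
        using r[of j] unfolding d_def by linarith
    qed
  qed simp
  then have 2: "L2_tendsto M (\<lambda>j. grad (\<phi> (r j))) G" using L2_tendsto_iff_integral[OF t(2) uL(2)] by simp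
  have "(\<integral>\<^sup>+y. ennreal ((\<phi> (r k) (y, 0) - \<phi> (r j) (y, 0))\<^sup>2) \<partial>B) \<le> ennreal ((1/8) ^ j)" if "j \<le> k" for j k
  proof -
    define \<psi> where "\<psi> x = \<phi> (r k) x - \<phi> (r j) x" for x
    have \<psi>: "Sob M B \<psi> (\<lambda>x. grad (\<phi> (r k)) x - grad (\<phi> (r j)) x) (\<lambda>y. \<psi> (y, 0))"
      unfolding \<psi>_def by (intro Sob_diff Sob_test p)
    note \<psi>L = Sob_L2[OF \<psi>]
    have "(\<integral>y. (\<psi> (y, 0))\<^sup>2 \<partial>B) \<le> (\<integral>x. (\<psi> x)\<^sup>2 \<partial>M) + (\<integral>x. (norm (grad (\<phi> (r k)) x - grad (\<phi> (r j)) x))\<^sup>2 \<partial>M)"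
      using Sob_trace_ineq[OF \<psi>] two_mult_le[OF \<psi>L(1,2)] by linarith
    also have "(\<integral>x. (\<psi> x)\<^sup>2 \<partial>M) \<le> (\<integral>x. 2 * (norm (\<phi> (r k) x - u x))\<^sup>2 + 2 * (norm (\<phi> (r j) x - u x))\<^sup>2 \<partial>M)"
    proof (rule integral_mono)
      show "integrable M (\<lambda>x. (\<psi> x)\<^sup>2)" using L2_integrable[OF \<psi>L(1)] by simp
      show "(\<psi> x)\<^sup>2 \<le> 2 * (norm (\<phi> (r k) x - u x))\<^sup>2 + 2 * (norm (\<phi> (r j) x - u x))\<^sup>2" for x
        using norm_diff_sq_le[of "\<phi> (r k) x - u x" "\<phi> (r j) x - u x"] by (simp add: \<psi>_def)
    qed (use i in auto)
    also have "(\<integral>x. (norm (grad (\<phi> (r k)) x - grad (\<phi> (r j)) x))\<^sup>2 \<partial>M) \<le>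
        (\<integral>x. 2 * (norm (grad (\<phi> (r k)) x - G x))\<^sup>2 + 2 * (norm (grad (\<phi> (r j)) x - G x))\<^sup>2 \<partial>M)"
    proof (rule integral_mono)
      show "integrable M (\<lambda>x. (norm (grad (\<phi> (r k)) x - grad (\<phi> (r j)) x))\<^sup>2)" using L2_integrable[OF \<psi>L(2)] by simp
      show "(norm (grad (\<phi> (r k)) x - grad (\<phi> (r j)) x))\<^sup>2 \<le> 2 * (norm (grad (\<phi> (r k)) x - G x))\<^sup>2 + 2 * (norm (grad (\<phi> (r j)) x - G x))\<^sup>2" for x
        using norm_diff_sq_le[of "grad (\<phi> (r k)) x - G x" "grad (\<phi> (r j)) x - G x"] by simp
    qed (use i in auto)
    also have "(\<integral>x. 2 * (norm (\<phi> (r k) x - u x))\<^sup>2 + 2 * (norm (\<phi> (r j) x - u x))\<^sup>2 \<partial>M) +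
        (\<integral>x. 2 * (norm (grad (\<phi> (r k)) x - G x))\<^sup>2 + 2 * (norm (grad (\<phi> (r j)) x - G x))\<^sup>2 \<partial>M) = 2 * d (r k) + 2 * d (r j)"
      using i unfolding d_def by simp
    also have "\<dots> \<le> (1/8) ^ j"
    proof -
      have "(1/8::real) ^ k \<le> (1/8) ^ j" using that by (intro power_decreasing) auto
      then show ?thesis using r[of k] r[of j] by linarith
    qed
    finally have "(\<integral>y. (\<psi> (y, 0))\<^sup>2 \<partial>B) \<le> (1/8) ^ j" by simp
    moreover have "(\<integral>\<^sup>+y. ennreal ((\<psi> (y, 0))\<^sup>2) \<partial>B) = ennreal (\<integral>y. (\<psi> (y, 0))\<^sup>2 \<partial>B)"
      using L2_integrable[OF \<psi>L(3)] by (intro nn_integral_eq_integral) auto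
    ultimately show ?thesis unfolding \<psi>_def by (simp add: ennreal_leI)
  qed
  from L2_complete_fast[of "\<lambda>j y. \<phi> (r j) (y, 0)", OF t(3) this]
  obtain T where T: "T \<in> borel_measurable B" "L2_tendsto B (\<lambda>j y. \<phi> (r j) (y, 0)) T" by blast
  have "Sob M B u G T"
    unfolding Sob_def using um T 1 2 p(1) by (intro conjI exI[of _ "\<lambda>j. \<phi> (r j)"]) auto
  then show ?thesis by blast
qed

end

lemma MH_trace_pair: "trace_pair MH MB"
  by (intro trace_pair.intro MH_pair trace_pair_axioms.intro trace_test_MH)

lemma M0_trace_pair: "trace_pair M0 lborel"
  by (intro trace_pair.intro M0_pair trace_pair_axioms.intro trace_test_M0)

interpretation MH: trace_pair MH MB by (rule MH_trace_pair)
interpretation M0: trace_pair M0 lborel by (rule M0_trace_pair)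

section \<open>Uniqueness of gradient and trace\<close>

lemma Sob_by_parts:
  assumes S: "Sob M0 lborel u G T" and g: "g \<in> test_functions"
  shows "(\<integral>x. (G x \<bullet> w) * g x \<partial>M0) =
     - (\<integral>x. u x * (grad g x \<bullet> w) \<partial>M0) - snd w * (\<integral>y. T y * g (y, 0) \<partial>lborel)"
proof -
  obtain \<phi> where p: "\<And>k. \<phi> k \<in> test_functions" "L2_tendsto M0 \<phi> u" "L2_tendsto M0 (\<lambda>k. grad (\<phi> k)) G"
     "L2_tendsto lborel (\<lambda>k y. \<phi> k (y, 0)) T"
    using S by (auto simp: Sob_def)
  note t = M0.test_L2[OF p(1)] and s = M0.Sob_L2[OF S] and gL = M0.test_L2[OF g]
  note tm = t[THEN L2_measurable] and sm = s[THEN L2_measurable]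
  have "(\<integral>x. (grad (\<phi> k) x \<bullet> w) * g x \<partial>M0) =
     - (\<integral>x. \<phi> k x * (grad g x \<bullet> w) \<partial>M0) - snd w * (\<integral>y. \<phi> k (y, 0) * g (y, 0) \<partial>lborel)" for k
  proof -
    have "(\<integral>x. (\<phi> k x *\<^sub>R grad g x + g x *\<^sub>R grad (\<phi> k) x) \<bullet> w \<partial>M0) = - snd w * (\<integral>y. \<phi> k (y, 0) * g (y, 0) \<partial>lborel)"
      by (rule divergence_halfspace(1)[OF C1c_mult[OF test_C1c[OF p(1)] test_C1[OF g]]])
    moreover have "integrable M0 (\<lambda>x. \<phi> k x * (grad g x \<bullet> w))" "integrable M0 (\<lambda>x. (grad (\<phi> k) x \<bullet> w) * g x)"
      by (intro L2_mult_integrable L2_inner t gL)+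
    ultimately show ?thesis by (simp add: inner_add_left mult.commute[of "g _"])
  qed
  moreover have "(\<lambda>k. \<integral>x. (grad (\<phi> k) x \<bullet> w) * g x \<partial>M0) \<longlonglongrightarrow> (\<integral>x. (G x \<bullet> w) * g x \<partial>M0)"
    by (intro L2_tendsto_integral_mult L2_tendsto_inner L2_tendsto_const p tm sm L2_inner t gL borel_measurable_inner gL[THEN L2_measurable] borel_measurable_const)
  moreover have "(\<lambda>k. - (\<integral>x. \<phi> k x * (grad g x \<bullet> w) \<partial>M0) - snd w * (\<integral>y. \<phi> k (y, 0) * g (y, 0) \<partial>lborel)) \<longlonglongrightarrow>
     - (\<integral>x. u x * (grad g x \<bullet> w) \<partial>M0) - snd w * (\<integral>y. T y * g (y, 0) \<partial>lborel)"
    by (intro tendsto_diff tendsto_minus tendsto_mult tendsto_const L2_tendsto_integral_mult L2_tendsto_const p tm sm L2_inner t gL borel_measurable_inner gL[THEN L2_measurable] borel_measurable_const)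
  ultimately show ?thesis by (simp add: LIMSEQ_unique)
qed

lemma integral_sq_0_AE:
  assumes "f \<in> L2 M" "(\<integral>x. (norm (f x))\<^sup>2 \<partial>M) \<le> 0" shows "AE x in M. f x = 0"
proof -
  have "(\<integral>x. (norm (f x))\<^sup>2 \<partial>M) = 0" using assms(2) by (simp add: antisym)
  then have "AE x in M. (norm (f x))\<^sup>2 = 0"
    by (subst (asm) integral_nonneg_eq_0_iff_AE) (use L2_integrable[OF assms(1)] in auto)
  then show ?thesis by simp
qed

text \<open>Testing the integration by parts with the partial derivatives of the approximating functions
  themselves shows that the limit gradient of a null sequence is orthogonal to the sequence that
  converges to it.\<close>

lemma Sob_zero:
  assumes S: "Sob M0 lborel u G T" and u: "AE x in M0. u x = 0"
  shows "AE x in M0. G x = 0" "AE y in lborel. T y = 0"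
proof -
  obtain \<phi> where p: "\<And>k. \<phi> k \<in> test_functions" "L2_tendsto M0 \<phi> u" "L2_tendsto M0 (\<lambda>k. grad (\<phi> k)) G"
     "L2_tendsto lborel (\<lambda>k y. \<phi> k (y, 0)) T"
    using S by (auto simp: Sob_def)
  note t = M0.test_L2[OF p(1)] and s = M0.Sob_L2[OF S]
  note tm = t[THEN L2_measurable] and sm = s[THEN L2_measurable]
  have "(\<integral>x. \<bar>u x\<bar> * norm (G x) \<partial>M0) = 0"
    using u by (intro integral_eq_zero_AE) auto
  then show T: "AE y in lborel. T y = 0"
    using M0.Sob_trace_ineq[OF S] by (intro integral_sq_0_AE s) simp
  have "AE x in M0. G x \<bullet> b = 0" if b: "b \<in> Basis" for b
  proof (rule integral_sq_0_AE[OF L2_inner[OF s(2)]])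
    have "(\<integral>x. (G x \<bullet> b) * (grad (\<phi> k) x \<bullet> b) \<partial>M0) = 0" for k
    proof -
      let ?g = "\<lambda>x. frechet_derivative (\<phi> k) (at x) b"
      obtain R where R: "\<And>x. norm x \<ge> R \<Longrightarrow> grad (\<phi> k) x = 0"
        using test_C1c[OF p(1)[of k]] unfolding C1c_def by blast
      have g: "?g \<in> test_functions"
        by (rule testI[of _ R, OF smooth_partial[OF test_smooth[OF p(1)] b]])
           (simp add: frechet_derivative_grad[OF test_smooth[OF p(1)]] R)
      have "(\<integral>x. (G x \<bullet> b) * ?g x \<partial>M0) = - (\<integral>x. u x * (grad ?g x \<bullet> b) \<partial>M0) - snd b * (\<integral>y. T y * ?g (y, 0) \<partial>lborel)"
        by (rule Sob_by_parts[OF S g])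
      also have "(\<integral>x. u x * (grad ?g x \<bullet> b) \<partial>M0) = 0"
        using u by (intro integral_eq_zero_AE) auto
      also have "(\<integral>y. T y * ?g (y, 0) \<partial>lborel) = 0"
        using T by (intro integral_eq_zero_AE) auto
      finally show ?thesis by (simp add: grad_inner[OF b])
    qed
    moreover have "(\<lambda>k. \<integral>x. (G x \<bullet> b) * (grad (\<phi> k) x \<bullet> b) \<partial>M0) \<longlonglongrightarrow> (\<integral>x. (G x \<bullet> b) * (G x \<bullet> b) \<partial>M0)"
      by (intro L2_tendsto_integral_mult L2_tendsto_inner L2_tendsto_const p tm sm L2_inner t s borel_measurable_inner borel_measurable_const)
    ultimately show "(\<integral>x. (norm (G x \<bullet> b))\<^sup>2 \<partial>M0) \<le> 0"
      by (simp add: LIMSEQ_const_iff power2_eq_square)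
  qed
  then have "AE x in M0. \<forall>b\<in>Basis. G x \<bullet> b = 0" by (subst AE_ball_countable) (auto simp: countable_finite)
  then show "AE x in M0. G x = 0"
    by (rule AE_mp) (auto simp: euclidean_all_zero_iff simp del: split_paired_All)
qed

lemma Sob_unique:
  assumes "Sob M0 lborel u G T" "Sob M0 lborel v H S" "AE x in M0. u x = v x"
  shows "AE x in M0. G x = H x" "AE y in lborel. T y = S y"
  using Sob_zero[OF M0.Sob_diff[OF assms(1,2)]] assms(3) by auto

lemma (in measure_pair) Sob_cong:
  assumes S: "Sob M B u G T" and "G' \<in> borel_measurable M" "T' \<in> borel_measurable B"
    and GG: "AE x in M. G x = G' x" and TT: "AE y in B. T y = T' y"
  shows "Sob M B u G' T'"
proof -
  have "(\<integral>\<^sup>+x. ennreal ((norm (h x - G x))\<^sup>2) \<partial>M) = (\<integral>\<^sup>+x. ennreal ((norm (h x - G' x))\<^sup>2) \<partial>M)" for h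
    by (rule nn_integral_cong_AE) (use GG in auto)
  then have "L2_tendsto M f G = L2_tendsto M f G'" for f by (simp add: L2_tendsto_def)
  moreover have "(\<integral>\<^sup>+y. ennreal ((norm (h y - T y))\<^sup>2) \<partial>B) = (\<integral>\<^sup>+y. ennreal ((norm (h y - T' y))\<^sup>2) \<partial>B)" for h
    by (rule nn_integral_cong_AE) (use TT in auto)
  then have "L2_tendsto B f T = L2_tendsto B f T'" for f by (simp add: L2_tendsto_def)
  ultimately show ?thesis using assms by (simp add: Sob_def)
qed

lemma Sob_X_limit: "Sob MH MB u G T \<Longrightarrow> \<exists>\<phi>. X_limit \<phi> u G \<and> T \<in> borel_measurable MB \<and>
   (\<lambda>k. \<integral>\<^sup>+y. ennreal ((\<phi> k (y, 0) - T y)\<^sup>2) \<partial>MB) \<longlonglongrightarrow> 0"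
  by (auto simp: Sob_def X_limit_def L2_tendsto_def)

lemma X_limit_Sob: "X_limit \<phi> u G \<Longrightarrow> \<exists>T. Sob MH MB u G T"
  by (rule MH.Sob_trace_exists[of \<phi>]) (auto simp: X_limit_def L2_tendsto_def)

lemma Sob_in_X:
  assumes "Sob MH MB u G T" shows "u \<in> X"
  using Sob_X_limit[OF assms] unfolding X_def by blast

text \<open>The functions selected in the definitions of \<open>wgrad\<close> and \<open>trace\<close> may come from different approximating
  sequences; uniqueness of gradient and trace reconciles them.\<close>

lemma X_Sob:
  assumes u: "u \<in> X" shows "Sob MH MB u (wgrad u) (trace u)"
proof -
  obtain \<phi> G where "X_limit \<phi> u G" using u by (auto simp: X_def)
  then have "\<exists>G \<phi>. X_limit \<phi> u G" by blast
  then have "\<exists>\<phi>. X_limit \<phi> u (wgrad u)" unfolding wgrad_def by (rule someI_ex)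
  then obtain T where T: "Sob MH MB u (wgrad u) T" using X_limit_Sob by blast
  from Sob_X_limit[OF this] have "\<exists>T. T \<in> borel_measurable MB \<and> (\<exists>\<phi> G. X_limit \<phi> u G \<and>
        (\<lambda>k. \<integral>\<^sup>+y. ennreal ((\<phi> k (y, 0) - T y)\<^sup>2) \<partial>MB) \<longlonglongrightarrow> 0)" by blast
  then have tr: "trace u \<in> borel_measurable MB \<and> (\<exists>\<phi> G. X_limit \<phi> u G \<and>
        (\<lambda>k. \<integral>\<^sup>+y. ennreal ((\<phi> k (y, 0) - trace u y)\<^sup>2) \<partial>MB) \<longlonglongrightarrow> 0)"
    unfolding trace_def by (rule someI_ex)
  then obtain \<psi> G' where "X_limit \<psi> u G'" "(\<lambda>k. \<integral>\<^sup>+y. ennreal ((\<psi> k (y, 0) - trace u y)\<^sup>2) \<partial>MB) \<longlonglongrightarrow> 0" by blast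
  with tr have S: "Sob MH MB u G' (trace u)"
    by (auto simp: Sob_def X_limit_def L2_tendsto_def intro!: exI[of _ \<psi>])
  from Sob_unique(2)[OF Sob_MH_imp_M0[OF T] Sob_MH_imp_M0[OF S]] have "AE y in MB. T y = trace u y"
    by (simp add: AE_MB)
  then show ?thesis using T tr by (intro MH.Sob_cong[OF T]) (auto simp: Sob_def)
qed

lemma Sob_wgrad_trace:
  assumes "Sob MH MB u G T"
  shows "AE x in M0. wgrad u x = G x" "AE y in lborel. trace u y = T y"
  using Sob_unique[OF Sob_MH_imp_M0[OF X_Sob[OF Sob_in_X[OF assms]]] Sob_MH_imp_M0[OF assms]] by auto

section \<open>Membership in the weighted space\<close>

lemma L2_tendsto_dominated:
  assumes [measurable]: "\<And>k. f k \<in> borel_measurable M" "g \<in> borel_measurable M" and w: "integrable M w"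
    and bd: "\<And>k. AE x in M. (norm (f k x - g x))\<^sup>2 \<le> w x" and lim: "AE x in M. (\<lambda>k. f k x) \<longlonglongrightarrow> g x"
  shows "L2_tendsto M f g"
proof -
  have i: "integrable M (\<lambda>x. (norm (f k x - g x))\<^sup>2)" for k
    by (rule Bochner_Integration.integrable_bound[OF w]) (use bd[of k] in auto)
  have "(\<lambda>k. \<integral>x. (norm (f k x - g x))\<^sup>2 \<partial>M) \<longlonglongrightarrow> (\<integral>x. 0 \<partial>M)"
  proof (rule integral_dominated_convergence[OF _ _ w])
    show "AE x in M. (\<lambda>k. (norm (f k x - g x))\<^sup>2) \<longlonglongrightarrow> 0"
      using lim
    proof eventually_elim
      case (elim x)
      then have "(\<lambda>k. (norm (f k x - g x))\<^sup>2) \<longlonglongrightarrow> (norm (g x - g x))\<^sup>2" by (intro tendsto_intros)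
      then show ?case by simp
    qed
  qed (use bd in auto)
  then have "(\<lambda>k. \<integral>x. (norm (f k x - g x))\<^sup>2 \<partial>M) \<longlonglongrightarrow> 0" by simp
  from tendsto_ennrealI[OF this] show ?thesis
    unfolding L2_tendsto_def by (simp add: nn_integral_eq_integral[OF i])
qed

text \<open>A smooth function with the right integrability belongs to \<open>X\<close>: it is cut off by dilated bumps,
  whose gradients tend to zero uniformly.\<close>

lemma Sob_smooth:
  fixes \<psi> :: "('m::finite) pt \<Rightarrow> real"
  assumes \<psi>: "smooth \<psi>" and L: "\<psi> \<in> L2 MH" "grad \<psi> \<in> L2 MH" "(\<lambda>y. \<psi> (y, 0)) \<in> L2 MB"
  shows "Sob MH MB \<psi> (grad \<psi>) (\<lambda>y. \<psi> (y, 0))"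
proof -
  define cf where "cf k = (bump (real (Suc k)) :: 'm pt \<Rightarrow> real)" for k
  have cfs: "smooth (cf k)" for k by (simp add: cf_def smooth_bump)
  have cft: "cf k \<in> test_functions" for k
    unfolding cf_def by (rule testI[OF smooth_bump bump_support]) auto
  have t: "(\<lambda>x. cf k x * \<psi> x) \<in> test_functions" for k by (rule test_mult[OF cft \<psi>])
  note tm = MH.test_L2[OF t, THEN L2_measurable] and Lm = L[THEN L2_measurable]
  have c1: "(cf k x - 1)\<^sup>2 \<le> 1" for k x
    using bump_bounds[of "real (Suc k)" x] by (simp add: cf_def abs_square_le_1 abs_le_iff)
  have lim: "(\<lambda>k. cf k x) \<longlonglongrightarrow> 1" for x by (simp add: cf_def bump_tendsto del: of_nat_Suc)
  have gr: "grad (\<lambda>x. cf k x * \<psi> x) x - grad \<psi> x = (cf k x - 1) *\<^sub>R grad \<psi> x + \<psi> x *\<^sub>R grad (cf k) x" for k x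
    unfolding C1_grad[OF C1_mult[OF C1_smooth[OF cfs] C1_smooth[OF \<psi>]]]
    by (simp add: algebra_simps)
  have gb: "norm (grad (cf k) x) \<le> 32 * exp 1 / real (Suc k)" for k x
  proof (cases "norm x < real (Suc k)")
    case True
    have "norm (grad (cf k) x) \<le> 32 * exp 1 / (real (Suc k))\<^sup>2 * norm x"
      unfolding cf_def by (rule grad_bump_bound) simp
    also have "\<dots> \<le> 32 * exp 1 / (real (Suc k))\<^sup>2 * real (Suc k)"
      using True by (intro mult_left_mono) auto
    also have "\<dots> = 32 * exp 1 / real (Suc k)" by (simp add: power2_eq_square del: of_nat_Suc)
    finally show ?thesis .
  next
    case False
    then have "(real (Suc k))\<^sup>2 \<le> (norm x)\<^sup>2" by (intro power_mono) auto
    then have "1 - (norm x)\<^sup>2 / (real (Suc k))\<^sup>2 \<le> 0" by (simp add: le_divide_eq del: of_nat_Suc)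
    then have "flat 2 (1 - (norm x)\<^sup>2 / (real (Suc k))\<^sup>2) = 0"
      unfolding flat_def by (intro if_not_P leD)
    then have "grad (cf k) x = 0"
      unfolding cf_def by (subst grad_bump) (simp_all del: of_nat_Suc)
    then show ?thesis by simp
  qed
  have "L2_tendsto MH (\<lambda>k x. cf k x * \<psi> x) \<psi>"
  proof (rule L2_tendsto_dominated[OF tm(1) Lm(1) L2_integrable[OF L(1)]])
    have "(norm (cf k x * \<psi> x - \<psi> x))\<^sup>2 \<le> (norm (\<psi> x))\<^sup>2" for k x
      using mult_right_mono[OF c1[of k x], of "(\<psi> x)\<^sup>2"] by (simp add: power_mult_distrib[symmetric] algebra_simps)
    then show "AE x in MH. (norm (cf k x * \<psi> x - \<psi> x))\<^sup>2 \<le> (norm (\<psi> x))\<^sup>2" for k by simp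
    show "AE x in MH. (\<lambda>k. cf k x * \<psi> x) \<longlonglongrightarrow> \<psi> x"
      using tendsto_mult[OF lim tendsto_const] by (intro AE_I2) fastforce
  qed
  moreover have "L2_tendsto MB (\<lambda>k y. cf k (y, 0) * \<psi> (y, 0)) (\<lambda>y. \<psi> (y, 0))"
  proof (rule L2_tendsto_dominated[OF tm(3) Lm(3) L2_integrable[OF L(3)]])
    have "(norm (cf k x * \<psi> x - \<psi> x))\<^sup>2 \<le> (norm (\<psi> x))\<^sup>2" for k x
      using mult_right_mono[OF c1[of k x], of "(\<psi> x)\<^sup>2"] by (simp add: power_mult_distrib[symmetric] algebra_simps)
    then show "AE y in MB. (norm (cf k (y, 0) * \<psi> (y, 0) - \<psi> (y, 0)))\<^sup>2 \<le> (norm (\<psi> (y, 0)))\<^sup>2" for k by simp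
    show "AE y in MB. (\<lambda>k. cf k (y, 0) * \<psi> (y, 0)) \<longlonglongrightarrow> \<psi> (y, 0)"
      using tendsto_mult[OF lim tendsto_const] by (intro AE_I2) fastforce
  qed
  moreover have "L2_tendsto MH (\<lambda>k. grad (\<lambda>x. cf k x * \<psi> x)) (grad \<psi>)"
  proof (rule L2_tendsto_dominated[OF tm(2) Lm(2), of "\<lambda>x. 2 * (norm (grad \<psi> x))\<^sup>2 + 2 * ((32 * exp 1)\<^sup>2 * (norm (\<psi> x))\<^sup>2)"])
    show "integrable MH (\<lambda>x. 2 * (norm (grad \<psi> x))\<^sup>2 + 2 * ((32 * exp 1)\<^sup>2 * (norm (\<psi> x))\<^sup>2))"
      by (intro Bochner_Integration.integrable_add integrable_mult_right L2_integrable L)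
    have "(norm (grad (\<lambda>x. cf k x * \<psi> x) x - grad \<psi> x))\<^sup>2 \<le> 2 * (norm (grad \<psi> x))\<^sup>2 + 2 * ((32 * exp 1)\<^sup>2 * (norm (\<psi> x))\<^sup>2)" for k x
    proof -
      have "(norm ((cf k x - 1) *\<^sub>R grad \<psi> x))\<^sup>2 \<le> (norm (grad \<psi> x))\<^sup>2"
        using mult_right_mono[OF c1[of k x], of "(norm (grad \<psi> x))\<^sup>2"] by (simp add: power_mult_distrib)
      moreover have "(norm (\<psi> x *\<^sub>R grad (cf k) x))\<^sup>2 \<le> (32 * exp 1)\<^sup>2 * (norm (\<psi> x))\<^sup>2"
      proof -
        have "norm (grad (cf k) x) \<le> 32 * exp 1"
          by (rule order_trans[OF gb]) (simp add: divide_le_eq mult_le_cancel_left1)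
        then have "(norm (grad (cf k) x))\<^sup>2 \<le> (32 * exp 1)\<^sup>2" by (intro power_mono) auto
        from mult_right_mono[OF this, of "(norm (\<psi> x))\<^sup>2"] show ?thesis by (simp add: power_mult_distrib mult.commute)
      qed
      ultimately show ?thesis
        unfolding gr using norm_add_sq_le[of "(cf k x - 1) *\<^sub>R grad \<psi> x" "\<psi> x *\<^sub>R grad (cf k) x"] by linarith
    qed
    then show "AE x in MH. (norm (grad (\<lambda>x. cf k x * \<psi> x) x - grad \<psi> x))\<^sup>2 \<le> 2 * (norm (grad \<psi> x))\<^sup>2 + 2 * ((32 * exp 1)\<^sup>2 * (norm (\<psi> x))\<^sup>2)" for k
      by simp
    have "(\<lambda>k. grad (\<lambda>x. cf k x * \<psi> x) x) \<longlonglongrightarrow> grad \<psi> x" for x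
    proof -
      have "(\<lambda>k. grad (cf k) x) \<longlonglongrightarrow> 0"
      proof (rule Lim_null_comparison)
        show "\<forall>\<^sub>F k in sequentially. norm (grad (cf k) x) \<le> 32 * exp 1 * inverse (real (Suc k))"
          using gb by (simp add: divide_inverse)
        have "(\<lambda>k. 32 * exp 1 * inverse (real (Suc k))) \<longlonglongrightarrow> 32 * exp 1 * 0"
          by (intro tendsto_intros LIMSEQ_inverse_real_of_nat)
        then show "(\<lambda>k. 32 * exp 1 * inverse (real (Suc k))) \<longlonglongrightarrow> 0" by simp
      qed
      then have "(\<lambda>k. (cf k x - 1) *\<^sub>R grad \<psi> x + \<psi> x *\<^sub>R grad (cf k) x) \<longlonglongrightarrow> (1 - 1) *\<^sub>R grad \<psi> x + \<psi> x *\<^sub>R 0"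
        by (intro tendsto_intros lim)
      then show ?thesis unfolding gr[symmetric] by (simp add: LIM_zero_iff)
    qed
    then show "AE x in MH. (\<lambda>k. grad (\<lambda>x. cf k x * \<psi> x) x) \<longlonglongrightarrow> grad \<psi> x" by simp
  qed
  ultimately show ?thesis
    unfolding Sob_def using Lm t by (intro conjI exI[of _ "\<lambda>k x. cf k x * \<psi> x"] allI)
qed

lemma smooth_inverse_K: "smooth (\<lambda>x. 1 / K x)"
proof -
  have "smooth (\<lambda>x::'a pt. exp ((norm x)\<^sup>2 * (- 1/4)))"
    by (intro smooth_exp smooth_mult smooth_norm2 smooth_const)
  then show ?thesis by (simp add: K_def exp_minus inverse_eq_divide)
qed

lemma C1_inverse:
  assumes f: "C1 f F" and nz: "\<And>x. f x \<noteq> 0"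
  shows "C1 (\<lambda>x. 1 / f x) (\<lambda>x. (- 1 / (f x)\<^sup>2) *\<^sub>R F x)"
  unfolding C1_def
proof (intro conjI allI)
  fix x
  have "((\<lambda>x. inverse (f x)) has_derivative (\<lambda>v. - (inverse (f x) * (F x \<bullet> v) * inverse (f x)))) (at x)"
    by (rule Deriv.has_derivative_inverse[OF nz C1_has_derivative[OF f]])
  then show "((\<lambda>x. 1 / f x) has_derivative (\<lambda>v. (- 1 / (f x)\<^sup>2) *\<^sub>R F x \<bullet> v)) (at x)"
    by (simp add: inverse_eq_divide power2_eq_square mult.commute)
  show "continuous_on UNIV (\<lambda>x. (- 1 / (f x)\<^sup>2) *\<^sub>R F x)"
    by (intro continuous_intros C1_continuous[OF f]) (use nz in auto)
qed

lemma norm2_le_K: "(norm x)\<^sup>2 \<le> 4 * K x"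
  using exp_ge_add_one_self[of "(norm x)\<^sup>2 / 4"] unfolding K_def by linarith

text \<open>Division by \<open>K\<close> turns the unweighted space into test functions for the weighted equation.\<close>

lemma Sob_div_K:
  fixes v :: "('m::finite) pt \<Rightarrow> real"
  assumes S: "Sob M0 lborel v H S"
  shows "Sob MH MB (\<lambda>x. v x / K x) (\<lambda>x. (1 / K x) *\<^sub>R (H x - (v x / 2) *\<^sub>R x)) (\<lambda>y. S y / K (y, 0))"
proof -
  obtain \<phi> where p: "\<And>k. \<phi> k \<in> test_functions" "L2_tendsto M0 \<phi> v" "L2_tendsto M0 (\<lambda>k. grad (\<phi> k)) H"
     "L2_tendsto lborel (\<lambda>k y. \<phi> k (y, 0)) S"
    using S by (auto simp: Sob_def)
  note t = M0.test_L2[OF p(1)] and s = M0.Sob_L2[OF S]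
  note [measurable] = t[THEN L2_measurable] s[THEN L2_measurable]
  have [measurable]: "(\<lambda>x. x) \<in> borel_measurable (M0 :: 'm pt measure)"
    by (intro continuous_measurable_M0 continuous_intros)
  have gr: "grad (\<lambda>x. \<phi> k x * (1 / K x)) x = (1 / K x) *\<^sub>R (grad (\<phi> k) x - (\<phi> k x / 2) *\<^sub>R x)" for k x
    unfolding C1_grad[OF C1_mult[OF test_C1[OF p(1)] C1_inverse[OF C1_K K_pos(3)]]]
    by (simp add: power2_eq_square algebra_simps)
  have t': "(\<lambda>x. \<phi> k x / K x) \<in> test_functions" for k
    using test_mult[OF p(1) smooth_inverse_K] by simp
  have comparison: "L2_tendsto MH f g"
    if e: "\<And>k x. K x * (norm (f k x - g x))\<^sup>2 \<le> 2 * (norm (grad (\<phi> k) x - H x))\<^sup>2 + 2 * (norm (\<phi> k x - v x))\<^sup>2"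
      and [measurable]: "\<And>k. f k \<in> borel_measurable M0" "g \<in> borel_measurable M0"
    for f :: "nat \<Rightarrow> 'm pt \<Rightarrow> 'c::euclidean_space" and g
    unfolding L2_tendsto_def
  proof (rule ennreal_tendsto_zero_le)
    let ?b = "\<lambda>k. 2 * (\<integral>\<^sup>+x. ennreal ((norm (grad (\<phi> k) x - H x))\<^sup>2) \<partial>M0) + 2 * (\<integral>\<^sup>+x. ennreal ((norm (\<phi> k x - v x))\<^sup>2) \<partial>M0)"
    have "?b \<longlonglongrightarrow> 2 * 0 + 2 * 0"
      by (intro tendsto_add ennreal_tendsto_cmult p(2,3)[unfolded L2_tendsto_def]) auto
    then show "?b \<longlonglongrightarrow> 0" by simp
    fix k
    have "(\<integral>\<^sup>+x. ennreal ((norm (f k x - g x))\<^sup>2) \<partial>MH) = (\<integral>\<^sup>+x. ennreal (K x * (norm (f k x - g x))\<^sup>2) \<partial>M0)"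
      by (subst nn_integral_MH) (auto simp: ennreal_mult)
    also have "\<dots> \<le> (\<integral>\<^sup>+x. 2 * ennreal ((norm (grad (\<phi> k) x - H x))\<^sup>2) + 2 * ennreal ((norm (\<phi> k x - v x))\<^sup>2) \<partial>M0)"
      by (intro nn_integral_mono order_trans[OF ennreal_leI[OF e]]) (simp add: ennreal_plus ennreal_mult'')
    also have "\<dots> = ?b k" by (simp add: nn_integral_add nn_integral_cmult)
    finally show "(\<integral>\<^sup>+x. ennreal ((norm (f k x - g x))\<^sup>2) \<partial>MH) \<le> ?b k" .
  qed
  have K1: "1 / K x \<le> 1" for x :: "'m pt" using K_ge_1[of x] by simp
  have "L2_tendsto MH (\<lambda>k x. \<phi> k x / K x) (\<lambda>x. v x / K x)"
  proof (rule comparison)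
    fix k and x :: "'m pt"
    have "K x * (norm (\<phi> k x / K x - v x / K x))\<^sup>2 = (1 / K x) * (norm (\<phi> k x - v x))\<^sup>2"
      by (simp add: diff_divide_distrib[symmetric] power_divide power2_eq_square)
    also have "\<dots> \<le> 1 * (norm (\<phi> k x - v x))\<^sup>2" by (intro mult_right_mono K1) auto
    also have "\<dots> \<le> 2 * (norm (grad (\<phi> k) x - H x))\<^sup>2 + 2 * (norm (\<phi> k x - v x))\<^sup>2" by simp
    finally show "K x * (norm (\<phi> k x / K x - v x / K x))\<^sup>2 \<le> 2 * (norm (grad (\<phi> k) x - H x))\<^sup>2 + 2 * (norm (\<phi> k x - v x))\<^sup>2" .
  qed measurable
  moreover have "L2_tendsto MH (\<lambda>k. grad (\<lambda>x. \<phi> k x / K x)) (\<lambda>x. (1 / K x) *\<^sub>R (H x - (v x / 2) *\<^sub>R x))"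
  proof (rule comparison)
    fix k and x :: "'m pt"
    let ?a = "grad (\<phi> k) x - H x" and ?c = "\<phi> k x - v x"
    have "(norm (?a - (?c / 2) *\<^sub>R x))\<^sup>2 \<le> 2 * (norm ?a)\<^sup>2 + 2 * (norm ((?c / 2) *\<^sub>R x))\<^sup>2"
      by (rule norm_diff_sq_le)
    also have "\<dots> = 2 * (norm ?a)\<^sup>2 + (?c)\<^sup>2 / 2 * (norm x)\<^sup>2"
      by (simp add: power_mult_distrib power_divide)
    also have "\<dots> \<le> K x * (2 * (norm ?a)\<^sup>2 + 2 * (norm ?c)\<^sup>2)"
    proof -
      have "(?c)\<^sup>2 / 2 * (norm x)\<^sup>2 \<le> (?c)\<^sup>2 / 2 * (4 * K x)"
        by (intro mult_left_mono norm2_le_K) auto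
      moreover have "1 * (2 * (norm ?a)\<^sup>2) \<le> K x * (2 * (norm ?a)\<^sup>2)"
        by (intro mult_right_mono K_ge_1) auto
      ultimately show ?thesis by (simp add: algebra_simps)
    qed
    finally have *: "(norm (?a - (?c / 2) *\<^sub>R x))\<^sup>2 \<le> K x * (2 * (norm ?a)\<^sup>2 + 2 * (norm ?c)\<^sup>2)" .
    have "grad (\<lambda>x. \<phi> k x / K x) x - (1 / K x) *\<^sub>R (H x - (v x / 2) *\<^sub>R x) = (1 / K x) *\<^sub>R (?a - (?c / 2) *\<^sub>R x)"
      using gr[of k x] by (simp add: algebra_simps diff_divide_distrib)
    then have "K x * (norm (grad (\<lambda>x. \<phi> k x / K x) x - (1 / K x) *\<^sub>R (H x - (v x / 2) *\<^sub>R x)))\<^sup>2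
       = (norm (?a - (?c / 2) *\<^sub>R x))\<^sup>2 / K x"
      by (simp add: power_mult_distrib power_divide power2_eq_square)
    also have "\<dots> \<le> 2 * (norm ?a)\<^sup>2 + 2 * (norm ?c)\<^sup>2"
      using * by (simp add: divide_le_eq mult.commute)
    finally show "K x * (norm (grad (\<lambda>x. \<phi> k x / K x) x - (1 / K x) *\<^sub>R (H x - (v x / 2) *\<^sub>R x)))\<^sup>2
      \<le> 2 * (norm ?a)\<^sup>2 + 2 * (norm ?c)\<^sup>2" .
  next
    show "grad (\<lambda>x. \<phi> k x / K x) \<in> borel_measurable M0" for k
      by (rule L2_measurable[OF M0.test_L2(2)[OF t']])
  qed measurable
  moreover have "L2_tendsto MB (\<lambda>k y. \<phi> k (y, 0) / K (y, 0)) (\<lambda>y. S y / K (y, 0))"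
    unfolding L2_tendsto_def
  proof (rule ennreal_tendsto_zero_le)
    show "(\<lambda>k. \<integral>\<^sup>+y. ennreal ((norm (\<phi> k (y, 0) - S y))\<^sup>2) \<partial>lborel) \<longlonglongrightarrow> 0"
      using p(4) by (simp add: L2_tendsto_def)
    fix k
    have [measurable]: "S \<in> borel_measurable borel" "(\<lambda>y. \<phi> k (y, 0)) \<in> borel_measurable borel"
      using L2_measurable[OF s(3)] L2_measurable[OF t(3)[of k]] by simp_all
    have "(\<integral>\<^sup>+y. ennreal ((norm (\<phi> k (y, 0) / K (y, 0) - S y / K (y, 0)))\<^sup>2) \<partial>MB) =
       (\<integral>\<^sup>+y. ennreal (K (y, 0) * (norm (\<phi> k (y, 0) / K (y, 0) - S y / K (y, 0)))\<^sup>2) \<partial>lborel)"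
      by (subst nn_integral_MB) (auto simp: ennreal_mult)
    also have "\<dots> \<le> (\<integral>\<^sup>+y. ennreal ((norm (\<phi> k (y, 0) - S y))\<^sup>2) \<partial>lborel)"
    proof (intro nn_integral_mono ennreal_leI)
      fix y :: "real^'m"
      have "K (y, 0) * (norm (\<phi> k (y, 0) / K (y, 0) - S y / K (y, 0)))\<^sup>2 = (1 / K (y, 0)) * (norm (\<phi> k (y, 0) - S y))\<^sup>2"
        by (simp add: diff_divide_distrib[symmetric] power_divide power2_eq_square)
      also have "\<dots> \<le> 1 * (norm (\<phi> k (y, 0) - S y))\<^sup>2" by (intro mult_right_mono K1) auto
      finally show "K (y, 0) * (norm (\<phi> k (y, 0) / K (y, 0) - S y / K (y, 0)))\<^sup>2 \<le> (norm (\<phi> k (y, 0) - S y))\<^sup>2" by simp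
    qed
    finally show "(\<integral>\<^sup>+y. ennreal ((norm (\<phi> k (y, 0) / K (y, 0) - S y / K (y, 0)))\<^sup>2) \<partial>MB) \<le> (\<integral>\<^sup>+y. ennreal ((norm (\<phi> k (y, 0) - S y))\<^sup>2) \<partial>lborel)" .
  qed
  moreover have "(\<lambda>y. S y / K (y, 0)) \<in> borel_measurable borel"
    using L2_measurable[OF s(3)] by simp
  ultimately show ?thesis
    unfolding Sob_def measurable_MH measurable_MB
    by (intro conjI exI[of _ "\<lambda>k x. \<phi> k x / K x"] allI t') measurable
qed

section \<open>Traces of nonnegative functions\<close>

text \<open>The trace inequality is applied to the square of the negative part, which is still continuously
  differentiable.\<close>

lemma Sob_trace_nonneg:
  assumes S: "Sob M0 lborel u G T" and u: "AE x in M0. u x \<ge> 0"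
  shows "AE y in lborel. T y \<ge> 0"
proof -
  obtain \<phi> where p: "\<And>k. \<phi> k \<in> test_functions" "L2_tendsto M0 \<phi> u" "L2_tendsto M0 (\<lambda>k. grad (\<phi> k)) G"
     "L2_tendsto lborel (\<lambda>k y. \<phi> k (y, 0)) T"
    using S by (auto simp: Sob_def)
  note t = M0.test_L2[OF p(1)] and s = M0.Sob_L2[OF S]
  note tm = t[THEN L2_measurable] and sm = s[THEN L2_measurable]
  have min_L2: "(\<lambda>x. min (f x) 0) \<in> L2 M" if "f \<in> L2 M" for f :: "'z \<Rightarrow> real" and M
    by (rule L2_bound[OF _ L2_integrable[OF that]]) (use L2_measurable[OF that] in \<open>auto simp: min_def\<close>)
  have min_lim: "L2_tendsto M (\<lambda>k x. min (f k x) 0) (\<lambda>x. min (g x) 0)"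
    if "L2_tendsto M f g" "g \<in> borel_measurable M" "\<And>k. f k \<in> borel_measurable M" for f :: "nat \<Rightarrow> 'z \<Rightarrow> real" and g M
  proof (rule L2_tendsto_bound[OF that, of _ _ 1])
    have "(norm (min a 0 - min b 0))\<^sup>2 \<le> 1 * (norm (a - b))\<^sup>2" for a b :: real
      unfolding mult_1 real_norm_def by (intro power_mono) auto
    then show "AE x in M. \<forall>k. (norm (min (f k x) 0 - min (g x) 0))\<^sup>2 \<le> 1 * (norm (f k x - g x))\<^sup>2" by blast
  qed simp
  have h: "((\<lambda>s::real. (min s 0)\<^sup>2) has_real_derivative 2 * min s 0) (at s)" for s
  proof -
    consider "s < 0" | "s > 0" | "s = 0" by linarith
    then show ?thesis
    proof cases
      case 1
      have "((\<lambda>s. s\<^sup>2) has_real_derivative 2 * min s 0) (at s)"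
        using 1 by (auto intro!: derivative_eq_intros)
      then show ?thesis
        by (rule has_field_derivative_transform_within_open[where S="{..<0}"]) (use 1 in auto)
    next
      case 2
      have "((\<lambda>s. 0) has_real_derivative 2 * min s 0) (at s)" using 2 by simp
      then show ?thesis
        by (rule has_field_derivative_transform_within_open[where S="{0<..}"]) (use 2 in auto)
    next
      case 3
      have "((\<lambda>s::real. (min s 0)\<^sup>2 / s) \<longlongrightarrow> 0) (at 0)"
      proof (rule Lim_null_comparison)
        show "((\<lambda>s::real. \<bar>s\<bar>) \<longlongrightarrow> 0) (at 0)" by (auto intro!: tendsto_eq_intros)
        have "norm ((min s 0)\<^sup>2 / s) \<le> \<bar>s\<bar>" for s :: real
          by (cases "s < 0") (auto simp: min_def power2_eq_square abs_mult)
        then show "\<forall>\<^sub>F s in at (0::real). norm ((min s 0)\<^sup>2 / s) \<le> \<bar>s\<bar>" by simp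
      qed
      then show ?thesis using 3 by (simp add: has_field_derivative_iff)
    qed
  qed
  have "(\<integral>y. (norm (min (\<phi> k (y, 0)) 0))\<^sup>2 \<partial>lborel) \<le> 2 * (\<integral>x. norm (min (\<phi> k x) 0) * norm (grad (\<phi> k) x) \<partial>M0)" for k
  proof -
    obtain R where R: "\<And>x. norm x \<ge> R \<Longrightarrow> \<phi> k x = 0" using test_support[OF p(1)[of k]] by blast
    have "C1c (\<lambda>x. (min (\<phi> k x) 0)\<^sup>2) (\<lambda>x. (2 * min (\<phi> k x) 0) *\<^sub>R grad (\<phi> k) x)"
      by (rule C1cI[OF C1_compose[OF h _ test_C1[OF p(1)]], of R]) (auto intro!: continuous_intros simp: R)
    from boundary_integral_le[OF this] show ?thesis
      by (simp add: abs_mult mult.assoc)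
  qed
  moreover have "(\<lambda>k. \<integral>y. (norm (min (\<phi> k (y, 0)) 0))\<^sup>2 \<partial>lborel) \<longlonglongrightarrow> (\<integral>y. (norm (min (T y) 0))\<^sup>2 \<partial>lborel)"
    by (intro L2_tendsto_integral_sq min_lim p min_L2 t borel_measurable_min sm tm) simp
  moreover have "(\<lambda>k. 2 * (\<integral>x. norm (min (\<phi> k x) 0) * norm (grad (\<phi> k) x) \<partial>M0)) \<longlonglongrightarrow> 2 * (\<integral>x. norm (min (u x) 0) * norm (G x) \<partial>M0)"
    by (intro tendsto_mult tendsto_const L2_tendsto_integral_mult L2_tendsto_norm min_lim p L2_norm min_L2 t
        borel_measurable_min sm tm borel_measurable_const borel_measurable_norm[THEN measurable_compose[rotated]])
  moreover have "(\<integral>x. norm (min (u x) 0) * norm (G x) \<partial>M0) = 0"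
    using u by (intro integral_eq_zero_AE) (auto simp: min_def elim!: eventually_mono)
  ultimately have "(\<integral>y. (norm (min (T y) 0))\<^sup>2 \<partial>lborel) \<le> 0"
    by (intro LIMSEQ_le[of "\<lambda>k. \<integral>y. (norm (min (\<phi> k (y, 0)) 0))\<^sup>2 \<partial>lborel" _
      "\<lambda>k. 2 * (\<integral>x. norm (min (\<phi> k x) 0) * norm (grad (\<phi> k) x) \<partial>M0)"]) (simp_all only: mult_zero_right, blast)
  then have "AE y in lborel. min (T y) 0 = 0" by (intro integral_sq_0_AE min_L2 s)
  then show ?thesis by (rule AE_mp) (auto simp: min_def split: if_splits)
qed

section \<open>Explicit solutions of the linear equation\<close>

lemma integrable_gauss_real: "integrable lborel (\<lambda>s::real. exp (- (s\<^sup>2 / 8)))"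
proof -
  have "set_integrable lborel (einterval (-\<infinity>) \<infinity>) (\<lambda>s. 1 / (1 + s\<^sup>2))"
  proof (rule interval_integral_FTC_nonneg(1)[where F=arctan and A="- (pi/2)" and B="pi/2"])
    show "isCont (\<lambda>s. 1 / (1 + s\<^sup>2)) x" for x :: real
      by (intro continuous_intros) (use zero_le_power2[of x] in linarith)
    show "(arctan has_real_derivative 1 / (1 + x\<^sup>2)) (at x)" for x
      using DERIV_arctan[of x] by (simp add: inverse_eq_divide)
    show "((arctan \<circ> real_of_ereal) \<longlongrightarrow> - (pi/2)) (at_right (-\<infinity>))"
      using tendsto_arctan_at_bot by (simp add: ereal_tendsto_simps)
    show "((arctan \<circ> real_of_ereal) \<longlongrightarrow> pi/2) (at_left \<infinity>)"
      using tendsto_arctan_at_top by (simp add: ereal_tendsto_simps)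
  qed auto
  then have "integrable lborel (\<lambda>s::real. 1 / (1 + s\<^sup>2))"
    by (simp add: set_integrable_def einterval_def)
  then have "integrable lborel (\<lambda>s::real. 8 * (1 / (1 + s\<^sup>2)))" by (rule integrable_mult_right)
  then show ?thesis
  proof (rule Bochner_Integration.integrable_bound)
    have "exp (- (s\<^sup>2 / 8)) \<le> 8 * (1 / (1 + s\<^sup>2))" for s :: real
    proof -
      have "1 + s\<^sup>2 \<le> 8 * exp (s\<^sup>2 / 8)" using exp_ge_add_one_self[of "s\<^sup>2 / 8"] by linarith
      moreover have "1 + s\<^sup>2 > 0" by (simp add: add_pos_nonneg)
      ultimately show ?thesis by (simp add: exp_minus field_simps)
    qed
    then show "AE s in lborel. norm (exp (- ((s::real)\<^sup>2 / 8))) \<le> norm (8 * (1 / (1 + s\<^sup>2)))"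
      by (auto intro: order_trans abs_ge_self)
  qed auto
qed

lemma integrable_gauss: "integrable lborel (\<lambda>x::'a::euclidean_space. exp (- ((norm x)\<^sup>2 / 8)))"
proof -
  have "(\<integral>\<^sup>+x. ennreal (exp (- ((norm (x::'a))\<^sup>2 / 8))) \<partial>lborel) = (\<integral>\<^sup>+x. (\<Prod>b\<in>Basis. ennreal (exp (- (((x::'a) \<bullet> b)\<^sup>2 / 8)))) \<partial>lborel)"
  proof (intro nn_integral_cong)
    fix x :: 'a
    have "- ((norm x)\<^sup>2 / 8) = (\<Sum>b\<in>Basis. - ((x \<bullet> b)\<^sup>2 / 8))"
      unfolding power2_norm_eq_inner euclidean_inner[of x x]
      by (simp add: sum_negf sum_divide_distrib[symmetric] power2_eq_square)
    then show "ennreal (exp (- ((norm x)\<^sup>2 / 8))) = (\<Prod>b\<in>Basis. ennreal (exp (- ((x \<bullet> b)\<^sup>2 / 8))))"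
      by (simp add: exp_sum prod_ennreal)
  qed
  also have "\<dots> = (\<Prod>b\<in>(Basis::'a set). \<integral>\<^sup>+s. ennreal (exp (- (s\<^sup>2 / 8))) \<partial>lborel)"
    by (rule nn_integral_lborel_prod) auto
  also have "\<dots> < \<infinity>"
    using integrable_gauss_real by (simp add: integrable_iff_bounded power_less_top_ennreal)
  finally show ?thesis by (auto simp: integrable_iff_bounded)
qed

lemma gaussian_tail_exists:
  "\<exists>E. (\<forall>t. (E has_real_derivative - exp (- (t\<^sup>2 / 4))) (at t)) \<and>
     (\<forall>t. 0 \<le> E t) \<and> (\<forall>t\<ge>1. E t \<le> 2 * exp (- (t\<^sup>2 / 4)))"
proof -
  have "\<exists>F. \<forall>x. -\<infinity> < ereal x \<longrightarrow> ereal x < \<infinity> \<longrightarrow> (F has_vector_derivative exp (- (x\<^sup>2 / 4))) (at x)"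
    by (rule einterval_antiderivative) (auto intro!: continuous_intros)
  then obtain F where F: "\<And>x. (F has_real_derivative exp (- (x\<^sup>2 / 4))) (at x)"
    by (auto simp: has_real_derivative_iff_has_vector_derivative)
  have mono: "F s \<le> F t" if "s \<le> t" for s t
    by (rule DERIV_nonneg_imp_nondecreasing[OF that]) (use F in \<open>auto intro!: exI[of _ "exp (- (_\<^sup>2 / 4))"]\<close>)
  have le: "F s + 2 * exp (- (s\<^sup>2 / 4)) \<le> F t + 2 * exp (- (t\<^sup>2 / 4))" if "1 \<le> t" "t \<le> s" for s t
  proof (rule DERIV_nonpos_imp_nonincreasing[OF that(2)])
    fix x assume x: "t \<le> x" "x \<le> s"
    have "((\<lambda>s. F s + 2 * exp (- (s\<^sup>2 / 4))) has_real_derivative (1 - x) * exp (- (x\<^sup>2 / 4))) (at x)"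
      by (auto intro!: derivative_eq_intros F simp: algebra_simps)
    moreover have "(1 - x) * exp (- (x\<^sup>2 / 4)) \<le> 0" using x that by (intro mult_nonpos_nonneg) auto
    ultimately show "\<exists>y. ((\<lambda>s. F s + 2 * exp (- (s\<^sup>2 / 4))) has_real_derivative y) (at x) \<and> y \<le> 0" by blast
  qed
  have ub: "F s \<le> F t + 2 * exp (- (t\<^sup>2 / 4))" if "1 \<le> t" for s t
  proof (cases "t \<le> s")
    case True
    then show ?thesis using le[OF that True] exp_ge_zero[of "- (s\<^sup>2 / 4)"] by linarith
  next
    case False
    then show ?thesis using mono[of s t] exp_ge_zero[of "- (t\<^sup>2 / 4)"] by linarith
  qed
  have bdd: "bdd_above (range F)" using ub[of 1] by (auto intro!: bdd_aboveI)
  show ?thesis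
  proof (intro exI[of _ "\<lambda>t. Sup (range F) - F t"] conjI allI impI)
    show "((\<lambda>t. Sup (range F) - F t) has_real_derivative - exp (- (t\<^sup>2 / 4))) (at t)" for t
      by (auto intro!: derivative_eq_intros F)
    show "0 \<le> Sup (range F) - F t" for t using cSup_upper[OF _ bdd] by simp
    show "Sup (range F) - F t \<le> 2 * exp (- (t\<^sup>2 / 4))" if "1 \<le> t" for t
    proof -
      have "Sup (range F) \<le> F t + 2 * exp (- (t\<^sup>2 / 4))"
        by (rule cSup_least) (use ub[OF that] in auto)
      then show ?thesis by simp
    qed
  qed
qed

text \<open>The integral of \<open>exp (- s\<^sup>2/4)\<close> over \<open>s \<ge> t\<close>, that is the complementary error function up to constants;
  it is characterized by its derivative and its decay.\<close>

definition gaussian_tail :: "real \<Rightarrow> real" where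
  "gaussian_tail = (SOME E. (\<forall>t. (E has_real_derivative - exp (- (t\<^sup>2 / 4))) (at t)) \<and>
     (\<forall>t. 0 \<le> E t) \<and> (\<forall>t\<ge>1. E t \<le> 2 * exp (- (t\<^sup>2 / 4))))"

lemma gaussian_tail:
  "(gaussian_tail has_real_derivative - exp (- (t\<^sup>2 / 4))) (at t)"
  "0 \<le> gaussian_tail t" "t \<ge> 1 \<Longrightarrow> gaussian_tail t \<le> 2 * exp (- (t\<^sup>2 / 4))"
  using someI_ex[OF gaussian_tail_exists] unfolding gaussian_tail_def[symmetric] by blast+

text \<open>These are the Hermite functions of negative order (repeated integrals of the Gaussian), the
  decaying solutions of \<open>h'' + (t/2) h' = ((j - 1)/2) h\<close>.\<close>

fun herm :: "nat \<Rightarrow> real \<Rightarrow> real" where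
  "herm 0 t = exp (- (t\<^sup>2 / 4))"
| "herm (Suc 0) t = gaussian_tail t"
| "herm (Suc (Suc j)) t = (2 * herm j t - t * herm (Suc j) t) / real (Suc j)"

text \<open>The derivative of \<open>herm j\<close>: each function is the negative derivative of its successor.\<close>

definition hermd :: "nat \<Rightarrow> real \<Rightarrow> real" where
  "hermd j t = (case j of 0 \<Rightarrow> - (t / 2) * herm 0 t | Suc i \<Rightarrow> - herm i t)"

lemma herm_derivative: "(herm j has_real_derivative hermd j t) (at t)"
proof (induction j t rule: herm.induct)
  case (1 t)
  have "((\<lambda>t. exp (- (t\<^sup>2 / 4))) has_real_derivative - (t / 2) * exp (- (t\<^sup>2 / 4))) (at t)"
    by (auto intro!: derivative_eq_intros)
  moreover have "herm 0 = (\<lambda>t. exp (- (t\<^sup>2 / 4)))" by auto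
  ultimately show ?case by (simp add: hermd_def)
next
  case (2 t)
  have "herm (Suc 0) = gaussian_tail" by auto
  then show ?case using gaussian_tail(1) by (simp add: hermd_def)
next
  case (3 j t)
  have "((\<lambda>t. (2 * herm j t - t * herm (Suc j) t) / real (Suc j)) has_real_derivative
      (2 * hermd j t - (1 * herm (Suc j) t + hermd (Suc j) t * t)) / real (Suc j)) (at t)"
    by (intro DERIV_cdivide DERIV_diff DERIV_cmult DERIV_mult DERIV_ident 3)
  moreover have "2 * hermd j t - (1 * herm (Suc j) t + hermd (Suc j) t * t) = - real (Suc j) * herm (Suc j) t"
  proof (cases j)
    case (Suc i)
    have "real (Suc i) * herm (Suc (Suc i)) t = 2 * herm i t - t * herm (Suc i) t"
      by (simp del: of_nat_Suc)
    then show ?thesis unfolding Suc hermd_def by (simp del: herm.simps add: algebra_simps)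
  qed (simp add: hermd_def)
  moreover have "herm (Suc (Suc j)) = (\<lambda>t. (2 * herm j t - t * herm (Suc j) t) / real (Suc j))" by auto
  ultimately show ?case by (simp add: hermd_def del: of_nat_Suc)
qed

lemma hermd_derivative:
  "(hermd j has_real_derivative ((real j - 1) / 2 * herm j t - t / 2 * hermd j t)) (at t)"
proof (cases "(j, t)" rule: herm.cases)
  case (1 s)
  have "hermd 0 = (\<lambda>t. - (t / 2) * herm 0 t)" by (auto simp: hermd_def)
  moreover have "((\<lambda>t. - (t / 2) * herm 0 t) has_real_derivative - (1/2) * herm 0 t + hermd 0 t * - (t / 2)) (at t)"
    by (intro DERIV_mult herm_derivative) (auto intro!: derivative_eq_intros)
  ultimately show ?thesis using 1 by (simp add: algebra_simps)
next
  case (2 s)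
  have "hermd (Suc 0) = (\<lambda>t. - herm 0 t)" by (auto simp: hermd_def)
  moreover have "((\<lambda>t. - herm 0 t) has_real_derivative - hermd 0 t) (at t)"
    by (intro DERIV_minus herm_derivative)
  ultimately show ?thesis using 2 by (simp add: hermd_def)
next
  case (3 i s)
  have "hermd (Suc (Suc i)) = (\<lambda>t. - herm (Suc i) t)" by (auto simp: hermd_def)
  moreover have "((\<lambda>t. - herm (Suc i) t) has_real_derivative - hermd (Suc i) t) (at t)"
    by (intro DERIV_minus herm_derivative)
  moreover have "(real (Suc (Suc i)) - 1) * herm (Suc (Suc i)) t = 2 * herm i t - t * herm (Suc i) t"
    by simp
  then have e: "(real j - 1) / 2 * herm j t - t / 2 * hermd j t = - hermd (Suc i) t"
    using 3 by (simp add: hermd_def diff_divide_distrib del: herm.simps)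
  ultimately have "(hermd (Suc (Suc i)) has_real_derivative - hermd (Suc i) t) (at t)" by (simp only:)
  moreover have "j = Suc (Suc i)" using 3 by simp
  ultimately show ?thesis unfolding e by (simp only:)
qed

lemma herm_bound_poly: "\<exists>C\<ge>0. \<forall>t\<ge>0. \<bar>herm j t\<bar> \<le> C * ((1 + t) ^ j * exp (- (t\<^sup>2 / 4)))"
proof (induction j rule: less_induct)
  case (less j)
  consider "j = 0" | "j = Suc 0" | i where "j = Suc (Suc i)" by (metis not0_implies_Suc)
  then show ?case
  proof cases
    case 1
    then show ?thesis by (intro exI[of _ 1]) auto
  next
    case 2
    let ?C = "max 2 (gaussian_tail 0 * exp (1/4))"
    have "\<bar>gaussian_tail t\<bar> \<le> ?C * ((1 + t) * exp (- (t\<^sup>2 / 4)))" if "t \<ge> 0" for t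
    proof -
      have "gaussian_tail t \<le> ?C * exp (- (t\<^sup>2 / 4))"
      proof (cases "t \<ge> 1")
        case True
        then show ?thesis using gaussian_tail(3)[OF True]
          by (rule_tac order_trans[OF _ mult_right_mono[of 2]]) auto
      next
        case False
        have "gaussian_tail t \<le> gaussian_tail 0"
          by (rule DERIV_nonpos_imp_nonincreasing[OF that]) (use gaussian_tail(1) in \<open>auto intro!: exI[of _ "- exp (- (_\<^sup>2 / 4))"]\<close>)
        also have "\<dots> = gaussian_tail 0 * exp (1/4) * exp (- (1/4))" by (simp add: exp_minus)
        also have "\<dots> \<le> ?C * exp (- (t\<^sup>2 / 4))"
          using False that by (intro mult_mono) (auto simp: gaussian_tail(2) abs_square_le_1)
        finally show ?thesis .
      qed
      also have "\<dots> \<le> ?C * ((1 + t) * exp (- (t\<^sup>2 / 4)))"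
        using that by (intro mult_left_mono) auto
      finally show ?thesis using gaussian_tail(2)[of t] by simp
    qed
    then show ?thesis using 2 by (intro exI[of _ ?C]) auto
  next
    case 3
    obtain C D where C: "C \<ge> 0" "\<And>t. t \<ge> 0 \<Longrightarrow> \<bar>herm i t\<bar> \<le> C * ((1 + t) ^ i * exp (- (t\<^sup>2 / 4)))"
      and D: "D \<ge> 0" "\<And>t. t \<ge> 0 \<Longrightarrow> \<bar>herm (Suc i) t\<bar> \<le> D * ((1 + t) ^ Suc i * exp (- (t\<^sup>2 / 4)))"
      using less[of i] less[of "Suc i"] 3 by auto
    have "\<bar>herm j t\<bar> \<le> (2 * C + D) * ((1 + t) ^ j * exp (- (t\<^sup>2 / 4)))" if t: "t \<ge> 0" for t
    proof -
      let ?e = "(1 + t) ^ j * exp (- (t\<^sup>2 / 4))"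
      have "\<bar>herm j t\<bar> = \<bar>2 * herm i t - t * herm (Suc i) t\<bar> / real (Suc i)"
        using 3 by simp
      also have "\<dots> \<le> \<bar>2 * herm i t - t * herm (Suc i) t\<bar>"
        by (simp add: divide_le_eq mult_le_cancel_left1)
      also have "\<dots> \<le> 2 * \<bar>herm i t\<bar> + t * \<bar>herm (Suc i) t\<bar>"
        using t abs_triangle_ineq4[of "2 * herm i t" "t * herm (Suc i) t"] by (simp add: abs_mult)
      also have "\<bar>herm i t\<bar> \<le> C * ?e"
        using t 3 by (intro order_trans[OF C(2)[OF t]] mult_left_mono mult_right_mono power_increasing C(1)) auto
      also have "t * \<bar>herm (Suc i) t\<bar> \<le> (1 + t) * (D * ((1 + t) ^ Suc i * exp (- (t\<^sup>2 / 4))))"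
        using t D(2)[OF t] by (intro mult_mono) auto
      also have "\<dots> = D * ?e" using 3 by simp
      finally show ?thesis by (simp add: algebra_simps)
    qed
    then show ?thesis using C(1) D(1) by (intro exI[of _ "2 * C + D"]) auto
  qed
qed

text \<open>The rate \<open>3/16\<close> is below \<open>1/4\<close>, which absorbs the polynomial factor, and above \<open>1/8\<close>, so that the square
  stays integrable against the weight \<open>exp (t\<^sup>2/4)\<close>.\<close>

lemma herm_bound: "\<exists>C\<ge>0. \<forall>t\<ge>0. \<bar>herm j t\<bar> \<le> C * exp (- (3 * t\<^sup>2 / 16))"
proof -
  obtain C where C: "C \<ge> 0" "\<And>t. t \<ge> 0 \<Longrightarrow> \<bar>herm j t\<bar> \<le> C * ((1 + t) ^ j * exp (- (t\<^sup>2 / 4)))"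
    using herm_bound_poly[of j] by blast
  have "\<bar>herm j t\<bar> \<le> (C * (real j ^ j * exp 5)) * exp (- (3 * t\<^sup>2 / 16))" if t: "t \<ge> 0" for t
  proof -
    have "0 \<le> (t / 4 - 2)\<^sup>2" by simp
    then have "t \<le> t\<^sup>2 / 16 + 4" by (simp add: power2_diff power_divide)
    then have "1 + t + - (t\<^sup>2 / 4) \<le> 5 + - (3 * t\<^sup>2 / 16)" by simp
    then have "exp (1 + t + - (t\<^sup>2 / 4)) \<le> exp (5 + - (3 * t\<^sup>2 / 16))" by (simp only: exp_le_cancel_iff)
    then have e: "exp (1 + t) * exp (- (t\<^sup>2 / 4)) \<le> exp 5 * exp (- (3 * t\<^sup>2 / 16))" by (simp only: exp_add[symmetric])
    have "(1 + t) ^ j * exp (- (t\<^sup>2 / 4)) \<le> real j ^ j * exp (1 + t) * exp (- (t\<^sup>2 / 4))"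
      using t by (intro mult_right_mono power_le_exp) auto
    also have "\<dots> \<le> real j ^ j * (exp 5 * exp (- (3 * t\<^sup>2 / 16)))"
      using mult_left_mono[OF e, of "real j ^ j"] by (simp add: mult.assoc)
    finally have "(1 + t) ^ j * exp (- (t\<^sup>2 / 4)) \<le> real j ^ j * (exp 5 * exp (- (3 * t\<^sup>2 / 16)))" .
    from mult_left_mono[OF this C(1)] show ?thesis using C(2)[OF t] by (simp add: mult.assoc)
  qed
  then show ?thesis using C(1) by (intro exI[of _ "C * (real j ^ j * exp 5)"]) auto
qed

lemma hermd_bound: "\<exists>C\<ge>0. \<forall>t\<ge>0. \<bar>hermd j t\<bar> \<le> C * exp (- (3 * t\<^sup>2 / 16))"
proof (cases j)
  case 0
  have "\<bar>hermd 0 t\<bar> \<le> 2 * exp (- (3 * t\<^sup>2 / 16))" if t: "t \<ge> 0" for t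
  proof -
    have "0 \<le> (t / 4 - 2)\<^sup>2" by simp
    then have "t \<le> t\<^sup>2 / 16 + 4" by (simp add: power2_diff power_divide)
    moreover have "1 + t\<^sup>2 / 16 \<le> exp (t\<^sup>2 / 16)" by (rule exp_ge_add_one_self)
    moreover have "0 \<le> t\<^sup>2" by simp
    ultimately have "t / 2 \<le> 2 * exp (t\<^sup>2 / 16)" by linarith
    then have "t / 2 * exp (- (t\<^sup>2 / 4)) \<le> 2 * exp (t\<^sup>2 / 16) * exp (- (t\<^sup>2 / 4))"
      by (intro mult_right_mono) auto
    also have "\<dots> = 2 * exp (- (3 * t\<^sup>2 / 16))" by (simp add: mult.assoc exp_add[symmetric])
    finally show ?thesis using t by (simp add: hermd_def abs_mult)
  qed
  then show ?thesis unfolding 0 by (intro exI[of _ 2]) auto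
next
  case (Suc i)
  then show ?thesis using herm_bound[of i] by (simp add: hermd_def)
qed

text \<open>If \<open>herm j\<close> is positive, then its successor is strictly decreasing, and it tends to \<open>0\<close>.\<close>

lemma herm_pos: "herm j t > 0"
proof (induction j arbitrary: t)
  case (Suc j)
  have dec: "herm (Suc j) t < herm (Suc j) s" if "s < t" for s t
    by (rule DERIV_neg_imp_decreasing[OF that])
       (use herm_derivative[of "Suc j"] Suc in \<open>auto simp: hermd_def intro!: exI[of _ "- herm j _"]\<close>)
  obtain C where C: "C \<ge> 0" "\<And>t. t \<ge> 0 \<Longrightarrow> \<bar>herm (Suc j) t\<bar> \<le> C * exp (- (3 * t\<^sup>2 / 16))"
    using herm_bound[of "Suc j"] by blast
  show ?case
  proof (rule ccontr)
    assume "\<not> herm (Suc j) t > 0"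
    with dec[of t "t + 1"] have neg: "herm (Suc j) (t + 1) < 0" by simp
    define d where "d = - herm (Suc j) (t + 1)"
    define s where "s = max (t + 2) (max 4 (C / d))"
    have "d > 0" using neg by (simp add: d_def)
    have s: "s > t + 1" "s \<ge> 4" "s \<ge> C / d" by (auto simp: s_def)
    have "d < \<bar>herm (Suc j) s\<bar>" using dec[OF s(1)] by (simp add: d_def)
    also have "\<dots> \<le> C * exp (- (3 * s\<^sup>2 / 16))" using s by (intro C) auto
    finally have "d * exp (3 * s\<^sup>2 / 16) < C" by (simp add: exp_minus field_simps)
    moreover have "s < exp (3 * s\<^sup>2 / 16)"
    proof -
      have "16 * s \<le> 4 * s\<^sup>2" using s(2) by (simp add: power2_eq_square)
      then have "3 * s\<^sup>2 / 16 \<ge> 3 / 4 * s" using s by auto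
      have "(1 + s / 4) ^ 2 = (s / 4 - 1)\<^sup>2 + s" by (simp add: power2_eq_square algebra_simps)
      then have "s \<le> (1 + s / 4) ^ 2" by simp
      also have "\<dots> \<le> (exp (s / 4))\<^sup>2" using s by (intro power_mono exp_ge_add_one_self) auto
      also have "\<dots> = exp (s / 2)" by (simp add: exp_double[symmetric])
      also have "\<dots> < exp (3 * s\<^sup>2 / 16)" using \<open>3 * s\<^sup>2 / 16 \<ge> 3 / 4 * s\<close> s by auto
      finally show ?thesis .
    qed
    then have "d * s < d * exp (3 * s\<^sup>2 / 16)" using \<open>d > 0\<close> by (intro mult_strict_left_mono)
    moreover have "C \<le> d * s" using s(3) \<open>d > 0\<close> by (simp add: field_simps)
    ultimately show False by linarith
  qed
qed simp

definition herm_sol :: "nat \<Rightarrow> ('m::finite) pt \<Rightarrow> real" where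
  "herm_sol j x = exp (- ((norm (fst x))\<^sup>2 / 4)) * herm j (snd x)"

definition herm_grad :: "nat \<Rightarrow> ('m::finite) pt \<Rightarrow> 'm pt" where
  "herm_grad j x = (- (herm_sol j x / 2) *\<^sub>R fst x, exp (- ((norm (fst x))\<^sup>2 / 4)) * hermd j (snd x))"

lemma norm2_pt: "(norm x)\<^sup>2 = (norm (fst x))\<^sup>2 + (snd x)\<^sup>2" for x :: "'a::real_inner \<times> real"
  by (simp add: norm_prod_def)

lemma smooth_tangential_gauss: "smooth (\<lambda>x::('m::finite) pt. exp (- ((norm (fst x))\<^sup>2 / 4)))"
proof -
  have "smooth (\<lambda>x::'m pt. exp (((norm x)\<^sup>2 - (x \<bullet> (0, 1)) * (x \<bullet> (0, 1))) * (- 1/4)))"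
    by (intro smooth_exp smooth_mult smooth_diff smooth_norm2 smooth_const smooth_inner)
  moreover have "((norm x)\<^sup>2 - (x \<bullet> (0, 1)) * (x \<bullet> (0, 1))) * (- 1/4) = - ((norm (fst x))\<^sup>2 / 4)" for x :: "'m pt"
    unfolding norm2_pt by (simp add: inner_prod_def power2_eq_square)
  ultimately show ?thesis by (simp only:)
qed

lemma has_derivative_pt_normal:
  assumes "(h has_real_derivative d) (at (snd x))"
  shows "((\<lambda>x::('m::finite) pt. h (snd x)) has_derivative (\<lambda>v. (0, d) \<bullet> v)) (at x)"
proof -
  have "((\<lambda>x::'m pt. h (snd x)) has_derivative (\<lambda>v. d * snd v)) (at x)"
    using assms unfolding has_field_derivative_def
    by (rule has_derivative_compose[OF has_derivative_snd[OF has_derivative_ident]])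
  then show ?thesis by (simp add: inner_prod_def)
qed

lemma smooth_herm_snd: "smooth (\<lambda>x::('m::finite) pt. herm j (snd x))"
proof (induction j)
  case 0
  have "smooth (\<lambda>x::'m pt. exp ((x \<bullet> (0, 1)) * (x \<bullet> (0, 1)) * (- 1/4)))"
    by (intro smooth_exp smooth_mult smooth_const smooth_inner)
  then show ?case by (simp add: inner_prod_def power2_eq_square)
next
  case (Suc j)
  have fd: "((\<lambda>x::'m pt. herm (Suc j) (snd x)) has_derivative (\<lambda>v. (- herm j (snd x)) * (v \<bullet> (0, 1)))) (at x)" for x
    by (rule has_derivative_eq_rhs[OF has_derivative_pt_normal[OF herm_derivative]])
       (simp add: inner_prod_def hermd_def fun_eq_iff)
  have "smooth (\<lambda>x::'m pt. (- 1 * herm j (snd x)) * (b \<bullet> (0, 1)))" for b :: "'m pt"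
    by (intro smooth_mult smooth_const Suc)
  then have sm: "smooth (\<lambda>x::'m pt. (- herm j (snd x)) * (b \<bullet> (0, 1)))" for b :: "'m pt"
    by (simp only: mult_minus1)
  show ?case
    unfolding smooth_iff[of "\<lambda>x. herm (Suc j) (snd x)"] frechet_derivative_at[OF fd, symmetric]
    by (intro conjI allI ballI differentiableI[OF fd] sm)
qed

lemma smooth_herm_sol: "smooth (herm_sol j)"
  using smooth_mult[OF smooth_tangential_gauss smooth_herm_snd[of j]] by (simp add: herm_sol_def[abs_def])

lemma C1_normal:
  assumes d: "\<And>t. (h has_real_derivative h' t) (at t)" and c: "continuous_on UNIV h'"
  shows "C1 (\<lambda>x::('m::finite) pt. h (snd x)) (\<lambda>x. (0, h' (snd x)))"
  unfolding C1_def
  by (intro conjI allI has_derivative_pt_normal d continuous_on_Pair continuous_on_const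
      continuous_on_compose2[OF c] continuous_on_snd continuous_on_id subset_UNIV)

lemma C1_tangential_gauss:
  "C1 (\<lambda>x::('m::finite) pt. exp (- ((norm (fst x))\<^sup>2 / 4))) (\<lambda>x. (- (exp (- ((norm (fst x))\<^sup>2 / 4)) / 2) *\<^sub>R fst x, 0))"
proof -
  let ?E = "\<lambda>x::'m pt. exp (- ((norm (fst x))\<^sup>2 / 4))"
  have "grad ?E = (\<lambda>x. (- (?E x / 2) *\<^sub>R fst x, 0))"
  proof (intro ext grad_eqI)
    fix x :: "'m pt"
    have "((\<lambda>x::'m pt. - ((norm (fst x))\<^sup>2 / 4)) has_derivative (\<lambda>v. - (fst x \<bullet> fst v) / 2)) (at x)"
      unfolding power2_norm_eq_inner by (auto intro!: derivative_eq_intros simp: inner_commute)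
    from has_derivative_exp[OF this]
    show "(?E has_derivative (\<lambda>v. (- (?E x / 2) *\<^sub>R fst x, 0) \<bullet> v)) (at x)"
      by (rule has_derivative_eq_rhs) (simp add: inner_prod_def mult.commute fun_eq_iff)
  qed
  moreover have "C1 ?E (grad ?E)" by (rule C1_smooth[OF smooth_tangential_gauss])
  ultimately show ?thesis by (simp only:)
qed

lemma continuous_herm: "continuous_on UNIV (herm j)" "continuous_on UNIV (hermd j)"
  by (intro continuous_at_imp_continuous_on ballI DERIV_isCont[OF herm_derivative] DERIV_isCont[OF hermd_derivative])+

lemma C1_herm_sol: "C1 (herm_sol j :: ('m::finite) pt \<Rightarrow> real) (herm_grad j)"
proof -
  have "C1 (\<lambda>x::'m pt. exp (- ((norm (fst x))\<^sup>2 / 4)) * herm j (snd x))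
     (\<lambda>x. exp (- ((norm (fst x))\<^sup>2 / 4)) *\<^sub>R (0, hermd j (snd x)) + herm j (snd x) *\<^sub>R (- (exp (- ((norm (fst x))\<^sup>2 / 4)) / 2) *\<^sub>R fst x, 0))"
    by (rule C1_mult[OF C1_tangential_gauss C1_normal[OF herm_derivative continuous_herm(2)]])
  then show ?thesis
    by (simp add: herm_sol_def[abs_def] herm_grad_def[abs_def] mult.commute)
qed

lemma grad_herm_sol: "grad (herm_sol j) = herm_grad j"
  by (rule C1_grad[OF C1_herm_sol])

lemma C1_cmult: "C1 f F \<Longrightarrow> C1 (\<lambda>x. c * f x) (\<lambda>x. c *\<^sub>R F x)"
proof -
  assume f: "C1 f F"
  have "((\<lambda>x. c * f x) has_derivative (\<lambda>v. c *\<^sub>R F x \<bullet> v)) (at x)" for x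
    using has_derivative_mult_right[OF C1_has_derivative[OF f, of x UNIV], of c] by simp
  then show ?thesis unfolding C1_def by (intro conjI allI continuous_intros C1_continuous[OF f])
qed

lemma C1_inner: "C1 (\<lambda>x. x \<bullet> b) (\<lambda>x. b)"
  unfolding C1_def by (auto intro!: derivative_eq_intros simp: inner_commute)

text \<open>The function \<open>\<phi> = herm_sol j\<close> satisfies \<open>- div (K \<nabla>\<phi>) = (m + 1 - j)/2 K \<phi>\<close> and, with the outward normal
  \<open>n\<close>, the boundary condition \<open>\<partial>\<phi>/\<partial>n = herm_robin j \<phi>\<close>; here \<open>m = CARD('m)\<close>.\<close>

definition herm_robin :: "nat \<Rightarrow> real" where
  "herm_robin j = - hermd j 0 / herm j 0"

text \<open>On the boundary the weight compensates the Gaussian, so unweighted integrability of powers of the trace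
  suffices there.\<close>

lemma K_herm_sol_boundary: "K (y, 0) * herm_sol j (y, 0) = herm j 0"
  by (simp add: K_def herm_sol_def norm_Pair exp_minus)

text \<open>The divergence theorem is applied to \<open>v K \<partial>\<phi>/\<partial>x\<^sub>i\<close> for each coordinate; only the normal one contributes a
  boundary term.\<close>

lemma green_herm_C1c:
  fixes v :: "('m::finite) pt \<Rightarrow> real"
  assumes v: "C1c v V"
  shows "(\<integral>x. V x \<bullet> herm_grad j x \<partial>MH) =
    (real CARD('m) + 1 - real j) / 2 * (\<integral>x. v x * herm_sol j x \<partial>MH)
     + herm_robin j * (\<integral>y. v (y, 0) * herm_sol j (y, 0) \<partial>MB)"
proof -
  let ?p = "herm_sol j :: 'm pt \<Rightarrow> real" and ?G = "herm_grad j :: 'm pt \<Rightarrow> 'm pt"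
  let ?E = "\<lambda>x::'m pt. exp (- ((norm (fst x))\<^sup>2 / 4))"
  let ?c = "(real CARD('m) + 1 - real j) / 2"
  define dd where "dd t = (real j - 1) / 2 * herm j t - t / 2 * hermd j t" for t
  have hd: "(hermd j has_real_derivative dd t) (at t)" for t
    unfolding dd_def by (rule hermd_derivative)
  have ddc: "continuous_on UNIV dd"
    unfolding dd_def by (intro continuous_intros continuous_herm) auto
  note vc = C1_continuous[OF C1c_C1[OF v]]
  have "C1 ?p ?G" by (rule C1_herm_sol)
  note pc = C1_continuous[OF this]
  \<comment> \<open>the partial derivatives of the explicit solution, with their gradients\<close>
  define P where "P b x = (- 1/2) * ((x \<bullet> b) * ?p x)" for b x
  define Q where "Q b x = (- 1/2) *\<^sub>R ((x \<bullet> b) *\<^sub>R ?G x + ?p x *\<^sub>R b)" for b x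
  have PQ: "C1 (P b) (Q b)" for b
    unfolding P_def[abs_def] Q_def[abs_def] by (rule C1_cmult[OF C1_mult[OF C1_inner C1_herm_sol]])
  define PN where "PN x = ?E x * hermd j (snd x)" for x
  define QN where "QN x = ?E x *\<^sub>R (0, dd (snd x)) + hermd j (snd x) *\<^sub>R (- (?E x / 2) *\<^sub>R fst x, 0)" for x
  have PQN: "C1 PN QN"
    unfolding PN_def[abs_def] QN_def[abs_def]
    by (rule C1_mult[OF C1_tangential_gauss C1_normal[OF hd ddc]])
  define W where "W x = v x *\<^sub>R ((K x / 2) *\<^sub>R x) + K x *\<^sub>R V x" for x
  have vK: "C1c (\<lambda>x. v x * K x) W"
    unfolding W_def[abs_def] by (rule C1c_mult[OF v C1_K])
  let ?F = "\<lambda>b x. (v x * K x) *\<^sub>R Q b x + P b x *\<^sub>R W x"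
  let ?FN = "\<lambda>x. (v x * K x) *\<^sub>R QN x + PN x *\<^sub>R W x"
  have F: "C1c (\<lambda>x. v x * K x * P b x) (?F b)" for b by (rule C1c_mult[OF vK PQ])
  have FN: "C1c (\<lambda>x. v x * K x * PN x) ?FN" by (rule C1c_mult[OF vK PQN])
  have tang: "(\<integral>x. ?F (i, 0) x \<bullet> (i, 0) \<partial>M0) = 0" "integrable M0 (\<lambda>x. ?F (i, 0) x \<bullet> (i, 0))" for i :: "real^'m"
    using divergence_halfspace[OF F[of "(i, 0)"], of "(i, 0)"] by auto
  have norm: "(\<integral>x. ?FN x \<bullet> (0, 1) \<partial>M0) = - (\<integral>y. v (y, 0) * K (y, 0) * PN (y, 0) \<partial>lborel)" "integrable M0 (\<lambda>x. ?FN x \<bullet> (0, 1))"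
    using divergence_halfspace[OF FN, of "(0, 1)"] by auto
  have pw: "(\<Sum>i\<in>Basis. ?F (i, 0) x \<bullet> (i, 0)) + ?FN x \<bullet> (0, 1) = K x * (V x \<bullet> ?G x) - ?c * (K x * (v x * ?p x))" for x
  proof -
    have "?F (i, 0) x \<bullet> (i, 0) = - (v x * K x * ?p x / 2) + K x * (- (?p x / 2) * ((fst x \<bullet> i) * (fst (V x) \<bullet> i)))"
      if "i \<in> Basis" for i
      using that by (simp add: Q_def P_def W_def herm_grad_def inner_prod_def inner_add_left algebra_simps inner_Basis)
    then have "(\<Sum>i\<in>Basis. ?F (i, 0) x \<bullet> (i, 0)) = (\<Sum>i\<in>Basis. - (v x * K x * ?p x / 2) + K x * (- (?p x / 2) * ((fst x \<bullet> i) * (fst (V x) \<bullet> i))))"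
      by (intro sum.cong) auto
    also have "\<dots> = - real CARD('m) * (v x * K x * ?p x / 2) + K x * (- (?p x / 2) * (fst x \<bullet> fst (V x)))"
      unfolding sum.distrib sum_distrib_left[symmetric] euclidean_inner[of "fst x" "fst (V x)"] by simp
    finally have 1: "(\<Sum>i\<in>Basis. ?F (i, 0) x \<bullet> (i, 0)) = - real CARD('m) * (v x * K x * ?p x / 2) + K x * (- (?p x / 2) * (fst x \<bullet> fst (V x)))" .
    have 2: "?FN x \<bullet> (0, 1) = v x * K x * ((real j - 1) / 2) * ?p x + K x * (PN x * snd (V x))"
      by (simp add: QN_def PN_def W_def dd_def inner_prod_def herm_sol_def algebra_simps)
    have 3: "V x \<bullet> ?G x = - (?p x / 2) * (fst x \<bullet> fst (V x)) + PN x * snd (V x)"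
      by (simp add: herm_grad_def PN_def inner_prod_def inner_commute mult.commute)
    have alg: "- m * (a * k * p / 2) + k * (- (p / 2) * f) + (a * k * ((i - 1) / 2) * p + k * (n * s))
      = k * (- (p / 2) * f + n * s) - (m + 1 - i) / 2 * (k * (a * p))" for m a k p f i n s :: real
      by (simp add: field_simps)
    show ?thesis unfolding 1 2 3 by (rule alg)
  qed
  have m: "(\<lambda>x. V x \<bullet> ?G x) \<in> borel_measurable M0" "(\<lambda>x. v x * ?p x) \<in> borel_measurable M0"
    by (intro continuous_measurable_M0 continuous_intros vc pc)+
  have mb: "(\<lambda>y. v (y, 0) * ?p (y, 0)) \<in> borel_measurable borel"
    by (intro borel_measurable_continuous_onI continuous_on_mult continuous_on_compose2[OF vc(1)]
        continuous_on_compose2[OF pc(1)] continuous_intros) auto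
  obtain R where R: "\<And>x. norm x \<ge> R \<Longrightarrow> v x = 0 \<and> V x = 0" using v unfolding C1c_def by blast
  have i1: "integrable M0 (\<lambda>x. K x * (V x \<bullet> ?G x))"
    by (rule M0.compact_M[of _ R]) (auto intro!: continuous_intros vc pc continuous_K simp: R)
  have i2: "integrable M0 (\<lambda>x. K x * (v x * ?p x))"
    by (rule M0.compact_M[of _ R]) (auto intro!: continuous_intros vc pc continuous_K simp: R)
  have "(\<integral>x. (\<Sum>i\<in>Basis. ?F (i, 0) x \<bullet> (i, 0)) + ?FN x \<bullet> (0, 1) \<partial>M0) = - (\<integral>y. v (y, 0) * K (y, 0) * PN (y, 0) \<partial>lborel)"
    using tang norm by (subst Bochner_Integration.integral_add) (auto simp: Bochner_Integration.integral_sum)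
  then have "(\<integral>x. K x * (V x \<bullet> ?G x) \<partial>M0) - ?c * (\<integral>x. K x * (v x * ?p x) \<partial>M0) = - (\<integral>y. v (y, 0) * K (y, 0) * PN (y, 0) \<partial>lborel)"
    unfolding pw using i1 i2 by simp
  moreover have "- (v (y, 0) * K (y, 0) * PN (y, 0)) = herm_robin j * (K (y, 0) * (v (y, 0) * ?p (y, 0)))" for y
    using herm_pos[of j 0] by (simp add: PN_def herm_robin_def herm_sol_def)
  then have "- (\<integral>y. v (y, 0) * K (y, 0) * PN (y, 0) \<partial>lborel) = herm_robin j * (\<integral>y. K (y, 0) * (v (y, 0) * ?p (y, 0)) \<partial>lborel)"
    unfolding Bochner_Integration.integral_minus[symmetric] by simp
  ultimately show ?thesis
    unfolding integral_MH[OF m(1)] integral_MH[OF m(2)] integral_MB[OF mb] by linarith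
qed

lemma herm_sol_L2:
  "(herm_sol j :: ('a::finite) pt \<Rightarrow> real) \<in> L2 MH" "(herm_grad j :: 'a pt \<Rightarrow> 'a pt) \<in> L2 MH"
  "(\<lambda>y::real^'a. herm_sol j (y, 0)) \<in> L2 MB"
proof -
  obtain C where C: "C \<ge> 0" "\<And>t. t \<ge> 0 \<Longrightarrow> \<bar>herm j t\<bar> \<le> C * exp (- (3 * t\<^sup>2 / 16))"
    using herm_bound by blast
  obtain D where D: "D \<ge> 0" "\<And>t. t \<ge> 0 \<Longrightarrow> \<bar>hermd j t\<bar> \<le> D * exp (- (3 * t\<^sup>2 / 16))"
    using hermd_bound by blast
  have sq: "h\<^sup>2 \<le> A\<^sup>2 * exp (- (3 * t\<^sup>2 / 8))" if "\<bar>h\<bar> \<le> A * exp (- (3 * t\<^sup>2 / 16))" for h A t :: real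
  proof -
    have "\<bar>h\<bar>\<^sup>2 \<le> (A * exp (- (3 * t\<^sup>2 / 16)))\<^sup>2" using that by (intro power_mono) auto
    also have "\<dots> = A\<^sup>2 * exp (- (3 * t\<^sup>2 / 8))" by (simp add: power_mult_distrib exp_double[symmetric])
    finally show ?thesis by simp
  qed
  have g: "exp (- ((norm x)\<^sup>2 / 8)) = exp (- ((norm (fst x))\<^sup>2 / 8)) * exp (- ((snd x)\<^sup>2 / 8))" for x :: "'a pt"
    unfolding norm2_pt exp_add[symmetric] by (simp add: field_simps)
  have Ksq: "K x * (exp (- ((norm (fst x))\<^sup>2 / 4)))\<^sup>2 * exp (- (3 * (snd x)\<^sup>2 / 8)) =
     exp (- ((norm (fst x))\<^sup>2 / 4)) * exp (- ((snd x)\<^sup>2 / 8))" for x :: "'a pt"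
    unfolding K_def norm2_pt exp_double[symmetric] exp_add[symmetric] by (simp add: field_simps)
  have e1: "exp (- ((norm (fst x))\<^sup>2 / 4)) \<le> exp (- ((norm (fst x))\<^sup>2 / 8))" for x :: "'a pt"
    by simp
  have hs: "K x * (herm_sol j x)\<^sup>2 \<le> C\<^sup>2 * (exp (- ((norm (fst x))\<^sup>2 / 4)) * exp (- ((snd x)\<^sup>2 / 8)))" if "snd x > 0" for x :: "'a pt"
  proof -
    have "K x * (herm_sol j x)\<^sup>2 = K x * (exp (- ((norm (fst x))\<^sup>2 / 4)))\<^sup>2 * (herm j (snd x))\<^sup>2"
      by (simp add: herm_sol_def power_mult_distrib)
    also have "\<dots> \<le> K x * (exp (- ((norm (fst x))\<^sup>2 / 4)))\<^sup>2 * (C\<^sup>2 * exp (- (3 * (snd x)\<^sup>2 / 8)))"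
      using that by (intro mult_left_mono sq C(2)) auto
    also have "\<dots> = C\<^sup>2 * (K x * (exp (- ((norm (fst x))\<^sup>2 / 4)))\<^sup>2 * exp (- (3 * (snd x)\<^sup>2 / 8)))"
      by (simp only: mult_ac)
    finally show ?thesis unfolding Ksq .
  qed
  have gs: "K x * (norm (herm_grad j x))\<^sup>2 \<le> (2 * (C\<^sup>2 + D\<^sup>2)) * exp (- ((norm x)\<^sup>2 / 8))" if "snd x > 0" for x :: "'a pt"
  proof -
    let ?a = "(norm (fst x))\<^sup>2"
    have "K x * (norm (herm_grad j x))\<^sup>2 = ?a / 4 * (K x * (herm_sol j x)\<^sup>2) + K x * (exp (- (?a / 4)))\<^sup>2 * (hermd j (snd x))\<^sup>2"
      unfolding norm2_pt[of "herm_grad j x"]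
      by (simp add: herm_grad_def power_mult_distrib power_divide algebra_simps)
    also have "\<dots> \<le> ?a / 4 * (C\<^sup>2 * (exp (- (?a / 4)) * exp (- ((snd x)\<^sup>2 / 8)))) + K x * (exp (- (?a / 4)))\<^sup>2 * (D\<^sup>2 * exp (- (3 * (snd x)\<^sup>2 / 8)))"
      using that by (intro add_mono mult_left_mono hs sq D(2)) auto
    also have "\<dots> = (?a / 4 * C\<^sup>2 + D\<^sup>2) * (exp (- (?a / 4)) * exp (- ((snd x)\<^sup>2 / 8)))"
      using Ksq[of x] by (simp add: algebra_simps)
    also have "\<dots> \<le> (2 * exp (?a / 8) * (C\<^sup>2 + D\<^sup>2)) * (exp (- (?a / 4)) * exp (- ((snd x)\<^sup>2 / 8)))"
    proof (intro mult_right_mono)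
      have "1 + ?a / 8 \<le> exp (?a / 8)" by (rule exp_ge_add_one_self)
      moreover have "0 \<le> ?a" by simp
      ultimately have e: "?a / 4 \<le> 2 * exp (?a / 8)" "1 \<le> 2 * exp (?a / 8)" by linarith+
      show "?a / 4 * C\<^sup>2 + D\<^sup>2 \<le> 2 * exp (?a / 8) * (C\<^sup>2 + D\<^sup>2)"
        using mult_right_mono[OF e(1), of "C\<^sup>2"] mult_right_mono[OF e(2), of "D\<^sup>2"] by (simp add: algebra_simps)
    qed auto
    also have "\<dots> = (2 * (C\<^sup>2 + D\<^sup>2)) * ((exp (?a / 8) * exp (- (?a / 4))) * exp (- ((snd x)\<^sup>2 / 8)))"
      by (simp add: mult_ac)
    also have "exp (?a / 8) * exp (- (?a / 4)) = exp (- (?a / 8))"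
      unfolding exp_add[symmetric] by (simp add: field_simps)
    finally show ?thesis unfolding g .
  qed
  have ig: "integrable M0 (\<lambda>x::'a pt. c * exp (- ((norm x)\<^sup>2 / 8)))" for c
    by (intro integrable_mult_right integrable_lborel_imp_M0 integrable_gauss)
  have C1s: "C1 (herm_sol j :: 'a pt \<Rightarrow> real) (herm_grad j)" by (rule C1_herm_sol)
  note cont = C1_continuous[OF C1s]
  have m: "herm_sol j \<in> borel_measurable (M0 :: 'a pt measure)" "herm_grad j \<in> borel_measurable (M0 :: 'a pt measure)"
    by (intro continuous_measurable_M0 cont)+
  have bound: "f \<in> L2 MH" if "f \<in> borel_measurable M0" "\<And>x. snd x > 0 \<Longrightarrow> K x * (norm (f x))\<^sup>2 \<le> c * exp (- ((norm x)\<^sup>2 / 8))"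
    for f :: "'a pt \<Rightarrow> 'c::euclidean_space" and c
  proof -
    have "integrable M0 (\<lambda>x. K x * (norm (f x))\<^sup>2)"
    proof (rule Bochner_Integration.integrable_bound[OF ig[of c]])
      show "AE x in M0. norm (K x * (norm (f x))\<^sup>2) \<le> norm (c * exp (- ((norm x)\<^sup>2 / 8)))"
        using that(2) by (intro AE_I2) (auto simp: halfspace_def intro: order_trans[OF _ abs_ge_self])
    qed (use that(1) in auto)
    then show ?thesis using that(1) by (simp add: L2_def measurable_MH integrable_MH)
  qed
  show "herm_sol j \<in> L2 (MH :: 'a pt measure)"
  proof (rule bound[OF m(1), of "C\<^sup>2"])
    fix x :: "'a pt" assume x: "snd x > 0"
    have "K x * (herm_sol j x)\<^sup>2 \<le> C\<^sup>2 * (exp (- ((norm (fst x))\<^sup>2 / 8)) * exp (- ((snd x)\<^sup>2 / 8)))"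
      by (rule order_trans[OF hs[OF x]]) (intro mult_left_mono mult_right_mono e1, auto)
    then show "K x * (norm (herm_sol j x))\<^sup>2 \<le> C\<^sup>2 * exp (- ((norm x)\<^sup>2 / 8))" unfolding g by simp
  qed
  show "herm_grad j \<in> L2 (MH :: 'a pt measure)" by (rule bound[OF m(2) gs])
  have mb: "(\<lambda>y::real^'a. herm_sol j (y, 0)) \<in> borel_measurable borel"
    by (intro borel_measurable_continuous_onI continuous_on_compose2[OF cont(1)] continuous_intros) auto
  have "integrable lborel (\<lambda>y::real^'a. K (y, 0) * (herm_sol j (y, 0))\<^sup>2)"
  proof (rule Bochner_Integration.integrable_bound[OF integrable_mult_right[OF integrable_gauss, of "(herm j 0)\<^sup>2"]])
    have "K (y, 0) * (herm_sol j (y, 0))\<^sup>2 \<le> (herm j 0)\<^sup>2 * exp (- ((norm y)\<^sup>2 / 8))" for y :: "real^'a"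
    proof -
      have "K (y, 0) * (herm_sol j (y, 0))\<^sup>2 = (K (y, 0) * herm_sol j (y, 0)) * herm_sol j (y, 0)"
        by (simp add: power2_eq_square)
      also have "\<dots> = (herm j 0)\<^sup>2 * exp (- ((norm y)\<^sup>2 / 4))"
        unfolding K_herm_sol_boundary by (simp add: herm_sol_def power2_eq_square)
      finally show ?thesis by (simp add: mult_left_mono)
    qed
    then show "AE y::real^'a in lborel. norm (K (y, 0) * (herm_sol j (y, 0))\<^sup>2) \<le> norm ((herm j 0)\<^sup>2 * exp (- ((norm y)\<^sup>2 / 8)))"
      by auto
  qed (use mb in auto)
  then show "(\<lambda>y. herm_sol j (y, 0)) \<in> L2 (MB :: (real^'a) measure)"
    using mb by (simp add: L2_def measurable_MB integrable_MB)
qed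

lemma Sob_herm_sol: "Sob MH MB (herm_sol j) (herm_grad j) (\<lambda>y. herm_sol j (y, 0))"
  by (rule Sob_smooth[OF smooth_herm_sol, unfolded grad_herm_sol, OF herm_sol_L2])

lemma green_herm:
  fixes v :: "('m::finite) pt \<Rightarrow> real"
  assumes S: "Sob MH MB v H S"
  shows "(\<integral>x. H x \<bullet> herm_grad j x \<partial>MH) =
    (real CARD('m) + 1 - real j) / 2 * (\<integral>x. v x * herm_sol j x \<partial>MH)
     + herm_robin j * (\<integral>y. S y * herm_sol j (y, 0) \<partial>MB)"
proof -
  obtain \<phi> where p: "\<And>k. \<phi> k \<in> test_functions" "L2_tendsto MH \<phi> v" "L2_tendsto MH (\<lambda>k. grad (\<phi> k)) H"
     "L2_tendsto MB (\<lambda>k y. \<phi> k (y, 0)) S"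
    using S by (auto simp: Sob_def)
  note t = MH.test_L2[OF p(1)] and s = MH.Sob_L2[OF S]
  have h: "(herm_sol j :: 'm pt \<Rightarrow> real) \<in> L2 MH" "(herm_grad j :: 'm pt \<Rightarrow> 'm pt) \<in> L2 MH"
    "(\<lambda>y::real^'m. herm_sol j (y, 0)) \<in> L2 MB"
    by (rule herm_sol_L2)+
  note sm = s[THEN L2_measurable] and hm = h[THEN L2_measurable]
  have "(\<lambda>k. \<integral>x. grad (\<phi> k) x \<bullet> herm_grad j x \<partial>MH) \<longlonglongrightarrow> (\<integral>x. H x \<bullet> herm_grad j x \<partial>MH)"
    by (intro L2_tendsto_integral_inner L2_tendsto_const p t sm h hm)
  moreover have "(\<lambda>k. \<integral>x. grad (\<phi> k) x \<bullet> herm_grad j x \<partial>MH) \<longlonglongrightarrow>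
    (real CARD('m) + 1 - real j) / 2 * (\<integral>x. v x * herm_sol j x \<partial>MH)
     + herm_robin j * (\<integral>y. S y * herm_sol j (y, 0) \<partial>MB)"
    unfolding green_herm_C1c[OF test_C1c[OF p(1)]]
    by (intro tendsto_add tendsto_mult tendsto_const L2_tendsto_integral_mult L2_tendsto_const p t sm h hm)
  ultimately show ?thesis by (rule LIMSEQ_unique)
qed

text \<open>Ground state substitution: for the positive solution \<open>\<phi> = herm_sol (m + 1)\<close> the identity above with
  \<open>v = w\<^sup>2/\<phi>\<close> has the integrand \<open>|\<nabla>w|\<^sup>2 - |\<nabla>w - (w/\<phi>) \<nabla>\<phi>|\<^sup>2\<close>.\<close>

lemma robin_quotient:
  fixes u :: "('m::finite) pt \<Rightarrow> real"
  assumes S: "Sob MH MB u G T"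
  shows "herm_robin (CARD('m) + 1) * (\<integral>y. (T y)\<^sup>2 \<partial>MB) \<le> (\<integral>x. (norm (G x))\<^sup>2 \<partial>MH)"
proof -
  let ?j = "CARD('m) + 1"
  let ?p = "herm_sol ?j :: 'm pt \<Rightarrow> real" and ?G = "herm_grad ?j :: 'm pt \<Rightarrow> 'm pt"
  have pp: "?p x > 0" for x by (simp add: herm_sol_def herm_pos)
  have test: "herm_robin ?j * (\<integral>y. (w (y, 0))\<^sup>2 \<partial>MB) \<le> (\<integral>x. (norm (grad w x))\<^sup>2 \<partial>MH)"
    if w: "w \<in> test_functions" for w :: "'m pt \<Rightarrow> real"
  proof -
    let ?V = "\<lambda>x. (w x * w x) *\<^sub>R ((- 1 / (?p x)\<^sup>2) *\<^sub>R ?G x) + (1 / ?p x) *\<^sub>R (w x *\<^sub>R grad w x + w x *\<^sub>R grad w x)"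
    have V: "C1c (\<lambda>x. w x * w x * (1 / ?p x)) ?V"
      by (rule C1c_mult[OF C1c_mult[OF test_C1c[OF w] test_C1[OF w]] C1_inverse[OF C1_herm_sol]])
         (use pp in \<open>simp add: less_imp_neq[THEN not_sym]\<close>)
    have pnz: "?p x \<noteq> 0" for x using pp[of x] by simp
    have "herm_robin ?j * (\<integral>y. (w (y, 0))\<^sup>2 \<partial>MB) = (\<integral>x. ?V x \<bullet> ?G x \<partial>MH)"
      unfolding green_herm_C1c[OF V, of ?j] using pnz by (simp add: power2_eq_square)
    also have "\<dots> \<le> (\<integral>x. (norm (grad w x))\<^sup>2 \<partial>MH)"
    proof (rule integral_mono)
      obtain R where R: "\<And>x. norm x \<ge> R \<Longrightarrow> ?V x = 0" using V unfolding C1c_def by blast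
      show "integrable MH (\<lambda>x. ?V x \<bullet> ?G x)"
        by (rule MH.compact_M[of _ R])
           (intro continuous_on_inner C1_continuous(2)[OF C1c_C1[OF V]] C1_continuous(2)[OF C1_herm_sol],
            simp only: R inner_zero_left)
      show "integrable MH (\<lambda>x. (norm (grad w x))\<^sup>2)" by (rule L2_integrable[OF MH.test_L2(2)[OF w]])
      fix x
      have "?V x \<bullet> ?G x = 2 * (w x / ?p x) * (grad w x \<bullet> ?G x) - (w x / ?p x)\<^sup>2 * (?G x \<bullet> ?G x)"
        by (simp add: inner_add_left power2_eq_square algebra_simps)
      moreover have "(norm (grad w x - (w x / ?p x) *\<^sub>R ?G x))\<^sup>2 =
         (norm (grad w x))\<^sup>2 - 2 * (w x / ?p x) * (grad w x \<bullet> ?G x) + (w x / ?p x)\<^sup>2 * (?G x \<bullet> ?G x)"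
        unfolding power2_norm_eq_inner inner_diff_left inner_diff_right
        by (simp add: inner_commute power2_eq_square algebra_simps)
      ultimately show "?V x \<bullet> ?G x \<le> (norm (grad w x))\<^sup>2"
        using zero_le_power2[of "norm (grad w x - (w x / ?p x) *\<^sub>R ?G x)"] by linarith
    qed
    finally show ?thesis .
  qed
  obtain \<phi> where p: "\<And>k. \<phi> k \<in> test_functions" "L2_tendsto MH \<phi> u" "L2_tendsto MH (\<lambda>k. grad (\<phi> k)) G"
     "L2_tendsto MB (\<lambda>k y. \<phi> k (y, 0)) T"
    using S by (auto simp: Sob_def)
  note t = MH.test_L2[OF p(1)] and s = MH.Sob_L2[OF S, THEN L2_measurable]
  have "(\<lambda>k. herm_robin ?j * (\<integral>y. (norm (\<phi> k (y, 0)))\<^sup>2 \<partial>MB)) \<longlonglongrightarrow> herm_robin ?j * (\<integral>y. (norm (T y))\<^sup>2 \<partial>MB)"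
    by (intro tendsto_mult tendsto_const L2_tendsto_integral_sq p t s)
  then have "(\<lambda>k. herm_robin ?j * (\<integral>y. (\<phi> k (y, 0))\<^sup>2 \<partial>MB)) \<longlonglongrightarrow> herm_robin ?j * (\<integral>y. (T y)\<^sup>2 \<partial>MB)" by simp
  moreover have "(\<lambda>k. \<integral>x. (norm (grad (\<phi> k) x))\<^sup>2 \<partial>MH) \<longlonglongrightarrow> (\<integral>x. (norm (G x))\<^sup>2 \<partial>MH)"
    by (intro L2_tendsto_integral_sq p t s)
  ultimately show ?thesis
    by (rule LIMSEQ_le) (use test[OF p(1)] in blast)
qed

lemma robin_le_mu1: "ereal (herm_robin (CARD('m::finite) + 1)) \<le> mu1 TYPE('m)"
  unfolding mu1_def
proof (rule INF_greatest)
  fix u :: "'m pt \<Rightarrow> real"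
  assume "u \<in> {u \<in> X. \<not> (AE x in MH. u x = 0)}"
  then have S: "Sob MH MB u (wgrad u) (trace u)" using X_Sob by blast
  show "ereal (herm_robin (CARD('m) + 1)) \<le> (if AE y in MB. trace u y = 0 then \<infinity>
     else ereal ((X_norm u)\<^sup>2 / (\<integral>y. (trace u y)\<^sup>2 \<partial>MB)))"
  proof (cases "AE y in MB. trace u y = 0")
    case False
    have "(\<integral>y. (trace u y)\<^sup>2 \<partial>MB) > 0"
    proof (rule ccontr)
      assume "\<not> (\<integral>y. (trace u y)\<^sup>2 \<partial>MB) > 0"
      then have "AE y in MB. trace u y = 0"
        by (intro integral_sq_0_AE MH.Sob_L2(3)[OF S]) simp
      with False show False by simp
    qed
    moreover have "(X_norm u)\<^sup>2 = (\<integral>x. (norm (wgrad u x))\<^sup>2 \<partial>MH)"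
      unfolding X_norm_def by (rule real_sqrt_pow2) simp
    ultimately show ?thesis using robin_quotient[OF S] False by (simp add: le_divide_eq)
  qed simp
qed

section \<open>The Gagliardo--Nirenberg inequality\<close>

text \<open>Roots on the extended half-line, so that the inequalities below hold for arbitrary measurable
  functions, with the value \<open>\<infinity>\<close> admitted.\<close>

definition eroot :: "nat \<Rightarrow> ennreal \<Rightarrow> ennreal" where
  "eroot n x = (if x = top then top else ennreal (root n (enn2real x)))"

lemma eroot_ennreal: "r \<ge> 0 \<Longrightarrow> eroot n (ennreal r) = ennreal (root n r)"
  by (simp add: eroot_def)

lemma eroot_power: "n > 0 \<Longrightarrow> eroot n x ^ n = x"
  by (cases x) (auto simp: eroot_def ennreal_power real_root_pow_pos2 top_power_ennreal)

lemma eroot_of_power: "n > 0 \<Longrightarrow> eroot n (x ^ n) = x"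
  by (cases x) (auto simp: eroot_def ennreal_power real_root_power_cancel top_power_ennreal)

lemma eroot_mono: "n > 0 \<Longrightarrow> x \<le> y \<Longrightarrow> eroot n x \<le> eroot n y"
  by (cases x; cases y) (auto simp: eroot_def real_root_le_iff top_unique intro!: ennreal_leI)

lemma eroot_measurable [measurable]: "eroot n \<in> borel_measurable borel"
  unfolding eroot_def[abs_def] by measurable

lemma prod_le_mean_power:
  fixes x :: "'i \<Rightarrow> ennreal"
  assumes S: "finite S" "S \<noteq> {}"
  shows "(\<Prod>s\<in>S. x s) \<le> ennreal (1 / real (card S)) * (\<Sum>s\<in>S. x s ^ card S)"
proof (cases "\<exists>s\<in>S. x s = top")
  case True
  then obtain s where s: "s \<in> S" "x s = top" by blast
  have c: "card S > 0" using S by (simp add: card_gt_0_iff)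
  have "x s ^ card S \<le> (\<Sum>s\<in>S. x s ^ card S)" using S s by (intro member_le_sum) auto
  then have "(\<Sum>s\<in>S. x s ^ card S) = top" using s c by (simp add: top_power_ennreal top_unique)
  then show ?thesis using c by (simp add: ennreal_mult_top)
next
  case False
  define r where "r s = enn2real (x s)" for s
  have x: "x s = ennreal (r s)" "r s \<ge> 0" if "s \<in> S" for s
    using False that by (auto simp: r_def less_top)
  have c: "card S > 0" using S by (simp add: card_gt_0_iff)
  have "(\<Prod>s\<in>S. r s ^ card S) powr (1 / card S) \<le> (\<Sum>s\<in>S. r s ^ card S / card S)"
    by (rule arith_geom_mean) (use S x in auto)
  moreover have "(\<Prod>s\<in>S. r s ^ card S) powr (1 / card S) = (\<Prod>s\<in>S. r s)"
  proof -
    have p0: "(\<Prod>s\<in>S. r s) \<ge> 0" using x by (intro prod_nonneg) auto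
    have "(\<Prod>s\<in>S. r s ^ card S) = (\<Prod>s\<in>S. r s) ^ card S" by (simp add: prod_power_distrib)
    then show ?thesis
    proof (cases "(\<Prod>s\<in>S. r s) = 0")
      case False
      with p0 have "(\<Prod>s\<in>S. r s) > 0" by simp
      then have "(\<Prod>s\<in>S. r s) ^ card S = (\<Prod>s\<in>S. r s) powr real (card S)" by (simp only: powr_realpow)
      then show ?thesis using p0 c \<open>_ = (\<Prod>s\<in>S. r s) ^ card S\<close> by (simp add: powr_powr)
    qed (use c in \<open>simp add: zero_power\<close>)
  qed
  ultimately have "(\<Prod>s\<in>S. r s) \<le> (1 / real (card S)) * (\<Sum>s\<in>S. r s ^ card S)"
    by (simp add: sum_divide_distrib)
  then have "ennreal (\<Prod>s\<in>S. r s) \<le> ennreal (1 / real (card S)) * ennreal (\<Sum>s\<in>S. r s ^ card S)"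
    by (subst ennreal_mult[symmetric]) (auto intro!: ennreal_leI sum_nonneg zero_le_power x(2))
  moreover have "(\<Prod>s\<in>S. x s) = ennreal (\<Prod>s\<in>S. r s)" using x by (simp add: prod_ennreal)
  moreover have "(\<Sum>s\<in>S. x s ^ card S) = ennreal (\<Sum>s\<in>S. r s ^ card S)"
    using x by (subst sum_ennreal[symmetric]) (auto simp: ennreal_power)
  ultimately show ?thesis by simp
qed

text \<open>The factors are normalized to integral \<open>1\<close>, and the inequality of arithmetic and geometric means is
  integrated.\<close>

lemma Hoelder_equal_exponents:
  fixes h :: "'i \<Rightarrow> 'a \<Rightarrow> ennreal"
  assumes S: "finite S" "S \<noteq> {}" and [measurable]: "\<And>s. s \<in> S \<Longrightarrow> h s \<in> borel_measurable M"
  shows "(\<integral>\<^sup>+x. (\<Prod>s\<in>S. h s x) \<partial>M) ^ card S \<le> (\<Prod>s\<in>S. \<integral>\<^sup>+x. h s x ^ card S \<partial>M)"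
proof -
  let ?n = "card S"
  define A where "A s = (\<integral>\<^sup>+x. h s x ^ ?n \<partial>M)" for s
  have n: "?n > 0" using S by (simp add: card_gt_0_iff)
  consider s where "s \<in> S" "A s = 0" | s where "s \<in> S" "A s = top" "\<forall>s\<in>S. A s \<noteq> 0"
    | "\<forall>s\<in>S. A s \<noteq> 0 \<and> A s \<noteq> top" by blast
  then show ?thesis unfolding A_def[symmetric]
  proof cases
    case 1
    then have "AE x in M. h s x ^ ?n = 0"
      unfolding A_def by (subst (asm) nn_integral_0_iff_AE) auto
    then have "AE x in M. (\<Prod>s\<in>S. h s x) = 0"
      by (rule AE_mp) (use 1 S n in \<open>auto simp: prod_zero_iff\<close>)
    then have "(\<integral>\<^sup>+x. (\<Prod>s\<in>S. h s x) \<partial>M) = 0" by (subst nn_integral_0_iff_AE) auto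
    then show "(\<integral>\<^sup>+x. (\<Prod>s\<in>S. h s x) \<partial>M) ^ ?n \<le> (\<Prod>s\<in>S. A s)" using n by (simp add: zero_power)
  next
    case 2
    have "(\<Prod>s\<in>S. A s) = A s * (\<Prod>s\<in>S - {s}. A s)" using 2 S by (simp add: prod.remove)
    also have "\<dots> = top" using 2 S by (auto simp: ennreal_top_mult)
    finally show "(\<integral>\<^sup>+x. (\<Prod>s\<in>S. h s x) \<partial>M) ^ ?n \<le> (\<Prod>s\<in>S. A s)" by simp
  next
    case 3
    define c where "c s = eroot ?n (A s)" for s
    have c: "c s ^ ?n = A s" "c s \<noteq> 0" "c s \<noteq> top" if "s \<in> S" for s
    proof -
      show 1: "c s ^ ?n = A s" unfolding c_def by (rule eroot_power[OF n])
      have "A s = 0" if "c s = 0" using 1 n that by (simp add: zero_power)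
      with 3 that show "c s \<noteq> 0" by blast
      have "A s = top" if "c s = top" using 1 n that by (simp add: top_power_ennreal)
      with 3 that show "c s \<noteq> top" by blast
    qed
    have div: "c s * (x / c s) = x" if "s \<in> S" for s x
      using c(2,3)[OF that] by (simp add: ennreal_mult_divide_eq mult.commute ennreal_times_divide)
    have "(\<integral>\<^sup>+x. (\<Prod>s\<in>S. h s x) \<partial>M) = (\<integral>\<^sup>+x. (\<Prod>s\<in>S. c s) * (\<Prod>s\<in>S. h s x / c s) \<partial>M)"
      by (intro nn_integral_cong) (simp add: prod.distrib[symmetric] div)
    also have "\<dots> = (\<Prod>s\<in>S. c s) * (\<integral>\<^sup>+x. (\<Prod>s\<in>S. h s x / c s) \<partial>M)"
      by (intro nn_integral_cmult) auto
    also have "(\<integral>\<^sup>+x. (\<Prod>s\<in>S. h s x / c s) \<partial>M) \<le> (\<integral>\<^sup>+x. ennreal (1 / real ?n) * (\<Sum>s\<in>S. (h s x / c s) ^ ?n) \<partial>M)"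
      by (intro nn_integral_mono prod_le_mean_power S)
    also have "\<dots> = ennreal (1 / real ?n) * (\<Sum>s\<in>S. \<integral>\<^sup>+x. (h s x / c s) ^ ?n \<partial>M)"
      by (subst nn_integral_cmult) (auto simp: nn_integral_sum)
    also have "(\<Sum>s\<in>S. \<integral>\<^sup>+x. (h s x / c s) ^ ?n \<partial>M) = (\<Sum>s\<in>S. 1)"
    proof (intro sum.cong refl)
      fix s assume s: "s \<in> S"
      have "(\<integral>\<^sup>+x. (h s x / c s) ^ ?n \<partial>M) = (\<integral>\<^sup>+x. inverse (c s) ^ ?n * h s x ^ ?n \<partial>M)"
        by (intro nn_integral_cong) (simp add: divide_ennreal_def power_mult_distrib mult.commute)
      also have "\<dots> = inverse (c s) ^ ?n * c s ^ ?n"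
        unfolding c(1)[OF s] A_def using s by (intro nn_integral_cmult) auto
      also have "\<dots> = (c s / c s) ^ ?n" by (simp add: divide_ennreal_def power_mult_distrib mult.commute)
      also have "\<dots> = 1" using c(2,3)[OF s] by (simp add: ennreal_divide_self less_top)
      finally show "(\<integral>\<^sup>+x. (h s x / c s) ^ ?n \<partial>M) = 1" .
    qed
    also have "ennreal (1 / real ?n) * (\<Sum>s\<in>S. 1) = 1"
    proof -
      have "(\<Sum>s\<in>S. 1::ennreal) = ennreal (real ?n)" by (simp add: ennreal_of_nat_eq_real_of_nat)
      then show ?thesis using n by (simp add: ennreal_mult[symmetric])
    qed
    finally have "(\<integral>\<^sup>+x. (\<Prod>s\<in>S. h s x) \<partial>M) \<le> (\<Prod>s\<in>S. c s)" by (simp add: mult_left_mono)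
    then have "(\<integral>\<^sup>+x. (\<Prod>s\<in>S. h s x) \<partial>M) ^ ?n \<le> (\<Prod>s\<in>S. c s) ^ ?n" by (intro power_mono) auto
    also have "\<dots> = (\<Prod>s\<in>S. A s)" using c(1) by (simp add: prod_power_distrib)
    finally show "(\<integral>\<^sup>+x. (\<Prod>s\<in>S. h s x) \<partial>M) ^ ?n \<le> (\<Prod>s\<in>S. A s)" .
  qed
qed

text \<open>The induction integrates out one coordinate at a time. The power of \<open>f\<close> in the integrand makes the
  total exponent right in every step, so that Hoelder's inequality replaces \<open>f\<close> by its integral over the
  coordinate and leaves an integrand of the same form.\<close>

lemma grid_lines:
  fixes f :: "('i \<Rightarrow> real) \<Rightarrow> ennreal"
  assumes "finite I" "M > 0" "card I \<le> M + 1" "f \<in> borel_measurable (Pi\<^sub>M I (\<lambda>_. lborel))"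
  shows "(\<integral>\<^sup>+x. eroot M (f x) ^ (M + 1 - card I) * (\<Prod>i\<in>I. eroot M (\<integral>\<^sup>+t. f (x(i := t)) \<partial>lborel)) \<partial>Pi\<^sub>M I (\<lambda>_. lborel)) ^ M
    \<le> (\<integral>\<^sup>+x. f x \<partial>Pi\<^sub>M I (\<lambda>_. lborel)) ^ (M + 1)"
  using assms
proof (induction I arbitrary: f rule: finite_induct)
  case empty
  interpret product_sigma_finite "\<lambda>_::'i. lborel :: real measure" by standard
  have "(eroot M (f (\<lambda>_. undefined)) ^ (M + 1)) ^ M = (eroot M (f (\<lambda>_. undefined)) ^ M) ^ (M + 1)"
    by (simp only: power_mult[symmetric] mult.commute)
  then show ?case using empty by (simp add: PiM_empty nn_integral_count_space_finite eroot_power)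
next
  case (insert i s)
  interpret product_sigma_finite "\<lambda>_::'i. lborel :: real measure" by standard
  let ?P = "\<lambda>I::'i set. Pi\<^sub>M I (\<lambda>_. lborel :: real measure)"
  note [measurable] = insert.prems(3)
  have upd [measurable]: "(\<lambda>(x, t). x(j := t)) \<in> ?P J \<Otimes>\<^sub>M lborel \<rightarrow>\<^sub>M ?P (insert i s)" if "insert i s = J \<union> {j}" for j J
    unfolding case_prod_beta by (rule measurable_fun_upd[OF that]) auto
  define F where "F x = (\<integral>\<^sup>+t. f (x(i := t)) \<partial>lborel)" for x
  have F_meas [measurable]: "F \<in> borel_measurable (?P s)"
    unfolding F_def using upd[of s i] by (intro lborel.borel_measurable_nn_integral) (auto simp: case_prod_beta' intro: measurable_compose[of _ _ _ f])
  have inner_meas: "(\<lambda>x. \<integral>\<^sup>+t. f (x(j := t)) \<partial>lborel) \<in> borel_measurable (?P (insert i s))" if "j \<in> insert i s" for j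
  proof -
    have "(\<lambda>p. (fst p)(j := snd p)) \<in> ?P (insert i s) \<Otimes>\<^sub>M lborel \<rightarrow>\<^sub>M ?P (insert i s)"
      by (rule measurable_fun_upd[of _ "insert i s"]) (use that in auto)
    from measurable_compose[OF this insert.prems(3)] show ?thesis
      by (intro lborel.borel_measurable_nn_integral) (simp only: case_prod_beta')
  qed
  have Fj_meas: "(\<lambda>x. \<integral>\<^sup>+t. F (x(j := t)) \<partial>lborel) \<in> borel_measurable (?P s)" if "j \<in> s" for j
  proof -
    have "(\<lambda>(x, t). x(j := t)) \<in> ?P s \<Otimes>\<^sub>M lborel \<rightarrow>\<^sub>M ?P s"
      unfolding case_prod_beta by (rule measurable_fun_upd[of _ s]) (use that in auto)
    then show ?thesis
      by (intro lborel.borel_measurable_nn_integral) (auto simp: case_prod_beta' intro: measurable_compose[of _ _ _ F])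
  qed
  have card: "card s \<le> M" "card (insert i s) = Suc (card s)" using insert by auto
  let ?k = "\<lambda>x. eroot M (f x)"
  let ?h = "\<lambda>j x. eroot M (\<integral>\<^sup>+t. f (x(j := t)) \<partial>lborel)"
  let ?g = "\<lambda>x. ?k x ^ (M - card s) * (?h i x * (\<Prod>j\<in>s. ?h j x))"
  have g_meas: "?g \<in> borel_measurable (?P (insert i s))"
  proof -
    have [measurable]: "(\<lambda>x. \<integral>\<^sup>+t. f (x(i := t)) \<partial>lborel) \<in> borel_measurable (?P (insert i s))"
      "\<And>j. j \<in> s \<Longrightarrow> (\<lambda>x. \<integral>\<^sup>+t. f (x(j := t)) \<partial>lborel) \<in> borel_measurable (?P (insert i s))"
      by (intro inner_meas; simp)+
    show ?thesis by measurable
  qed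
  have step: "(\<integral>\<^sup>+y. ?g (x(i := y)) \<partial>lborel) \<le>
     eroot M (F x) ^ (M + 1 - card s) * (\<Prod>j\<in>s. eroot M (\<integral>\<^sup>+t. F (x(j := t)) \<partial>lborel))" if x: "x \<in> space (?P s)" for x
  proof -
    have xi: "(\<lambda>y. x(i := y)) \<in> lborel \<rightarrow>\<^sub>M ?P (insert i s)"
      using x by (intro measurable_fun_upd[of _ s]) auto
    have m1: "(\<lambda>y. ?k (x(i := y))) \<in> borel_measurable lborel"
      by (intro measurable_compose[OF _ eroot_measurable] measurable_compose[OF xi insert.prems(3)])
    have m2: "(\<lambda>y. ?h j (x(i := y))) \<in> borel_measurable lborel" if "j \<in> s" for j
      using that by (intro measurable_compose[OF _ eroot_measurable] measurable_compose[OF xi inner_meas]) auto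
    let ?S = "Inl ` s \<union> Inr ` {..<M - card s} :: ('i + nat) set"
    let ?H = "\<lambda>c y. case c of Inl j \<Rightarrow> ?h j (x(i := y)) | Inr _ \<Rightarrow> ?k (x(i := y))"
    have S: "finite ?S" "card ?S = M"
      using insert.hyps(1) card(1) by (simp, subst card_Un_disjoint) (auto simp: card_image)
    have "?S \<noteq> {}" using S insert.prems(1) by (metis card.empty less_numeral_extra(3))
    have prod_S: "(\<Prod>c\<in>?S. q c) = (\<Prod>j\<in>s. q (Inl j)) * (\<Prod>l<M - card s. q (Inr l))" for q :: "'i + nat \<Rightarrow> ennreal"
      using insert.hyps(1) by (subst prod.union_disjoint) (auto simp: prod.reindex)
    have H: "(\<integral>\<^sup>+y. (\<Prod>c\<in>?S. ?H c y) \<partial>lborel) ^ card ?S \<le> (\<Prod>c\<in>?S. \<integral>\<^sup>+y. ?H c y ^ card ?S \<partial>lborel)"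
      by (rule Hoelder_equal_exponents) (use S \<open>?S \<noteq> {}\<close> m1 m2 in auto)
    have prodH: "(\<Prod>c\<in>?S. \<integral>\<^sup>+y. ?H c y ^ M \<partial>lborel) = (\<Prod>j\<in>s. \<integral>\<^sup>+t. F (x(j := t)) \<partial>lborel) * F x ^ (M - card s)"
    proof -
      have "(\<integral>\<^sup>+y. ?h j (x(i := y)) ^ M \<partial>lborel) = (\<integral>\<^sup>+t. F (x(j := t)) \<partial>lborel)" if j: "j \<in> s" for j
      proof -
        have "i \<noteq> j" using j insert.hyps(2) by auto
        have m: "(\<lambda>(y, t). f (x(i := y, j := t))) \<in> borel_measurable (lborel \<Otimes>\<^sub>M lborel)"
        proof -
          have "(\<lambda>p. (x(i := fst p))(j := snd p)) \<in> lborel \<Otimes>\<^sub>M lborel \<rightarrow>\<^sub>M ?P (insert i s)"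
            by (rule measurable_fun_upd[of _ "insert i s"]) (use j x in \<open>auto intro!: measurable_fun_upd[of _ s]\<close>)
          then show ?thesis unfolding case_prod_beta by (rule measurable_compose[OF _ insert.prems(3)])
        qed
        have "(\<integral>\<^sup>+y. ?h j (x(i := y)) ^ M \<partial>lborel) = (\<integral>\<^sup>+y. \<integral>\<^sup>+t. f (x(i := y, j := t)) \<partial>lborel \<partial>lborel)"
          using insert.prems(1) by (simp add: eroot_power)
        also have "\<dots> = (\<integral>\<^sup>+t. \<integral>\<^sup>+y. f (x(i := y, j := t)) \<partial>lborel \<partial>lborel)"
          by (rule lborel_pair.Fubini'[symmetric, OF m])
        also have "\<dots> = (\<integral>\<^sup>+t. F (x(j := t)) \<partial>lborel)"
          unfolding F_def using \<open>i \<noteq> j\<close> by (simp add: fun_upd_twist)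
        finally show ?thesis .
      qed
      moreover have "(\<integral>\<^sup>+y. ?k (x(i := y)) ^ M \<partial>lborel) = F x"
        using insert.prems(1) by (simp add: eroot_power F_def)
      ultimately show ?thesis unfolding prod_S by simp
    qed
    have "(\<integral>\<^sup>+y. (\<Prod>c\<in>?S. ?H c y) \<partial>lborel) ^ M \<le>
       (eroot M (F x) ^ (M - card s) * (\<Prod>j\<in>s. eroot M (\<integral>\<^sup>+t. F (x(j := t)) \<partial>lborel))) ^ M"
    proof -
      have "(eroot M (F x) ^ (M - card s)) ^ M = F x ^ (M - card s)"
        using insert.prems(1) by (simp add: power_mult[symmetric] mult.commute[of _ M]) (simp add: power_mult eroot_power)
      then have "(eroot M (F x) ^ (M - card s) * (\<Prod>j\<in>s. eroot M (\<integral>\<^sup>+t. F (x(j := t)) \<partial>lborel))) ^ M =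
         F x ^ (M - card s) * (\<Prod>j\<in>s. \<integral>\<^sup>+t. F (x(j := t)) \<partial>lborel)"
        using insert.prems(1) by (simp add: power_mult_distrib prod_power_distrib eroot_power)
      with H prodH show ?thesis by (simp add: S(2) mult.commute)
    qed
    from eroot_mono[OF insert.prems(1) this]
    have "(\<integral>\<^sup>+y. (\<Prod>c\<in>?S. ?H c y) \<partial>lborel) \<le> eroot M (F x) ^ (M - card s) * (\<Prod>j\<in>s. eroot M (\<integral>\<^sup>+t. F (x(j := t)) \<partial>lborel))"
      by (simp add: eroot_of_power[OF insert.prems(1)])
    then have *: "(\<integral>\<^sup>+y. ?k (x(i := y)) ^ (M - card s) * (\<Prod>j\<in>s. ?h j (x(i := y))) \<partial>lborel) \<le>
       eroot M (F x) ^ (M - card s) * (\<Prod>j\<in>s. eroot M (\<integral>\<^sup>+t. F (x(j := t)) \<partial>lborel))"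
      unfolding prod_S by (simp add: mult.commute)
    have "(\<integral>\<^sup>+y. ?g (x(i := y)) \<partial>lborel) = (\<integral>\<^sup>+y. eroot M (F x) * (?k (x(i := y)) ^ (M - card s) * (\<Prod>j\<in>s. ?h j (x(i := y)))) \<partial>lborel)"
      by (intro nn_integral_cong) (simp add: F_def mult_ac)
    also have "\<dots> = eroot M (F x) * (\<integral>\<^sup>+y. ?k (x(i := y)) ^ (M - card s) * (\<Prod>j\<in>s. ?h j (x(i := y))) \<partial>lborel)"
    proof (rule nn_integral_cmult)
      note [measurable] = m1 m2
      show "(\<lambda>y. ?k (x(i := y)) ^ (M - card s) * (\<Prod>j\<in>s. ?h j (x(i := y)))) \<in> borel_measurable lborel" by measurable
    qed
    also have "\<dots> \<le> eroot M (F x) * (eroot M (F x) ^ (M - card s) * (\<Prod>j\<in>s. eroot M (\<integral>\<^sup>+t. F (x(j := t)) \<partial>lborel)))"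
      by (intro mult_left_mono *) auto
    also have "\<dots> = eroot M (F x) ^ (M + 1 - card s) * (\<Prod>j\<in>s. eroot M (\<integral>\<^sup>+t. F (x(j := t)) \<partial>lborel))"
      using card(1) by (simp add: Suc_diff_le mult.assoc)
    finally show ?thesis .
  qed
  have "(\<integral>\<^sup>+x. ?k x ^ (M + 1 - card (insert i s)) * (\<Prod>j\<in>insert i s. ?h j x) \<partial>?P (insert i s)) = (\<integral>\<^sup>+x. ?g x \<partial>?P (insert i s))"
    using insert.hyps by (simp add: card(2))
  also have "\<dots> = (\<integral>\<^sup>+x. \<integral>\<^sup>+y. ?g (x(i := y)) \<partial>lborel \<partial>?P s)"
    by (rule product_nn_integral_insert[OF insert.hyps g_meas])
  also have "\<dots> \<le> (\<integral>\<^sup>+x. eroot M (F x) ^ (M + 1 - card s) * (\<Prod>j\<in>s. eroot M (\<integral>\<^sup>+t. F (x(j := t)) \<partial>lborel)) \<partial>?P s)"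
    by (rule nn_integral_mono[OF step])
  finally have "(\<integral>\<^sup>+x. ?k x ^ (M + 1 - card (insert i s)) * (\<Prod>j\<in>insert i s. ?h j x) \<partial>?P (insert i s)) ^ M \<le> \<dots> ^ M"
    by (intro power_mono) auto
  also have "\<dots> \<le> (\<integral>\<^sup>+x. F x \<partial>?P s) ^ (M + 1)"
    by (rule insert.IH[OF insert.prems(1) _ F_meas]) (use card in auto)
  also have "(\<integral>\<^sup>+x. F x \<partial>?P s) = (\<integral>\<^sup>+x. f x \<partial>?P (insert i s))"
    unfolding F_def by (rule product_nn_integral_insert[OF insert.hyps insert.prems(3), symmetric])
  finally show ?case .
qed

lemma Gagliardo_lborel:
  fixes f :: "'a::euclidean_space \<Rightarrow> ennreal"
  assumes [measurable]: "f \<in> borel_measurable borel" and M: "DIM('a) = M + 1" "M > 0"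
  shows "(\<integral>\<^sup>+x. (\<Prod>b\<in>Basis. eroot M (\<integral>\<^sup>+t. f (x + (t - x \<bullet> b) *\<^sub>R b) \<partial>lborel)) \<partial>lborel) ^ M \<le> (\<integral>\<^sup>+x. f x \<partial>lborel) ^ (M + 1)"
proof -
  define e where "e z = (\<Sum>b\<in>Basis. z b *\<^sub>R b :: 'a)" for z
  let ?P = "Pi\<^sub>M (Basis::'a set) (\<lambda>_. lborel :: real measure)"
  have e: "e \<in> ?P \<rightarrow>\<^sub>M borel" unfolding e_def by measurable
  have lb: "lborel = distr ?P borel e" unfolding e_def by (rule lborel_eq)
  have ei: "e z \<bullet> b = z b" if "b \<in> Basis" for z b
    using that by (simp add: e_def inner_sum_left inner_Basis if_distrib[of "\<lambda>t. _ * t"] sum.delta' cong: if_cong)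
  have eu: "e (z(b := t)) = e z + (t - e z \<bullet> b) *\<^sub>R b" if b: "b \<in> Basis" for z b t
  proof (rule euclidean_eqI)
    fix c :: 'a assume c: "c \<in> Basis"
    show "e (z(b := t)) \<bullet> c = (e z + (t - e z \<bullet> b) *\<^sub>R b) \<bullet> c"
      using b c by (simp add: ei inner_add_left inner_Basis)
  qed
  have m: "(\<lambda>x. \<Prod>b\<in>Basis. eroot M (\<integral>\<^sup>+t. f (x + (t - x \<bullet> b) *\<^sub>R b) \<partial>lborel)) \<in> borel_measurable borel"
    by measurable
  have "(\<integral>\<^sup>+x. (\<Prod>b\<in>Basis. eroot M (\<integral>\<^sup>+t. f (x + (t - x \<bullet> b) *\<^sub>R b) \<partial>lborel)) \<partial>lborel)
     = (\<integral>\<^sup>+z. (\<Prod>b\<in>Basis. eroot M (\<integral>\<^sup>+t. f (e z + (t - e z \<bullet> b) *\<^sub>R b) \<partial>lborel)) \<partial>?P)"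
    by (subst lb) (rule nn_integral_distr[OF e], use m in simp)
  also have "\<dots> = (\<integral>\<^sup>+z. eroot M (f (e z)) ^ (M + 1 - card (Basis::'a set)) * (\<Prod>b\<in>Basis. eroot M (\<integral>\<^sup>+t. f (e (z(b := t))) \<partial>lborel)) \<partial>?P)"
    using M(1) by (simp add: eu)
  finally show ?thesis
    using grid_lines[of "Basis::'a set" M "\<lambda>z. f (e z)"] M measurable_compose[OF e, of f]
    by (simp add: nn_integral_distr[OF e, of f, folded lb])
qed

section \<open>Sobolev inequalities on the half-space\<close>

text \<open>The fundamental theorem of calculus on the ray from \<open>x\<close> in the direction \<open>b\<close>, which stays in the
  half-space because no basis vector points outwards.\<close>

lemma halfspace_line_bound:
  fixes g :: "('m::finite) pt \<Rightarrow> real"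
  assumes g: "C1c g G" and x: "x \<in> halfspace" and b: "b \<in> Basis"
  shows "ennreal (g x) \<le> (\<integral>\<^sup>+t. ennreal (norm (G (x + (t - x \<bullet> b) *\<^sub>R b))) * indicator halfspace (x + (t - x \<bullet> b) *\<^sub>R b) \<partial>lborel)"
proof -
  obtain R where R: "R > 0" "\<And>x. norm x \<ge> R \<Longrightarrow> g x = 0 \<and> G x = 0" using g unfolding C1c_def by blast
  note cont = C1_continuous[OF C1c_C1[OF g]]
  define p where "p t = x + (t - x \<bullet> b) *\<^sub>R b" for t
  define c where "c = x \<bullet> b"
  define T where "T = max c R + 1"
  have T: "c \<le> T" "R \<le> T" by (auto simp: T_def)
  have pb: "p t \<bullet> b = t" for t using b by (simp add: p_def inner_add_left)
  have pc: "p c = x" by (simp add: p_def c_def)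
  have "norm (p T) \<ge> R" using Basis_le_norm[OF b, of "p T"] T R by (simp add: pb)
  then have gT: "g (p T) = 0" using R by blast
  have contG: "continuous_on S (\<lambda>t. G (p t))" for S
    unfolding p_def by (intro continuous_on_compose2[OF cont(2)] continuous_intros) auto
  have in_half: "p t \<in> halfspace" if "c \<le> t" for t
  proof -
    have "snd b \<ge> 0" using b by (auto simp: Basis_prod_def)
    then have "(t - c) * snd b \<ge> 0" using that by simp
    then show ?thesis using x by (simp add: halfspace_def p_def c_def)
  qed
  have int: "integrable lborel (\<lambda>t. indicator {c..T} t *\<^sub>R (G (p t) \<bullet> b))" "integrable lborel (\<lambda>t. indicator {c..T} t *\<^sub>R norm (G (p t)))"
    by (intro borel_integrable_compact continuous_intros contG; simp)+
  have "(\<integral>t. indicator {c..T} t *\<^sub>R (G (p t) \<bullet> b) \<partial>lborel) = g (p T) - g (p c)"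
  proof (rule integral_FTC_atLeastAtMost[OF T(1)])
    show "((\<lambda>t. g (p t)) has_vector_derivative G (p t) \<bullet> b) (at t within {c..T})" for t
    proof -
      have "(p has_derivative (\<lambda>s. s *\<^sub>R b)) (at t within {c..T})"
        unfolding p_def by (auto intro!: derivative_eq_intros)
      from has_derivative_compose[OF this C1_has_derivative[OF C1c_C1[OF g]]]
      show ?thesis by (simp add: has_vector_derivative_def)
    qed
    show "continuous_on {c..T} (\<lambda>t. G (p t) \<bullet> b)" by (intro continuous_intros contG)
  qed
  then have "g x = (\<integral>t. - (indicator {c..T} t *\<^sub>R (G (p t) \<bullet> b)) \<partial>lborel)" using gT pc by simp
  also have "\<dots> \<le> (\<integral>t. indicator {c..T} t *\<^sub>R norm (G (p t)) \<partial>lborel)"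
  proof (rule integral_mono)
    show "- (indicator {c..T} t *\<^sub>R (G (p t) \<bullet> b)) \<le> indicator {c..T} t *\<^sub>R norm (G (p t))" for t
      using Basis_le_norm[OF b, of "G (p t)"] by (auto simp: indicator_def)
  qed (use int in auto)
  finally have "ennreal (g x) \<le> ennreal (\<integral>t. indicator {c..T} t *\<^sub>R norm (G (p t)) \<partial>lborel)" by (rule ennreal_leI)
  also have "\<dots> = (\<integral>\<^sup>+t. ennreal (indicator {c..T} t *\<^sub>R norm (G (p t))) \<partial>lborel)"
    by (rule nn_integral_eq_integral[OF int(2), symmetric]) auto
  also have "\<dots> \<le> (\<integral>\<^sup>+t. ennreal (norm (G (p t))) * indicator halfspace (p t) \<partial>lborel)"
    by (intro nn_integral_mono) (auto simp: indicator_def in_half)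
  finally show ?thesis unfolding p_def .
qed

lemma ennreal_prod_mono: "finite A \<Longrightarrow> (\<And>i. i \<in> A \<Longrightarrow> f i \<le> g i) \<Longrightarrow> (\<Prod>i\<in>A. f i) \<le> (\<Prod>i\<in>A. g i :: ennreal)"
  by (induction rule: finite_induct) (auto intro!: mult_mono)

lemma Gagliardo_halfspace:
  fixes g :: "('m::finite) pt \<Rightarrow> real"
  assumes g: "C1c g G" and nn: "\<And>x. g x \<ge> 0"
  shows "(\<integral>\<^sup>+x. ennreal (root CARD('m) (g x)) ^ (CARD('m) + 1) \<partial>M0) ^ CARD('m)
    \<le> (\<integral>\<^sup>+x. ennreal (norm (G x)) \<partial>M0) ^ (CARD('m) + 1)"
proof -
  let ?M = "CARD('m)"
  have M: "?M > 0" by simp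
  note cont = C1_continuous[OF C1c_C1[OF g]]
  have [measurable]: "G \<in> borel_measurable borel" "g \<in> borel_measurable borel"
    by (intro borel_measurable_continuous_onI cont)+
  define f where "f y = ennreal (norm (G y)) * indicator halfspace y" for y
  have [measurable]: "f \<in> borel_measurable borel" unfolding f_def by measurable
  have "(\<integral>\<^sup>+x. ennreal (root ?M (g x)) ^ (?M + 1) \<partial>M0) = (\<integral>\<^sup>+x. ennreal (root ?M (g x)) ^ (?M + 1) * indicator halfspace x \<partial>lborel)"
    unfolding M0_def by (subst nn_integral_restrict_space) auto
  also have "\<dots> \<le> (\<integral>\<^sup>+x. (\<Prod>b\<in>Basis. eroot ?M (\<integral>\<^sup>+t. f (x + (t - x \<bullet> b) *\<^sub>R b) \<partial>lborel)) \<partial>lborel)"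
  proof (intro nn_integral_mono)
    fix x :: "'m pt"
    show "ennreal (root ?M (g x)) ^ (?M + 1) * indicator halfspace x \<le> (\<Prod>b\<in>Basis. eroot ?M (\<integral>\<^sup>+t. f (x + (t - x \<bullet> b) *\<^sub>R b) \<partial>lborel))"
    proof (cases "x \<in> halfspace")
      case True
      have "ennreal (root ?M (g x)) \<le> eroot ?M (\<integral>\<^sup>+t. f (x + (t - x \<bullet> b) *\<^sub>R b) \<partial>lborel)" if "b \<in> Basis" for b
        using eroot_mono[OF M halfspace_line_bound[OF g True that]] nn by (simp add: f_def eroot_ennreal)
      then have "(\<Prod>b\<in>(Basis::'m pt set). ennreal (root ?M (g x))) \<le> (\<Prod>b\<in>Basis. eroot ?M (\<integral>\<^sup>+t. f (x + (t - x \<bullet> b) *\<^sub>R b) \<partial>lborel))"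
        by (rule ennreal_prod_mono[OF finite_Basis])
      then show ?thesis using True by simp
    qed simp
  qed
  finally have "(\<integral>\<^sup>+x. ennreal (root ?M (g x)) ^ (?M + 1) \<partial>M0) ^ ?M \<le> (\<integral>\<^sup>+x. (\<Prod>b\<in>Basis. eroot ?M (\<integral>\<^sup>+t. f (x + (t - x \<bullet> b) *\<^sub>R b) \<partial>lborel)) \<partial>lborel) ^ ?M"
    by (intro power_mono) auto
  also have "\<dots> \<le> (\<integral>\<^sup>+x. f x \<partial>lborel) ^ (?M + 1)"
    by (rule Gagliardo_lborel) auto
  also have "(\<integral>\<^sup>+x. f x \<partial>lborel) = (\<integral>\<^sup>+x. ennreal (norm (G x)) \<partial>M0)"
    unfolding M0_def f_def by (subst nn_integral_restrict_space) auto
  finally show ?thesis .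
qed

lemma abs_powr_derivative:
  assumes r: "r > 2"
  shows "((\<lambda>s. \<bar>s\<bar> powr r) has_real_derivative r * s * \<bar>s\<bar> powr (r - 2)) (at s)"
proof -
  consider "s > 0" | "s < 0" | "s = 0" by linarith
  then show ?thesis
  proof cases
    case 1
    have "((\<lambda>s. s powr r) has_real_derivative r * s powr (r - 1)) (at s)"
      using 1 by (rule has_real_derivative_powr)
    moreover have "r * s powr (r - 1) = r * s * \<bar>s\<bar> powr (r - 2)"
      using 1 powr_mult_base[of s "r - 2"] by simp
    ultimately show ?thesis
      by (rule_tac has_field_derivative_transform_within_open[where S="{0<..}" and f="\<lambda>s. s powr r"]) (use 1 in auto)
  next
    case 2
    have "((\<lambda>s. (- s) powr r) has_real_derivative (r * (- s) powr (r - 1)) * (- 1)) (at s)"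
      using 2 by (intro DERIV_chain2[of "\<lambda>s. s powr r"] has_real_derivative_powr) (auto intro!: derivative_eq_intros)
    moreover have "(r * (- s) powr (r - 1)) * (- 1) = r * s * \<bar>s\<bar> powr (r - 2)"
    proof -
      have e: "(- s) powr (r - 1) = (- s) * (- s) powr (r - 2)"
        using 2 powr_mult_base[of "- s" "r - 2"] by simp
      show ?thesis unfolding e using 2 by simp
    qed
    ultimately show ?thesis
      by (rule_tac has_field_derivative_transform_within_open[where S="{..<0}" and f="\<lambda>s. (- s) powr r"]) (use 2 in auto)
  next
    case 3
    have "((\<lambda>h::real. \<bar>h\<bar> powr r / h) \<longlongrightarrow> 0) (at 0)"
    proof (rule Lim_null_comparison)
      have "((\<lambda>h::real. \<bar>h\<bar> powr (r - 1)) \<longlongrightarrow> \<bar>0\<bar> powr (r - 1)) (at 0)"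
        by (rule tendsto_powr'[OF tendsto_rabs[OF tendsto_ident_at] tendsto_const]) (use r in auto)
      then show "((\<lambda>h::real. \<bar>h\<bar> powr (r - 1)) \<longlongrightarrow> 0) (at 0)" by simp
      have "norm (\<bar>h\<bar> powr r / h) \<le> \<bar>h\<bar> powr (r - 1)" for h :: real
        by (cases "h = 0") (auto simp: powr_diff)
      then show "\<forall>\<^sub>F h in at (0::real). norm (\<bar>h\<bar> powr r / h) \<le> \<bar>h\<bar> powr (r - 1)" by simp
    qed
    then show ?thesis using 3 by (simp add: has_field_derivative_iff)
  qed
qed

text \<open>The two exponents are tied together: the Gagliardo--Nirenberg inequality is applied to
  \<open>|\<phi>| powr two_trace\<close>, and the boundary integral of the same function is bounded by the same
  gradient integral.\<close>

lemma Sobolev_test: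
  fixes \<phi> :: "('m::finite) pt \<Rightarrow> real"
  assumes \<phi>: "\<phi> \<in> test_functions" and m: "CARD('m) \<ge> 2"
  defines "p \<equiv> two_star (CARD('m) + 1)" and "r \<equiv> two_trace (CARD('m) + 1)"
  shows "(\<integral>x. \<bar>\<phi> x\<bar> powr p \<partial>M0) \<le> (r\<^sup>2 * (\<integral>x. (norm (grad \<phi> x))\<^sup>2 \<partial>M0)) powr (p / 2)"
    "(\<integral>y. \<bar>\<phi> (y, 0)\<bar> powr r \<partial>lborel) \<le> (r\<^sup>2 * (\<integral>x. (norm (grad \<phi> x))\<^sup>2 \<partial>M0)) powr (r / 2)"
proof -
  let ?M = "CARD('m)"
  have pr: "p = 2 * (real ?M + 1) / (real ?M - 1)" "r = 2 * real ?M / (real ?M - 1)"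
    by (simp_all add: p_def r_def two_star_def two_trace_def)
  have m1: "real ?M - 1 > 0" using m by simp
  have r2: "r > 2" using m1 by (simp add: pr field_simps)
  have p0: "p > 0" using m1 by (simp add: pr)
  have prel: "r * ((real ?M + 1) / real ?M) = p" "2 * (r - 1) = p"
    using m1 by (simp_all add: pr field_simps)
  note C = test_C1[OF \<phi>]
  note cont = C1_continuous[OF C]
  obtain R where R: "\<And>x. norm x \<ge> R \<Longrightarrow> \<phi> x = 0" using test_support[OF \<phi>] by blast
  have cp: "continuous_on UNIV (\<lambda>x. \<bar>\<phi> x\<bar> powr e)" if "e > 0" for e
    by (intro continuous_on_powr' continuous_intros cont) (use that in auto)
  define g where "g x = \<bar>\<phi> x\<bar> powr r" for x
  define G where "G x = (r * \<phi> x * \<bar>\<phi> x\<bar> powr (r - 2)) *\<^sub>R grad \<phi> x" for x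
  have "continuous_on UNIV (\<lambda>s::real. r * s * \<bar>s\<bar> powr (r - 2))"
    by (intro continuous_intros continuous_on_powr') (use r2 in auto)
  from C1_compose[OF abs_powr_derivative[OF r2] this C]
  have g: "C1c g G" unfolding g_def[abs_def] G_def[abs_def]
    by (rule C1cI[of _ _ R]) (simp add: R)
  have nG: "norm (G x) = r * (\<bar>\<phi> x\<bar> powr (r - 1) * norm (grad \<phi> x))" for x
    using r2 powr_mult_base[of "\<bar>\<phi> x\<bar>" "r - 2"] by (simp add: G_def abs_mult mult.assoc[symmetric])
  define S where "S = (\<integral>x. \<bar>\<phi> x\<bar> powr p \<partial>M0)"
  define D where "D = (\<integral>x. (norm (grad \<phi> x))\<^sup>2 \<partial>M0)"
  define I where "I = (\<integral>x. norm (G x) \<partial>M0)"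
  have S0: "S \<ge> 0" and D0: "D \<ge> 0" and I0: "I \<ge> 0" by (simp_all add: S_def D_def I_def)
  have iS: "integrable M0 (\<lambda>x. \<bar>\<phi> x\<bar> powr p)"
    by (rule M0.compact_M[OF cp[OF p0], of R]) (simp add: R)
  have iI: "integrable M0 (\<lambda>x. norm (G x))"
    using C1c_integrable(2)[OF g] by (intro integrable_norm integrable_lborel_imp_M0)
  have I_le: "I \<le> r * (sqrt S * sqrt D)"
  proof -
    have L: "(\<lambda>x. \<bar>\<phi> x\<bar> powr (r - 1)) \<in> L2 M0"
      by (rule M0.compact_L2(1)[of _ R]) (use r2 R in \<open>auto intro!: cp\<close>)
    have e: "(norm (\<bar>\<phi> x\<bar> powr (r - 1)))\<^sup>2 = \<bar>\<phi> x\<bar> powr p" for x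
      unfolding prel(2)[symmetric] by (simp add: power2_eq_square powr_add[symmetric])
    have "(\<integral>x. \<bar>\<phi> x\<bar> powr (r - 1) \<bullet> norm (grad \<phi> x) \<partial>M0) \<le> sqrt S * sqrt D"
      using L2_Cauchy_Schwarz_sqrt[OF L L2_norm[OF M0.test_L2(2)[OF \<phi>]]]
      unfolding e S_def[symmetric] by (simp add: D_def)
    then show ?thesis unfolding I_def nG using r2 by simp
  qed
  have "S ^ ?M \<le> I ^ (?M + 1)"
  proof -
    have "ennreal (root ?M (g x)) ^ (?M + 1) = ennreal (\<bar>\<phi> x\<bar> powr p)" for x
    proof (cases "\<phi> x = 0")
      case False
      have "root ?M (g x) ^ (?M + 1) = (g x powr (1 / real ?M)) powr real (?M + 1)"
        using False by (subst powr_realpow) (auto simp: g_def root_powr_inverse)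
      also have "\<dots> = \<bar>\<phi> x\<bar> powr p"
        unfolding g_def powr_powr prel(1)[symmetric] by (simp add: field_simps)
      finally have e: "root ?M (g x) ^ (?M + 1) = \<bar>\<phi> x\<bar> powr p" .
      have "root ?M (g x) \<ge> 0" by (simp add: g_def real_root_ge_zero)
      then show ?thesis by (simp only: ennreal_power e)
    qed (use p0 in \<open>simp add: g_def\<close>)
    then have "(\<integral>\<^sup>+x. ennreal (\<bar>\<phi> x\<bar> powr p) \<partial>M0) ^ ?M \<le> (\<integral>\<^sup>+x. ennreal (norm (G x)) \<partial>M0) ^ (?M + 1)"
      using Gagliardo_halfspace[OF g] by (simp add: g_def)
    also have "(\<integral>\<^sup>+x. ennreal (\<bar>\<phi> x\<bar> powr p) \<partial>M0) = ennreal S"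
      unfolding S_def by (rule nn_integral_eq_integral[OF iS]) simp
    also have "(\<integral>\<^sup>+x. ennreal (norm (G x)) \<partial>M0) = ennreal I"
      unfolding I_def by (rule nn_integral_eq_integral[OF iI]) simp
    finally show ?thesis using S0 I0 by (simp only: ennreal_power ennreal_le_iff zero_le_power)
  qed
  also have "\<dots> \<le> (r * (sqrt S * sqrt D)) ^ (?M + 1)"
    using I_le I0 by (intro power_mono)
  finally have "(S ^ ?M)\<^sup>2 \<le> ((r * (sqrt S * sqrt D)) ^ (?M + 1))\<^sup>2"
    using S0 by (intro power_mono) auto
  moreover have "((r * (sqrt S * sqrt D)) ^ (?M + 1))\<^sup>2 = (S * (r\<^sup>2 * D)) ^ (?M + 1)"
  proof -
    have "(r * (sqrt S * sqrt D))\<^sup>2 = S * (r\<^sup>2 * D)" using S0 D0 by (simp add: power_mult_distrib)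
    then show ?thesis by (metis power_mult mult.commute)
  qed
  moreover have "(S ^ ?M)\<^sup>2 = S ^ (?M + 1) * S ^ (?M - 1)"
  proof -
    have "?M * 2 = (?M + 1) + (?M - 1)" using m by simp
    then show ?thesis by (simp only: power_mult[symmetric] power_add[symmetric])
  qed
  ultimately have key: "S ^ (?M + 1) * S ^ (?M - 1) \<le> S ^ (?M + 1) * (r\<^sup>2 * D) ^ (?M + 1)"
    by (simp only: power_mult_distrib[of S "r\<^sup>2 * D"])
  have Sob1: "S \<le> (r\<^sup>2 * D) powr (p / 2)"
  proof (cases "S = 0")
    case False
    then have S: "S > 0" using S0 by simp
    then have k: "S ^ (?M - 1) \<le> (r\<^sup>2 * D) ^ (?M + 1)" using key by simp
    then have rD: "r\<^sup>2 * D > 0"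
    proof -
      have "S ^ (?M - 1) > 0" using S by simp
      with k have "(r\<^sup>2 * D) ^ (?M + 1) > 0" by linarith
      then have "r\<^sup>2 * D \<noteq> 0" by (metis less_irrefl power_0_left add_is_0 one_neq_zero)
      then show ?thesis using D0 by (simp add: less_le)
    qed
    have "S = (S ^ (?M - 1)) powr (1 / (real ?M - 1))"
      using S m by (simp add: powr_realpow[symmetric] powr_powr of_nat_diff)
    also have "\<dots> \<le> ((r\<^sup>2 * D) ^ (?M + 1)) powr (1 / (real ?M - 1))"
      using k S m1 by (intro powr_mono2) auto
    also have "\<dots> = (r\<^sup>2 * D) powr (p / 2)"
    proof -
      have "real (?M + 1) * (1 / (real ?M - 1)) = p / 2" using m1 by (simp add: pr(1) field_simps)
      then show ?thesis by (simp only: powr_realpow[OF rD, symmetric] powr_powr)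
    qed
    finally show ?thesis .
  qed simp
  then show "(\<integral>x. \<bar>\<phi> x\<bar> powr p \<partial>M0) \<le> (r\<^sup>2 * (\<integral>x. (norm (grad \<phi> x))\<^sup>2 \<partial>M0)) powr (p / 2)"
    by (simp add: S_def D_def)
  have "(\<integral>y. \<bar>\<phi> (y, 0)\<bar> powr r \<partial>lborel) \<le> I"
    using boundary_integral_le[OF g] by (simp add: g_def I_def)
  also have "\<dots> \<le> sqrt (r\<^sup>2 * D) * sqrt S"
    using I_le r2 by (simp add: real_sqrt_mult mult_ac)
  also have "\<dots> \<le> sqrt (r\<^sup>2 * D) * sqrt ((r\<^sup>2 * D) powr (p / 2))"
    using Sob1 D0 by (intro mult_left_mono) auto
  also have "\<dots> = (r\<^sup>2 * D) powr (1/2) * ((r\<^sup>2 * D) powr (p / 2)) powr (1/2)"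
    using D0 by (simp add: powr_half_sqrt)
  also have "\<dots> = (r\<^sup>2 * D) powr (r / 2)"
  proof -
    have "1/2 + p / 2 * (1/2) = r / 2" using prel(2) by simp
    then show ?thesis by (simp only: powr_powr powr_add[symmetric])
  qed
  finally show "(\<integral>y. \<bar>\<phi> (y, 0)\<bar> powr r \<partial>lborel) \<le> (r\<^sup>2 * (\<integral>x. (norm (grad \<phi> x))\<^sup>2 \<partial>M0)) powr (r / 2)"
    by (simp add: D_def)
qed

text \<open>Only convergence in \<open>L\<^sup>2\<close> is available, so norms with other exponents pass to the limit along an almost
  everywhere convergent subsequence.\<close>

lemma powr_Fatou:
  fixes f :: "nat \<Rightarrow> 'a \<Rightarrow> real"
  assumes lim: "L2_tendsto M f g" and fL: "\<And>k. f k \<in> L2 M" and gm: "g \<in> borel_measurable M" and r: "r > 0"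
    and i: "\<And>k. integrable M (\<lambda>x. \<bar>f k x\<bar> powr r)" and b: "\<And>k. (\<integral>x. \<bar>f k x\<bar> powr r \<partial>M) \<le> b k" "b \<longlonglongrightarrow> \<beta>"
  shows "integrable M (\<lambda>x. \<bar>g x\<bar> powr r)" "(\<integral>x. \<bar>g x\<bar> powr r \<partial>M) \<le> \<beta>"
proof -
  note [measurable] = gm L2_measurable[OF fL]
  have \<beta>0: "\<beta> \<ge> 0"
    by (rule LIMSEQ_le_const[OF b(2)]) (use order_trans[OF integral_nonneg_AE b(1)] in auto)
  obtain s :: "nat \<Rightarrow> nat" where s: "strict_mono s" "AE x in M. (\<lambda>k. f (s k) x) \<longlonglongrightarrow> g x"
    using L2_tendsto_AE_subseq[OF lim fL gm] by blast
  have "(\<integral>\<^sup>+x. ennreal (\<bar>g x\<bar> powr r) \<partial>M) = (\<integral>\<^sup>+x. liminf (\<lambda>k. ennreal (\<bar>f (s k) x\<bar> powr r)) \<partial>M)"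
  proof (rule nn_integral_cong_AE)
    show "AE x in M. ennreal (\<bar>g x\<bar> powr r) = liminf (\<lambda>k. ennreal (\<bar>f (s k) x\<bar> powr r))"
      using s(2)
    proof eventually_elim
      case (elim x)
      have "(\<lambda>k. \<bar>f (s k) x\<bar> powr r) \<longlonglongrightarrow> \<bar>g x\<bar> powr r"
        by (rule tendsto_powr') (use r elim in \<open>auto intro!: tendsto_intros\<close>)
      from lim_imp_Liminf[OF sequentially_bot tendsto_ennrealI[OF this]] show ?case by simp
    qed
  qed
  also have "\<dots> \<le> liminf (\<lambda>k. \<integral>\<^sup>+x. ennreal (\<bar>f (s k) x\<bar> powr r) \<partial>M)"
    by (intro nn_integral_liminf) auto
  also have "\<dots> \<le> liminf (\<lambda>k. ennreal (b (s k)))"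
  proof (intro Liminf_mono always_eventually allI)
    fix k
    show "(\<integral>\<^sup>+x. ennreal (\<bar>f (s k) x\<bar> powr r) \<partial>M) \<le> ennreal (b (s k))"
      by (subst nn_integral_eq_integral[OF i]) (auto intro!: ennreal_leI b(1))
  qed
  also have "\<dots> = ennreal \<beta>"
    using LIMSEQ_subseq_LIMSEQ[OF b(2) s(1)]
    by (intro lim_imp_Liminf[OF sequentially_bot] tendsto_ennrealI) (simp add: o_def)
  finally have *: "(\<integral>\<^sup>+x. ennreal (\<bar>g x\<bar> powr r) \<partial>M) \<le> ennreal \<beta>" .
  show "integrable M (\<lambda>x. \<bar>g x\<bar> powr r)"
    using order_le_less_trans[OF *] by (intro integrableI_bounded) (auto simp: ennreal_less_top)
  from nn_integral_eq_integral[OF this] * \<beta>0 show "(\<integral>x. \<bar>g x\<bar> powr r \<partial>M) \<le> \<beta>" by simp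
qed

lemma Sobolev:
  fixes u :: "('m::finite) pt \<Rightarrow> real"
  assumes S: "Sob M0 lborel u G T" and m: "CARD('m) \<ge> 2"
  defines "p \<equiv> two_star (CARD('m) + 1)" and "r \<equiv> two_trace (CARD('m) + 1)"
  shows "integrable M0 (\<lambda>x. \<bar>u x\<bar> powr p)"
    "(\<integral>x. \<bar>u x\<bar> powr p \<partial>M0) \<le> (r\<^sup>2 * (\<integral>x. (norm (G x))\<^sup>2 \<partial>M0)) powr (p / 2)"
    "integrable lborel (\<lambda>y. \<bar>T y\<bar> powr r)"
    "(\<integral>y. \<bar>T y\<bar> powr r \<partial>lborel) \<le> (r\<^sup>2 * (\<integral>x. (norm (G x))\<^sup>2 \<partial>M0)) powr (r / 2)"
proof -
  obtain \<phi> where ph: "\<And>k. \<phi> k \<in> test_functions" "L2_tendsto M0 \<phi> u" "L2_tendsto M0 (\<lambda>k. grad (\<phi> k)) G"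
     "L2_tendsto lborel (\<lambda>k y. \<phi> k (y, 0)) T"
    using S by (auto simp: Sob_def)
  note t = M0.test_L2[OF ph(1)] and s = M0.Sob_L2[OF S]
  note sm = s[THEN L2_measurable]
  have m1: "real CARD('m) - 1 > 0" using m by simp
  have p0: "p > 0" and r0: "r > 0" using m1 by (auto simp: p_def r_def two_star_def two_trace_def)
  have D: "(\<lambda>k. r\<^sup>2 * (\<integral>x. (norm (grad (\<phi> k) x))\<^sup>2 \<partial>M0)) \<longlonglongrightarrow> r\<^sup>2 * (\<integral>x. (norm (G x))\<^sup>2 \<partial>M0)"
    by (intro tendsto_mult tendsto_const L2_tendsto_integral_sq ph t sm)
  have lim: "(\<lambda>k. (r\<^sup>2 * (\<integral>x. (norm (grad (\<phi> k) x))\<^sup>2 \<partial>M0)) powr e) \<longlonglongrightarrow> (r\<^sup>2 * (\<integral>x. (norm (G x))\<^sup>2 \<partial>M0)) powr e" if "e > 0" for e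
    by (rule tendsto_powr'[OF D tendsto_const]) (use that in auto)
  have int: "integrable M0 (\<lambda>x. \<bar>\<phi> k x\<bar> powr e)" "integrable lborel (\<lambda>y. \<bar>\<phi> k (y, 0)\<bar> powr e)" if "e > 0" for e k
  proof -
    obtain R where R: "\<And>x. norm x \<ge> R \<Longrightarrow> \<phi> k x = 0" using test_support[OF ph(1)] by blast
    have c: "continuous_on UNIV (\<lambda>x. \<bar>\<phi> k x\<bar> powr e)"
      by (intro continuous_on_powr' continuous_intros C1_continuous[OF test_C1[OF ph(1)]]) (use that in auto)
    show "integrable M0 (\<lambda>x. \<bar>\<phi> k x\<bar> powr e)" "integrable lborel (\<lambda>y. \<bar>\<phi> k (y, 0)\<bar> powr e)"
      using M0.compact_M[OF c, of R] M0.compact_B[OF c, of R] by (simp_all add: R)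
  qed
  have "p / 2 > 0" "r / 2 > 0" using p0 r0 by auto
  note P = powr_Fatou[OF ph(2) t(1) sm(1) p0 int(1)[OF p0] Sobolev_test(1)[OF ph(1) m, folded p_def r_def] lim[OF this(1)]]
  note Q = powr_Fatou[OF ph(4) t(3) sm(3) r0 int(2)[OF r0] Sobolev_test(2)[OF ph(1) m, folded p_def r_def] lim[OF \<open>r / 2 > 0\<close>]]
  show "integrable M0 (\<lambda>x. \<bar>u x\<bar> powr p)" by (rule P(1))
  show "(\<integral>x. \<bar>u x\<bar> powr p \<partial>M0) \<le> (r\<^sup>2 * (\<integral>x. (norm (G x))\<^sup>2 \<partial>M0)) powr (p / 2)" by (rule P(2))
  show "integrable lborel (\<lambda>y. \<bar>T y\<bar> powr r)" by (rule Q(1))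
  show "(\<integral>y. \<bar>T y\<bar> powr r \<partial>lborel) \<le> (r\<^sup>2 * (\<integral>x. (norm (G x))\<^sup>2 \<partial>M0)) powr (r / 2)" by (rule Q(2))
qed

section \<open>Dilations\<close>

text \<open>Homogeneity of degree \<open>n\<close>; the cases of interest are the half-space, where \<open>n = CARD('m) + 1\<close>, and its
  boundary, where \<open>n = CARD('m)\<close>.\<close>

definition dilation_measure :: "'a::euclidean_space measure \<Rightarrow> nat \<Rightarrow> bool" where
  "dilation_measure M n \<longleftrightarrow> (\<forall>s>0. (\<lambda>x. s *\<^sub>R x) \<in> M \<rightarrow>\<^sub>M M \<and>
     distr M M (\<lambda>x. s *\<^sub>R x) = density M (\<lambda>_. ennreal (1 / s ^ n)))"

lemma dilation_lborel: "dilation_measure (lborel :: 'a::euclidean_space measure) DIM('a)"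
  unfolding dilation_measure_def
proof (intro allI impI conjI)
  fix s :: real assume s: "s > 0"
  show "(\<lambda>x::'a. s *\<^sub>R x) \<in> lborel \<rightarrow>\<^sub>M lborel" by measurable
  let ?D = "distr (lborel :: 'a measure) borel (\<lambda>x. s *\<^sub>R x)"
  have "density lborel (\<lambda>_::'a. ennreal (1 / s ^ DIM('a))) = density (density ?D (\<lambda>_. ennreal (s ^ DIM('a)))) (\<lambda>_. ennreal (1 / s ^ DIM('a)))"
    using lborel_affine[of s "0::'a"] s by (simp add: abs_of_pos)
  also have "\<dots> = density ?D (\<lambda>_. 1)"
    using s by (subst density_density_eq) (auto simp: ennreal_mult[symmetric])
  also have "\<dots> = ?D" by (rule density_1)
  also have "\<dots> = distr lborel lborel (\<lambda>x::'a. s *\<^sub>R x)" by (intro distr_cong) auto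
  finally show "distr lborel lborel (\<lambda>x::'a. s *\<^sub>R x) = density lborel (\<lambda>_. ennreal (1 / s ^ DIM('a)))" by simp
qed

lemma dilation_M0: "dilation_measure (M0 :: ('m::finite) pt measure) (CARD('m) + 1)"
  unfolding dilation_measure_def
proof (intro allI impI conjI)
  fix s :: real assume s: "s > 0"
  let ?M = "M0 :: 'm pt measure" and ?n = "CARD('m) + 1"
  have D: "distr lborel lborel (\<lambda>x::'m pt. s *\<^sub>R x) = density lborel (\<lambda>_. ennreal (1 / s ^ ?n))"
    using dilation_lborel[where 'a="'m pt"] s by (simp add: dilation_measure_def)
  have h: "s *\<^sub>R x \<in> halfspace \<longleftrightarrow> x \<in> halfspace" for x :: "'m pt"
    using s by (simp add: halfspace_def zero_less_mult_iff)
  show meas: "(\<lambda>x. s *\<^sub>R x) \<in> ?M \<rightarrow>\<^sub>M ?M"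
    unfolding M0_def by (intro measurable_restrict_space3) (auto simp: h)
  show "distr ?M ?M (\<lambda>x. s *\<^sub>R x) = density ?M (\<lambda>_. ennreal (1 / s ^ ?n))"
  proof (rule measure_eqI)
    fix A assume "A \<in> sets (distr ?M ?M (\<lambda>x. s *\<^sub>R x))"
    then have A: "A \<in> sets ?M" by simp
    then have A': "A \<in> sets borel" "A \<subseteq> halfspace"
      by (auto simp: M0_def sets_restrict_space)
    have pre: "(\<lambda>x. s *\<^sub>R x) -` A \<subseteq> halfspace"
    proof
      fix x assume "x \<in> (\<lambda>x. s *\<^sub>R x) -` A"
      then have "s *\<^sub>R x \<in> halfspace" using A'(2) by auto
      then show "x \<in> halfspace" by (simp only: h)
    qed
    have "emeasure (distr ?M ?M (\<lambda>x. s *\<^sub>R x)) A = emeasure ?M ((\<lambda>x. s *\<^sub>R x) -` A \<inter> space ?M)"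
      by (rule emeasure_distr[OF meas A])
    also have "(\<lambda>x. s *\<^sub>R x) -` A \<inter> space ?M = (\<lambda>x. s *\<^sub>R x) -` A"
      using pre by auto
    also have "emeasure ?M \<dots> = emeasure lborel ((\<lambda>x. s *\<^sub>R x) -` A)"
      unfolding M0_def by (rule emeasure_restrict_space) (use pre in auto)
    also have "\<dots> = emeasure (distr lborel lborel (\<lambda>x::'m pt. s *\<^sub>R x)) A"
      using A'(1) by (subst emeasure_distr) auto
    also have "\<dots> = ennreal (1 / s ^ ?n) * emeasure lborel A"
      unfolding D using A'(1) by (subst emeasure_density_const) auto
    also have "emeasure lborel A = emeasure ?M A"
      unfolding M0_def by (rule emeasure_restrict_space[symmetric]) (use A'(2) in auto)
    also have "ennreal (1 / s ^ ?n) * emeasure ?M A = emeasure (density ?M (\<lambda>_. ennreal (1 / s ^ ?n))) A"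
      using A by (subst emeasure_density_const) auto
    finally show "emeasure (distr ?M ?M (\<lambda>x. s *\<^sub>R x)) A = emeasure (density ?M (\<lambda>_. ennreal (1 / s ^ ?n))) A" .
  qed simp
qed

text \<open>For fixed \<open>\<beta>\<close> these operators form a one-parameter group in \<open>t\<close>; the factor decides which norm is
  preserved.\<close>

definition dil :: "real \<Rightarrow> real \<Rightarrow> ('a::euclidean_space \<Rightarrow> 'b::real_vector) \<Rightarrow> 'a \<Rightarrow> 'b" where
  "dil \<beta> t u x = exp (\<beta> * t) *\<^sub>R u (exp t *\<^sub>R x)"

context
  fixes M :: "'a::euclidean_space measure" and n :: nat
  assumes dM: "dilation_measure M n"
begin

lemma dil_meas: "(\<lambda>x. exp t *\<^sub>R x) \<in> M \<rightarrow>\<^sub>M M"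
  using dM by (simp add: dilation_measure_def)

lemma dil_distr: "distr M M (\<lambda>x. exp t *\<^sub>R x) = density M (\<lambda>_. ennreal (exp (- (real n * t))))"
proof -
  have "1 / exp t ^ n = exp (- (real n * t))" by (simp add: exp_minus exp_of_nat_mult inverse_eq_divide)
  then show ?thesis using dM by (simp add: dilation_measure_def)
qed

lemma dil_measurable: "u \<in> borel_measurable M \<Longrightarrow> dil \<beta> t u \<in> borel_measurable M" for u :: "'a \<Rightarrow> 'b::euclidean_space"
  unfolding dil_def[abs_def] by (intro borel_measurable_scaleR borel_measurable_const measurable_compose[OF dil_meas])

lemma dilate_integrable:
  fixes f :: "'a \<Rightarrow> real"
  assumes [measurable]: "f \<in> borel_measurable M"
  shows "integrable M (\<lambda>x. f (exp t *\<^sub>R x)) \<longleftrightarrow> integrable M f"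
proof -
  have "integrable M (\<lambda>x. f (exp t *\<^sub>R x)) \<longleftrightarrow> integrable (distr M M (\<lambda>x. exp t *\<^sub>R x)) f"
    by (rule integrable_distr_eq[OF dil_meas assms, symmetric])
  also have "\<dots> \<longleftrightarrow> integrable M f"
    unfolding dil_distr by (subst integrable_density) auto
  finally show ?thesis .
qed

lemma dilate_integral:
  fixes f :: "'a \<Rightarrow> real"
  assumes [measurable]: "f \<in> borel_measurable M"
  shows "(\<integral>x. f (exp t *\<^sub>R x) \<partial>M) = exp (- (real n * t)) * (\<integral>x. f x \<partial>M)"
proof -
  have "(\<integral>x. f (exp t *\<^sub>R x) \<partial>M) = (\<integral>x. f x \<partial>distr M M (\<lambda>x. exp t *\<^sub>R x))"
    by (rule integral_distr[OF dil_meas assms, symmetric])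
  also have "\<dots> = exp (- (real n * t)) * (\<integral>x. f x \<partial>M)"
    unfolding dil_distr by (subst integral_density) auto
  finally show ?thesis .
qed

lemma dilate_nn_integral:
  assumes [measurable]: "f \<in> borel_measurable M"
  shows "(\<integral>\<^sup>+x. f (exp t *\<^sub>R x) \<partial>M) = ennreal (exp (- (real n * t))) * (\<integral>\<^sup>+x. f x \<partial>M)"
proof -
  have "(\<integral>\<^sup>+x. f (exp t *\<^sub>R x) \<partial>M) = (\<integral>\<^sup>+x. f x \<partial>distr M M (\<lambda>x. exp t *\<^sub>R x))"
    by (rule nn_integral_distr[symmetric]) (use dil_meas in auto)
  also have "\<dots> = ennreal (exp (- (real n * t))) * (\<integral>\<^sup>+x. f x \<partial>M)"
    unfolding dil_distr by (subst nn_integral_density) (auto simp: nn_integral_cmult)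
  finally show ?thesis .
qed

lemma norm_dil_sq: "(norm (dil \<beta> t u x))\<^sup>2 = exp (2 * \<beta> * t) * (norm (u (exp t *\<^sub>R x)))\<^sup>2" for u :: "'a \<Rightarrow> 'b::euclidean_space"
  by (simp add: dil_def power_mult_distrib exp_double[symmetric] mult.assoc)

lemma dil_L2:
  fixes u :: "'a \<Rightarrow> 'b::euclidean_space"
  assumes u: "u \<in> L2 M"
  shows "dil \<beta> t u \<in> L2 M"
    "(\<integral>x. (norm (dil \<beta> t u x))\<^sup>2 \<partial>M) = exp (2 * \<beta> * t - real n * t) * (\<integral>x. (norm (u x))\<^sup>2 \<partial>M)"
proof -
  have m: "(\<lambda>x. (norm (u x))\<^sup>2) \<in> borel_measurable M" using L2_measurable[OF u] by measurable
  show "dil \<beta> t u \<in> L2 M"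
    unfolding L2_def using dil_measurable[OF L2_measurable[OF u]] dilate_integrable[OF m, of t] L2_integrable[OF u]
    by (auto simp: norm_dil_sq)
  show "(\<integral>x. (norm (dil \<beta> t u x))\<^sup>2 \<partial>M) = exp (2 * \<beta> * t - real n * t) * (\<integral>x. (norm (u x))\<^sup>2 \<partial>M)"
    unfolding norm_dil_sq using dilate_integral[OF m, of t] by (simp add: exp_diff exp_minus divide_inverse)
qed

lemma dil_diff: "dil \<beta> t (\<lambda>x. u x - v x) = (\<lambda>x. dil \<beta> t u x - dil \<beta> t v x)" for u v :: "'a \<Rightarrow> 'b::euclidean_space"
  by (auto simp: dil_def algebra_simps)

lemma L2_tendsto_dil:
  fixes g :: "'a \<Rightarrow> 'b::euclidean_space"
  assumes f: "L2_tendsto M f g" and [measurable]: "\<And>k. f k \<in> borel_measurable M" "g \<in> borel_measurable M"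
  shows "L2_tendsto M (\<lambda>k. dil \<beta> t (f k)) (dil \<beta> t g)"
proof -
  have "(\<integral>\<^sup>+x. ennreal ((norm (dil \<beta> t (f k) x - dil \<beta> t g x))\<^sup>2) \<partial>M) =
     ennreal (exp (2 * \<beta> * t)) * (ennreal (exp (- (real n * t))) * (\<integral>\<^sup>+x. ennreal ((norm (f k x - g x))\<^sup>2) \<partial>M))" for k
  proof -
    have "(norm (dil \<beta> t (f k) x - dil \<beta> t g x))\<^sup>2 = exp (2 * \<beta> * t) * (norm (f k (exp t *\<^sub>R x) - g (exp t *\<^sub>R x)))\<^sup>2" for x
      using norm_dil_sq[of \<beta> t "\<lambda>x. f k x - g x"] by (simp add: dil_diff)
    then have "(\<integral>\<^sup>+x. ennreal ((norm (dil \<beta> t (f k) x - dil \<beta> t g x))\<^sup>2) \<partial>M) =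
      (\<integral>\<^sup>+x. ennreal (exp (2 * \<beta> * t)) * ennreal ((norm (f k (exp t *\<^sub>R x) - g (exp t *\<^sub>R x)))\<^sup>2) \<partial>M)"
      by (simp add: ennreal_mult)
    also have "\<dots> = ennreal (exp (2 * \<beta> * t)) * (\<integral>\<^sup>+x. ennreal ((norm (f k (exp t *\<^sub>R x) - g (exp t *\<^sub>R x)))\<^sup>2) \<partial>M)"
      by (rule nn_integral_cmult) (rule measurable_compose[OF dil_meas], measurable)
    also have "(\<integral>\<^sup>+x. ennreal ((norm (f k (exp t *\<^sub>R x) - g (exp t *\<^sub>R x)))\<^sup>2) \<partial>M) = ennreal (exp (- (real n * t))) * (\<integral>\<^sup>+x. ennreal ((norm (f k x - g x))\<^sup>2) \<partial>M)"
      by (rule dilate_nn_integral) measurable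
    finally show ?thesis .
  qed
  moreover have "(\<lambda>k. ennreal (exp (2 * \<beta> * t)) * (ennreal (exp (- (real n * t))) * (\<integral>\<^sup>+x. ennreal ((norm (f k x - g x))\<^sup>2) \<partial>M)))
     \<longlonglongrightarrow> ennreal (exp (2 * \<beta> * t)) * (ennreal (exp (- (real n * t))) * 0)"
    by (intro ennreal_tendsto_cmult f[unfolded L2_tendsto_def]) auto
  ultimately show ?thesis by (simp add: L2_tendsto_def)
qed

end

text \<open>The chain rule produces one more factor \<open>exp t\<close> in the gradient, hence the exponent \<open>\<beta> + 1\<close>.\<close>

lemma Sob_dil:
  fixes u :: "('m::finite) pt \<Rightarrow> real"
  assumes S: "Sob M0 lborel u G T"
  shows "Sob M0 lborel (dil \<beta> t u) (dil (\<beta> + 1) t G) (dil \<beta> t T)"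
proof -
  obtain \<phi> where p: "\<And>k. \<phi> k \<in> test_functions" "L2_tendsto M0 \<phi> u" "L2_tendsto M0 (\<lambda>k. grad (\<phi> k)) G"
     "L2_tendsto lborel (\<lambda>k y. \<phi> k (y, 0)) T"
    using S by (auto simp: Sob_def)
  note t = M0.test_L2[OF p(1), THEN L2_measurable] and s = M0.Sob_L2[OF S, THEN L2_measurable]
  have lb: "dilation_measure (lborel :: (real^'m) measure) DIM(real^'m)" by (rule dilation_lborel)
  have t': "dil \<beta> t (\<phi> k) \<in> test_functions" for k
    unfolding dil_def[abs_def] using test_cmult[OF test_scale[OF p(1)], of "exp t" "exp (\<beta> * t)"] by simp
  have g: "grad (dil \<beta> t (\<phi> k)) = dil (\<beta> + 1) t (grad (\<phi> k))" for k
    unfolding dil_def[abs_def] real_scaleR_def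
    by (simp add: grad_cmult[OF smooth_scale[OF test_smooth[OF p(1)]]] grad_scale[OF test_smooth[OF p(1)]] algebra_simps exp_add)
  have b: "(\<lambda>y. dil \<beta> t (\<phi> k) (y, 0)) = dil \<beta> t (\<lambda>y. \<phi> k (y, 0))" for k
    by (auto simp: dil_def)
  show ?thesis
    unfolding Sob_def
  proof (intro conjI exI[of _ "\<lambda>k. dil \<beta> t (\<phi> k)"] allI t')
    show "L2_tendsto M0 (\<lambda>k. grad (dil \<beta> t (\<phi> k))) (dil (\<beta> + 1) t G)"
      unfolding g by (rule L2_tendsto_dil[OF dilation_M0 p(3) t(2) s(2)])
    show "L2_tendsto lborel (\<lambda>k y. dil \<beta> t (\<phi> k) (y, 0)) (dil \<beta> t T)"
      unfolding b by (rule L2_tendsto_dil[OF lb p(4) t(3) s(3)])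
    show "L2_tendsto M0 (\<lambda>k. dil \<beta> t (\<phi> k)) (dil \<beta> t u)"
      by (rule L2_tendsto_dil[OF dilation_M0 p(2) t(1) s(1)])
  qed (intro dil_measurable[OF dilation_M0] dil_measurable[OF lb] s)+
qed

text \<open>The generator of the dilations \<open>dil \<beta>\<close>.\<close>

definition radial :: "real \<Rightarrow> ('a::euclidean_space \<Rightarrow> real) \<Rightarrow> ('a \<Rightarrow> 'a) \<Rightarrow> 'a \<Rightarrow> real" where
  "radial \<beta> u G x = x \<bullet> G x + \<beta> * u x"

lemma dil_derivative:
  assumes f: "C1 f F"
  shows "((\<lambda>t. dil \<beta> t f x) has_real_derivative dil \<beta> t (radial \<beta> f F) x) (at t)"
proof -
  have "((\<lambda>t. f (exp t *\<^sub>R x)) has_derivative (\<lambda>v. F (exp t *\<^sub>R x) \<bullet> ((v * exp t) *\<^sub>R x))) (at t)"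
    by (intro has_derivative_compose[of "\<lambda>t. exp t *\<^sub>R x" _ _ _ f] C1_has_derivative[OF f]) (auto intro!: derivative_eq_intros)
  then have 1: "((\<lambda>t. f (exp t *\<^sub>R x)) has_real_derivative (F (exp t *\<^sub>R x) \<bullet> (exp t *\<^sub>R x))) (at t)"
    unfolding has_field_derivative_def by (rule has_derivative_eq_rhs) (auto simp: mult.commute)
  have 2: "((\<lambda>t. exp (\<beta> * t)) has_real_derivative (exp (\<beta> * t) * \<beta>)) (at t)"
    by (auto intro!: derivative_eq_intros)
  show ?thesis
    unfolding dil_def real_scaleR_def
    by (rule DERIV_cong[OF DERIV_mult[OF 2 1]]) (simp add: radial_def inner_commute algebra_simps)
qed

text \<open>The Cauchy--Schwarz inequality for the increment as an integral along the orbit, at a fixed point.\<close>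

lemma dil_increment_sq:
  assumes f: "C1 f F"
  shows "(dil \<beta> t f x - f x)\<^sup>2 \<le> \<bar>t\<bar> * (\<integral>s. indicator {min 0 t..max 0 t} s * (dil \<beta> s (radial \<beta> f F) x)\<^sup>2 \<partial>lborel)"
    "integrable lborel (\<lambda>s. indicator {min 0 t..max 0 t} s * (dil \<beta> s (radial \<beta> f F) x)\<^sup>2)"
proof -
  let ?a = "min 0 t" and ?b = "max 0 t"
  let ?h = "\<lambda>s. dil \<beta> s f x" and ?d = "\<lambda>s. dil \<beta> s (radial \<beta> f F) x"
  let ?J = "\<lambda>s. indicator {?a..?b} s :: real"
  note cont = C1_continuous[OF f]
  have zc: "continuous_on UNIV (radial \<beta> f F)" unfolding radial_def[abs_def] by (intro continuous_intros cont)
  have dc: "continuous_on S ?d" for S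
    unfolding dil_def by (intro continuous_intros continuous_on_compose2[OF zc]) auto
  have ab: "?a \<le> ?b" by simp
  show i: "integrable lborel (\<lambda>s. ?J s * (?d s)\<^sup>2)"
    using borel_integrable_compact[OF compact_Icc continuous_on_power[OF dc, of _ 2], of ?a ?b] by simp
  have [measurable]: "?d \<in> borel_measurable borel" by (rule borel_measurable_continuous_onI[OF dc])
  have sq: "(?J s * ?d s)\<^sup>2 = ?J s * (?d s)\<^sup>2" for s by (simp add: indicator_def)
  have Jsq: "(norm (?J s))\<^sup>2 = ?J s" for s by (simp add: indicator_def)
  have L: "(\<lambda>s. ?J s * ?d s) \<in> L2 lborel" "?J \<in> L2 lborel"
    unfolding L2_def mem_Collect_eq Jsq using i by (auto simp: sq intro!: integrable_real_indicator)
  have J2: "(\<integral>s. (norm (?J s))\<^sup>2 \<partial>lborel) = \<bar>t\<bar>"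
  proof -
    have "(norm (?J s))\<^sup>2 = ?J s" for s by (simp add: indicator_def)
    then show ?thesis by (auto simp: min_def max_def)
  qed
  have "(\<integral>s. ?J s *\<^sub>R ?d s \<partial>lborel) = ?h ?b - ?h ?a"
    by (rule integral_FTC_atLeastAtMost[OF ab])
       (use dil_derivative[OF f] dc in \<open>auto simp: has_real_derivative_iff_has_vector_derivative[symmetric] intro: DERIV_subset\<close>)
  then have e: "(\<integral>s. (?J s * ?d s) \<bullet> ?J s \<partial>lborel) = ?h ?b - ?h ?a"
  proof -
    have "(?J s * ?d s) \<bullet> ?J s = ?J s *\<^sub>R ?d s" for s by (simp add: indicator_def)
    then show ?thesis using \<open>(\<integral>s. ?J s *\<^sub>R ?d s \<partial>lborel) = _\<close> by (simp only:)
  qed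
  have h0: "?h 0 = f x" by (simp add: dil_def)
  have "(?h t - f x)\<^sup>2 = (?h ?b - ?h ?a)\<^sup>2"
    using h0 by (cases "t \<ge> 0") (auto simp: min_def max_def power2_commute)
  also have "\<dots> \<le> (\<integral>s. (norm (?J s * ?d s))\<^sup>2 \<partial>lborel) * \<bar>t\<bar>"
    using L2_Cauchy_Schwarz[OF L] unfolding e J2 .
  also have "(\<integral>s. (norm (?J s * ?d s))\<^sup>2 \<partial>lborel) = (\<integral>s. ?J s * (?d s)\<^sup>2 \<partial>lborel)"
    by (simp add: sq)
  finally show "(?h t - f x)\<^sup>2 \<le> \<bar>t\<bar> * (\<integral>s. ?J s * (?d s)\<^sup>2 \<partial>lborel)" by (simp add: mult.commute)
qed

text \<open>Along the dilation group the increment is the integral of the dilated generator, whose norm is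
  controlled by scaling.\<close>

lemma dil_increment_test:
  fixes f :: "('m::finite) pt \<Rightarrow> real"
  assumes f: "f \<in> test_functions" and t: "\<bar>t\<bar> \<le> 1"
  shows "(\<integral>x. (dil \<beta> t f x - f x)\<^sup>2 \<partial>M0) \<le>
    t\<^sup>2 * (exp \<bar>2 * \<beta> - real (CARD('m) + 1)\<bar> * (\<integral>x. (radial \<beta> f (grad f) x)\<^sup>2 \<partial>M0))"
proof -
  let ?z = "radial \<beta> f (grad f)" and ?n = "CARD('m) + 1"
  let ?J = "\<lambda>s. indicator {min 0 t..max 0 t} s :: real"
  let ?c = "exp \<bar>2 * \<beta> - real ?n\<bar>"
  note C = test_C1[OF f]
  note cont = C1_continuous[OF C]
  obtain R where R: "\<And>x. norm x \<ge> R \<Longrightarrow> f x = 0 \<and> grad f x = 0" using test_C1c[OF f] unfolding C1c_def by blast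
  have zc: "continuous_on UNIV ?z" unfolding radial_def[abs_def] by (intro continuous_intros cont)
  have zL: "?z \<in> L2 M0" by (rule M0.compact_L2(1)[OF zc, of R]) (simp add: radial_def R)
  have [measurable]: "?z \<in> borel_measurable borel" by (rule borel_measurable_continuous_onI[OF zc])
  have dm: "(\<lambda>(x, s). indicator halfspace x * (ennreal (\<bar>t\<bar> * (?J s * (dil \<beta> s ?z x)\<^sup>2)))) \<in> borel_measurable (lborel \<Otimes>\<^sub>M lborel)"
    unfolding dil_def by measurable
  have dL: "(\<lambda>x. dil \<beta> t f x - f x) \<in> L2 M0"
    by (intro L2_diff dil_L2(1)[OF dilation_M0] M0.test_L2(1) f)
  have "ennreal (\<integral>x. (dil \<beta> t f x - f x)\<^sup>2 \<partial>M0) = (\<integral>\<^sup>+x. ennreal ((dil \<beta> t f x - f x)\<^sup>2) \<partial>M0)"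
    using L2_integrable[OF dL] by (intro nn_integral_eq_integral[symmetric]) auto
  also have "\<dots> \<le> (\<integral>\<^sup>+x. (\<integral>\<^sup>+s. ennreal (\<bar>t\<bar> * (?J s * (dil \<beta> s ?z x)\<^sup>2)) \<partial>lborel) \<partial>M0)"
  proof (intro nn_integral_mono)
    fix x :: "'m pt"
    have "ennreal ((dil \<beta> t f x - f x)\<^sup>2) \<le> ennreal (\<integral>s. \<bar>t\<bar> * (?J s * (dil \<beta> s ?z x)\<^sup>2) \<partial>lborel)"
      using dil_increment_sq(1)[OF C, of \<beta> t x] by (intro ennreal_leI) simp
    also have "\<dots> = (\<integral>\<^sup>+s. ennreal (\<bar>t\<bar> * (?J s * (dil \<beta> s ?z x)\<^sup>2)) \<partial>lborel)"
      by (intro nn_integral_eq_integral[symmetric] integrable_mult_right dil_increment_sq(2)[OF C]) auto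
    finally show "ennreal ((dil \<beta> t f x - f x)\<^sup>2) \<le> (\<integral>\<^sup>+s. ennreal (\<bar>t\<bar> * (?J s * (dil \<beta> s ?z x)\<^sup>2)) \<partial>lborel)" .
  qed
  also have "\<dots> = (\<integral>\<^sup>+x. (\<integral>\<^sup>+s. indicator halfspace x * ennreal (\<bar>t\<bar> * (?J s * (dil \<beta> s ?z x)\<^sup>2)) \<partial>lborel) \<partial>lborel)"
    unfolding M0_def dil_def by (subst nn_integral_restrict_space) (auto simp: nn_integral_cmult mult.commute intro!: nn_integral_cong)
  also have "\<dots> = (\<integral>\<^sup>+s. (\<integral>\<^sup>+x. indicator halfspace x * ennreal (\<bar>t\<bar> * (?J s * (dil \<beta> s ?z x)\<^sup>2)) \<partial>lborel) \<partial>lborel)"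
    by (rule lborel_pair.Fubini'[symmetric, OF dm])
  also have "\<dots> = (\<integral>\<^sup>+s. (\<integral>\<^sup>+x. ennreal (\<bar>t\<bar> * ?J s) * ennreal ((norm (dil \<beta> s ?z x))\<^sup>2) \<partial>M0) \<partial>lborel)"
    unfolding M0_def by (subst nn_integral_restrict_space) (auto simp: ennreal_mult'' mult.assoc mult.commute intro!: nn_integral_cong split: split_indicator)
  also have "\<dots> = (\<integral>\<^sup>+s. ennreal (\<bar>t\<bar> * ?J s) * ennreal (exp (2 * \<beta> * s - real ?n * s) * (\<integral>x. (norm (?z x))\<^sup>2 \<partial>M0)) \<partial>lborel)"
  proof (intro nn_integral_cong)
    fix s
    have d: "dil \<beta> s ?z \<in> L2 M0" by (rule dil_L2(1)[OF dilation_M0 zL])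
    have "(\<integral>\<^sup>+x. ennreal (\<bar>t\<bar> * ?J s) * ennreal ((norm (dil \<beta> s ?z x))\<^sup>2) \<partial>M0) = ennreal (\<bar>t\<bar> * ?J s) * (\<integral>\<^sup>+x. ennreal ((norm (dil \<beta> s ?z x))\<^sup>2) \<partial>M0)"
      using L2_measurable[OF d] by (intro nn_integral_cmult) measurable
    also have "(\<integral>\<^sup>+x. ennreal ((norm (dil \<beta> s ?z x))\<^sup>2) \<partial>M0) = ennreal (\<integral>x. (norm (dil \<beta> s ?z x))\<^sup>2 \<partial>M0)"
      by (intro nn_integral_eq_integral L2_integrable[OF d]) auto
    finally show "(\<integral>\<^sup>+x. ennreal (\<bar>t\<bar> * ?J s) * ennreal ((norm (dil \<beta> s ?z x))\<^sup>2) \<partial>M0) =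
       ennreal (\<bar>t\<bar> * ?J s) * ennreal (exp (2 * \<beta> * s - real ?n * s) * (\<integral>x. (norm (?z x))\<^sup>2 \<partial>M0))"
      by (simp only: dil_L2(2)[OF dilation_M0 zL])
  qed
  also have "\<dots> \<le> (\<integral>\<^sup>+s. ennreal (\<bar>t\<bar> * (?c * (\<integral>x. (norm (?z x))\<^sup>2 \<partial>M0))) * indicator {min 0 t..max 0 t} s \<partial>lborel)"
  proof (intro nn_integral_mono)
    fix s
    show "ennreal (\<bar>t\<bar> * ?J s) * ennreal (exp (2 * \<beta> * s - real ?n * s) * (\<integral>x. (norm (?z x))\<^sup>2 \<partial>M0)) \<le>
       ennreal (\<bar>t\<bar> * (?c * (\<integral>x. (norm (?z x))\<^sup>2 \<partial>M0))) * indicator {min 0 t..max 0 t} s"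
    proof (cases "s \<in> {min 0 t..max 0 t}")
      case True
      then have "\<bar>s\<bar> \<le> 1" using t by auto
      have "2 * \<beta> * s - real ?n * s \<le> \<bar>(2 * \<beta> - real ?n) * s\<bar>" by (simp add: left_diff_distrib)
      also have "\<dots> \<le> \<bar>2 * \<beta> - real ?n\<bar>"
        using \<open>\<bar>s\<bar> \<le> 1\<close> unfolding abs_mult by (rule mult_left_le) auto
      finally have "exp (2 * \<beta> * s - real ?n * s) \<le> ?c" by simp
      then have "\<bar>t\<bar> * (exp (2 * \<beta> * s - real ?n * s) * (\<integral>x. (norm (?z x))\<^sup>2 \<partial>M0)) \<le> \<bar>t\<bar> * (?c * (\<integral>x. (norm (?z x))\<^sup>2 \<partial>M0))"
        by (intro mult_left_mono mult_right_mono) auto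
      from ennreal_leI[OF this] show ?thesis using True by (simp add: ennreal_mult)
    qed simp
  qed
  also have "\<dots> = ennreal (\<bar>t\<bar> * (?c * (\<integral>x. (norm (?z x))\<^sup>2 \<partial>M0))) * ennreal \<bar>t\<bar>"
    by (subst nn_integral_cmult_indicator) (auto simp: min_def max_def)
  also have "\<dots> = ennreal (t\<^sup>2 * (?c * (\<integral>x. (?z x)\<^sup>2 \<partial>M0)))"
  proof -
    have "\<bar>t\<bar> * X * \<bar>t\<bar> = t\<^sup>2 * X" for X
      by (simp only: power2_abs[of t, symmetric] power2_eq_square mult_ac)
    then show ?thesis by (subst ennreal_mult[symmetric]) auto
  qed
  finally show ?thesis by (subst (asm) ennreal_le_iff) auto
qed

text \<open>The factor \<open>x\<close> in the generator is absorbed by the weight, since \<open>|x|\<^sup>2 \<le> 4 K\<close>; this is where the weighted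
  convergence of gradients enters the unweighted calculus.\<close>

lemma radial_tendsto:
  fixes \<phi> :: "nat \<Rightarrow> ('m::finite) pt \<Rightarrow> real"
  assumes p: "L2_tendsto MH \<phi> u" "L2_tendsto MH F G"
    and m: "\<And>k. \<phi> k \<in> borel_measurable M0" "\<And>k. F k \<in> borel_measurable M0" "u \<in> borel_measurable M0" "G \<in> borel_measurable M0"
  shows "L2_tendsto M0 (\<lambda>k. radial \<beta> (\<phi> k) (F k)) (radial \<beta> u G)"
proof -
  note [measurable] = m
  have [measurable]: "(\<lambda>x. x) \<in> borel_measurable (M0 :: 'm pt measure)"
    by (intro continuous_measurable_M0 continuous_intros)
  have 1: "L2_tendsto M0 (\<lambda>k x. x \<bullet> F k x) (\<lambda>x. x \<bullet> G x)"
    unfolding L2_tendsto_def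
  proof (rule ennreal_tendsto_zero_le)
    show "(\<lambda>k. 4 * (\<integral>\<^sup>+x. ennreal ((norm (F k x - G x))\<^sup>2) \<partial>MH)) \<longlonglongrightarrow> 0"
      using ennreal_tendsto_cmult[OF _ p(2)[unfolded L2_tendsto_def], of 4] by simp
    fix k
    have "(\<integral>\<^sup>+x. ennreal ((norm (x \<bullet> F k x - x \<bullet> G x))\<^sup>2) \<partial>M0) \<le> (\<integral>\<^sup>+x. 4 * (ennreal (K x) * ennreal ((norm (F k x - G x))\<^sup>2)) \<partial>M0)"
    proof (intro nn_integral_mono)
      fix x :: "'m pt"
      have "(norm (x \<bullet> F k x - x \<bullet> G x))\<^sup>2 \<le> (norm x * norm (F k x - G x))\<^sup>2"
        unfolding inner_diff_right[symmetric] real_norm_def using Cauchy_Schwarz_ineq2[of x "F k x - G x"]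
        by (intro power_mono) auto
      also have "\<dots> \<le> 4 * K x * (norm (F k x - G x))\<^sup>2"
        unfolding power_mult_distrib by (intro mult_right_mono norm2_le_K) auto
      finally have "ennreal ((norm (x \<bullet> F k x - x \<bullet> G x))\<^sup>2) \<le> ennreal (4 * K x * (norm (F k x - G x))\<^sup>2)" by (rule ennreal_leI)
      then show "ennreal ((norm (x \<bullet> F k x - x \<bullet> G x))\<^sup>2) \<le> 4 * (ennreal (K x) * ennreal ((norm (F k x - G x))\<^sup>2))"
        by (simp add: ennreal_mult mult.assoc)
    qed
    also have "\<dots> = 4 * (\<integral>\<^sup>+x. ennreal ((norm (F k x - G x))\<^sup>2) \<partial>MH)"
      by (subst nn_integral_MH) (auto intro!: nn_integral_cmult)
    finally show "(\<integral>\<^sup>+x. ennreal ((norm (x \<bullet> F k x - x \<bullet> G x))\<^sup>2) \<partial>M0) \<le> 4 * (\<integral>\<^sup>+x. ennreal ((norm (F k x - G x))\<^sup>2) \<partial>MH)" .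
  qed
  have 2: "L2_tendsto M0 (\<lambda>k x. \<beta> * \<phi> k x) (\<lambda>x. \<beta> * u x)"
    using L2_tendsto_scaleR[OF L2_tendsto_MH_imp_M0[OF p(1)], of \<beta>] m by simp
  show ?thesis
    unfolding radial_def[abs_def] by (rule L2_tendsto_add[OF 1 2]) measurable
qed

lemma radial_test_L2:
  assumes "f \<in> test_functions" shows "radial \<beta> f (grad f) \<in> L2 M0"
proof -
  obtain R where R: "\<And>x. norm x \<ge> R \<Longrightarrow> f x = 0 \<and> grad f x = 0" using test_C1c[OF assms] unfolding C1c_def by blast
  have "continuous_on UNIV (radial \<beta> f (grad f))"
    unfolding radial_def[abs_def] by (intro continuous_intros C1_continuous[OF test_C1[OF assms]])
  then show ?thesis by (rule M0.compact_L2(1)[of _ R]) (simp add: radial_def R)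
qed

lemma radial_L2:
  assumes S: "Sob MH MB u G T" shows "radial \<beta> u G \<in> L2 M0"
proof -
  obtain \<phi> where p: "\<And>k. \<phi> k \<in> test_functions" "L2_tendsto MH \<phi> u" "L2_tendsto MH (\<lambda>k. grad (\<phi> k)) G"
    using S by (auto simp: Sob_def)
  note t = M0.test_L2[OF p(1), THEN L2_measurable] and s = M0.Sob_L2[OF Sob_MH_imp_M0[OF S], THEN L2_measurable]
  have [measurable]: "(\<lambda>x. x) \<in> borel_measurable (M0 :: 'a pt measure)"
    by (intro continuous_measurable_M0 continuous_intros)
  note [measurable] = s
  have "radial \<beta> u G \<in> borel_measurable M0" unfolding radial_def[abs_def] by measurable
  then show ?thesis
    by (rule L2_tendsto_in_L2[OF radial_tendsto[OF p(2,3) t(1,2) s(1,2)] radial_test_L2[OF p(1)]])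
qed

lemma dil_increment:
  fixes u :: "('m::finite) pt \<Rightarrow> real"
  assumes S: "Sob MH MB u G T" and t: "\<bar>t\<bar> \<le> 1"
  shows "(\<integral>x. (dil \<beta> t u x - u x)\<^sup>2 \<partial>M0) \<le>
    t\<^sup>2 * (exp \<bar>2 * \<beta> - real (CARD('m) + 1)\<bar> * (\<integral>x. (radial \<beta> u G x)\<^sup>2 \<partial>M0))"
proof -
  obtain \<phi> where p: "\<And>k. \<phi> k \<in> test_functions" "L2_tendsto MH \<phi> u" "L2_tendsto MH (\<lambda>k. grad (\<phi> k)) G"
    using S by (auto simp: Sob_def)
  note tl = M0.test_L2[OF p(1)] and sl = M0.Sob_L2[OF Sob_MH_imp_M0[OF S]]
  note tm = tl[THEN L2_measurable] and s = sl[THEN L2_measurable]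
  have p0: "L2_tendsto M0 \<phi> u" by (rule L2_tendsto_MH_imp_M0[OF p(2) tm(1) s(1)])
  have d: "L2_tendsto M0 (\<lambda>k. dil \<beta> t (\<phi> k)) (dil \<beta> t u)" by (rule L2_tendsto_dil[OF dilation_M0 p0 tm(1) s(1)])
  note dm = dil_measurable[OF dilation_M0]
  have neg: "L2_tendsto M0 (\<lambda>k x. - \<phi> k x) (\<lambda>x. - u x)"
    using L2_tendsto_scaleR[OF p0 s(1) tm(1), of "-1"] by simp
  have dd: "L2_tendsto M0 (\<lambda>k x. dil \<beta> t (\<phi> k) x - \<phi> k x) (\<lambda>x. dil \<beta> t u x - u x)"
    using L2_tendsto_add[OF d neg dm[OF s(1)] dm[OF tm(1)]] s(1) tm(1) by simp
  have "(\<lambda>k. \<integral>x. (norm (dil \<beta> t (\<phi> k) x - \<phi> k x))\<^sup>2 \<partial>M0) \<longlonglongrightarrow> (\<integral>x. (norm (dil \<beta> t u x - u x))\<^sup>2 \<partial>M0)"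
    by (intro L2_tendsto_integral_sq dd L2_diff dil_L2(1)[OF dilation_M0] tl borel_measurable_diff dm s)
  moreover have "(\<lambda>k. t\<^sup>2 * (exp \<bar>2 * \<beta> - real (CARD('m) + 1)\<bar> * (\<integral>x. (norm (radial \<beta> (\<phi> k) (grad (\<phi> k)) x))\<^sup>2 \<partial>M0))) \<longlonglongrightarrow>
     t\<^sup>2 * (exp \<bar>2 * \<beta> - real (CARD('m) + 1)\<bar> * (\<integral>x. (norm (radial \<beta> u G x))\<^sup>2 \<partial>M0))"
    by (intro tendsto_mult tendsto_const L2_tendsto_integral_sq radial_tendsto p tm s radial_test_L2 L2_measurable[OF radial_L2[OF S]])
  moreover have "(\<integral>x. (norm (dil \<beta> t (\<phi> k) x - \<phi> k x))\<^sup>2 \<partial>M0) \<le>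
    t\<^sup>2 * (exp \<bar>2 * \<beta> - real (CARD('m) + 1)\<bar> * (\<integral>x. (norm (radial \<beta> (\<phi> k) (grad (\<phi> k)) x))\<^sup>2 \<partial>M0))" for k
    using dil_increment_test[OF p(1) t] by simp
  ultimately have "(\<integral>x. (norm (dil \<beta> t u x - u x))\<^sup>2 \<partial>M0) \<le>
     t\<^sup>2 * (exp \<bar>2 * \<beta> - real (CARD('m) + 1)\<bar> * (\<integral>x. (norm (radial \<beta> u G x))\<^sup>2 \<partial>M0))"
    by (intro LIMSEQ_le[of "\<lambda>k. \<integral>x. (norm (dil \<beta> t (\<phi> k) x - \<phi> k x))\<^sup>2 \<partial>M0" _
       "\<lambda>k. t\<^sup>2 * (exp \<bar>2 * \<beta> - real (CARD('m) + 1)\<bar> * (\<integral>x. (norm (radial \<beta> (\<phi> k) (grad (\<phi> k)) x))\<^sup>2 \<partial>M0))"]) blast+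
  then show ?thesis by simp
qed

lemma dil_quotient_test:
  fixes f :: "('m::finite) pt \<Rightarrow> real"
  assumes f: "f \<in> test_functions" and t: "t \<longlonglongrightarrow> 0" "\<And>n. t n \<noteq> 0" "\<And>n. \<bar>t n\<bar> \<le> 1"
  shows "L2_tendsto M0 (\<lambda>n x. (dil \<beta> (t n) f x - f x) / t n) (radial \<beta> f (grad f))"
proof -
  let ?z = "radial \<beta> f (grad f)"
  note C = test_C1[OF f]
  note cont = C1_continuous[OF C]
  obtain R where R: "R > 0" "\<And>x. norm x \<ge> R \<Longrightarrow> f x = 0 \<and> grad f x = 0" using test_C1c[OF f] unfolding C1c_def by blast
  have z0: "?z x = 0" if "norm x \<ge> R" for x using R(2)[OF that] by (simp add: radial_def)
  have zc: "continuous_on UNIV ?z" unfolding radial_def[abs_def] by (intro continuous_intros cont)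
  have "bounded (?z ` cball 0 R)"
    by (intro compact_imp_bounded compact_continuous_image continuous_on_subset[OF zc]) auto
  then obtain B where B: "B > 0" "\<And>x. x \<in> cball 0 R \<Longrightarrow> norm (?z x) \<le> B" unfolding bounded_pos by blast
  have zB: "\<bar>?z x\<bar> \<le> B" for x using B z0[of x] by (cases "norm x \<le> R") auto
  define D where "D = exp \<bar>\<beta>\<bar> * B"
  have D0: "D > 0" using B by (simp add: D_def)
  have dB: "(dil \<beta> s ?z x)\<^sup>2 \<le> D\<^sup>2" if "\<bar>s\<bar> \<le> 1" for s x
  proof -
    have "\<beta> * s \<le> \<bar>\<beta>\<bar> * \<bar>s\<bar>" using abs_ge_self[of "\<beta> * s"] by (simp add: abs_mult)
    also have "\<dots> \<le> \<bar>\<beta>\<bar>" using that by (simp add: mult_left_le)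
    finally have "\<bar>dil \<beta> s ?z x\<bar> \<le> D"
      unfolding D_def dil_def real_scaleR_def abs_mult using zB by (intro mult_mono) auto
    then show ?thesis using D0 by (simp add: abs_le_square_iff[symmetric])
  qed
  have far: "norm (exp s *\<^sub>R x) \<ge> R" if "\<bar>s\<bar> \<le> 1" "norm x \<ge> 3 * R" for s and x :: "'m pt"
  proof -
    have "exp (1::real) \<le> 3" by (rule exp_le)
    then have "1 / 3 \<le> exp (- 1 :: real)" by (simp add: exp_minus field_simps)
    also have "\<dots> \<le> exp s" using that by simp
    finally have "1 / 3 * (3 * R) \<le> exp s * norm x" using that R(1) by (intro mult_mono) auto
    then show ?thesis by simp
  qed
  define q where "q n x = (dil \<beta> (t n) f x - f x) / t n" for n x
  have qB: "(q n x)\<^sup>2 \<le> D\<^sup>2" for n x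
  proof -
    let ?J = "\<lambda>s. indicator {min 0 (t n)..max 0 (t n)} s :: real"
    have "(dil \<beta> (t n) f x - f x)\<^sup>2 \<le> \<bar>t n\<bar> * (\<integral>s. ?J s * (dil \<beta> s ?z x)\<^sup>2 \<partial>lborel)"
      by (rule dil_increment_sq(1)[OF C])
    also have "(\<integral>s. ?J s * (dil \<beta> s ?z x)\<^sup>2 \<partial>lborel) \<le> (\<integral>s. ?J s * D\<^sup>2 \<partial>lborel)"
    proof (rule integral_mono[OF dil_increment_sq(2)[OF C]])
      show "integrable lborel (\<lambda>s. ?J s * D\<^sup>2)" by (intro integrable_mult_left integrable_real_indicator) auto
      show "?J s * (dil \<beta> s ?z x)\<^sup>2 \<le> ?J s * D\<^sup>2" for s
        using t(3)[of n] dB[of s x] by (auto simp: indicator_def)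
    qed
    also have "(\<integral>s. ?J s * D\<^sup>2 \<partial>lborel) = \<bar>t n\<bar> * D\<^sup>2" by (auto simp: min_def max_def)
    finally have "(dil \<beta> (t n) f x - f x)\<^sup>2 \<le> (t n)\<^sup>2 * D\<^sup>2" by (simp add: mult_left_mono power2_eq_square mult.assoc[symmetric])
    then show ?thesis using t(2)[of n] by (simp add: q_def power_divide divide_le_eq mult.commute)
  qed
  have zD: "(?z x)\<^sup>2 \<le> D\<^sup>2" for x using dB[of 0 x] by (simp add: dil_def)
  have fm: "f \<in> borel_measurable M0" by (rule L2_measurable[OF M0.test_L2(1)[OF f]])
  have "L2_tendsto M0 q ?z"
  proof (rule L2_tendsto_dominated[where w="\<lambda>x. 4 * D\<^sup>2 * indicator (cball 0 (3 * R)) x"])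
    show "q n \<in> borel_measurable M0" for n
      unfolding q_def[abs_def] using dil_measurable[OF dilation_M0 fm] fm by measurable
    show "?z \<in> borel_measurable M0" by (rule continuous_measurable_M0[OF zc])
    show "integrable M0 (\<lambda>x::'m pt. 4 * D\<^sup>2 * indicator (cball 0 (3 * R)) x)"
      by (intro integrable_lborel_imp_M0 integrable_mult_right integrable_real_indicator)
         (auto simp: emeasure_lborel_cball_finite[unfolded infinity_ennreal_def])
    have "(norm (q n x - ?z x))\<^sup>2 \<le> 4 * D\<^sup>2 * indicator (cball 0 (3 * R)) x" for n x
    proof (cases "norm x \<le> 3 * R")
      case True
      have "(norm (q n x - ?z x))\<^sup>2 \<le> 2 * (norm (q n x))\<^sup>2 + 2 * (norm (?z x))\<^sup>2" by (rule norm_diff_sq_le)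
      also have "\<dots> \<le> 4 * D\<^sup>2" using qB[of n x] zD[of x] by simp
      finally show ?thesis using True by (simp add: indicator_def)
    next
      case False
      then have x: "norm x \<ge> 3 * R" "norm x \<ge> R" using R(1) by auto
      have "f (exp (t n) *\<^sub>R x) = 0" using R(2)[OF far[OF t(3) x(1)]] by simp
      then show ?thesis using R(2)[OF x(2)] z0[OF x(2)] by (simp add: q_def dil_def)
    qed
    then show "AE x in M0. (norm (q n x - ?z x))\<^sup>2 \<le> 4 * D\<^sup>2 * indicator (cball 0 (3 * R)) x" for n by simp
    have "(\<lambda>n. q n x) \<longlonglongrightarrow> ?z x" for x
    proof -
      have "((\<lambda>s. dil \<beta> s f x) has_real_derivative ?z x) (at 0)"
        using dil_derivative[OF C, of \<beta> x 0] by (simp add: dil_def)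
      then have "((\<lambda>h. (dil \<beta> h f x - f x) / h) \<longlongrightarrow> ?z x) (at 0)"
        by (simp add: has_field_derivative_iff dil_def)
      moreover have "filterlim t (at 0) sequentially" using t by (intro filterlim_atI) auto
      ultimately show ?thesis unfolding q_def by (rule filterlim_compose)
    qed
    then show "AE x in M0. (\<lambda>n. q n x) \<longlonglongrightarrow> ?z x" by simp
  qed
  then show ?thesis by (simp add: q_def[abs_def])
qed

text \<open>For test functions the difference quotients converge pointwise with a uniform bound. The bound of
  \<open>dil_increment\<close> is uniform in \<open>t\<close> and carries the convergence over to the closure.\<close>

lemma dil_quotient:
  fixes u :: "('m::finite) pt \<Rightarrow> real"
  assumes S: "Sob MH MB u G T" and t: "t \<longlonglongrightarrow> 0" "\<And>n. t n \<noteq> 0" "\<And>n. \<bar>t n\<bar> \<le> 1"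
  shows "L2_tendsto M0 (\<lambda>n x. (dil \<beta> (t n) u x - u x) / t n) (radial \<beta> u G)"
proof -
  obtain \<phi> where p: "\<And>k. \<phi> k \<in> test_functions" "L2_tendsto MH \<phi> u" "L2_tendsto MH (\<lambda>k. grad (\<phi> k)) G"
    using S by (auto simp: Sob_def)
  note sl = M0.Sob_L2[OF Sob_MH_imp_M0[OF S]]
  define C where "C = exp \<bar>2 * \<beta> - real (CARD('m) + 1)\<bar>"
  have C0: "C > 0" by (simp add: C_def)
  let ?z = "radial \<beta> u G" and ?zk = "\<lambda>k. radial \<beta> (\<phi> k) (grad (\<phi> k))"
  let ?q = "\<lambda>v n x. (dil \<beta> (t n) v x - v x) / t n"
  have zL: "?z \<in> L2 M0" by (rule radial_L2[OF S])
  have zkL: "?zk k \<in> L2 M0" for k by (rule radial_test_L2[OF p(1)])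
  have qL: "?q v n \<in> L2 M0" if "v \<in> L2 M0" for v :: "'m pt \<Rightarrow> real" and n
    using L2_mult_left[OF L2_diff[OF dil_L2(1)[OF dilation_M0 that] that], of "1 / t n"] by simp
  have zlim: "(\<lambda>k. \<integral>x. (norm (?zk k x - ?z x))\<^sup>2 \<partial>M0) \<longlonglongrightarrow> 0"
    by (rule L2_tendsto_integral_norm[OF radial_tendsto[OF p(2,3)] zkL])
       (intro L2_measurable[OF M0.test_L2(1)[OF p(1)]] L2_measurable[OF M0.test_L2(2)[OF p(1)]] sl[THEN L2_measurable] L2_measurable[OF zL])+
  have est: "(\<integral>x. (norm (?q u n x - ?z x))\<^sup>2 \<partial>M0) \<le>
      3 * ((C + 1) * (\<integral>x. (norm (?zk k x - ?z x))\<^sup>2 \<partial>M0) + (\<integral>x. (norm (?q (\<phi> k) n x - ?zk k x))\<^sup>2 \<partial>M0))" for n k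
  proof -
    define w where "w x = u x - \<phi> k x" for x
    have Sw: "Sob MH MB w (\<lambda>x. G x - grad (\<phi> k) x) (\<lambda>y. T y - \<phi> k (y, 0))"
      unfolding w_def by (rule MH.Sob_diff[OF S MH.Sob_test[OF p(1)]])
    have wL: "w \<in> L2 M0" by (rule M0.Sob_L2(1)[OF Sob_MH_imp_M0[OF Sw]])
    note \<phi>L = M0.test_L2(1)[OF p(1)[of k]]
    let ?a = "?q w n" and ?b = "\<lambda>x. ?q (\<phi> k) n x - ?zk k x" and ?c = "\<lambda>x. ?zk k x - ?z x"
    have i: "integrable M0 (\<lambda>x. (norm (?a x))\<^sup>2)" "integrable M0 (\<lambda>x. (norm (?b x))\<^sup>2)" "integrable M0 (\<lambda>x. (norm (?c x))\<^sup>2)"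
      by (intro L2_integrable L2_diff qL wL \<phi>L zkL zL)+
    have rw: "radial \<beta> w (\<lambda>x. G x - grad (\<phi> k) x) x = - ?c x" for x
      by (simp add: radial_def w_def inner_diff_right algebra_simps)
    have "(\<integral>x. (dil \<beta> (t n) w x - w x)\<^sup>2 \<partial>M0) \<le> (t n)\<^sup>2 * (C * (\<integral>x. (?c x)\<^sup>2 \<partial>M0))"
      using dil_increment[OF Sw t(3)[of n], of \<beta>] unfolding rw C_def by (simp only: power2_minus)
    then have ai: "(\<integral>x. (norm (?a x))\<^sup>2 \<partial>M0) \<le> C * (\<integral>x. (norm (?c x))\<^sup>2 \<partial>M0)"
      using t(2)[of n] by (simp add: power_divide divide_le_eq mult.commute)
    have "(\<integral>x. (norm (?q u n x - ?z x))\<^sup>2 \<partial>M0) \<le> (\<integral>x. 3 * ((norm (?a x))\<^sup>2 + (norm (?b x))\<^sup>2 + (norm (?c x))\<^sup>2) \<partial>M0)"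
    proof (rule integral_mono)
      show "integrable M0 (\<lambda>x. (norm (?q u n x - ?z x))\<^sup>2)" by (intro L2_integrable L2_diff qL sl zL)
      show "integrable M0 (\<lambda>x. 3 * ((norm (?a x))\<^sup>2 + (norm (?b x))\<^sup>2 + (norm (?c x))\<^sup>2))" using i by simp
      fix x
      have "?q u n x - ?z x = ?a x + ?b x + ?c x"
        by (simp add: w_def dil_def diff_divide_distrib[symmetric] add_divide_distrib[symmetric] algebra_simps)
      moreover have "(norm (a + b + c))\<^sup>2 \<le> 3 * ((norm a)\<^sup>2 + (norm b)\<^sup>2 + (norm c)\<^sup>2)" for a b c :: real
      proof -
        have "0 \<le> (a - b)\<^sup>2 + (b - c)\<^sup>2 + (a - c)\<^sup>2" by simp
        then show ?thesis by (simp add: power2_eq_square algebra_simps)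
      qed
      ultimately show "(norm (?q u n x - ?z x))\<^sup>2 \<le> 3 * ((norm (?a x))\<^sup>2 + (norm (?b x))\<^sup>2 + (norm (?c x))\<^sup>2)" by metis
    qed
    also have "\<dots> = 3 * ((\<integral>x. (norm (?a x))\<^sup>2 \<partial>M0) + (\<integral>x. (norm (?b x))\<^sup>2 \<partial>M0) + (\<integral>x. (norm (?c x))\<^sup>2 \<partial>M0))"
      using i by simp
    also have "\<dots> \<le> 3 * ((C + 1) * (\<integral>x. (norm (?c x))\<^sup>2 \<partial>M0) + (\<integral>x. (norm (?b x))\<^sup>2 \<partial>M0))"
    proof -
      have "3 * (a + b + c) \<le> 3 * ((C + 1) * c + b)" if "a \<le> C * c" for a b c :: real
        using that by (simp add: algebra_simps)
      from this[OF ai] show ?thesis .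
    qed
    finally show ?thesis .
  qed
  have "(\<lambda>n. \<integral>x. (norm (?q u n x - ?z x))\<^sup>2 \<partial>M0) \<longlonglongrightarrow> 0"
  proof (rule LIMSEQ_I)
    fix e :: real assume e: "e > 0"
    have "e / (6 * (C + 1)) > 0" using e C0 by simp
    then have "\<exists>k. (\<integral>x. (norm (?zk k x - ?z x))\<^sup>2 \<partial>M0) < e / (6 * (C + 1))"
      by (intro eventually_happens'[OF sequentially_bot] order_tendstoD(2)[OF zlim])
    then obtain k where k: "(\<integral>x. (norm (?zk k x - ?z x))\<^sup>2 \<partial>M0) < e / (6 * (C + 1))" by blast
    have "(C + 1) * (\<integral>x. (norm (?zk k x - ?z x))\<^sup>2 \<partial>M0) < (C + 1) * (e / (6 * (C + 1)))"
      using k C0 by (intro mult_strict_left_mono) auto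
    also have "\<dots> = e / 6"
    proof -
      have "c * (e / (6 * c)) = e / 6" if "c > 0" for c using that by simp
      from this[of "C + 1"] show ?thesis using C0 by simp
    qed
    finally have k': "(C + 1) * (\<integral>x. (norm (?zk k x - ?z x))\<^sup>2 \<partial>M0) < e / 6" .
    have "(\<lambda>n. \<integral>x. (norm (?q (\<phi> k) n x - ?zk k x))\<^sup>2 \<partial>M0) \<longlonglongrightarrow> 0"
      by (rule L2_tendsto_integral_norm[OF dil_quotient_test[OF p(1) t]])
         (intro qL M0.test_L2(1) p(1) L2_measurable[OF zkL])+
    then have "\<forall>\<^sub>F n in sequentially. (\<integral>x. (norm (?q (\<phi> k) n x - ?zk k x))\<^sup>2 \<partial>M0) < e / 6"
      by (rule order_tendstoD(2)) (use e in simp)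
    then obtain N where N: "\<And>n. n \<ge> N \<Longrightarrow> (\<integral>x. (norm (?q (\<phi> k) n x - ?zk k x))\<^sup>2 \<partial>M0) < e / 6"
      unfolding eventually_sequentially by blast
    have "(\<integral>x. (norm (?q u n x - ?z x))\<^sup>2 \<partial>M0) < e" if "n \<ge> N" for n
    proof -
      have "a < e" if "a \<le> 3 * (c + d)" "c < e / 6" "d < e / 6" for a c d :: real
        using that by simp
      from this[OF est[of n k] k' N[OF that]] show ?thesis .
    qed
    then show "\<exists>no. \<forall>n\<ge>no. norm ((\<integral>x. (norm (?q u n x - ?z x))\<^sup>2 \<partial>M0) - 0) < e"
      by (intro exI[of _ N]) (auto simp: abs_of_nonneg)
  qed
  then show ?thesis
    using L2_tendsto_iff_integral[of "?q u" M0 ?z] qL[OF sl(1)] zL by blast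
qed

section \<open>Power nonlinearities\<close>

text \<open>The derivative of \<open>|a| powr \<rho> / \<rho>\<close>, for \<open>\<rho> > 1\<close>.\<close>

definition pw :: "real \<Rightarrow> real \<Rightarrow> real" where
  "pw \<rho> a = \<bar>a\<bar> powr (\<rho> - 2) * a"

lemma pw_abs: "\<bar>pw \<rho> a\<bar> = \<bar>a\<bar> powr (\<rho> - 1)"
  using powr_mult_base[of "\<bar>a\<bar>" "\<rho> - 2"] by (cases "a = 0") (auto simp: pw_def abs_mult mult.commute)

lemma pw_mult_self: "pw \<rho> a * a = \<bar>a\<bar> powr \<rho>"
proof (cases "a = 0")
  case False
  then have "pw \<rho> a * a = \<bar>a\<bar> powr (\<rho> - 2) * \<bar>a\<bar> powr 2"
    by (simp add: pw_def power2_eq_square[symmetric])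
  also have "\<dots> = \<bar>a\<bar> powr \<rho>" by (subst powr_add[symmetric]) simp
  finally show ?thesis .
qed (simp add: pw_def)

lemma pw_scale: "c > 0 \<Longrightarrow> pw \<rho> (c * a) = c powr (\<rho> - 1) * pw \<rho> a"
  using powr_mult_base[of c "\<rho> - 2"] by (simp add: pw_def abs_mult powr_mult mult_ac)

lemma pw_measurable [measurable]: "pw \<rho> \<in> borel_measurable borel"
  unfolding pw_def[abs_def] by measurable

lemma pw_Young:
  assumes r: "\<rho> > 1"
  shows "pw \<rho> a * b \<le> (1 - 1 / \<rho>) * \<bar>a\<bar> powr \<rho> + (1 / \<rho>) * \<bar>b\<bar> powr \<rho>"
proof -
  have "pw \<rho> a * b \<le> \<bar>a\<bar> powr (\<rho> - 1) * \<bar>b\<bar>"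
    using abs_ge_self[of "pw \<rho> a * b"] by (simp add: abs_mult pw_abs)
  also have "\<dots> \<le> (\<bar>a\<bar> powr (\<rho> - 1)) powr (\<rho> / (\<rho> - 1)) / (\<rho> / (\<rho> - 1)) + \<bar>b\<bar> powr \<rho> / \<rho>"
    by (rule Youngs_inequality) (use r in \<open>auto simp: field_simps\<close>)
  also have "\<dots> = (1 - 1 / \<rho>) * \<bar>a\<bar> powr \<rho> + (1 / \<rho>) * \<bar>b\<bar> powr \<rho>"
  proof -
    have "(\<bar>a\<bar> powr (\<rho> - 1)) powr (\<rho> / (\<rho> - 1)) = \<bar>a\<bar> powr \<rho>" using r by (simp add: powr_powr)
    then show ?thesis using r by (simp add: field_simps)
  qed
  finally show ?thesis .
qed

lemma pw_integrable:
  assumes [measurable]: "u \<in> borel_measurable M" "v \<in> borel_measurable M"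
    and r: "\<rho> > 1" and i: "integrable M (\<lambda>x. \<bar>u x\<bar> powr \<rho>)" "integrable M (\<lambda>x. \<bar>v x\<bar> powr \<rho>)"
  shows "integrable M (\<lambda>x. pw \<rho> (u x) * v x)"
proof (rule Bochner_Integration.integrable_bound[of M "\<lambda>x. \<bar>u x\<bar> powr \<rho> + \<bar>v x\<bar> powr \<rho>"])
  have "\<bar>pw \<rho> a * b\<bar> \<le> \<bar>a\<bar> powr \<rho> + \<bar>b\<bar> powr \<rho>" for a b
  proof -
    have "\<bar>pw \<rho> a * b\<bar> = pw \<rho> \<bar>a\<bar> * \<bar>b\<bar>" by (simp add: pw_def abs_mult)
    also have "\<dots> \<le> (1 - 1 / \<rho>) * \<bar>a\<bar> powr \<rho> + (1 / \<rho>) * \<bar>b\<bar> powr \<rho>"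
      using pw_Young[OF r, of "\<bar>a\<bar>" "\<bar>b\<bar>"] by simp
    also have "\<dots> \<le> 1 * \<bar>a\<bar> powr \<rho> + 1 * \<bar>b\<bar> powr \<rho>"
      using r by (intro add_mono mult_right_mono) auto
    finally show ?thesis by simp
  qed
  then show "AE x in M. norm (pw \<rho> (u x) * v x) \<le> norm (\<bar>u x\<bar> powr \<rho> + \<bar>v x\<bar> powr \<rho>)" by simp
qed (use i in auto)

text \<open>For arguments of equal sign by the mean value theorem, for opposite signs by comparing with the larger
  modulus.\<close>

lemma pw_diff_le:
  assumes r: "\<rho> > 2"
  shows "(pw \<rho> a - pw \<rho> b) * (a - b) \<le> (\<rho> - 1) * max \<bar>a\<bar> \<bar>b\<bar> powr (\<rho> - 2) * (a - b)\<^sup>2"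
proof -
  have pos: "(pw \<rho> a - pw \<rho> b) * (a - b) \<le> (\<rho> - 1) * a powr (\<rho> - 2) * (a - b)\<^sup>2" if ab: "0 < b" "b < a" for a b
  proof -
    have "\<exists>z. b < z \<and> z < a \<and> a powr (\<rho> - 1) - b powr (\<rho> - 1) = (a - b) * ((\<rho> - 1) * z powr (\<rho> - 1 - 1))"
      by (rule MVT2[OF ab(2)]) (use ab has_real_derivative_powr[of _ "\<rho> - 1"] in auto)
    then obtain z where z: "b < z" "z < a" "a powr (\<rho> - 1) - b powr (\<rho> - 1) = (a - b) * ((\<rho> - 1) * z powr (\<rho> - 1 - 1))" by blast
    have pwp: "pw \<rho> c = c powr (\<rho> - 1)" if "c > 0" for c
      using that powr_mult_base[of c "\<rho> - 2"] by (simp add: pw_def mult.commute)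
    have "pw \<rho> a - pw \<rho> b = (a - b) * ((\<rho> - 1) * z powr (\<rho> - 2))" using z(3) ab by (simp add: pwp)
    also have "\<dots> \<le> (a - b) * ((\<rho> - 1) * a powr (\<rho> - 2))"
      using z ab r by (intro mult_left_mono powr_mono2) auto
    finally have "(pw \<rho> a - pw \<rho> b) * (a - b) \<le> (a - b) * ((\<rho> - 1) * a powr (\<rho> - 2)) * (a - b)"
      using ab by (intro mult_right_mono) auto
    then show ?thesis by (simp add: power2_eq_square mult_ac)
  qed
  have opp: "(pw \<rho> a - pw \<rho> b) * (a - b) \<le> (\<rho> - 1) * max \<bar>a\<bar> \<bar>b\<bar> powr (\<rho> - 2) * (a - b)\<^sup>2" if ab: "b \<le> 0" "0 \<le> a" for a b
  proof -
    let ?m = "max \<bar>a\<bar> \<bar>b\<bar> powr (\<rho> - 2)"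
    have "\<bar>a\<bar> powr (\<rho> - 2) \<le> ?m" "\<bar>b\<bar> powr (\<rho> - 2) \<le> ?m"
      using r by (auto intro!: powr_mono2)
    then have "pw \<rho> a \<le> ?m * a" "?m * b \<le> pw \<rho> b"
      unfolding pw_def using mult_right_mono[OF _ ab(2)] mult_right_mono_neg[OF _ ab(1)] by blast+
    then have "pw \<rho> a - pw \<rho> b \<le> ?m * (a - b)" by (simp add: right_diff_distrib)
    then have "(pw \<rho> a - pw \<rho> b) * (a - b) \<le> ?m * (a - b) * (a - b)" using ab by (intro mult_right_mono) auto
    also have "\<dots> = 1 * (?m * (a - b)\<^sup>2)" by (simp add: power2_eq_square)
    also have "\<dots> \<le> (\<rho> - 1) * (?m * (a - b)\<^sup>2)" using r by (intro mult_right_mono) auto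
    finally show ?thesis by (simp add: mult.assoc)
  qed
  have sgn: "pw \<rho> (- c) = - pw \<rho> c" for c by (simp add: pw_def)
  have main: "(pw \<rho> a - pw \<rho> b) * (a - b) \<le> (\<rho> - 1) * max \<bar>a\<bar> \<bar>b\<bar> powr (\<rho> - 2) * (a - b)\<^sup>2" if ab: "b < a" for a b
  proof -
    consider "0 < b" | "a < 0" | "b \<le> 0" "0 \<le> a" by linarith
    then show ?thesis
    proof cases
      case 1
      then show ?thesis using pos[OF 1 ab] ab by simp
    next
      case 2
      have "(pw \<rho> (- b) - pw \<rho> (- a)) * (- b - - a) \<le> (\<rho> - 1) * (- b) powr (\<rho> - 2) * (- b - - a)\<^sup>2"
        using pos[of "- a" "- b"] 2 ab by simp
      then show ?thesis using 2 ab by (simp add: sgn add.commute)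
    next
      case 3
      then show ?thesis by (rule opp)
    qed
  qed
  consider "b < a" | "a < b" | "a = b" by linarith
  then show ?thesis
  proof cases
    case 2
    from main[OF 2] show ?thesis by (simp add: power2_commute[of b a] max.commute[of "\<bar>b\<bar>"] algebra_simps)
  qed (use main in auto)
qed

context
  fixes M :: "'a::euclidean_space measure" and n :: nat
  assumes dM: "dilation_measure M n"
begin

lemma dil_powr:
  fixes u :: "'a \<Rightarrow> real"
  assumes [measurable]: "u \<in> borel_measurable M" and i: "integrable M (\<lambda>x. \<bar>u x\<bar> powr \<rho>)"
  shows "integrable M (\<lambda>x. \<bar>dil \<beta> t u x\<bar> powr \<rho>)"
    "(\<integral>x. \<bar>dil \<beta> t u x\<bar> powr \<rho> \<partial>M) = exp ((\<beta> * \<rho> - real n) * t) * (\<integral>x. \<bar>u x\<bar> powr \<rho> \<partial>M)"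
proof -
  have m: "(\<lambda>x. \<bar>u x\<bar> powr \<rho>) \<in> borel_measurable M" by measurable
  have e: "\<bar>dil \<beta> t u x\<bar> powr \<rho> = exp (\<beta> * t * \<rho>) * \<bar>u (exp t *\<^sub>R x)\<bar> powr \<rho>" for x
    by (simp add: dil_def abs_mult powr_mult) (simp add: powr_def mult.commute)
  show "integrable M (\<lambda>x. \<bar>dil \<beta> t u x\<bar> powr \<rho>)"
    unfolding e using dilate_integrable[OF dM m, of t] i by simp
  show "(\<integral>x. \<bar>dil \<beta> t u x\<bar> powr \<rho> \<partial>M) = exp ((\<beta> * \<rho> - real n) * t) * (\<integral>x. \<bar>u x\<bar> powr \<rho> \<partial>M)"
  proof -
    have ee: "exp ((\<beta> * \<rho> - real n) * t) = exp (\<beta> * t * \<rho>) * exp (- (real n * t))"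
      by (simp add: exp_add[symmetric] algebra_simps)
    show ?thesis unfolding e ee using dilate_integral[OF dM m, of t] by simp
  qed
qed

text \<open>Young's inequality loses nothing at \<open>t = 0\<close> if the two functions have the same norm. Therefore it is
  applied to the dilation with exponent \<open>n/\<rho>\<close>, which preserves the norm, and the remaining factor is the
  exponential.\<close>

lemma dil_Young:
  fixes u :: "'a \<Rightarrow> real"
  assumes u [measurable]: "u \<in> borel_measurable M" and i: "integrable M (\<lambda>x. \<bar>u x\<bar> powr \<rho>)" and r: "\<rho> > 1"
  shows "(\<integral>x. pw \<rho> (u x) * dil \<beta> t u x \<partial>M) \<le> exp (- ((real n - \<beta> * \<rho>) / \<rho> * t)) * (\<integral>x. \<bar>u x\<bar> powr \<rho> \<partial>M)"
proof -
  define c where "c = real n / \<rho>"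
  have cr: "c * \<rho> - real n = 0" using r by (simp add: c_def)
  have v [measurable]: "dil c t u \<in> borel_measurable M" by (rule dil_measurable[OF dM u])
  note d = dil_powr[OF u i, of c t, unfolded cr]
  have iv: "integrable M (\<lambda>x. pw \<rho> (u x) * dil c t u x)" by (rule pw_integrable[OF u v r i d(1)])
  have "(\<integral>x. pw \<rho> (u x) * dil c t u x \<partial>M) \<le> (\<integral>x. (1 - 1 / \<rho>) * \<bar>u x\<bar> powr \<rho> + (1 / \<rho>) * \<bar>dil c t u x\<bar> powr \<rho> \<partial>M)"
    by (rule integral_mono[OF iv _ pw_Young[OF r]]) (use i d in auto)
  also have "\<dots> = (1 - 1 / \<rho>) * (\<integral>x. \<bar>u x\<bar> powr \<rho> \<partial>M) + (1 / \<rho>) * (\<integral>x. \<bar>dil c t u x\<bar> powr \<rho> \<partial>M)"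
    using i d(1) by simp
  also have "\<dots> = (\<integral>x. \<bar>u x\<bar> powr \<rho> \<partial>M)" using d(2) by (simp add: algebra_simps)
  finally have 1: "(\<integral>x. pw \<rho> (u x) * dil c t u x \<partial>M) \<le> (\<integral>x. \<bar>u x\<bar> powr \<rho> \<partial>M)" .
  have "dil \<beta> t u x = exp (- ((real n - \<beta> * \<rho>) / \<rho> * t)) * dil c t u x" for x
  proof -
    have "\<beta> * t = - ((real n - \<beta> * \<rho>) / \<rho> * t) + c * t" using r by (simp add: c_def field_simps)
    then have "exp (\<beta> * t) = exp (- ((real n - \<beta> * \<rho>) / \<rho> * t)) * exp (c * t)"
      by (simp only: exp_add)
    then show ?thesis by (simp add: dil_def)
  qed
  then have "(\<integral>x. pw \<rho> (u x) * dil \<beta> t u x \<partial>M) = (\<integral>x. exp (- ((real n - \<beta> * \<rho>) / \<rho> * t)) * (pw \<rho> (u x) * dil c t u x) \<partial>M)"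
    by (intro Bochner_Integration.integral_cong refl) (simp only: mult.left_commute)
  also have "\<dots> = exp (- ((real n - \<beta> * \<rho>) / \<rho> * t)) * (\<integral>x. pw \<rho> (u x) * dil c t u x \<partial>M)"
    by simp
  also have "\<dots> \<le> exp (- ((real n - \<beta> * \<rho>) / \<rho> * t)) * (\<integral>x. \<bar>u x\<bar> powr \<rho> \<partial>M)"
    by (intro mult_left_mono 1) auto
  finally show ?thesis .
qed

text \<open>The substitution of the inverse dilation, for the scale invariant exponent.\<close>

lemma dil_dual:
  fixes u :: "'a \<Rightarrow> real"
  assumes u [measurable]: "u \<in> borel_measurable M" and b: "\<beta> * \<rho> = real n"
  shows "(\<integral>x. pw \<rho> (u x) * dil \<beta> (- t) u x \<partial>M) = (\<integral>x. pw \<rho> (dil \<beta> t u x) * u x \<partial>M)"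
proof -
  have m: "(\<lambda>x. pw \<rho> (u x) * dil \<beta> (- t) u x) \<in> borel_measurable M"
    using dil_measurable[OF dM u] by measurable
  have "pw \<rho> (dil \<beta> t u x) * u x = exp (real n * t) * (pw \<rho> (u (exp t *\<^sub>R x)) * dil \<beta> (- t) u (exp t *\<^sub>R x))" for x
  proof -
    have "exp (\<beta> * t) powr (\<rho> - 1) = exp (real n * t) * exp (- (\<beta> * t))"
      by (simp add: powr_def b[symmetric] exp_add[symmetric] algebra_simps)
    moreover have "dil \<beta> (- t) u (exp t *\<^sub>R x) = exp (- (\<beta> * t)) * u x"
      by (simp add: dil_def exp_minus)
    ultimately show ?thesis by (simp add: dil_def pw_scale mult_ac)
  qed
  then have "(\<integral>x. pw \<rho> (dil \<beta> t u x) * u x \<partial>M) = exp (real n * t) * (\<integral>x. pw \<rho> (u (exp t *\<^sub>R x)) * dil \<beta> (- t) u (exp t *\<^sub>R x) \<partial>M)"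
    by simp
  also have "\<dots> = (\<integral>x. pw \<rho> (u x) * dil \<beta> (- t) u x \<partial>M)"
    unfolding dilate_integral[OF dM m] by (simp add: exp_minus)
  finally show ?thesis by simp
qed

text \<open>For the scale invariant exponent the second difference of the nonlinear term is small compared
  with the Dirichlet integral, up to a multiple of the \<open>L\<^sup>2\<close> norm: where both functions are bounded the
  nonlinearity is Lipschitz, and the tails of \<open>|u| powr \<rho>\<close> are uniformly small along the orbit.\<close>

lemma pw_dil_difference:
  fixes u :: "'a \<Rightarrow> real"
  assumes u [measurable]: "u \<in> borel_measurable M" and i: "integrable M (\<lambda>x. \<bar>u x\<bar> powr \<rho>)"
    and r: "\<rho> > 2" and b: "\<beta> * \<rho> = real n" and th: "\<theta> > 0"
  shows "\<exists>C\<ge>0. \<forall>t A. \<bar>t\<bar> \<le> 1 \<longrightarrow> A > 0 \<longrightarrow> integrable M (\<lambda>x. (dil \<beta> t u x - u x)\<^sup>2) \<longrightarrow>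
     (\<integral>x. \<bar>dil \<beta> t u x - u x\<bar> powr \<rho> \<partial>M) \<le> A powr (\<rho> / 2) \<longrightarrow>
     (\<integral>x. (pw \<rho> (dil \<beta> t u x) - pw \<rho> (u x)) * (dil \<beta> t u x - u x) \<partial>M) \<le>
       \<theta> * A + C * (\<integral>x. (dil \<beta> t u x - u x)\<^sup>2 \<partial>M)"
proof -
  define \<sigma> where "\<sigma> = \<rho> / (\<rho> - 2)"
  define \<eta> where "\<eta> = \<theta> / (4 * (\<rho> - 1))"
  have eta: "\<eta> > 0" using th r by (simp add: \<eta>_def)
  have sig: "\<sigma> > 1" "1 / \<sigma> + 1 / (\<rho> / 2) = 1" using r by (auto simp: \<sigma>_def field_simps)
  define tail where "tail w k x = (if \<bar>w x\<bar> > k then \<bar>w x\<bar> powr \<rho> else 0)" for w :: "'a \<Rightarrow> real" and k x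
  have tail_meas: "tail w k \<in> borel_measurable M" if [measurable]: "w \<in> borel_measurable M" for w k
    unfolding tail_def[abs_def] by measurable
  have tail_int: "integrable M (tail w k)" if "w \<in> borel_measurable M" "integrable M (\<lambda>x. \<bar>w x\<bar> powr \<rho>)" for w k
    by (rule Bochner_Integration.integrable_bound[OF that(2) tail_meas[OF that(1)]]) (auto simp: tail_def)
  have "(\<lambda>j. \<integral>x. tail u (real j) x \<partial>M) \<longlonglongrightarrow> (\<integral>x. 0 \<partial>M)"
  proof (rule integral_dominated_convergence[OF _ _ i])
    show "AE x in M. (\<lambda>j. tail u (real j) x) \<longlonglongrightarrow> 0"
    proof (intro AE_I2 tendsto_eventually)
      fix x
      obtain j0 :: nat where "\<bar>u x\<bar> \<le> real j0" using real_arch_simple by blast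
      then show "\<forall>\<^sub>F j in sequentially. tail u (real j) x = 0"
        by (intro eventually_sequentiallyI[of j0]) (auto simp: tail_def)
    qed
    show "AE x in M. norm (tail u (real j) x) \<le> \<bar>u x\<bar> powr \<rho>" for j by (auto simp: tail_def)
  qed (auto intro: tail_meas u)
  then have tlim: "(\<lambda>j. \<integral>x. tail u (real j) x \<partial>M) \<longlonglongrightarrow> 0" by simp
  \<comment> \<open>Above the level Hoelder's inequality has the exponents \<open>\<sigma>\<close> and \<open>\<rho>/2\<close>; the constant \<open>\<eta>\<close> accounts for the
    factor \<open>\<rho> - 1\<close> and for the four terms of the final estimate.\<close>
  have "\<exists>j. (\<integral>x. tail u (real j) x \<partial>M) < \<eta> powr \<sigma>"
    by (rule eventually_happens'[OF sequentially_bot order_tendstoD(2)[OF tlim]]) (use eta in auto)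
  then obtain j where j: "(\<integral>x. tail u (real j) x \<partial>M) < \<eta> powr \<sigma>" by blast
  \<comment> \<open>With this level the tail of every dilation with \<open>|t| \<le> 1\<close> is bounded by the tail of \<open>u\<close> above \<open>j\<close>.\<close>
  define k where "k = real j * exp \<bar>\<beta>\<bar>"
  have k0: "k \<ge> 0" by (simp add: k_def)
  define C where "C = (\<rho> - 1) * k powr (\<rho> - 2)"
  show ?thesis
  proof (intro exI[of _ C] conjI allI impI)
    show "0 \<le> C" using r by (simp add: C_def)
    fix t A :: real
    assume t: "\<bar>t\<bar> \<le> 1" and A: "A > 0" and i2: "integrable M (\<lambda>x. (dil \<beta> t u x - u x)\<^sup>2)"
      and dA: "(\<integral>x. \<bar>dil \<beta> t u x - u x\<bar> powr \<rho> \<partial>M) \<le> A powr (\<rho> / 2)"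
    let ?v = "dil \<beta> t u"
    let ?d = "\<lambda>x. ?v x - u x"
    have v [measurable]: "?v \<in> borel_measurable M" by (rule dil_measurable[OF dM u])
    have iv: "integrable M (\<lambda>x. \<bar>?v x\<bar> powr \<rho>)" by (rule dil_powr(1)[OF u i])
    have id: "integrable M (\<lambda>x. \<bar>?d x\<bar> powr \<rho>)"
    proof (rule Bochner_Integration.integrable_bound[of M "\<lambda>x. 2 powr \<rho> * (\<bar>?v x\<bar> powr \<rho> + \<bar>u x\<bar> powr \<rho>)"])
      have "\<bar>a - c\<bar> powr \<rho> \<le> 2 powr \<rho> * (\<bar>a\<bar> powr \<rho> + \<bar>c\<bar> powr \<rho>)" for a c :: real
      proof -
        have "\<bar>a - c\<bar> powr \<rho> \<le> (2 * max \<bar>a\<bar> \<bar>c\<bar>) powr \<rho>" using r by (intro powr_mono2) auto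
        also have "\<dots> = 2 powr \<rho> * max \<bar>a\<bar> \<bar>c\<bar> powr \<rho>" by (simp add: powr_mult)
        also have "\<dots> \<le> 2 powr \<rho> * (\<bar>a\<bar> powr \<rho> + \<bar>c\<bar> powr \<rho>)" by (intro mult_left_mono) (auto simp: max_def)
        finally show ?thesis .
      qed
      then show "AE x in M. norm (\<bar>?d x\<bar> powr \<rho>) \<le> norm (2 powr \<rho> * (\<bar>?v x\<bar> powr \<rho> + \<bar>u x\<bar> powr \<rho>))" by simp
    qed (use i iv in auto)
    have small: "(if \<bar>w\<bar> > k then \<bar>w\<bar> powr (\<rho> - 2) else 0) * d\<^sup>2 \<le>
       A * \<eta> * ((if \<bar>w\<bar> > k then \<bar>w\<bar> powr \<rho> else 0) / \<eta> powr \<sigma> + \<bar>d\<bar> powr \<rho> / A powr (\<rho> / 2))" for w d :: real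
    proof -
      define a where "a = (if \<bar>w\<bar> > k then \<bar>w\<bar> powr (\<rho> - 2) else 0)"
      have a0: "a \<ge> 0" by (simp add: a_def)
      have as: "a powr \<sigma> = (if \<bar>w\<bar> > k then \<bar>w\<bar> powr \<rho> else 0)"
        using r by (simp add: a_def \<sigma>_def powr_powr)
      have ds: "(d\<^sup>2) powr (\<rho> / 2) = \<bar>d\<bar> powr \<rho>"
      proof (cases "d = 0")
        case False
        have "d\<^sup>2 = \<bar>d\<bar> powr 2" using False by simp
        then show ?thesis by (simp only: powr_powr) simp
      qed simp
      have "(a / \<eta>) * (d\<^sup>2 / A) \<le> (a / \<eta>) powr \<sigma> / \<sigma> + (d\<^sup>2 / A) powr (\<rho> / 2) / (\<rho> / 2)"
        by (rule Youngs_inequality) (use sig r a0 eta A in auto)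
      also have "\<dots> \<le> (a / \<eta>) powr \<sigma> / 1 + (d\<^sup>2 / A) powr (\<rho> / 2) / 1"
        using sig(1) r by (intro add_mono divide_left_mono) auto
      also have "\<dots> = (if \<bar>w\<bar> > k then \<bar>w\<bar> powr \<rho> else 0) / \<eta> powr \<sigma> + \<bar>d\<bar> powr \<rho> / A powr (\<rho> / 2)"
        using a0 eta A by (simp add: powr_divide as[symmetric] ds)
      finally have "A * \<eta> * ((a / \<eta>) * (d\<^sup>2 / A)) \<le> A * \<eta> * ((if \<bar>w\<bar> > k then \<bar>w\<bar> powr \<rho> else 0) / \<eta> powr \<sigma> + \<bar>d\<bar> powr \<rho> / A powr (\<rho> / 2))"
        using A eta by (intro mult_left_mono) auto
      moreover have "A * \<eta> * ((a / \<eta>) * (d\<^sup>2 / A)) = a * d\<^sup>2" using A eta by simp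
      ultimately show ?thesis unfolding a_def by simp
    qed
    let ?W = "\<lambda>x. C * (?d x)\<^sup>2 + (\<rho> - 1) * (A * \<eta>) * (tail ?v k x / \<eta> powr \<sigma> + tail u k x / \<eta> powr \<sigma> + 2 * (\<bar>?d x\<bar> powr \<rho> / A powr (\<rho> / 2)))"
    have pt: "(pw \<rho> (?v x) - pw \<rho> (u x)) * ?d x \<le> ?W x" for x
    proof -
      let ?m = "max \<bar>?v x\<bar> \<bar>u x\<bar>"
      let ?a = "\<lambda>w. (if \<bar>w\<bar> > k then \<bar>w\<bar> powr (\<rho> - 2) else 0)"
      have "?m powr (\<rho> - 2) \<le> k powr (\<rho> - 2) + ?a (?v x) + ?a (u x)"
      proof (cases "?m > k")
        case False
        then have "?m powr (\<rho> - 2) \<le> k powr (\<rho> - 2)" using r k0 by (intro powr_mono2) auto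
        moreover have "0 \<le> ?a (?v x)" "0 \<le> ?a (u x)" by auto
        ultimately show ?thesis by linarith
      qed (auto simp: max_def)
      then have "?m powr (\<rho> - 2) * (?d x)\<^sup>2 \<le> (k powr (\<rho> - 2) + ?a (?v x) + ?a (u x)) * (?d x)\<^sup>2"
        by (intro mult_right_mono) auto
      also have "\<dots> = k powr (\<rho> - 2) * (?d x)\<^sup>2 + ?a (?v x) * (?d x)\<^sup>2 + ?a (u x) * (?d x)\<^sup>2"
        by (simp only: distrib_right)
      also have "\<dots> \<le> k powr (\<rho> - 2) * (?d x)\<^sup>2 + A * \<eta> * (tail ?v k x / \<eta> powr \<sigma> + \<bar>?d x\<bar> powr \<rho> / A powr (\<rho> / 2))
          + A * \<eta> * (tail u k x / \<eta> powr \<sigma> + \<bar>?d x\<bar> powr \<rho> / A powr (\<rho> / 2))"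
        unfolding tail_def by (intro add_mono small order_refl)
      finally have "(\<rho> - 1) * (?m powr (\<rho> - 2) * (?d x)\<^sup>2) \<le> (\<rho> - 1) * \<dots>"
        using r by (intro mult_left_mono) auto
      moreover have "(pw \<rho> (?v x) - pw \<rho> (u x)) * ?d x \<le> (\<rho> - 1) * (?m powr (\<rho> - 2) * (?d x)\<^sup>2)"
        using pw_diff_le[OF r, of "?v x" "u x"] by (simp only: mult.assoc)
      moreover have "c * (q * d + a * (y + z) + a * (y' + z)) = c * q * d + c * a * (y + y' + 2 * z)" for c q d a y y' z :: real
        by (simp add: algebra_simps)
      ultimately show ?thesis unfolding C_def by simp
    qed
    have vtail: "(\<integral>x. tail ?v k x \<partial>M) \<le> (\<integral>x. tail u (real j) x \<partial>M)"
    proof -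
      have "tail ?v k x \<le> exp (real n * t) * tail u (real j) (exp t *\<^sub>R x)" for x
      proof -
        have e: "\<bar>?v x\<bar> powr \<rho> = exp (real n * t) * \<bar>u (exp t *\<^sub>R x)\<bar> powr \<rho>"
          unfolding b[symmetric] by (simp add: dil_def abs_mult powr_mult) (simp add: powr_def mult_ac)
        have "\<bar>u (exp t *\<^sub>R x)\<bar> > real j" if "\<bar>?v x\<bar> > k"
        proof -
          have "\<beta> * t \<le> \<bar>\<beta>\<bar> * \<bar>t\<bar>" using abs_ge_self[of "\<beta> * t"] by (simp add: abs_mult)
          also have "\<dots> \<le> \<bar>\<beta>\<bar>" using t by (simp add: mult_left_le)
          finally have "exp (\<beta> * t) * \<bar>u (exp t *\<^sub>R x)\<bar> \<le> exp \<bar>\<beta>\<bar> * \<bar>u (exp t *\<^sub>R x)\<bar>"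
            by (intro mult_right_mono) auto
          moreover have "k < exp (\<beta> * t) * \<bar>u (exp t *\<^sub>R x)\<bar>" using that by (simp add: dil_def abs_mult)
          ultimately have "k < exp \<bar>\<beta>\<bar> * \<bar>u (exp t *\<^sub>R x)\<bar>" by linarith
          then show ?thesis by (simp add: k_def mult.commute[of "real j"])
        qed
        then show ?thesis by (auto simp: tail_def e)
      qed
      moreover have "integrable M (\<lambda>x. tail u (real j) (exp t *\<^sub>R x))"
        by (rule dilate_integrable[OF dM tail_meas[OF u], THEN iffD2, OF tail_int[OF u i]])
      ultimately have "(\<integral>x. tail ?v k x \<partial>M) \<le> (\<integral>x. exp (real n * t) * tail u (real j) (exp t *\<^sub>R x) \<partial>M)"
        by (intro integral_mono tail_int v iv) auto
      also have "\<dots> = (\<integral>x. tail u (real j) x \<partial>M)"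
        by (simp add: dilate_integral[OF dM tail_meas[OF u]] exp_minus)
      finally show ?thesis .
    qed
    have utail: "(\<integral>x. tail u k x \<partial>M) \<le> (\<integral>x. tail u (real j) x \<partial>M)"
    proof (intro integral_mono tail_int u i)
      have "real j * 1 \<le> k" unfolding k_def by (intro mult_left_mono) auto
      then show "tail u k x \<le> tail u (real j) x" for x by (auto simp: tail_def)
    qed
    note ti = tail_int[OF u i, of k] tail_int[OF v iv, of k]
    have ipw: "integrable M (\<lambda>x. (pw \<rho> (?v x) - pw \<rho> (u x)) * ?d x)"
    proof -
      have r1: "\<rho> > 1" using r by simp
      have "integrable M (\<lambda>x. pw \<rho> (?v x) * ?v x - pw \<rho> (?v x) * u x - pw \<rho> (u x) * ?v x + pw \<rho> (u x) * u x)"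
        by (intro Bochner_Integration.integrable_add Bochner_Integration.integrable_diff pw_integrable u v r1 i iv)
      then show ?thesis by (simp add: algebra_simps)
    qed
    have "(\<integral>x. (pw \<rho> (?v x) - pw \<rho> (u x)) * ?d x \<partial>M) \<le> (\<integral>x. ?W x \<partial>M)"
      by (rule integral_mono[OF ipw _ pt]) (use i2 id ti in auto)
    also have "\<dots> = C * (\<integral>x. (?d x)\<^sup>2 \<partial>M) + (\<rho> - 1) * (A * \<eta>) *
       ((\<integral>x. tail ?v k x \<partial>M) / \<eta> powr \<sigma> + (\<integral>x. tail u k x \<partial>M) / \<eta> powr \<sigma> + 2 * ((\<integral>x. \<bar>?d x\<bar> powr \<rho> \<partial>M) / A powr (\<rho> / 2)))"
      using i2 id ti by simp
    also have "\<dots> \<le> C * (\<integral>x. (?d x)\<^sup>2 \<partial>M) + (\<rho> - 1) * (A * \<eta>) * (1 + 1 + 2 * 1)"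
    proof (intro add_left_mono mult_left_mono add_mono)
      show "(\<integral>x. tail ?v k x \<partial>M) / \<eta> powr \<sigma> \<le> 1" "(\<integral>x. tail u k x \<partial>M) / \<eta> powr \<sigma> \<le> 1"
        using vtail utail j eta by (auto simp: divide_le_eq)
      show "(\<integral>x. \<bar>?d x\<bar> powr \<rho> \<partial>M) / A powr (\<rho> / 2) \<le> 1" using dA A by (simp add: divide_le_eq)
      show "0 \<le> (\<rho> - 1) * (A * \<eta>)" using r A eta by simp
    qed auto
    also have "(\<rho> - 1) * (A * \<eta>) * (1 + 1 + 2 * 1) = \<theta> * A"
      using r by (simp add: \<eta>_def field_simps)
    finally show "(\<integral>x. (pw \<rho> (?v x) - pw \<rho> (u x)) * ?d x \<partial>M) \<le> \<theta> * A + C * (\<integral>x. (?d x)\<^sup>2 \<partial>M)" by simp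
  qed
qed

lemma dil_first_difference:
  fixes u :: "'a \<Rightarrow> real"
  assumes u: "u \<in> borel_measurable M" and i: "integrable M (\<lambda>x. \<bar>u x\<bar> powr \<rho>)" and r: "\<rho> > 1"
  shows "(\<integral>x. pw \<rho> (u x) * (dil \<beta> t u x - u x) \<partial>M) \<le>
    (exp (- ((real n - \<beta> * \<rho>) / \<rho> * t)) - 1) * (\<integral>x. \<bar>u x\<bar> powr \<rho> \<partial>M)"
proof -
  have "integrable M (\<lambda>x. pw \<rho> (u x) * dil \<beta> t u x)"
    by (rule pw_integrable[OF u dil_measurable[OF dM u] r i dil_powr(1)[OF u i]])
  then have "(\<integral>x. pw \<rho> (u x) * (dil \<beta> t u x - u x) \<partial>M) = (\<integral>x. pw \<rho> (u x) * dil \<beta> t u x \<partial>M) - (\<integral>x. \<bar>u x\<bar> powr \<rho> \<partial>M)"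
    using i by (simp add: right_diff_distrib pw_mult_self)
  then show ?thesis using dil_Young[OF u i r, of \<beta> t] by (simp add: left_diff_distrib)
qed

lemma dil_second_difference:
  fixes u :: "'a \<Rightarrow> real"
  assumes u: "u \<in> borel_measurable M" and i: "integrable M (\<lambda>x. \<bar>u x\<bar> powr \<rho>)" and r: "\<rho> > 1" and b: "\<beta> * \<rho> = real n"
  shows "(\<integral>x. pw \<rho> (u x) * (dil \<beta> t u x - u x) \<partial>M) + (\<integral>x. pw \<rho> (u x) * (dil \<beta> (- t) u x - u x) \<partial>M)
    = - (\<integral>x. (pw \<rho> (dil \<beta> t u x) - pw \<rho> (u x)) * (dil \<beta> t u x - u x) \<partial>M)"
proof -
  have dm: "dil \<beta> s u \<in> borel_measurable M" for s by (rule dil_measurable[OF dM u])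
  note di = dil_powr(1)[OF u i]
  have i1: "integrable M (\<lambda>x. pw \<rho> (u x) * dil \<beta> s u x)" for s by (rule pw_integrable[OF u dm r i di])
  have i2: "integrable M (\<lambda>x. pw \<rho> (dil \<beta> t u x) * u x)" by (rule pw_integrable[OF dm u r di i])
  have e: "(pw \<rho> (dil \<beta> t u x) - pw \<rho> (u x)) * (dil \<beta> t u x - u x) =
     \<bar>dil \<beta> t u x\<bar> powr \<rho> - pw \<rho> (dil \<beta> t u x) * u x - pw \<rho> (u x) * dil \<beta> t u x + \<bar>u x\<bar> powr \<rho>" for x
    unfolding pw_mult_self[symmetric] by (simp add: algebra_simps)
  have "(\<integral>x. (pw \<rho> (dil \<beta> t u x) - pw \<rho> (u x)) * (dil \<beta> t u x - u x) \<partial>M) =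
     (\<integral>x. \<bar>dil \<beta> t u x\<bar> powr \<rho> \<partial>M) - (\<integral>x. pw \<rho> (dil \<beta> t u x) * u x \<partial>M) - (\<integral>x. pw \<rho> (u x) * dil \<beta> t u x \<partial>M) + (\<integral>x. \<bar>u x\<bar> powr \<rho> \<partial>M)"
    unfolding e using i i1[of t] i2 di[of \<beta> t] by simp
  moreover have "(\<integral>x. pw \<rho> (u x) * (dil \<beta> s u x - u x) \<partial>M) = (\<integral>x. pw \<rho> (u x) * dil \<beta> s u x \<partial>M) - (\<integral>x. \<bar>u x\<bar> powr \<rho> \<partial>M)" for s
    using i i1[of s] by (simp add: right_diff_distrib pw_mult_self)
  ultimately show ?thesis using dil_powr(2)[OF u i, of \<beta> t] b dil_dual[OF u b, of t] by simp
qed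

end

section \<open>The Pohozaev inequality\<close>

lemma powr_le_interpolate:
  fixes s :: real
  assumes "c \<le> q" "q \<le> r" shows "\<bar>s\<bar> powr q \<le> \<bar>s\<bar> powr c + \<bar>s\<bar> powr r"
proof (cases "\<bar>s\<bar> \<le> 1")
  case True
  then have "\<bar>s\<bar> powr q \<le> \<bar>s\<bar> powr c" using assms(1) by (cases "s = 0") (auto intro!: powr_mono')
  then show ?thesis using powr_ge_zero[of "\<bar>s\<bar>" r] by linarith
next
  case False
  then have "\<bar>s\<bar> powr q \<le> \<bar>s\<bar> powr r" using assms(2) by (intro powr_mono) auto
  then show ?thesis using powr_ge_zero[of "\<bar>s\<bar>" c] by linarith
qed

lemma trace_powr_integrable:
  fixes u :: "('m::finite) pt \<Rightarrow> real"
  assumes S: "Sob M0 lborel u G T" and m: "CARD('m) \<ge> 2" and q: "2 \<le> q" "q \<le> two_trace (CARD('m) + 1)"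
  shows "integrable lborel (\<lambda>y. \<bar>T y\<bar> powr q)"
proof (rule Bochner_Integration.integrable_bound)
  have "integrable lborel (\<lambda>y. (T y)\<^sup>2)" using L2_integrable[OF M0.Sob_L2(3)[OF S]] by simp
  moreover have "\<bar>s\<bar> powr 2 = s\<^sup>2" for s :: real by (cases "s = 0") auto
  ultimately show "integrable lborel (\<lambda>y. \<bar>T y\<bar> powr 2 + \<bar>T y\<bar> powr (two_trace (CARD('m) + 1)))"
    using Sobolev(3)[OF S m] by simp
  show "AE y in lborel. norm (\<bar>T y\<bar> powr q) \<le> norm (\<bar>T y\<bar> powr 2 + \<bar>T y\<bar> powr (two_trace (CARD('m) + 1)))"
    using powr_le_interpolate[OF q] by simp
qed (use L2_measurable[OF M0.Sob_L2(3)[OF S]] in measurable)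

text \<open>Since \<open>\<nabla>K = (K/2) x\<close>, one has \<open>K \<nabla>u \<cdot> \<nabla>(v/K) = \<nabla>u \<cdot> \<nabla>v - (1/2) (x \<cdot> \<nabla>u) v\<close>.\<close>

lemma weak_solution_unweighted:
  fixes u :: "('m::finite) pt \<Rightarrow> real"
  assumes weak: "weak_solution a lam \<mu> q u" and m: "CARD('m) \<ge> 2"
    and q: "2 \<le> q" "q < two_trace (CARD('m) + 1)" and V: "Sob M0 lborel v H S"
  shows "(\<integral>x. wgrad u x \<bullet> H x \<partial>M0) - (1/2) * (\<integral>x. (x \<bullet> wgrad u x) * v x \<partial>M0) =
    lam * (\<integral>x. u x * v x \<partial>M0) + a * (\<integral>x. pw (two_star (CARD('m) + 1)) (u x) * v x \<partial>M0)
     + \<mu> * (\<integral>y. pw q (trace u y) * S y \<partial>lborel) + (\<integral>y. pw (two_trace (CARD('m) + 1)) (trace u y) * S y \<partial>lborel)"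
proof -
  let ?p = "two_star (CARD('m) + 1)" and ?r = "two_trace (CARD('m) + 1)"
  let ?G = "wgrad u" and ?T = "trace u"
  have uX: "u \<in> X" using weak by (simp add: weak_solution_def)
  note Sw = X_Sob[OF uX]
  note S0 = Sob_MH_imp_M0[OF Sw]
  note um = M0.Sob_L2[OF S0] and vm = M0.Sob_L2[OF V]
  note [measurable] = um[THEN L2_measurable] vm[THEN L2_measurable]
  have [measurable]: "(\<lambda>x. x) \<in> borel_measurable (M0 :: 'm pt measure)"
    by (intro continuous_measurable_M0 continuous_intros)
  define \<phi> where "\<phi> x = v x / K x" for x
  note D = Sob_div_K[OF V, folded \<phi>_def]
  note tr = Sob_wgrad_trace[OF D]
  have "\<phi> \<in> X" by (rule Sob_in_X[OF D])
  with weak have eq: "(\<integral>x. ?G x \<bullet> wgrad \<phi> x \<partial>MH) = lam * (\<integral>x. u x * \<phi> x \<partial>MH)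
       + a * (\<integral>x. \<bar>u x\<bar> powr (?p - 2) * u x * \<phi> x \<partial>MH)
       + (\<integral>y. (\<mu> * \<bar>?T y\<bar> powr (q - 2) * ?T y + \<bar>?T y\<bar> powr (?r - 2) * ?T y) * trace \<phi> y \<partial>MB)"
    by (simp add: weak_solution_def Let_def)
  have L: "(\<integral>x. ?G x \<bullet> wgrad \<phi> x \<partial>MH) = (\<integral>x. ?G x \<bullet> H x \<partial>M0) - (1/2) * (\<integral>x. (x \<bullet> ?G x) * v x \<partial>M0)"
  proof -
    have "(\<integral>x. ?G x \<bullet> wgrad \<phi> x \<partial>MH) = (\<integral>x. ?G x \<bullet> ((1 / K x) *\<^sub>R (H x - (v x / 2) *\<^sub>R x)) \<partial>MH)"
      by (rule integral_cong_AE)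
         (use tr(1) L2_measurable[OF MH.Sob_L2(2)[OF X_Sob[OF \<open>\<phi> \<in> X\<close>]]] in \<open>auto simp: measurable_MH AE_MH\<close>)
    also have "\<dots> = (\<integral>x. K x * (?G x \<bullet> ((1 / K x) *\<^sub>R (H x - (v x / 2) *\<^sub>R x))) \<partial>M0)"
      by (rule integral_MH) measurable
    also have "\<dots> = (\<integral>x. ?G x \<bullet> H x - (1/2) * ((x \<bullet> ?G x) * v x) \<partial>M0)"
      by (intro Bochner_Integration.integral_cong refl) (simp add: inner_diff_right inner_commute)
    also have "\<dots> = (\<integral>x. ?G x \<bullet> H x \<partial>M0) - (1/2) * (\<integral>x. (x \<bullet> ?G x) * v x \<partial>M0)"
    proof -
      have "(\<lambda>x. x \<bullet> ?G x) \<in> L2 M0" using radial_L2[OF Sw, of 0] by (simp add: radial_def[abs_def])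
      from L2_mult_integrable[OF this vm(1)] L2_inner_integrable[OF um(2) vm(2)] show ?thesis by simp
    qed
    finally show ?thesis .
  qed
  have R1: "(\<integral>x. f x * \<phi> x \<partial>MH) = (\<integral>x. f x * v x \<partial>M0)" if [measurable]: "f \<in> borel_measurable M0" for f
  proof -
    have "(\<integral>x. f x * \<phi> x \<partial>MH) = (\<integral>x. K x * (f x * \<phi> x) \<partial>M0)" unfolding \<phi>_def by (rule integral_MH) measurable
    then show ?thesis by (simp add: \<phi>_def mult.left_commute)
  qed
  have R2: "(\<integral>y. (\<mu> * \<bar>?T y\<bar> powr (q - 2) * ?T y + \<bar>?T y\<bar> powr (?r - 2) * ?T y) * trace \<phi> y \<partial>MB) =
     \<mu> * (\<integral>y. pw q (?T y) * S y \<partial>lborel) + (\<integral>y. pw ?r (?T y) * S y \<partial>lborel)"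
  proof -
    have "(\<integral>y. (\<mu> * \<bar>?T y\<bar> powr (q - 2) * ?T y + \<bar>?T y\<bar> powr (?r - 2) * ?T y) * trace \<phi> y \<partial>MB) =
       (\<integral>y. (\<mu> * pw q (?T y) + pw ?r (?T y)) * (S y / K (y, 0)) \<partial>MB)"
      by (rule integral_cong_AE)
         (use tr(2) L2_measurable[OF MH.Sob_L2(3)[OF X_Sob[OF \<open>\<phi> \<in> X\<close>]]] in \<open>auto simp: measurable_MB AE_MB pw_def mult.assoc\<close>)
    also have "\<dots> = (\<integral>y. K (y, 0) * ((\<mu> * pw q (?T y) + pw ?r (?T y)) * (S y / K (y, 0))) \<partial>lborel)"
      by (rule integral_MB) measurable
    also have "\<dots> = (\<integral>y. \<mu> * (pw q (?T y) * S y) + pw ?r (?T y) * S y \<partial>lborel)"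
      by (intro Bochner_Integration.integral_cong refl) (simp add: algebra_simps)
    also have "\<dots> = \<mu> * (\<integral>y. pw q (?T y) * S y \<partial>lborel) + (\<integral>y. pw ?r (?T y) * S y \<partial>lborel)"
    proof -
      have "integrable lborel (\<lambda>y. pw \<rho> (?T y) * S y)" if "2 \<le> \<rho>" "\<rho> \<le> ?r" for \<rho>
        using that by (intro pw_integrable trace_powr_integrable[OF S0 m] trace_powr_integrable[OF V m]) auto
      from this[of q] this[of ?r] q show ?thesis by simp
    qed
    finally show ?thesis .
  qed
  show ?thesis
    using eq R1[of u] R1[of "\<lambda>x. pw ?p (u x)"] unfolding L R2 by (simp add: pw_def)
qed

lemma exp_difference_quotient: "(\<lambda>n. (exp (c * (1 / real (Suc n))) - 1) / (1 / real (Suc n))) \<longlonglongrightarrow> c"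
proof -
  have "((\<lambda>t. exp (c * t)) has_real_derivative c) (at 0)" by (auto intro!: derivative_eq_intros)
  then have "((\<lambda>h. (exp (c * h) - 1) / h) \<longlongrightarrow> c) (at 0)" by (simp add: has_field_derivative_iff)
  moreover have "filterlim (\<lambda>n. 1 / real (Suc n)) (at 0) sequentially"
    using LIMSEQ_inverse_real_of_nat by (intro filterlim_atI) (auto simp: inverse_eq_divide)
  ultimately show ?thesis by (rule filterlim_compose)
qed

text \<open>The equation is tested with \<open>(U\<^sub>t - u)/K\<close> for the dilations \<open>U\<^sub>t\<close> that preserve the Dirichlet integral
  and both critical norms. The sum of the relations for \<open>t\<close> and \<open>- t\<close> bounds the Dirichlet integral of
  \<open>U\<^sub>t - u\<close> by \<open>o(t)\<close>; then the critical terms drop out of the first-order relation, and what remains is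
  the Pohozaev relation as an inequality.\<close>

lemma Pohozaev:
  fixes u :: "('m::finite) pt \<Rightarrow> real"
  assumes weak: "weak_solution a lam \<mu> q u" and m: "CARD('m) \<ge> 2"
    and q: "2 \<le> q" "q < two_trace (CARD('m) + 1)" and a: "a \<in> {0, 1}" and mu: "\<mu> \<le> 0"
  shows "- \<mu> * ((real CARD('m) - (real CARD('m) - 1) / 2 * q) / q) * (\<integral>y. \<bar>trace u y\<bar> powr q \<partial>lborel)
     \<le> (lam - (real CARD('m) + 1) / 4) * (\<integral>x. (u x)\<^sup>2 \<partial>M0)"
proof -
  let ?n = "CARD('m)"
  let ?p = "two_star (?n + 1)" and ?r = "two_trace (?n + 1)"
  let ?G = "wgrad u" and ?T = "trace u"
  define \<beta> where "\<beta> = (real ?n - 1) / 2"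
  define \<gamma> where "\<gamma> = (real ?n - \<beta> * q) / q"
  have n1: "real ?n - 1 > 0" using m by simp
  have bp: "\<beta> * ?p = real (?n + 1)" and br: "\<beta> * ?r = real ?n" and b1: "2 * (\<beta> + 1) = real (?n + 1)"
    using n1 by (simp_all add: \<beta>_def two_star_def two_trace_def field_simps)
  have p2: "?p > 2" and r2: "?r > 2" using n1 by (simp_all add: two_star_def two_trace_def field_simps)
  have uX: "u \<in> X" using weak by (simp add: weak_solution_def)
  note Sw = X_Sob[OF uX]
  note S0 = Sob_MH_imp_M0[OF Sw]
  note uL = M0.Sob_L2[OF S0]
  note um = uL[THEN L2_measurable]
  note dH = dilation_M0[where 'm='m]
  have dB: "dilation_measure (lborel :: (real^'m) measure) ?n" using dilation_lborel[where 'a="real^'m"] by simp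
  have up: "integrable M0 (\<lambda>x. \<bar>u x\<bar> powr ?p)" by (rule Sobolev(1)[OF S0 m])
  have Tp: "integrable lborel (\<lambda>y. \<bar>?T y\<bar> powr \<rho>)" if "2 \<le> \<rho>" "\<rho> \<le> ?r" for \<rho>
    by (rule trace_powr_integrable[OF S0 m that])
  have Tm: "?T \<in> borel_measurable lborel" by (rule um(3))
  define \<delta> where "\<delta> t x = dil \<beta> t u x - u x" for t x
  define H where "H t x = dil (\<beta> + 1) t ?G x - ?G x" for t x
  define \<tau> where "\<tau> t y = dil \<beta> t ?T y - ?T y" for t y
  have SD: "Sob M0 lborel (\<delta> t) (H t) (\<tau> t)" for t
    unfolding \<delta>_def[abs_def] H_def[abs_def] \<tau>_def[abs_def] by (rule M0.Sob_diff[OF Sob_dil[OF S0] S0])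
  note DL = M0.Sob_L2[OF SD]
  define d where "d t = (\<integral>x. (norm (H t x))\<^sup>2 \<partial>M0)" for t
  define e where "e t = (\<integral>x. (x \<bullet> ?G x) * \<delta> t x \<partial>M0)" for t
  define g where "g t = (\<integral>x. u x * \<delta> t x \<partial>M0)" for t
  define P where "P t = (\<integral>x. pw ?p (u x) * \<delta> t x \<partial>M0)" for t
  define B where "B t = (\<integral>y. pw ?r (?T y) * \<tau> t y \<partial>lborel)" for t
  define Q where "Q t = (\<integral>y. pw q (?T y) * \<tau> t y \<partial>lborel)" for t
  define D2 where "D2 t = (\<integral>x. (\<delta> t x)\<^sup>2 \<partial>M0)" for t
  define Q0 where "Q0 = (\<integral>y. \<bar>?T y\<bar> powr q \<partial>lborel)"
  define U2 where "U2 = (\<integral>x. (u x)\<^sup>2 \<partial>M0)"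
  have d0: "d t \<ge> 0" and D20: "D2 t \<ge> 0" for t by (simp_all add: d_def D2_def)
  have Q00: "Q0 \<ge> 0" by (simp add: Q0_def)
  \<comment> \<open>the Dirichlet term, by the invariance of the Dirichlet integral\<close>
  have GG: "(\<integral>x. ?G x \<bullet> H t x \<partial>M0) = - (1/2) * d t" and inner_dil: "d t = 2 * (\<integral>x. (norm (?G x))\<^sup>2 \<partial>M0) - 2 * (\<integral>x. ?G x \<bullet> dil (\<beta> + 1) t ?G x \<partial>M0)" for t
  proof -
    let ?D = "dil (\<beta> + 1) t ?G"
    note DD = dil_L2[OF dH uL(2), of "\<beta> + 1" t]
    have z: "2 * (\<beta> + 1) * t - real (?n + 1) * t = 0" unfolding b1 by simp
    have n: "(\<integral>x. (norm (?D x))\<^sup>2 \<partial>M0) = (\<integral>x. (norm (?G x))\<^sup>2 \<partial>M0)" using DD(2) unfolding z by simp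
    note i = L2_inner_integrable[OF uL(2) DD(1)] L2_integrable[OF uL(2)] L2_integrable[OF DD(1)]
    have "(norm (H t x))\<^sup>2 = (norm (?D x))\<^sup>2 - 2 * (?G x \<bullet> ?D x) + (norm (?G x))\<^sup>2" for x
      unfolding H_def power2_norm_eq_inner inner_diff_left inner_diff_right by (simp add: inner_commute)
    then have "d t = (\<integral>x. (norm (?D x))\<^sup>2 \<partial>M0) - 2 * (\<integral>x. ?G x \<bullet> ?D x \<partial>M0) + (\<integral>x. (norm (?G x))\<^sup>2 \<partial>M0)"
      unfolding d_def using i by simp
    then show dt: "d t = 2 * (\<integral>x. (norm (?G x))\<^sup>2 \<partial>M0) - 2 * (\<integral>x. ?G x \<bullet> ?D x \<partial>M0)" unfolding n by simp
    have "?G x \<bullet> H t x = ?G x \<bullet> ?D x - (norm (?G x))\<^sup>2" for x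
      unfolding H_def power2_norm_eq_inner inner_diff_right ..
    then have "(\<integral>x. ?G x \<bullet> H t x \<partial>M0) = (\<integral>x. ?G x \<bullet> ?D x \<partial>M0) - (\<integral>x. (norm (?G x))\<^sup>2 \<partial>M0)" using i by simp
    moreover have "c = b - A \<Longrightarrow> D = 2 * A - 2 * b \<Longrightarrow> c = - (1/2) * D" for A b c D :: real by linarith
    ultimately show "(\<integral>x. ?G x \<bullet> H t x \<partial>M0) = - (1/2) * d t" using dt by blast
  qed
  have E: "- (1/2) * d t - (1/2) * e t = lam * g t + a * P t + \<mu> * Q t + B t" for t
    using weak_solution_unweighted[OF weak m q SD[of t]] unfolding GG e_def g_def P_def Q_def B_def .
  have dsym: "d (- t) = d t" for t
  proof -
    have mm: "(\<lambda>x. ?G x \<bullet> dil (\<beta> + 1) (- t) ?G x) \<in> borel_measurable M0"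
      using um(2) dil_measurable[OF dH um(2)] by measurable
    have "(\<integral>x. ?G x \<bullet> dil (\<beta> + 1) t ?G x \<partial>M0) = (\<integral>x. exp (2 * (\<beta> + 1) * t) * (?G (exp t *\<^sub>R x) \<bullet> dil (\<beta> + 1) (- t) ?G (exp t *\<^sub>R x)) \<partial>M0)"
    proof (intro Bochner_Integration.integral_cong refl)
      fix x
      have "exp (2 * (\<beta> + 1) * t) * exp ((\<beta> + 1) * - t) = exp ((\<beta> + 1) * t)"
        by (simp add: exp_add[symmetric] algebra_simps)
      then show "?G x \<bullet> dil (\<beta> + 1) t ?G x = exp (2 * (\<beta> + 1) * t) * (?G (exp t *\<^sub>R x) \<bullet> dil (\<beta> + 1) (- t) ?G (exp t *\<^sub>R x))"
        by (simp add: dil_def exp_minus inner_commute mult.assoc[symmetric])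
    qed
    also have "\<dots> = exp (2 * (\<beta> + 1) * t) * (exp (- (real (?n + 1) * t)) * (\<integral>x. ?G x \<bullet> dil (\<beta> + 1) (- t) ?G x \<partial>M0))"
      using dilate_integral[OF dH mm, of t] by simp
    also have "\<dots> = (\<integral>x. ?G x \<bullet> dil (\<beta> + 1) (- t) ?G x \<partial>M0)" unfolding b1 by (simp add: exp_minus)
    finally show ?thesis unfolding inner_dil by simp
  qed
  \<comment> \<open>first differences of the nonlinear terms, by Young's inequality\<close>
  have P_le: "P t \<le> 0" for t
    using dil_first_difference[OF dH um(1) up, of \<beta> t] p2 bp unfolding P_def \<delta>_def by simp
  have B_le: "B t \<le> 0" for t
    using dil_first_difference[OF dB Tm Tp[of ?r], of \<beta> t] r2 br unfolding B_def \<tau>_def by simp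
  have Q_le: "Q t \<le> (exp (- (\<gamma> * t)) - 1) * Q0" for t
    using dil_first_difference[OF dB Tm Tp[of q], of \<beta> t] q unfolding Q_def \<tau>_def Q0_def \<gamma>_def by simp
  \<comment> \<open>second differences of the critical terms\<close>
  define JP where "JP t = (\<integral>x. (pw ?p (dil \<beta> t u x) - pw ?p (u x)) * (dil \<beta> t u x - u x) \<partial>M0)" for t
  define JB where "JB t = (\<integral>y. (pw ?r (dil \<beta> t ?T y) - pw ?r (?T y)) * (dil \<beta> t ?T y - ?T y) \<partial>lborel)" for t
  have JP: "P t + P (- t) = - JP t" for t
    using dil_second_difference[OF dH um(1) up _ bp, of t] p2 unfolding P_def \<delta>_def JP_def by simp
  have JB: "B t + B (- t) = - JB t" for t
    using dil_second_difference[OF dB Tm Tp[of ?r] _ br, of t] r2 unfolding B_def \<tau>_def JB_def by simp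
  define \<theta> where "\<theta> = 1 / (8 * ?r\<^sup>2)"
  have th: "\<theta> > 0" using r2 by (simp add: \<theta>_def)
  obtain CP where CP: "CP \<ge> 0" "\<And>t A. \<bar>t\<bar> \<le> 1 \<Longrightarrow> A > 0 \<Longrightarrow> integrable M0 (\<lambda>x. (dil \<beta> t u x - u x)\<^sup>2) \<Longrightarrow>
     (\<integral>x. \<bar>dil \<beta> t u x - u x\<bar> powr ?p \<partial>M0) \<le> A powr (?p / 2) \<Longrightarrow> JP t \<le> \<theta> * A + CP * (\<integral>x. (dil \<beta> t u x - u x)\<^sup>2 \<partial>M0)"
    using pw_dil_difference[OF dH um(1) up p2 bp th] unfolding JP_def by blast
  have "integrable lborel (\<lambda>y. \<bar>?T y\<bar> powr ?r)" using Tp[of ?r] r2 by simp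
  then obtain CB where CB: "CB \<ge> 0" "\<And>t A. \<bar>t\<bar> \<le> 1 \<Longrightarrow> A > 0 \<Longrightarrow> integrable lborel (\<lambda>y. (dil \<beta> t ?T y - ?T y)\<^sup>2) \<Longrightarrow>
     (\<integral>y. \<bar>dil \<beta> t ?T y - ?T y\<bar> powr ?r \<partial>lborel) \<le> A powr (?r / 2) \<Longrightarrow> JB t \<le> \<theta> * A + CB * (\<integral>y. (dil \<beta> t ?T y - ?T y)\<^sup>2 \<partial>lborel)"
    using pw_dil_difference[OF dB Tm _ r2 br th] unfolding JB_def by blast
  define \<epsilon> where "\<epsilon> = 1 / (8 * (CB + 1))"
  have ep: "\<epsilon> > 0" "CB * \<epsilon> \<le> 1/8" using CB(1) by (simp_all add: \<epsilon>_def divide_le_eq)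
  define C3 where "C3 = 2 * \<theta> + CP + CB / \<epsilon>"
  have C30: "C3 \<ge> 0" using th CP(1) CB(1) ep by (simp add: C3_def)
  \<comment> \<open>By the Sobolev inequalities the bound of \<open>pw_dil_difference\<close> applies with a multiple of the Dirichlet
    integral; \<open>t\<^sup>2\<close> is added to make it positive. The constant \<open>\<theta>\<close> leaves \<open>1/8\<close> of \<open>d t\<close> for each critical term,
    and \<open>\<epsilon>\<close> leaves another \<open>1/8\<close> in the trace inequality for the \<open>L\<^sup>2\<close> norm of \<open>\<tau> t\<close>.\<close>
  have J_le: "a * JP t + JB t \<le> 3/8 * d t + C3 * (t\<^sup>2 + D2 t)" if t: "\<bar>t\<bar> \<le> 1" "t \<noteq> 0" for t
  proof -
    define A where "A = ?r\<^sup>2 * d t + t\<^sup>2"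
    have A: "A > 0" using t(2) d0[of t] by (simp add: A_def add_nonneg_pos)
    have le: "(?r\<^sup>2 * d t) powr s \<le> A powr s" if "s \<ge> 0" for s
      using that d0[of t] by (intro powr_mono2) (auto simp: A_def)
    have thA: "\<theta> * A = d t / 8 + \<theta> * t\<^sup>2" using r2 by (simp add: A_def \<theta>_def field_simps)
    have jp: "JP t \<le> \<theta> * A + CP * D2 t"
      unfolding D2_def \<delta>_def
    proof (rule CP(2)[OF t(1) A])
      show "integrable M0 (\<lambda>x. (dil \<beta> t u x - u x)\<^sup>2)" using L2_integrable[OF DL(1)[of t]] by (simp add: \<delta>_def)
      show "(\<integral>x. \<bar>dil \<beta> t u x - u x\<bar> powr ?p \<partial>M0) \<le> A powr (?p / 2)"
        using order_trans[OF Sobolev(2)[OF SD[of t] m, folded d_def] le[of "?p / 2"]] p2 by (simp add: \<delta>_def)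
    qed
    have jb: "JB t \<le> \<theta> * A + CB * (\<integral>y. (\<tau> t y)\<^sup>2 \<partial>lborel)"
      unfolding \<tau>_def
    proof (rule CB(2)[OF t(1) A])
      show "integrable lborel (\<lambda>y. (dil \<beta> t ?T y - ?T y)\<^sup>2)" using L2_integrable[OF DL(3)[of t]] by (simp add: \<tau>_def)
      show "(\<integral>y. \<bar>dil \<beta> t ?T y - ?T y\<bar> powr ?r \<partial>lborel) \<le> A powr (?r / 2)"
        using order_trans[OF Sobolev(4)[OF SD[of t] m, folded d_def] le[of "?r / 2"]] r2 by (simp add: \<tau>_def)
    qed
    have "(\<integral>y. (\<tau> t y)\<^sup>2 \<partial>lborel) \<le> (\<integral>x. 2 * (\<bar>\<delta> t x\<bar> * norm (H t x)) \<partial>M0)"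
      using M0.Sob_trace_ineq[OF SD[of t]] by simp
    also have "\<dots> \<le> (\<integral>x. \<epsilon> * (norm (H t x))\<^sup>2 + (1 / \<epsilon>) * (norm (\<delta> t x))\<^sup>2 \<partial>M0)"
    proof (rule integral_mono)
      show "integrable M0 (\<lambda>x. 2 * (\<bar>\<delta> t x\<bar> * norm (H t x)))"
        by (intro integrable_mult_right L2_mult_integrable L2_abs L2_norm DL)
      show "integrable M0 (\<lambda>x. \<epsilon> * (norm (H t x))\<^sup>2 + (1 / \<epsilon>) * (norm (\<delta> t x))\<^sup>2)"
        by (intro Bochner_Integration.integrable_add integrable_mult_right L2_integrable DL)
      have "2 * (x * y) \<le> \<epsilon> * y\<^sup>2 + (1 / \<epsilon>) * x\<^sup>2" for x y :: real
      proof -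
        have "0 \<le> (sqrt \<epsilon> * y - x / sqrt \<epsilon>)\<^sup>2" by simp
        also have "\<dots> = \<epsilon> * y\<^sup>2 + (1 / \<epsilon>) * x\<^sup>2 - 2 * (x * y)"
          using ep(1) by (simp add: power2_diff power_mult_distrib power_divide)
        finally show ?thesis by simp
      qed
      from this[of "\<bar>\<delta> t x\<bar>" "norm (H t x)" for x]
      show "2 * (\<bar>\<delta> t x\<bar> * norm (H t x)) \<le> \<epsilon> * (norm (H t x))\<^sup>2 + (1 / \<epsilon>) * (norm (\<delta> t x))\<^sup>2" for x by simp
    qed
    also have "\<dots> = \<epsilon> * d t + (1 / \<epsilon>) * D2 t"
      using L2_integrable[OF DL(1)[of t]] L2_integrable[OF DL(2)[of t]] by (simp add: d_def D2_def)
    finally have "CB * (\<integral>y. (\<tau> t y)\<^sup>2 \<partial>lborel) \<le> CB * (\<epsilon> * d t + (1 / \<epsilon>) * D2 t)"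
      using CB(1) by (intro mult_left_mono)
    also have "\<dots> = (CB * \<epsilon>) * d t + (CB / \<epsilon>) * D2 t" by (simp add: distrib_left mult.assoc)
    also have "\<dots> \<le> 1/8 * d t + (CB / \<epsilon>) * D2 t" using ep(2) d0[of t] by (intro add_right_mono mult_right_mono)
    finally have jb': "JB t \<le> \<theta> * A + 1/8 * d t + (CB / \<epsilon>) * D2 t" using jb by linarith
    have "JP t \<ge> 0" using JP[of t] P_le[of t] P_le[of "- t"] by linarith
    then have "a * JP t \<le> JP t" using a by auto
    moreover have "C3 * (t\<^sup>2 + D2 t) = 2 * (\<theta> * t\<^sup>2) + CP * D2 t + (CB / \<epsilon>) * D2 t + ((CP + CB / \<epsilon>) * t\<^sup>2 + 2 * \<theta> * D2 t)"
      by (simp add: C3_def algebra_simps)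
    moreover have "0 \<le> (CP + CB / \<epsilon>) * t\<^sup>2 + 2 * \<theta> * D2 t"
      using CP(1) CB(1) ep(1) th D20[of t] by (intro add_nonneg_nonneg mult_nonneg_nonneg) auto
    ultimately show ?thesis using jp jb' unfolding thA by linarith
  qed
  define L where "L t = \<bar>(1/2) * (e t + e (- t)) + lam * (g t + g (- t))\<bar>" for t
  define R where "R t = C3 * (t\<^sup>2 + D2 t) - \<mu> * (((exp (- (\<gamma> * t)) - 1) + (exp (\<gamma> * t) - 1)) * Q0) + L t" for t
  \<comment> \<open>The relations for \<open>t\<close> and \<open>- t\<close> are added; everything but \<open>d t\<close> is of order \<open>o(t)\<close>.\<close>
  have d_le: "5/8 * d t \<le> R t" if t: "\<bar>t\<bar> \<le> 1" "t \<noteq> 0" for t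
  proof -
    have "- \<mu> * (Q t + Q (- t)) \<le> - \<mu> * (((exp (- (\<gamma> * t)) - 1) + (exp (\<gamma> * t) - 1)) * Q0)"
    proof (rule mult_left_mono)
      have "Q (- t) \<le> (exp (\<gamma> * t) - 1) * Q0" using Q_le[of "- t"] by (simp only: mult_minus_right minus_minus)
      from add_mono[OF Q_le[of t] this]
      show "Q t + Q (- t) \<le> ((exp (- (\<gamma> * t)) - 1) + (exp (\<gamma> * t) - 1)) * Q0" by (simp only: distrib_right)
    qed (use mu in simp)
    moreover have "d t = a * JP t + JB t - \<mu> * (Q t + Q (- t)) - ((1/2) * (e t + e (- t)) + lam * (g t + g (- t)))"
    proof -
      have "- (1/2) * d t - (1/2) * e t + (- (1/2) * d t - (1/2) * e (- t)) =
         lam * g t + a * P t + \<mu> * Q t + B t + (lam * g (- t) + a * P (- t) + \<mu> * Q (- t) + B (- t))"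
        using E[of t] E[of "- t"] unfolding dsym by simp
      moreover have "a * P t + a * P (- t) = - (a * JP t)" using JP[of t] by (metis distrib_left mult_minus_right)
      ultimately show ?thesis using JB[of t] by (simp add: distrib_left)
    qed
    moreover have "- ((1/2) * (e t + e (- t)) + lam * (g t + g (- t))) \<le> L t"
      unfolding L_def by (rule abs_ge_minus_self)
    ultimately show ?thesis using J_le[OF t] unfolding R_def by linarith
  qed
  \<comment> \<open>The critical terms of the single relation have the favourable sign for \<open>- t\<close>, so each of them is at
    most the second difference, and that is \<open>o(t)\<close> by the preceding bound.\<close>
  have final: "\<mu> * ((exp (- (\<gamma> * t)) - 1) * Q0) \<le> - (1/2) * e t - lam * g t + 2 * R t" if t: "\<bar>t\<bar> \<le> 1" "t \<noteq> 0" for t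
  proof -
    have "\<mu> * ((exp (- (\<gamma> * t)) - 1) * Q0) \<le> \<mu> * Q t" using mu Q_le[of t] by (intro mult_left_mono_neg)
    moreover have "- (a * P t) \<le> a * JP t" "- B t \<le> JB t"
      using a JP[of t] P_le[of "- t"] JB[of t] B_le[of "- t"] by auto
    moreover have "C3 * (t\<^sup>2 + D2 t) \<le> R t"
    proof -
      have "0 \<le> (exp (- (\<gamma> * t)) - 1) + (exp (\<gamma> * t) - 1)"
        using exp_ge_add_one_self[of "- (\<gamma> * t)"] exp_ge_add_one_self[of "\<gamma> * t"] by linarith
      then have "0 \<le> - \<mu> * (((exp (- (\<gamma> * t)) - 1) + (exp (\<gamma> * t) - 1)) * Q0)"
        using mu Q00 by (intro mult_nonneg_nonneg) auto
      moreover have "L t \<ge> 0" by (simp add: L_def)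
      ultimately show ?thesis unfolding R_def by linarith
    qed
    ultimately show ?thesis using E[of t] J_le[OF t] d_le[OF t] d0[of t] by linarith
  qed
  \<comment> \<open>Passage to the limit along \<open>t = 1/(n+1)\<close>; the remainder \<open>R t\<close> contains the terms for \<open>- t\<close> too.\<close>
  define s where "s n = 1 / real (Suc n)" for n
  have s0: "s n > 0" "s n \<le> 1" for n by (auto simp: s_def)
  have s_lim: "s \<longlonglongrightarrow> 0" using LIMSEQ_inverse_real_of_nat by (simp add: s_def[abs_def] inverse_eq_divide)
  define z where "z = radial \<beta> u ?G"
  have zL: "z \<in> L2 M0" unfolding z_def by (rule radial_L2[OF Sw])
  have quot: "L2_tendsto M0 (\<lambda>n x. \<delta> (\<sigma> * s n) x / (\<sigma> * s n)) z" if "\<bar>\<sigma>\<bar> = 1" for \<sigma>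
    unfolding \<delta>_def z_def
  proof (rule dil_quotient[OF Sw])
    show "(\<lambda>n. \<sigma> * s n) \<longlonglongrightarrow> 0" using tendsto_mult[OF tendsto_const s_lim, of \<sigma>] by simp
    show "\<sigma> * s n \<noteq> 0" "\<bar>\<sigma> * s n\<bar> \<le> 1" for n using that s0[of n] by (auto simp: abs_mult)
  qed
  have quotL: "(\<lambda>x. \<delta> t x / t) \<in> L2 M0" for t
    using L2_mult_left[OF DL(1)[of t], of "1 / t"] by simp
  have lim_f: "(\<lambda>n. (\<integral>x. f x * \<delta> (\<sigma> * s n) x \<partial>M0) / (\<sigma> * s n)) \<longlonglongrightarrow> (\<integral>x. f x * z x \<partial>M0)" if "f \<in> L2 M0" "\<bar>\<sigma>\<bar> = 1" for f \<sigma>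
    using L2_tendsto_integral_mult[OF L2_tendsto_const that(1) L2_measurable[OF that(1)] quot[OF that(2)] quotL L2_measurable[OF zL]]
    by simp
  have xG: "(\<lambda>x. x \<bullet> ?G x) \<in> L2 M0" using radial_L2[OF Sw, of 0] by (simp add: radial_def[abs_def])
  let ?e = "\<integral>x. (x \<bullet> ?G x) * z x \<partial>M0" and ?g = "\<integral>x. u x * z x \<partial>M0"
  have lims: "(\<lambda>n. e (s n) / s n) \<longlonglongrightarrow> ?e" "(\<lambda>n. e (- s n) / s n) \<longlonglongrightarrow> - ?e"
      "(\<lambda>n. g (s n) / s n) \<longlonglongrightarrow> ?g" "(\<lambda>n. g (- s n) / s n) \<longlonglongrightarrow> - ?g"
    using lim_f[OF xG, of 1] tendsto_minus[OF lim_f[OF xG, of "-1"]] lim_f[OF uL(1), of 1] tendsto_minus[OF lim_f[OF uL(1), of "-1"]]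
    unfolding e_def g_def by simp_all
  have D2_lim: "(\<lambda>n. D2 (s n) / s n) \<longlonglongrightarrow> 0"
  proof -
    have "(\<lambda>n. \<integral>x. (norm (\<delta> (1 * s n) x / (1 * s n)))\<^sup>2 \<partial>M0) \<longlonglongrightarrow> (\<integral>x. (norm (z x))\<^sup>2 \<partial>M0)"
      by (rule L2_tendsto_integral_sq[OF quot quotL L2_measurable[OF zL]]) simp
    from tendsto_mult[OF s_lim this]
    have "(\<lambda>n. s n * (\<integral>x. (norm (\<delta> (1 * s n) x / (1 * s n)))\<^sup>2 \<partial>M0)) \<longlonglongrightarrow> 0" by simp
    moreover have "s n * (\<integral>x. (norm (\<delta> (1 * s n) x / (1 * s n)))\<^sup>2 \<partial>M0) = D2 (s n) / s n" for n
      using s0(1)[of n] by (simp add: power_divide D2_def power2_eq_square)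
    ultimately show ?thesis by simp
  qed
  have exp_lim: "(\<lambda>n. (exp (- (\<gamma> * s n)) - 1) / s n) \<longlonglongrightarrow> - \<gamma>" "(\<lambda>n. (exp (\<gamma> * s n) - 1) / s n) \<longlonglongrightarrow> \<gamma>"
    using exp_difference_quotient[of "- \<gamma>"] exp_difference_quotient[of \<gamma>] unfolding s_def by simp_all
  have R_lim: "(\<lambda>n. R (s n) / s n) \<longlonglongrightarrow> 0"
  proof -
    have "(\<lambda>n. C3 * (s n + D2 (s n) / s n) - \<mu> * (((exp (- (\<gamma> * s n)) - 1) / s n + (exp (\<gamma> * s n) - 1) / s n) * Q0)
        + \<bar>(1/2) * (e (s n) / s n + e (- s n) / s n) + lam * (g (s n) / s n + g (- s n) / s n)\<bar>) \<longlonglongrightarrow>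
        C3 * (0 + 0) - \<mu> * ((- \<gamma> + \<gamma>) * Q0) + \<bar>(1/2) * (?e + - ?e) + lam * (?g + - ?g)\<bar>"
      by (intro tendsto_intros s_lim D2_lim exp_lim lims)
    moreover have "C3 * (s n + D2 (s n) / s n) - \<mu> * (((exp (- (\<gamma> * s n)) - 1) / s n + (exp (\<gamma> * s n) - 1) / s n) * Q0)
        + \<bar>(1/2) * (e (s n) / s n + e (- s n) / s n) + lam * (g (s n) / s n + g (- s n) / s n)\<bar> = R (s n) / s n" for n
    proof -
      have "\<bar>(1/2) * (e (s n) / s n + e (- s n) / s n) + lam * (g (s n) / s n + g (- s n) / s n)\<bar> = L (s n) / s n"
      proof -
        have "(1/2) * (e (s n) / s n + e (- s n) / s n) + lam * (g (s n) / s n + g (- s n) / s n)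
          = ((1/2) * (e (s n) + e (- s n)) + lam * (g (s n) + g (- s n))) / s n"
          by (simp add: add_divide_distrib distrib_left)
        then show ?thesis unfolding L_def using s0(1)[of n] by (simp add: abs_divide)
      qed
      moreover have "C3 * (s n + D2 (s n) / s n) = C3 * ((s n)\<^sup>2 + D2 (s n)) / s n"
        using s0(1)[of n] by (simp add: power2_eq_square add_divide_distrib distrib_left)
      moreover have "\<mu> * ((a1 / r + a2 / r) * Q0) = \<mu> * ((a1 + a2) * Q0) / r" for a1 a2 r :: real
        by (simp add: add_divide_distrib[symmetric])
      moreover have "X = c / r \<Longrightarrow> Z = l / r \<Longrightarrow> Y = m / r \<Longrightarrow> X - Y + Z = (c - m + l) / r" for X Y Z c l m r :: real
        by (simp add: add_divide_distrib diff_divide_distrib)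
      ultimately show ?thesis unfolding R_def by presburger
    qed
    ultimately show ?thesis by simp
  qed
  have main: "\<mu> * (- \<gamma> * Q0) \<le> - (1/2) * ?e - lam * ?g + 2 * 0"
  proof (rule LIMSEQ_le)
    show "(\<lambda>n. \<mu> * ((exp (- (\<gamma> * s n)) - 1) / s n * Q0)) \<longlonglongrightarrow> \<mu> * (- \<gamma> * Q0)"
      by (intro tendsto_intros exp_lim)
    show "(\<lambda>n. - (1/2) * (e (s n) / s n) - lam * (g (s n) / s n) + 2 * (R (s n) / s n)) \<longlonglongrightarrow> - (1/2) * ?e - lam * ?g + 2 * 0"
      by (intro tendsto_intros lims R_lim)
    have "\<mu> * ((exp (- (\<gamma> * s n)) - 1) / s n * Q0) \<le> - (1/2) * (e (s n) / s n) - lam * (g (s n) / s n) + 2 * (R (s n) / s n)" for n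
    proof -
      have "\<bar>s n\<bar> \<le> 1" "s n \<noteq> 0" using s0[of n] by auto
      from divide_right_mono[OF final[OF this] less_imp_le[OF s0(1)[of n]]]
      have "\<mu> * ((exp (- (\<gamma> * s n)) - 1) * Q0) / s n \<le> (- (1/2) * e (s n) - lam * g (s n) + 2 * R (s n)) / s n" .
      moreover have "\<mu> * (x * Q0) / r = \<mu> * (x / r * Q0)"
          "(- (1/2) * x - lam * y + 2 * w) / r = - (1/2) * (x / r) - lam * (y / r) + 2 * (w / r)" for x y w r :: real
        by (simp_all add: add_divide_distrib diff_divide_distrib)
      ultimately show ?thesis by (simp only:)
    qed
    then show "\<exists>N. \<forall>n\<ge>N. \<mu> * ((exp (- (\<gamma> * s n)) - 1) / s n * Q0) \<le> - (1/2) * (e (s n) / s n) - lam * (g (s n) / s n) + 2 * (R (s n) / s n)"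
      by blast
  qed
  \<comment> \<open>The value \<open>\<integral>u z = - \<integral>u\<^sup>2\<close> comes from the scaling of the \<open>L\<^sup>2\<close> norm, since \<open>2 \<beta> - (?n + 1) = - 2\<close>; then
    \<open>\<integral>(z + u)\<^sup>2 \<ge> 0\<close> is a Hardy inequality.\<close>
  have iU: "integrable M0 (\<lambda>x. (u x)\<^sup>2)" using L2_integrable[OF uL(1)] by simp
  have iz: "integrable M0 (\<lambda>x. (z x)\<^sup>2)" using L2_integrable[OF zL] by simp
  have iuz: "integrable M0 (\<lambda>x. u x * z x)" by (rule L2_mult_integrable[OF uL(1) zL])
  have g_U: "?g = - U2"
  proof -
    have "g t = (1/2) * ((exp (- 2 * t) - 1) * U2 - D2 t)" for t
    proof -
      note DD = dil_L2[OF dH uL(1), of \<beta> t]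
      have "2 * \<beta> * t - real (?n + 1) * t = - 2 * t" by (simp add: \<beta>_def field_simps)
      then have n: "(\<integral>x. (dil \<beta> t u x)\<^sup>2 \<partial>M0) = exp (- 2 * t) * U2" using DD(2) by (simp add: U2_def)
      have i: "integrable M0 (\<lambda>x. (dil \<beta> t u x)\<^sup>2)" "integrable M0 (\<lambda>x. u x * dil \<beta> t u x)"
        using L2_integrable[OF DD(1)] L2_mult_integrable[OF uL(1) DD(1)] by auto
      have "D2 t = (\<integral>x. (dil \<beta> t u x)\<^sup>2 - 2 * (u x * dil \<beta> t u x) + (u x)\<^sup>2 \<partial>M0)"
        unfolding D2_def \<delta>_def by (intro Bochner_Integration.integral_cong refl) (simp add: power2_diff mult_ac)
      also have "\<dots> = exp (- 2 * t) * U2 - 2 * (\<integral>x. u x * dil \<beta> t u x \<partial>M0) + U2"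
        using i iU n by (simp add: U2_def)
      finally have 1: "D2 t = exp (- 2 * t) * U2 - 2 * (\<integral>x. u x * dil \<beta> t u x \<partial>M0) + U2" .
      have "g t = (\<integral>x. u x * dil \<beta> t u x - (u x)\<^sup>2 \<partial>M0)"
        unfolding g_def \<delta>_def by (intro Bochner_Integration.integral_cong refl) (simp add: right_diff_distrib power2_eq_square)
      also have "\<dots> = (\<integral>x. u x * dil \<beta> t u x \<partial>M0) - U2" using i iU by (simp add: U2_def)
      finally show ?thesis using 1 by (simp add: left_diff_distrib)
    qed
    moreover have "(1/2) * (x * U2 - w) / r = (1/2) * (x / r * U2 - w / r)" for x w r :: real
      by (simp add: diff_divide_distrib)
    ultimately have gs: "g (s n) / s n = (1/2) * ((exp (- 2 * s n) - 1) / s n * U2 - D2 (s n) / s n)" for n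
      by presburger
    have "(\<lambda>n. (1/2) * ((exp (- 2 * s n) - 1) / s n * U2 - D2 (s n) / s n)) \<longlonglongrightarrow> (1/2) * (- 2 * U2 - 0)"
      by (intro tendsto_intros D2_lim exp_difference_quotient[of "- 2", folded s_def])
    then have "(\<lambda>n. g (s n) / s n) \<longlonglongrightarrow> (1/2) * (- 2 * U2 - 0)" unfolding gs .
    then have "(\<lambda>n. g (s n) / s n) \<longlonglongrightarrow> - U2" by simp
    with lims(3) show ?thesis by (rule LIMSEQ_unique)
  qed
  have "?e = (\<integral>x. (z x)\<^sup>2 - \<beta> * (u x * z x) \<partial>M0)"
    by (intro Bochner_Integration.integral_cong refl) (simp add: z_def radial_def power2_eq_square algebra_simps)
  then have e_z: "?e = (\<integral>x. (z x)\<^sup>2 \<partial>M0) + \<beta> * U2" using iz iuz g_U by simp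
  have "0 \<le> (\<integral>x. (z x + u x)\<^sup>2 \<partial>M0)" by simp
  also have "(\<integral>x. (z x + u x)\<^sup>2 \<partial>M0) = (\<integral>x. (z x)\<^sup>2 + 2 * (u x * z x) + (u x)\<^sup>2 \<partial>M0)"
    by (intro Bochner_Integration.integral_cong refl) (simp add: power2_sum mult_ac)
  also have "\<dots> = (\<integral>x. (z x)\<^sup>2 \<partial>M0) + 2 * ?g + U2" using iz iuz iU by (simp add: U2_def)
  finally have z_ge: "(\<integral>x. (z x)\<^sup>2 \<partial>M0) \<ge> U2" using g_U by simp
  have "(lam - (real ?n + 1) / 4) * U2 = lam * U2 - (1/2) * (U2 + \<beta> * U2)"
    by (simp add: \<beta>_def field_simps)
  moreover have "- \<mu> * \<gamma> * Q0 = \<mu> * (- \<gamma> * Q0)" by simp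
  moreover have "\<mu> * (- \<gamma> * Q0) \<le> lam * U2 - (1/2) * (U2 + \<beta> * U2)"
  proof -
    have "x \<le> w * v - (1/2) * (v + b)" if "x \<le> - (1/2) * (y + b) - w * - v + 2 * 0" "v \<le> y" for x y b v w :: real
      using that by (simp add: field_simps)
    from this[OF main[unfolded e_z g_U] z_ge] show ?thesis .
  qed
  ultimately have "- \<mu> * \<gamma> * Q0 \<le> (lam - (real ?n + 1) / 4) * U2" by simp
  then show ?thesis unfolding \<gamma>_def \<beta>_def Q0_def U2_def .
qed

section \<open>Nonexistence\<close>

lemma herm_sol_pos: "herm_sol j x > 0"
  using herm_pos by (cases x) (simp add: herm_sol_def)

text \<open>Growth of order \<open>\<rho> - 1\<close> lies between \<open>1\<close> and the critical exponent: the first power is integrable against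
  \<open>\<phi>\<close> by the Cauchy--Schwarz inequality, the critical power because \<open>K \<phi>\<close> is constant on the boundary.\<close>

lemma boundary_test_integrable:
  fixes u :: "('m::finite) pt \<Rightarrow> real"
  assumes S: "Sob MH MB u G T" and m: "CARD('m) \<ge> 2" and \<rho>: "2 \<le> \<rho>" "\<rho> \<le> two_trace (CARD('m) + 1)"
  shows "integrable MB (\<lambda>y. pw \<rho> (T y) * herm_sol j (y, 0))"
proof -
  let ?r = "two_trace (CARD('m) + 1)" and ?f = "\<lambda>y. herm_sol j (y, 0) :: real"
  have [measurable]: "T \<in> borel_measurable borel" "?f \<in> borel_measurable borel"
    using L2_measurable[OF MH.Sob_L2(3)[OF S]] L2_measurable[OF herm_sol_L2(3)] by (simp_all add: measurable_MB)
  have i1: "integrable MB (\<lambda>y. \<bar>T y\<bar> * ?f y)"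
    by (intro L2_mult_integrable L2_abs MH.Sob_L2(3)[OF S] herm_sol_L2(3))
  have i2: "integrable MB (\<lambda>y. \<bar>T y\<bar> powr ?r * ?f y)"
  proof (subst integrable_MB)
    have e: "K (y, 0) * (\<bar>T y\<bar> powr ?r * ?f y) = herm j 0 * \<bar>T y\<bar> powr ?r" for y
      unfolding K_herm_sol_boundary[of y j, symmetric] by (simp only: mult_ac)
    show "integrable lborel (\<lambda>y. K (y, 0) * (\<bar>T y\<bar> powr ?r * ?f y))"
      unfolding e by (intro integrable_mult_right Sobolev(3)[OF Sob_MH_imp_M0[OF S] m])
  qed measurable
  show ?thesis
  proof (rule Bochner_Integration.integrable_bound)
    show "integrable MB (\<lambda>y. \<bar>T y\<bar> * ?f y + \<bar>T y\<bar> powr ?r * ?f y)"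
      using i1 i2 by simp
    show "(\<lambda>y. pw \<rho> (T y) * ?f y) \<in> borel_measurable MB" unfolding measurable_MB by measurable
    have "norm (pw \<rho> s * c) \<le> \<bar>s\<bar> * c + \<bar>s\<bar> powr ?r * c" if "c > 0" for s c :: real
    proof -
      have "\<bar>s\<bar> powr (\<rho> - 1) \<le> \<bar>s\<bar> powr 1 + \<bar>s\<bar> powr ?r" using \<rho> by (intro powr_le_interpolate) auto
      then have "\<bar>pw \<rho> s\<bar> \<le> \<bar>s\<bar> + \<bar>s\<bar> powr ?r" by (simp add: pw_abs)
      from mult_right_mono[OF this, of c] that show ?thesis by (simp add: abs_mult distrib_right)
    qed
    then have "norm (pw \<rho> (T y) * ?f y) \<le> \<bar>T y\<bar> * ?f y + \<bar>T y\<bar> powr ?r * ?f y" for y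
      by (simp add: herm_sol_pos)
    also have "\<bar>T y\<bar> * ?f y + \<bar>T y\<bar> powr ?r * ?f y \<le> norm (\<bar>T y\<bar> * ?f y + \<bar>T y\<bar> powr ?r * ?f y)" for y
      by simp
    finally show "AE y in MB. norm (pw \<rho> (T y) * ?f y) \<le> norm (\<bar>T y\<bar> * ?f y + \<bar>T y\<bar> powr ?r * ?f y)"
      by simp
  qed
qed

text \<open>The weak form with \<open>herm_sol j\<close> as test function, where the gradient term is evaluated by Green's formula
  with the roles of \<open>u\<close> and \<open>herm_sol j\<close> exchanged.\<close>

lemma test_herm_sol:
  fixes u :: "('m::finite) pt \<Rightarrow> real"
  assumes weak: "weak_solution a lam \<mu> q u" and m: "CARD('m) \<ge> 2"
    and q: "2 \<le> q" "q < two_trace (CARD('m) + 1)"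
  shows "(real CARD('m) + 1 - real j) / 2 * (\<integral>x. u x * herm_sol j x \<partial>MH)
      + herm_robin j * (\<integral>y. trace u y * herm_sol j (y, 0) \<partial>MB) =
    lam * (\<integral>x. u x * herm_sol j x \<partial>MH)
      + a * (\<integral>x. pw (two_star (CARD('m) + 1)) (u x) * herm_sol j x \<partial>MH)
      + \<mu> * (\<integral>y. pw q (trace u y) * herm_sol j (y, 0) \<partial>MB)
      + (\<integral>y. pw (two_trace (CARD('m) + 1)) (trace u y) * herm_sol j (y, 0) \<partial>MB)"
proof -
  let ?p = "two_star (CARD('m) + 1)" and ?r = "two_trace (CARD('m) + 1)"
  let ?T = "trace u" and ?\<phi> = "herm_sol j :: 'm pt \<Rightarrow> real" and ?H = "herm_grad j :: 'm pt \<Rightarrow> 'm pt"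
  note S\<phi> = Sob_herm_sol[of j, where 'a = 'm]
  have \<phi>X: "?\<phi> \<in> X" by (rule Sob_in_X[OF S\<phi>])
  have uX: "u \<in> X" using weak by (simp add: weak_solution_def)
  note Sw = X_Sob[OF uX]
  note tr = Sob_wgrad_trace[OF S\<phi>]
  note [measurable] = L2_measurable[OF MH.Sob_L2(2)[OF Sw]] L2_measurable[OF MH.Sob_L2(3)[OF Sw]]
    L2_measurable[OF MH.Sob_L2(2)[OF S\<phi>]] L2_measurable[OF MH.Sob_L2(3)[OF S\<phi>]]
    L2_measurable[OF MH.Sob_L2(2)[OF X_Sob[OF \<phi>X]]] L2_measurable[OF MH.Sob_L2(3)[OF X_Sob[OF \<phi>X]]]
  have r2: "?r \<ge> 2" using m by (simp add: two_trace_def field_simps)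
  from weak \<phi>X have eq: "(\<integral>x. wgrad u x \<bullet> wgrad ?\<phi> x \<partial>MH) = lam * (\<integral>x. u x * ?\<phi> x \<partial>MH)
       + a * (\<integral>x. \<bar>u x\<bar> powr (?p - 2) * u x * ?\<phi> x \<partial>MH)
       + (\<integral>y. (\<mu> * \<bar>?T y\<bar> powr (q - 2) * ?T y + \<bar>?T y\<bar> powr (?r - 2) * ?T y) * trace ?\<phi> y \<partial>MB)"
    by (simp add: weak_solution_def Let_def)
  have L: "(\<integral>x. wgrad u x \<bullet> wgrad ?\<phi> x \<partial>MH) = (\<integral>x. wgrad u x \<bullet> ?H x \<partial>MH)"
  proof (rule integral_cong_AE)
    show "AE x in MH. wgrad u x \<bullet> wgrad ?\<phi> x = wgrad u x \<bullet> ?H x"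
      unfolding AE_MH using tr(1) by eventually_elim simp
  qed measurable
  have R: "(\<integral>y. (\<mu> * \<bar>?T y\<bar> powr (q - 2) * ?T y + \<bar>?T y\<bar> powr (?r - 2) * ?T y) * trace ?\<phi> y \<partial>MB) =
     (\<integral>y. \<mu> * (pw q (?T y) * ?\<phi> (y, 0)) + pw ?r (?T y) * ?\<phi> (y, 0) \<partial>MB)"
  proof (rule integral_cong_AE)
    show "AE y in MB. (\<mu> * \<bar>?T y\<bar> powr (q - 2) * ?T y + \<bar>?T y\<bar> powr (?r - 2) * ?T y) * trace ?\<phi> y
        = \<mu> * (pw q (?T y) * ?\<phi> (y, 0)) + pw ?r (?T y) * ?\<phi> (y, 0)"
      unfolding AE_MB using tr(2) by eventually_elim (simp add: pw_def algebra_simps)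
  qed measurable
  have "(\<integral>y. \<mu> * (pw q (?T y) * ?\<phi> (y, 0)) + pw ?r (?T y) * ?\<phi> (y, 0) \<partial>MB) =
     \<mu> * (\<integral>y. pw q (?T y) * ?\<phi> (y, 0) \<partial>MB) + (\<integral>y. pw ?r (?T y) * ?\<phi> (y, 0) \<partial>MB)"
    using boundary_test_integrable[OF Sw m q(1) less_imp_le[OF q(2)], of j]
      boundary_test_integrable[OF Sw m r2 order_refl, of j] by simp
  then show ?thesis
    using eq green_herm[OF Sw, of j] unfolding L R by (simp add: pw_def)
qed

lemma trace_pw_zero:
  assumes S: "Sob MH MB (u :: ('m::finite) pt \<Rightarrow> real) G T" and m: "CARD('m) \<ge> 2" and pos: "AE y in lborel. T y \<ge> 0"
    and le: "(\<integral>y. pw (two_trace (CARD('m) + 1)) (T y) * herm_sol j (y, 0) \<partial>MB) \<le> 0"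
  shows "AE y in lborel. T y = 0"
proof -
  let ?f = "\<lambda>y. pw (two_trace (CARD('m) + 1)) (T y) * herm_sol j (y, 0)"
  have r2: "two_trace (CARD('m) + 1) \<ge> 2" using m by (simp add: two_trace_def field_simps)
  have nn: "AE y in MB. 0 \<le> ?f y"
    unfolding AE_MB using pos by eventually_elim (simp add: pw_def herm_sol_pos less_imp_le)
  have "(\<integral>y. ?f y \<partial>MB) = 0" using le integral_nonneg_AE[OF nn] by simp
  with integral_nonneg_eq_0_iff_AE[OF boundary_test_integrable[OF S m r2 order_refl] nn]
  have "AE y in MB. ?f y = 0" by simp
  then show ?thesis
    unfolding AE_MB by eventually_elim (use herm_sol_pos in \<open>auto simp: pw_def less_le\<close>)
qed

lemma weak_solution_zero_trace:
  assumes weak: "weak_solution a lam \<mu> q (u :: ('m::finite) pt \<Rightarrow> real)" and T: "AE y in lborel. trace u y = 0"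
  shows "weak_solution a lam 0 q u"
proof -
  have uX: "u \<in> X" using weak by (simp add: weak_solution_def)
  note [measurable] = L2_measurable[OF MH.Sob_L2(3)[OF X_Sob[OF uX]]]
  have "(\<integral>y. (\<mu> * \<bar>trace u y\<bar> powr (q - 2) * trace u y + \<bar>trace u y\<bar> powr r * trace u y) * trace \<phi> y \<partial>MB)
     = (\<integral>y. (0 * \<bar>trace u y\<bar> powr (q - 2) * trace u y + \<bar>trace u y\<bar> powr r * trace u y) * trace \<phi> y \<partial>MB)"
    if "\<phi> \<in> X" for \<phi> :: "'m pt \<Rightarrow> real" and r
  proof (rule integral_cong_AE)
    note [measurable] = L2_measurable[OF MH.Sob_L2(3)[OF X_Sob[OF that]]]
    show "(\<lambda>y. (\<mu> * \<bar>trace u y\<bar> powr (q - 2) * trace u y + \<bar>trace u y\<bar> powr r * trace u y) * trace \<phi> y) \<in> borel_measurable MB"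
      by measurable
    show "(\<lambda>y. (0 * \<bar>trace u y\<bar> powr (q - 2) * trace u y + \<bar>trace u y\<bar> powr r * trace u y) * trace \<phi> y) \<in> borel_measurable MB"
      by measurable
    show "AE y in MB. (\<mu> * \<bar>trace u y\<bar> powr (q - 2) * trace u y + \<bar>trace u y\<bar> powr r * trace u y) * trace \<phi> y =
       (0 * \<bar>trace u y\<bar> powr (q - 2) * trace u y + \<bar>trace u y\<bar> powr r * trace u y) * trace \<phi> y"
      unfolding AE_MB using T by eventually_elim simp
  qed
  then show ?thesis using weak unfolding weak_solution_def Let_def by simp
qed

lemma Pohozaev_vanishing:
  fixes u :: "('m::finite) pt \<Rightarrow> real"
  assumes "weak_solution a lam 0 q u" "CARD('m) \<ge> 2" "2 \<le> q" "q < two_trace (CARD('m) + 1)" "a \<in> {0, 1}"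
    and lam: "lam < (real CARD('m) + 1) / 4"
  shows "AE x in M0. u x = 0"
proof -
  have uX: "u \<in> X" using assms(1) by (simp add: weak_solution_def)
  have "0 \<le> (lam - (real CARD('m) + 1) / 4) * (\<integral>x. (u x)\<^sup>2 \<partial>M0)"
    using Pohozaev[OF assms(1-5)] by simp
  then have "(\<integral>x. (u x)\<^sup>2 \<partial>M0) \<le> 0" using lam by (simp add: zero_le_mult_iff)
  then show ?thesis
    using integral_sq_0_AE[OF M0.Sob_L2(1)[OF Sob_MH_imp_M0[OF X_Sob[OF uX]]]] by simp
qed

text \<open>Let \<open>N = CARD('m) + 1\<close>. Below \<open>N/4\<close> the Pohozaev inequality applies with \<open>\<mu> = 0\<close>; from \<open>N/4\<close> on, \<open>lam > 0\<close>, and the solution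
  \<open>herm_sol N\<close> with eigenvalue \<open>0\<close> is the test function.\<close>

lemma trace_zero_imp_zero:
  fixes u :: "('m::finite) pt \<Rightarrow> real"
  assumes weak: "weak_solution a lam \<mu> q u" and m: "CARD('m) \<ge> 2"
    and q: "2 \<le> q" "q < two_trace (CARD('m) + 1)" and a: "a \<in> {0, 1}" and lam: "lam \<ge> 0"
    and pos: "AE x in M0. u x \<ge> 0" and T: "AE y in lborel. trace u y = 0"
  shows "AE x in M0. u x = 0"
proof (cases "lam < (real CARD('m) + 1) / 4")
  case True
  then show ?thesis by (rule Pohozaev_vanishing[OF weak_solution_zero_trace[OF weak T] m q a])
next
  case False
  then have l0: "lam > 0" using zero_less_card_finite[where 'a = 'm] by (smt (verit) divide_pos_pos of_nat_0_le_iff)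
  let ?j = "CARD('m) + 1" and ?p = "two_star (CARD('m) + 1)"
  let ?\<phi> = "herm_sol ?j :: 'm pt \<Rightarrow> real"
  have uX: "u \<in> X" using weak by (simp add: weak_solution_def)
  note Sw = X_Sob[OF uX]
  note [measurable] = L2_measurable[OF MH.Sob_L2(3)[OF Sw]] L2_measurable[OF herm_sol_L2(3)[of ?j]]
  have B0: "(\<integral>y. f (trace u y) * ?\<phi> (y, 0) \<partial>MB) = 0" if [measurable]: "f \<in> borel_measurable borel" and "f 0 = 0" for f :: "real \<Rightarrow> real"
  proof -
    have "(\<integral>y. f (trace u y) * ?\<phi> (y, 0) \<partial>MB) = (\<integral>y. 0 \<partial>(MB :: (real^'m) measure))"
    proof (rule integral_cong_AE)
      show "AE y in MB. f (trace u y) * ?\<phi> (y, 0) = 0"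
        unfolding AE_MB using T by eventually_elim (simp add: that)
    qed measurable
    then show ?thesis by simp
  qed
  have "0 \<le> (\<integral>x. pw ?p (u x) * ?\<phi> x \<partial>MH)"
    by (intro integral_nonneg_AE, unfold AE_MH, use pos in eventually_elim)
       (simp add: pw_def herm_sol_pos less_imp_le)
  then have "0 \<le> a * (\<integral>x. pw ?p (u x) * ?\<phi> x \<partial>MH)" using a by auto
  then have "lam * (\<integral>x. u x * ?\<phi> x \<partial>MH) \<le> 0"
    using test_herm_sol[OF weak m q, of ?j] B0[of "\<lambda>s. s"] B0[of "pw q"] B0[of "pw (two_trace (CARD('m) + 1))"]
    by (simp add: pw_def[of _ 0])
  then have le: "(\<integral>x. u x * ?\<phi> x \<partial>MH) \<le> 0" using l0 by (simp add: mult_le_0_iff)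
  have nn: "AE x in MH. 0 \<le> u x * ?\<phi> x"
    unfolding AE_MH using pos by eventually_elim (simp add: herm_sol_pos less_imp_le)
  have "(\<integral>x. u x * ?\<phi> x \<partial>MH) = 0" using le integral_nonneg_AE[OF nn] by simp
  with integral_nonneg_eq_0_iff_AE[OF L2_mult_integrable[OF MH.Sob_L2(1)[OF Sw] herm_sol_L2(1)] nn]
  have "AE x in MH. u x * ?\<phi> x = 0" by simp
  then show ?thesis
    unfolding AE_MH by eventually_elim (use herm_sol_pos in \<open>auto simp: less_le\<close>)
qed

lemma nonexistence_AE:
  fixes u :: "('m::finite) pt \<Rightarrow> real"
  assumes weak: "weak_solution a lam \<mu> q u" and m: "CARD('m) \<ge> 2"
    and q: "2 \<le> q" "q < two_trace (CARD('m) + 1)" and a: "a \<in> {0, 1}"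
    and pos: "AE x in M0. u x \<ge> 0"
    and cases: "(lam < (real CARD('m) + 1) / 4 \<and> \<mu> = 0) \<or>
         (lam \<le> (real CARD('m) + 1) / 4 \<and> \<mu> < 0) \<or>
         (lam \<ge> (real CARD('m) + 1) / 2 \<and> \<mu> \<ge> 0) \<or>
         (q = 2 \<and> lam \<ge> 0 \<and> mu1 TYPE('m) \<le> ereal \<mu>)"
  shows "AE x in M0. u x = 0"
proof -
  let ?n = "real CARD('m)" and ?p = "two_star (CARD('m) + 1)" and ?r = "two_trace (CARD('m) + 1)"
  let ?T = "trace u"
  have uX: "u \<in> X" using weak by (simp add: weak_solution_def)
  note Sw = X_Sob[OF uX]
  note S0 = Sob_MH_imp_M0[OF Sw]
  have Tpos: "AE y in lborel. ?T y \<ge> 0" by (rule Sob_trace_nonneg[OF S0 pos])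
  note conclude = trace_zero_imp_zero[OF weak m q a _ pos]
  have inner_nonneg: "0 \<le> (\<integral>x. u x * herm_sol j x \<partial>MH)"
       "0 \<le> a * (\<integral>x. pw ?p (u x) * herm_sol j x \<partial>MH)"
       "0 \<le> (\<integral>y. pw \<rho> (?T y) * herm_sol j (y, 0) \<partial>MB)" "0 \<le> (\<integral>y. ?T y * herm_sol j (y, 0) \<partial>MB)" for j \<rho>
  proof -
    show "0 \<le> (\<integral>x. u x * herm_sol j x \<partial>MH)"
      by (intro integral_nonneg_AE, unfold AE_MH, use pos in eventually_elim) (simp add: herm_sol_pos less_imp_le)
    have "0 \<le> (\<integral>x. pw ?p (u x) * herm_sol j x \<partial>MH)"
      by (intro integral_nonneg_AE, unfold AE_MH, use pos in eventually_elim) (simp add: pw_def herm_sol_pos less_imp_le)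
    then show "0 \<le> a * (\<integral>x. pw ?p (u x) * herm_sol j x \<partial>MH)" using a by auto
    show "0 \<le> (\<integral>y. pw \<rho> (?T y) * herm_sol j (y, 0) \<partial>MB)"
      by (intro integral_nonneg_AE, unfold AE_MB, use Tpos in eventually_elim) (simp add: pw_def herm_sol_pos less_imp_le)
    show "0 \<le> (\<integral>y. ?T y * herm_sol j (y, 0) \<partial>MB)"
      by (intro integral_nonneg_AE, unfold AE_MB, use Tpos in eventually_elim) (simp add: herm_sol_pos less_imp_le)
  qed
  consider (1) "lam < (?n + 1) / 4" "\<mu> = 0" | (2) "lam \<le> (?n + 1) / 4" "\<mu> < 0"
    | (3) "lam \<ge> (?n + 1) / 2" "\<mu> \<ge> 0" | (4) "q = 2" "lam \<ge> 0" "mu1 TYPE('m) \<le> ereal \<mu>"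
    using cases by blast
  then show ?thesis
  proof cases
    case 1
    then show ?thesis using Pohozaev_vanishing[of a lam q u] weak m q a by simp
  next
    case 2
    have n1: "?n - 1 > 0" using m by simp
    define \<gamma> where "\<gamma> = (?n - (?n - 1) / 2 * q) / q"
    have \<gamma>: "\<gamma> > 0"
    proof -
      have "?r = 2 * ?n / (?n - 1)" by (simp add: two_trace_def)
      then have "(?n - 1) / 2 * q < (?n - 1) / 2 * (2 * ?n / (?n - 1))" using q(2) n1 by (intro mult_strict_left_mono) auto
      also have "\<dots> = ?n" using n1 by simp
      finally show ?thesis using q(1) by (simp add: \<gamma>_def)
    qed
    have Q0: "0 \<le> (\<integral>y. \<bar>?T y\<bar> powr q \<partial>lborel)" by simp
    have P: "- \<mu> * \<gamma> * (\<integral>y. \<bar>?T y\<bar> powr q \<partial>lborel) \<le> (lam - (?n + 1) / 4) * (\<integral>x. (u x)\<^sup>2 \<partial>M0)"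
      unfolding \<gamma>_def by (rule Pohozaev[OF weak m q a]) (use 2 in simp)
    have c: "- \<mu> * \<gamma> > 0" using 2 \<gamma> by (simp add: mult_neg_pos)
    have "(lam - (?n + 1) / 4) * (\<integral>x. (u x)\<^sup>2 \<partial>M0) \<le> 0"
      using 2 by (intro mult_nonpos_nonneg) auto
    with P have "- \<mu> * \<gamma> * (\<integral>y. \<bar>?T y\<bar> powr q \<partial>lborel) \<le> 0" by linarith
    then have "(\<integral>y. \<bar>?T y\<bar> powr q \<partial>lborel) \<le> 0" using mult_pos_pos[OF c] by (meson not_le)
    then have "(\<integral>y. \<bar>?T y\<bar> powr q \<partial>lborel) = 0" using Q0 by simp
    with integral_nonneg_eq_0_iff_AE[OF trace_powr_integrable[OF S0 m q(1) less_imp_le[OF q(2)]]]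
    have "AE y in lborel. \<bar>?T y\<bar> powr q = 0" by simp
    then have T0: "AE y in lborel. ?T y = 0" by eventually_elim simp
    show ?thesis
    proof (cases "lam < (?n + 1) / 4")
      case True
      then show ?thesis by (rule Pohozaev_vanishing[OF weak_solution_zero_trace[OF weak T0] m q a])
    next
      case False
      then have "lam \<ge> 0" by (smt (verit) divide_nonneg_nonneg of_nat_0_le_iff)
      then show ?thesis using T0 by (rule conclude)
    qed
  next
    case 3
    have "herm_robin 0 = 0" by (simp add: herm_robin_def hermd_def)
    moreover have "(?n + 1) / 2 * (\<integral>x. u x * herm_sol 0 x \<partial>MH) \<le> lam * (\<integral>x. u x * herm_sol 0 x \<partial>MH)"
      using 3(1) inner_nonneg(1) by (rule mult_right_mono)
    moreover have "0 \<le> \<mu> * (\<integral>y. pw q (?T y) * herm_sol 0 (y, 0) \<partial>MB)"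
      using 3(2) inner_nonneg(3) by (rule mult_nonneg_nonneg)
    ultimately have "(\<integral>y. pw ?r (?T y) * herm_sol 0 (y, 0) \<partial>MB) \<le> 0"
      using test_herm_sol[OF weak m q, of 0] inner_nonneg(2)[of 0] by simp
    then have "AE y in lborel. ?T y = 0" by (rule trace_pw_zero[OF Sw m Tpos])
    moreover have "lam \<ge> 0" using 3(1) by (smt (verit) divide_nonneg_nonneg of_nat_0_le_iff)
    ultimately show ?thesis by (intro conclude)
  next
    case 4
    let ?j = "CARD('m) + 1"
    have "herm_robin ?j \<le> \<mu>" using order_trans[OF robin_le_mu1 4(3)] by simp
    then have "herm_robin ?j * (\<integral>y. ?T y * herm_sol ?j (y, 0) \<partial>MB) \<le> \<mu> * (\<integral>y. ?T y * herm_sol ?j (y, 0) \<partial>MB)"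
      using inner_nonneg(4) by (rule mult_right_mono)
    moreover have "pw 2 = (\<lambda>s. s)" by (auto simp: pw_def)
    moreover have "0 \<le> lam * (\<integral>x. u x * herm_sol ?j x \<partial>MH)"
      using 4(2) inner_nonneg(1) by (rule mult_nonneg_nonneg)
    ultimately have "(\<integral>y. pw ?r (?T y) * herm_sol ?j (y, 0) \<partial>MB) \<le> 0"
      using test_herm_sol[OF weak m q, of ?j] inner_nonneg(2)[of ?j] 4(1) by simp
    then have "AE y in lborel. ?T y = 0" by (rule trace_pw_zero[OF Sw m Tpos])
    with 4(2) show ?thesis by (rule conclude)
  qed
qed

lemma continuous_AE_zero:
  fixes u :: "('m::finite) pt \<Rightarrow> real"
  assumes c: "continuous_on halfspace u" and z: "AE x in M0. u x = 0"
  shows "\<forall>x\<in>halfspace. u x = 0"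
proof -
  have o: "open (halfspace :: 'm pt set)"
    unfolding halfspace_def by (intro open_Collect_less continuous_intros)
  define A where "A = {x \<in> halfspace. u x \<noteq> 0}"
  have "A = halfspace \<inter> u -` (- {0})" by (auto simp: A_def)
  then have oA: "open A" using continuous_open_preimage[OF c o open_Compl[OF closed_singleton[of 0]]] by simp
  have "AE x in lborel. x \<in> halfspace \<longrightarrow> u x = 0"
    using z o unfolding M0_def by (subst (asm) AE_restrict_space_iff) auto
  then have "AE x in lborel. x \<notin> A" by eventually_elim (auto simp: A_def)
  then have "A \<in> null_sets lborel" using oA by (subst (asm) AE_iff_null_sets[symmetric]) auto
  then have "emeasure lborel A = 0" by blast
  then have "negligible A" using oA by (simp add: negligible_iff_null_sets null_sets_def)
  then have "A = {}" using open_not_negligible[OF oA] by blast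
  then show ?thesis by (auto simp: A_def)
qed

theorem theorem1p1:
  fixes u :: "('m::finite) pt \<Rightarrow> real" and N :: nat and a q lam \<mu> :: real
  assumes "N = DIM('m pt)" and "N \<ge> 3"
    and "a \<in> {0, 1}"
    and "2 \<le> q" and "q < two_trace N"
    and "Ck 2 halfspace u"
    and "u \<in> X"
    and "\<forall>x\<in>halfspace. u x \<ge> 0"
    and "weak_solution a lam \<mu> q u"
    and "(lam < real N / 4 \<and> \<mu> = 0) \<or>
         (lam \<le> real N / 4 \<and> \<mu> < 0) \<or>
         (lam \<ge> real N / 2 \<and> \<mu> \<ge> 0) \<or>
         (q = 2 \<and> lam \<ge> 0 \<and> mu1 TYPE('m) \<le> ereal \<mu>)"
  shows "\<forall>x\<in>halfspace. u x = 0"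
proof (rule continuous_AE_zero)
  have N: "N = CARD('m) + 1" using assms(1) by simp
  have "\<forall>x\<in>halfspace. u differentiable (at x)" using assms(6) by (simp add: numeral_2_eq_2)
  then show "continuous_on halfspace u"
    by (intro continuous_at_imp_continuous_on ballI differentiable_imp_continuous_within) auto
  have "AE x in M0. u x \<ge> 0"
    using assms(8) by (intro AE_I2) (simp add: M0_def space_restrict_space)
  then show "AE x in M0. u x = 0"
    using assms(2-5,9,10) unfolding N by (intro nonexistence_AE[of a lam \<mu> q u]) (simp_all add: add.commute)
qed

end
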